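(* Let $\mathcal C$ be a braided monoidal category. If $X$ is a Hecke object of $\mathcal C$, then the Orellana--Ram functor $OR_X:\widetilde{\mathcal B}\to\mathrm{Funct}(\mathcal C,\mathcal C)$ factors through the affine Hecke category $\widetilde{\mathcal H}(q)$, giving rise to a functor $OR_X:\widetilde{\mathcal H}(q)\to\mathrm{Funct}(\mathcal C,\mathcal C)$.
   Context: $k$ is a field; categories and functors are $k$-linear, and monoidal functors are strong monoidal. $c_{X,Y}:X\otimes Y\to Y\otimes X$ denotes the braiding of $\mathcal C$. An object $X$ of $\mathcal C$ is a Hecke object if $(c_{X,X}-q\,1_{X\otimes X})(c_{X,X}+q^{-1}\,1_{X\otimes X})=0$ for some non-zero scalar $q\in k$; this $q$ is the parameter of $\widetilde{\mathcal H}(q)$. The affine braid group $\widetilde B_n$ is the group with generators $t_1,\dots,t_{n-1}$, $y_1,\dots,y_n$ subject to $t_it_{i+1}t_i=t_{i+1}t_it_{i+1}$, $t_it_j=t_jt_i$ for $|i-j|>1$, $t_iy_it_i=y_{i+1}$, $y_iy_j=y_jy_i$, and $t_iy_j=y_jt_i$ for $j\ne i,i+1$. The affine Hecke algebra $\widetilde{\mathrm H}_n(q)$ is the quotient of the group algebra $k[\widetilde B_n]$ by the relations $(t_i-q)(t_i+q^{-1})=0$. For each of the sequences $A_n=k[\widetilde B_n]$ and $A_n=\widetilde{\mathrm H}_n(q)$, $n\ge0$, there are algebra homomorphisms $\mu_{m,n}:A_m\otimes A_n\to A_{m+n}$, $t_i\otimes1\mapsto t_i$, $1\otimes t_j\mapsto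 t_{j+m}$, $y_i\otimes1\mapsto y_i$, $1\otimes y_j\mapsto y_{j+m}$. For such a sequence, $\overline{\mathcal C}(A_* )$ is the monoidal category with objects $[n]$, $n\ge0$, no morphisms between different objects, $\mathrm{End}([n])=A_n$, $[m]\otimes[n]=[m+n]$ and tensor product of morphisms given by $\mu_{m,n}$; and $\mathcal C(A_* )$ is the category of $k$-linear functors from $\overline{\mathcal C}(A_* )^{op}$ to vector spaces, i.e. the direct sum $\oplus_n\mathrm{Mod}\text{-}A_n$ of categories of right modules, with the monoidal structure $M\otimes N=(M\otimes_kN)\otimes_{A_m\otimes A_n}A_{m+n}$ (Day convolution) for an $A_m$-module $M$ and an $A_n$-module $N$. The affine braid category is $\widetilde{\mathcal B}=\mathcal C(k[\widetilde B_*])$ and the affine Hecke category is $\widetilde{\mathcal H}(q)=\mathcal C(\widetilde{\mathrm H}_*(q))$. The quotient maps $k[\widetilde B_n]\to\widetilde{\mathrm H}_n(q)$ induce a monoidal functor $\widetilde{\mathcal B}\to\widetilde{\mathcal H}(q)$, $M\mapsto M\otimes_{k[\widetilde B_n]}\widetilde{\mathrm H}_n(q)$. $\mathrm{Funct}(\mathcal C,\mathcal C)$ is the monoidal category of endofunctors of $\mathcal C$, with composition as tensor product. For an object $X$ of $\mathcal C$ let $O:\mathcal C\to\mathcal C$ be the functor $O(Y)=Y\otimes X$, let $c:O\circ O\to O\circ O$ be the natural transformation $1_Y\otimes c_{X,X}:Y\otimes X^{\otimes2}\to Y\otimes X^{\otimes2}$, where $O\circ O(Y)=Y\otimes X^{\otimes2}$,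 and let $x:O\to O$ be the natural transformation given by the composition of $c_{Y,X}:Y\otimes X\to X\otimes Y$ followed by $c_{X,Y}:X\otimes Y\to Y\otimes X$. The Orellana--Ram functor $OR_X:\widetilde{\mathcal B}\to\mathrm{Funct}(\mathcal C,\mathcal C)$ is the monoidal functor defined by the triple $(O,x,c)$, i.e. sending the generating object $[1]$ of $\widetilde{\mathcal B}$ to $O$, its endomorphism given by $y_1\in\widetilde B_1$ to $x$, and the endomorphism of its tensor square given by $t_1\in\widetilde B_2$ to $c$. *)

theory Defs
  imports "HOL-Algebra.QuotRing" "HOL-Algebra.Module"
begin

section \<open>Linear categories\<close>

text \<open>Vector spaces over the field \<open>K\<close> are \<open>module K V\<close> with \<open>field K\<close>; the fields \<open>mult\<close> and \<open>one\<close>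
  of such a \<open>V\<close> play no role.\<close>

definition linear_space :: "'v set \<Rightarrow> 'v \<Rightarrow> ('v \<Rightarrow> 'v \<Rightarrow> 'v) \<Rightarrow> ('k \<Rightarrow> 'v \<Rightarrow> 'v) \<Rightarrow> ('k, 'v) module" where
  "linear_space V z p s =
    \<lparr>carrier = V, mult = undefined, one = undefined, zero = z, add = p, smult = s\<rparr>"

record ('k, 'o, 'a) lincat =
  Ob :: "'o set"
  Hom :: "'o \<Rightarrow> 'o \<Rightarrow> ('k, 'a) module"
  Id :: "'o \<Rightarrow> 'a"
  Comp :: "'a \<Rightarrow> 'a \<Rightarrow> 'a"  (infixr "\<bullet>\<index>" 70)

abbreviation mor :: "('k, 'o, 'a, 'z) lincat_scheme \<Rightarrow> 'o \<Rightarrow> 'o \<Rightarrow> 'a set" where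
  "mor C a b \<equiv> carrier (Hom C a b)"

definition arrows :: "('k, 'o, 'a, 'z) lincat_scheme \<Rightarrow> 'a set" where
  "arrows C = (\<Union>a\<in>Ob C. \<Union>b\<in>Ob C. mor C a b)"

locale linear_category =
  fixes K :: "'k ring" and C :: "('k, 'o, 'a, 'z) lincat_scheme"
  assumes field: "field K"
    and hom_space: "\<And>a b. \<lbrakk>a \<in> Ob C; b \<in> Ob C\<rbrakk> \<Longrightarrow> module K (Hom C a b)"
    and hom_disjoint: "\<And>a b a' b' f. \<lbrakk>a \<in> Ob C; b \<in> Ob C; a' \<in> Ob C; b' \<in> Ob C;
          f \<in> mor C a b; f \<in> mor C a' b'\<rbrakk> \<Longrightarrow> a = a' \<and> b = b'"
    and id_mor: "\<And>a. a \<in> Ob C \<Longrightarrow> Id C a \<in> mor C a a"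
    and comp_mor: "\<And>a b c f g. \<lbrakk>a \<in> Ob C; b \<in> Ob C; c \<in> Ob C; f \<in> mor C a b; g \<in> mor C b c\<rbrakk>
          \<Longrightarrow> g \<bullet>\<^bsub>C\<^esub> f \<in> mor C a c"
    and id_left: "\<And>a b f. \<lbrakk>a \<in> Ob C; b \<in> Ob C; f \<in> mor C a b\<rbrakk> \<Longrightarrow> Id C b \<bullet>\<^bsub>C\<^esub> f = f"
    and id_right: "\<And>a b f. \<lbrakk>a \<in> Ob C; b \<in> Ob C; f \<in> mor C a b\<rbrakk> \<Longrightarrow> f \<bullet>\<^bsub>C\<^esub> Id C a = f"
    and comp_assoc: "\<And>a b c d f g h. \<lbrakk>a \<in> Ob C; b \<in> Ob C; c \<in> Ob C; d \<in> Ob C;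
          f \<in> mor C a b; g \<in> mor C b c; h \<in> mor C c d\<rbrakk>
          \<Longrightarrow> (h \<bullet>\<^bsub>C\<^esub> g) \<bullet>\<^bsub>C\<^esub> f = h \<bullet>\<^bsub>C\<^esub> (g \<bullet>\<^bsub>C\<^esub> f)"
    and comp_add_left: "\<And>a b c f g g'. \<lbrakk>a \<in> Ob C; b \<in> Ob C; c \<in> Ob C;
          f \<in> mor C a b; g \<in> mor C b c; g' \<in> mor C b c\<rbrakk>
          \<Longrightarrow> (g \<oplus>\<^bsub>Hom C b c\<^esub> g') \<bullet>\<^bsub>C\<^esub> f = (g \<bullet>\<^bsub>C\<^esub> f) \<oplus>\<^bsub>Hom C a c\<^esub> (g' \<bullet>\<^bsub>C\<^esub> f)"
    and comp_add_right: "\<And>a b c f f' g. \<lbrakk>a \<in> Ob C; b \<in> Ob C; c \<in> Ob C;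
          f \<in> mor C a b; f' \<in> mor C a b; g \<in> mor C b c\<rbrakk>
          \<Longrightarrow> g \<bullet>\<^bsub>C\<^esub> (f \<oplus>\<^bsub>Hom C a b\<^esub> f') = (g \<bullet>\<^bsub>C\<^esub> f) \<oplus>\<^bsub>Hom C a c\<^esub> (g \<bullet>\<^bsub>C\<^esub> f')"
    and comp_smult_left: "\<And>a b c f g r. \<lbrakk>a \<in> Ob C; b \<in> Ob C; c \<in> Ob C;
          f \<in> mor C a b; g \<in> mor C b c; r \<in> carrier K\<rbrakk>
          \<Longrightarrow> (r \<odot>\<^bsub>Hom C b c\<^esub> g) \<bullet>\<^bsub>C\<^esub> f = r \<odot>\<^bsub>Hom C a c\<^esub> (g \<bullet>\<^bsub>C\<^esub> f)"
    and comp_smult_right: "\<And>a b c f g r. \<lbrakk>a \<in> Ob C; b \<in> Ob C; c \<in> Ob C;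
          f \<in> mor C a b; g \<in> mor C b c; r \<in> carrier K\<rbrakk>
          \<Longrightarrow> g \<bullet>\<^bsub>C\<^esub> (r \<odot>\<^bsub>Hom C a b\<^esub> f) = r \<odot>\<^bsub>Hom C a c\<^esub> (g \<bullet>\<^bsub>C\<^esub> f)"

definition iso_arr :: "('k, 'o, 'a, 'z) lincat_scheme \<Rightarrow> 'o \<Rightarrow> 'o \<Rightarrow> 'a \<Rightarrow> bool" where
  "iso_arr C a b f \<longleftrightarrow>
    f \<in> mor C a b \<and> (\<exists>g\<in>mor C b a. g \<bullet>\<^bsub>C\<^esub> f = Id C a \<and> f \<bullet>\<^bsub>C\<^esub> g = Id C b)"

definition inv_arr :: "('k, 'o, 'a, 'z) lincat_scheme \<Rightarrow> 'o \<Rightarrow> 'o \<Rightarrow> 'a \<Rightarrow> 'a" where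
  "inv_arr C a b f =
    (THE g. g \<in> mor C b a \<and> g \<bullet>\<^bsub>C\<^esub> f = Id C a \<and> f \<bullet>\<^bsub>C\<^esub> g = Id C b)"

definition op_cat :: "('k, 'o, 'a, 'z) lincat_scheme \<Rightarrow> ('k, 'o, 'a) lincat" where
  "op_cat C = \<lparr>Ob = Ob C, Hom = (\<lambda>a b. Hom C b a), Id = Id C, Comp = (\<lambda>g f. f \<bullet>\<^bsub>C\<^esub> g)\<rparr>"


section \<open>Linear functors and natural transformations\<close>

record ('o, 'a, 'p, 'b) funct =
  FO :: "'o \<Rightarrow> 'p"
  FA :: "'a \<Rightarrow> 'b"

text \<open>Functors are extensional, so that they are equal as soon as they agree on the source category.\<close>

locale linear_functor =
  fixes K :: "'k ring" and A :: "('k, 'o, 'a, 'y) lincat_scheme"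
    and B :: "('k, 'p, 'b, 'z) lincat_scheme" and F :: "('o, 'a, 'p, 'b, 'w) funct_scheme"
  assumes obj: "FO F \<in> Ob A \<rightarrow>\<^sub>E Ob B"
    and arr_ext: "FA F \<in> extensional (arrows A)"
    and arr: "\<And>a b f. \<lbrakk>a \<in> Ob A; b \<in> Ob A; f \<in> mor A a b\<rbrakk> \<Longrightarrow> FA F f \<in> mor B (FO F a) (FO F b)"
    and ident: "\<And>a. a \<in> Ob A \<Longrightarrow> FA F (Id A a) = Id B (FO F a)"
    and comp: "\<And>a b c f g. \<lbrakk>a \<in> Ob A; b \<in> Ob A; c \<in> Ob A; f \<in> mor A a b; g \<in> mor A b c\<rbrakk>
          \<Longrightarrow> FA F (g \<bullet>\<^bsub>A\<^esub> f) = FA F g \<bullet>\<^bsub>B\<^esub> FA F f"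
    and add: "\<And>a b f g. \<lbrakk>a \<in> Ob A; b \<in> Ob A; f \<in> mor A a b; g \<in> mor A a b\<rbrakk>
          \<Longrightarrow> FA F (f \<oplus>\<^bsub>Hom A a b\<^esub> g) = FA F f \<oplus>\<^bsub>Hom B (FO F a) (FO F b)\<^esub> FA F g"
    and smult: "\<And>a b f r. \<lbrakk>a \<in> Ob A; b \<in> Ob A; f \<in> mor A a b; r \<in> carrier K\<rbrakk>
          \<Longrightarrow> FA F (r \<odot>\<^bsub>Hom A a b\<^esub> f) = r \<odot>\<^bsub>Hom B (FO F a) (FO F b)\<^esub> FA F f"

definition id_functor :: "('k, 'o, 'a, 'z) lincat_scheme \<Rightarrow> ('o, 'a, 'o, 'a) funct" where
  "id_functor A = \<lparr>FO = (\<lambda>a\<in>Ob A. a), FA = (\<lambda>f\<in>arrows A. f)\<rparr>"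

definition comp_functor :: "('k, 'o, 'a, 'z) lincat_scheme \<Rightarrow> ('p, 'b, 'q, 'c, 'w) funct_scheme \<Rightarrow>
    ('o, 'a, 'p, 'b, 'v) funct_scheme \<Rightarrow> ('o, 'a, 'q, 'c) funct" where
  "comp_functor A G F =
    \<lparr>FO = (\<lambda>a\<in>Ob A. FO G (FO F a)), FA = (\<lambda>f\<in>arrows A. FA G (FA F f))\<rparr>"

definition natural :: "('k, 'o, 'a, 'y) lincat_scheme \<Rightarrow> ('k, 'p, 'b, 'z) lincat_scheme \<Rightarrow>
    ('o, 'a, 'p, 'b, 'v) funct_scheme \<Rightarrow> ('o, 'a, 'p, 'b, 'w) funct_scheme \<Rightarrow> ('o \<Rightarrow> 'b) \<Rightarrow> bool" where
  "natural A B F G \<eta> \<longleftrightarrow>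
    \<eta> \<in> (\<Pi>\<^sub>E a\<in>Ob A. mor B (FO F a) (FO G a)) \<and>
    (\<forall>a\<in>Ob A. \<forall>b\<in>Ob A. \<forall>f\<in>mor A a b. \<eta> b \<bullet>\<^bsub>B\<^esub> FA F f = FA G f \<bullet>\<^bsub>B\<^esub> \<eta> a)"

record ('f, 't) trans =
  Src :: 'f
  Tgt :: 'f
  At :: 't

definition functor_category :: "'k ring \<Rightarrow> ('k, 'o, 'a, 'y) lincat_scheme \<Rightarrow>
    ('k, 'p, 'b, 'z) lincat_scheme \<Rightarrow>
    ('k, ('o, 'a, 'p, 'b) funct, (('o, 'a, 'p, 'b) funct, 'o \<Rightarrow> 'b) trans) lincat" where
  "functor_category K A B =
    \<lparr>Ob = {F. linear_functor K A B F},
     Hom = (\<lambda>F G. linear_space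
       {\<alpha>. Src \<alpha> = F \<and> Tgt \<alpha> = G \<and> natural A B F G (At \<alpha>)}
       \<lparr>Src = F, Tgt = G, At = (\<lambda>a\<in>Ob A. \<zero>\<^bsub>Hom B (FO F a) (FO G a)\<^esub>)\<rparr>
       (\<lambda>\<alpha> \<beta>. \<lparr>Src = F, Tgt = G,
          At = (\<lambda>a\<in>Ob A. At \<alpha> a \<oplus>\<^bsub>Hom B (FO F a) (FO G a)\<^esub> At \<beta> a)\<rparr>)
       (\<lambda>r \<alpha>. \<lparr>Src = F, Tgt = G,
          At = (\<lambda>a\<in>Ob A. r \<odot>\<^bsub>Hom B (FO F a) (FO G a)\<^esub> At \<alpha> a)\<rparr>)),
     Id = (\<lambda>F. \<lparr>Src = F, Tgt = F, At = (\<lambda>a\<in>Ob A. Id B (FO F a))\<rparr>),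
     Comp = (\<lambda>\<beta> \<alpha>. \<lparr>Src = Src \<alpha>, Tgt = Tgt \<beta>, At = (\<lambda>a\<in>Ob A. At \<beta> a \<bullet>\<^bsub>B\<^esub> At \<alpha> a)\<rparr>)\<rparr>"


section \<open>Small colimits\<close>

text \<open>Shapes are quivers rather than categories. This gives the same notion of preserving all small
  colimits: a colimit over a category is one over its underlying quiver, and a colimit over a quiver
  is one over the free category on it.\<close>

record ('i, 'o, 'a) diagram =
  Verts :: "'i set"
  Edges :: "'i set"
  Tail :: "'i \<Rightarrow> 'i"
  Head :: "'i \<Rightarrow> 'i"
  DO :: "'i \<Rightarrow> 'o"
  DA :: "'i \<Rightarrow> 'a"

definition is_diagram :: "('k, 'o, 'a, 'z) lincat_scheme \<Rightarrow> ('i, 'o, 'a) diagram \<Rightarrow> bool" where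
  "is_diagram A D \<longleftrightarrow>
    (\<forall>i\<in>Verts D. DO D i \<in> Ob A) \<and>
    (\<forall>e\<in>Edges D. Tail D e \<in> Verts D \<and> Head D e \<in> Verts D \<and>
       DA D e \<in> mor A (DO D (Tail D e)) (DO D (Head D e)))"

definition is_cocone :: "('k, 'o, 'a, 'z) lincat_scheme \<Rightarrow> ('i, 'o, 'a) diagram \<Rightarrow> 'o \<Rightarrow>
    ('i \<Rightarrow> 'a) \<Rightarrow> bool" where
  "is_cocone A D c l \<longleftrightarrow>
    c \<in> Ob A \<and> (\<forall>i\<in>Verts D. l i \<in> mor A (DO D i) c) \<and>
    (\<forall>e\<in>Edges D. l (Head D e) \<bullet>\<^bsub>A\<^esub> DA D e = l (Tail D e))"

definition is_colimit :: "('k, 'o, 'a, 'z) lincat_scheme \<Rightarrow> ('i, 'o, 'a) diagram \<Rightarrow> 'o \<Rightarrow>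
    ('i \<Rightarrow> 'a) \<Rightarrow> bool" where
  "is_colimit A D c l \<longleftrightarrow>
    is_cocone A D c l \<and>
    (\<forall>c' l'. is_cocone A D c' l' \<longrightarrow>
       (\<exists>!h. h \<in> mor A c c' \<and> (\<forall>i\<in>Verts D. h \<bullet>\<^bsub>A\<^esub> l i = l' i)))"

definition map_diagram :: "('o, 'a, 'p, 'b, 'w) funct_scheme \<Rightarrow> ('i, 'o, 'a) diagram \<Rightarrow>
    ('i, 'p, 'b) diagram" where
  "map_diagram F D =
    \<lparr>Verts = Verts D, Edges = Edges D, Tail = Tail D, Head = Head D,
     DO = (\<lambda>i. FO F (DO D i)), DA = (\<lambda>e. FA F (DA D e))\<rparr>"

text \<open>The type \<open>'i\<close> plays the role of the universe of small sets.\<close>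

definition cocontinuous :: "'i itself \<Rightarrow> ('k, 'o, 'a, 'y) lincat_scheme \<Rightarrow>
    ('k, 'p, 'b, 'z) lincat_scheme \<Rightarrow> ('o, 'a, 'p, 'b, 'w) funct_scheme \<Rightarrow> bool" where
  "cocontinuous I A B F \<longleftrightarrow>
    (\<forall>(D :: ('i, 'o, 'a) diagram) c l. is_diagram A D \<longrightarrow> is_colimit A D c l \<longrightarrow>
       is_colimit B (map_diagram F D) (FO F c) (\<lambda>i. FA F (l i)))"


section \<open>Monoidal and braided categories, monoidal functors\<close>

record ('k, 'o, 'a) moncat = "('k, 'o, 'a) lincat" +
  TO :: "'o \<Rightarrow> 'o \<Rightarrow> 'o"  (infixr "\<boxtimes>\<index>" 75)
  TA :: "'a \<Rightarrow> 'a \<Rightarrow> 'a"  (infixr "\<boxdot>\<index>" 75)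
  Unit :: 'o
  Assoc :: "'o \<Rightarrow> 'o \<Rightarrow> 'o \<Rightarrow> 'a"
  Lun :: "'o \<Rightarrow> 'a"
  Run :: "'o \<Rightarrow> 'a"

locale monoidal_category = linear_category K C
  for K :: "'k ring" and C :: "('k, 'o, 'a, 'z) moncat_scheme" +
  assumes tensor_obj: "\<And>a b. \<lbrakk>a \<in> Ob C; b \<in> Ob C\<rbrakk> \<Longrightarrow> a \<boxtimes>\<^bsub>C\<^esub> b \<in> Ob C"
    and unit_obj: "Unit C \<in> Ob C"
    and tensor_arr: "\<And>a b a' b' f g. \<lbrakk>a \<in> Ob C; b \<in> Ob C; a' \<in> Ob C; b' \<in> Ob C;
          f \<in> mor C a a'; g \<in> mor C b b'\<rbrakk> \<Longrightarrow> f \<boxdot>\<^bsub>C\<^esub> g \<in> mor C (a \<boxtimes>\<^bsub>C\<^esub> b) (a' \<boxtimes>\<^bsub>C\<^esub> b')"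
    and tensor_id: "\<And>a b. \<lbrakk>a \<in> Ob C; b \<in> Ob C\<rbrakk> \<Longrightarrow> Id C a \<boxdot>\<^bsub>C\<^esub> Id C b = Id C (a \<boxtimes>\<^bsub>C\<^esub> b)"
    and tensor_comp: "\<And>a b a' b' a'' b'' f g f' g'. \<lbrakk>a \<in> Ob C; b \<in> Ob C; a' \<in> Ob C; b' \<in> Ob C;
          a'' \<in> Ob C; b'' \<in> Ob C; f \<in> mor C a a'; g \<in> mor C b b'; f' \<in> mor C a' a''; g' \<in> mor C b' b''\<rbrakk>
          \<Longrightarrow> (f' \<bullet>\<^bsub>C\<^esub> f) \<boxdot>\<^bsub>C\<^esub> (g' \<bullet>\<^bsub>C\<^esub> g) = (f' \<boxdot>\<^bsub>C\<^esub> g') \<bullet>\<^bsub>C\<^esub> (f \<boxdot>\<^bsub>C\<^esub> g)"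
    and tensor_add_left: "\<And>a b a' b' f f' g. \<lbrakk>a \<in> Ob C; b \<in> Ob C; a' \<in> Ob C; b' \<in> Ob C;
          f \<in> mor C a a'; f' \<in> mor C a a'; g \<in> mor C b b'\<rbrakk>
          \<Longrightarrow> (f \<oplus>\<^bsub>Hom C a a'\<^esub> f') \<boxdot>\<^bsub>C\<^esub> g =
              (f \<boxdot>\<^bsub>C\<^esub> g) \<oplus>\<^bsub>Hom C (a \<boxtimes>\<^bsub>C\<^esub> b) (a' \<boxtimes>\<^bsub>C\<^esub> b')\<^esub> (f' \<boxdot>\<^bsub>C\<^esub> g)"
    and tensor_add_right: "\<And>a b a' b' f g g'. \<lbrakk>a \<in> Ob C; b \<in> Ob C; a' \<in> Ob C; b' \<in> Ob C;
          f \<in> mor C a a'; g \<in> mor C b b'; g' \<in> mor C b b'\<rbrakk>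
          \<Longrightarrow> f \<boxdot>\<^bsub>C\<^esub> (g \<oplus>\<^bsub>Hom C b b'\<^esub> g') =
              (f \<boxdot>\<^bsub>C\<^esub> g) \<oplus>\<^bsub>Hom C (a \<boxtimes>\<^bsub>C\<^esub> b) (a' \<boxtimes>\<^bsub>C\<^esub> b')\<^esub> (f \<boxdot>\<^bsub>C\<^esub> g')"
    and tensor_smult_left: "\<And>a b a' b' f g r. \<lbrakk>a \<in> Ob C; b \<in> Ob C; a' \<in> Ob C; b' \<in> Ob C;
          f \<in> mor C a a'; g \<in> mor C b b'; r \<in> carrier K\<rbrakk>
          \<Longrightarrow> (r \<odot>\<^bsub>Hom C a a'\<^esub> f) \<boxdot>\<^bsub>C\<^esub> g =
              r \<odot>\<^bsub>Hom C (a \<boxtimes>\<^bsub>C\<^esub> b) (a' \<boxtimes>\<^bsub>C\<^esub> b')\<^esub> (f \<boxdot>\<^bsub>C\<^esub> g)"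
    and tensor_smult_right: "\<And>a b a' b' f g r. \<lbrakk>a \<in> Ob C; b \<in> Ob C; a' \<in> Ob C; b' \<in> Ob C;
          f \<in> mor C a a'; g \<in> mor C b b'; r \<in> carrier K\<rbrakk>
          \<Longrightarrow> f \<boxdot>\<^bsub>C\<^esub> (r \<odot>\<^bsub>Hom C b b'\<^esub> g) =
              r \<odot>\<^bsub>Hom C (a \<boxtimes>\<^bsub>C\<^esub> b) (a' \<boxtimes>\<^bsub>C\<^esub> b')\<^esub> (f \<boxdot>\<^bsub>C\<^esub> g)"
    and assoc_iso: "\<And>a b c. \<lbrakk>a \<in> Ob C; b \<in> Ob C; c \<in> Ob C\<rbrakk>
          \<Longrightarrow> iso_arr C ((a \<boxtimes>\<^bsub>C\<^esub> b) \<boxtimes>\<^bsub>C\<^esub> c) (a \<boxtimes>\<^bsub>C\<^esub> (b \<boxtimes>\<^bsub>C\<^esub> c)) (Assoc C a b c)"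
    and assoc_nat: "\<And>a b c a' b' c' f g h. \<lbrakk>a \<in> Ob C; b \<in> Ob C; c \<in> Ob C;
          a' \<in> Ob C; b' \<in> Ob C; c' \<in> Ob C; f \<in> mor C a a'; g \<in> mor C b b'; h \<in> mor C c c'\<rbrakk>
          \<Longrightarrow> Assoc C a' b' c' \<bullet>\<^bsub>C\<^esub> ((f \<boxdot>\<^bsub>C\<^esub> g) \<boxdot>\<^bsub>C\<^esub> h) = (f \<boxdot>\<^bsub>C\<^esub> (g \<boxdot>\<^bsub>C\<^esub> h)) \<bullet>\<^bsub>C\<^esub> Assoc C a b c"
    and lun_iso: "\<And>a. a \<in> Ob C \<Longrightarrow> iso_arr C (Unit C \<boxtimes>\<^bsub>C\<^esub> a) a (Lun C a)"
    and lun_nat: "\<And>a b f. \<lbrakk>a \<in> Ob C; b \<in> Ob C; f \<in> mor C a b\<rbrakk>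
          \<Longrightarrow> Lun C b \<bullet>\<^bsub>C\<^esub> (Id C (Unit C) \<boxdot>\<^bsub>C\<^esub> f) = f \<bullet>\<^bsub>C\<^esub> Lun C a"
    and run_iso: "\<And>a. a \<in> Ob C \<Longrightarrow> iso_arr C (a \<boxtimes>\<^bsub>C\<^esub> Unit C) a (Run C a)"
    and run_nat: "\<And>a b f. \<lbrakk>a \<in> Ob C; b \<in> Ob C; f \<in> mor C a b\<rbrakk>
          \<Longrightarrow> Run C b \<bullet>\<^bsub>C\<^esub> (f \<boxdot>\<^bsub>C\<^esub> Id C (Unit C)) = f \<bullet>\<^bsub>C\<^esub> Run C a"
    and pentagon: "\<And>a b c d. \<lbrakk>a \<in> Ob C; b \<in> Ob C; c \<in> Ob C; d \<in> Ob C\<rbrakk>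
          \<Longrightarrow> Assoc C a b (c \<boxtimes>\<^bsub>C\<^esub> d) \<bullet>\<^bsub>C\<^esub> Assoc C (a \<boxtimes>\<^bsub>C\<^esub> b) c d =
              (Id C a \<boxdot>\<^bsub>C\<^esub> Assoc C b c d) \<bullet>\<^bsub>C\<^esub> Assoc C a (b \<boxtimes>\<^bsub>C\<^esub> c) d \<bullet>\<^bsub>C\<^esub> (Assoc C a b c \<boxdot>\<^bsub>C\<^esub> Id C d)"
    and triangle: "\<And>a b. \<lbrakk>a \<in> Ob C; b \<in> Ob C\<rbrakk>
          \<Longrightarrow> (Id C a \<boxdot>\<^bsub>C\<^esub> Lun C b) \<bullet>\<^bsub>C\<^esub> Assoc C a (Unit C) b = Run C a \<boxdot>\<^bsub>C\<^esub> Id C b"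

record ('k, 'o, 'a) braidcat = "('k, 'o, 'a) moncat" +
  Braid :: "'o \<Rightarrow> 'o \<Rightarrow> 'a"

locale braided_category = monoidal_category K C
  for K :: "'k ring" and C :: "('k, 'o, 'a, 'z) braidcat_scheme" +
  assumes braid_iso: "\<And>a b. \<lbrakk>a \<in> Ob C; b \<in> Ob C\<rbrakk>
          \<Longrightarrow> iso_arr C (a \<boxtimes>\<^bsub>C\<^esub> b) (b \<boxtimes>\<^bsub>C\<^esub> a) (Braid C a b)"
    and braid_nat: "\<And>a b a' b' f g. \<lbrakk>a \<in> Ob C; b \<in> Ob C; a' \<in> Ob C; b' \<in> Ob C;
          f \<in> mor C a a'; g \<in> mor C b b'\<rbrakk>
          \<Longrightarrow> Braid C a' b' \<bullet>\<^bsub>C\<^esub> (f \<boxdot>\<^bsub>C\<^esub> g) = (g \<boxdot>\<^bsub>C\<^esub> f) \<bullet>\<^bsub>C\<^esub> Braid C a b"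
    and hexagon_right: "\<And>a b c. \<lbrakk>a \<in> Ob C; b \<in> Ob C; c \<in> Ob C\<rbrakk>
          \<Longrightarrow> Assoc C b c a \<bullet>\<^bsub>C\<^esub> Braid C a (b \<boxtimes>\<^bsub>C\<^esub> c) \<bullet>\<^bsub>C\<^esub> Assoc C a b c =
              (Id C b \<boxdot>\<^bsub>C\<^esub> Braid C a c) \<bullet>\<^bsub>C\<^esub> Assoc C b a c \<bullet>\<^bsub>C\<^esub> (Braid C a b \<boxdot>\<^bsub>C\<^esub> Id C c)"
    and hexagon_left: "\<And>a b c. \<lbrakk>a \<in> Ob C; b \<in> Ob C; c \<in> Ob C\<rbrakk>
          \<Longrightarrow> Braid C (a \<boxtimes>\<^bsub>C\<^esub> b) c =
              Assoc C c a b \<bullet>\<^bsub>C\<^esub> (Braid C a c \<boxdot>\<^bsub>C\<^esub> Id C b) \<bullet>\<^bsub>C\<^esub>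
              inv_arr C ((a \<boxtimes>\<^bsub>C\<^esub> c) \<boxtimes>\<^bsub>C\<^esub> b) (a \<boxtimes>\<^bsub>C\<^esub> (c \<boxtimes>\<^bsub>C\<^esub> b)) (Assoc C a c b) \<bullet>\<^bsub>C\<^esub>
              (Id C a \<boxdot>\<^bsub>C\<^esub> Braid C b c) \<bullet>\<^bsub>C\<^esub> Assoc C a b c"

record ('o, 'a, 'p, 'b) monfun = "('o, 'a, 'p, 'b) funct" +
  Mul :: "'o \<Rightarrow> 'o \<Rightarrow> 'b"
  Eps :: 'b

locale strong_monoidal_functor = linear_functor K A B F
  for K :: "'k ring" and A :: "('k, 'o, 'a, 'y) moncat_scheme"
    and B :: "('k, 'p, 'b, 'z) moncat_scheme" and F :: "('o, 'a, 'p, 'b, 'w) monfun_scheme" +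
  assumes mul_iso: "\<And>x y. \<lbrakk>x \<in> Ob A; y \<in> Ob A\<rbrakk>
          \<Longrightarrow> iso_arr B (FO F x \<boxtimes>\<^bsub>B\<^esub> FO F y) (FO F (x \<boxtimes>\<^bsub>A\<^esub> y)) (Mul F x y)"
    and mul_nat: "\<And>x y x' y' f g. \<lbrakk>x \<in> Ob A; y \<in> Ob A; x' \<in> Ob A; y' \<in> Ob A;
          f \<in> mor A x x'; g \<in> mor A y y'\<rbrakk>
          \<Longrightarrow> Mul F x' y' \<bullet>\<^bsub>B\<^esub> (FA F f \<boxdot>\<^bsub>B\<^esub> FA F g) = FA F (f \<boxdot>\<^bsub>A\<^esub> g) \<bullet>\<^bsub>B\<^esub> Mul F x y"
    and eps_iso: "iso_arr B (Unit B) (FO F (Unit A)) (Eps F)"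
    and mul_assoc: "\<And>x y z. \<lbrakk>x \<in> Ob A; y \<in> Ob A; z \<in> Ob A\<rbrakk>
          \<Longrightarrow> FA F (Assoc A x y z) \<bullet>\<^bsub>B\<^esub> Mul F (x \<boxtimes>\<^bsub>A\<^esub> y) z \<bullet>\<^bsub>B\<^esub> (Mul F x y \<boxdot>\<^bsub>B\<^esub> Id B (FO F z)) =
              Mul F x (y \<boxtimes>\<^bsub>A\<^esub> z) \<bullet>\<^bsub>B\<^esub> (Id B (FO F x) \<boxdot>\<^bsub>B\<^esub> Mul F y z) \<bullet>\<^bsub>B\<^esub>
              Assoc B (FO F x) (FO F y) (FO F z)"
    and mul_lun: "\<And>x. x \<in> Ob A
          \<Longrightarrow> FA F (Lun A x) \<bullet>\<^bsub>B\<^esub> Mul F (Unit A) x \<bullet>\<^bsub>B\<^esub> (Eps F \<boxdot>\<^bsub>B\<^esub> Id B (FO F x)) = Lun B (FO F x)"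
    and mul_run: "\<And>x. x \<in> Ob A
          \<Longrightarrow> FA F (Run A x) \<bullet>\<^bsub>B\<^esub> Mul F x (Unit A) \<bullet>\<^bsub>B\<^esub> (Id B (FO F x) \<boxdot>\<^bsub>B\<^esub> Eps F) = Run B (FO F x)"

definition comp_monfun :: "('k, 'o, 'a, 'y) lincat_scheme \<Rightarrow> ('k, 'q, 'c, 'z) lincat_scheme \<Rightarrow>
    ('p, 'b, 'q, 'c) monfun \<Rightarrow> ('o, 'a, 'p, 'b) monfun \<Rightarrow> ('o, 'a, 'q, 'c) monfun" where
  "comp_monfun A E G F =
    \<lparr>FO = FO (comp_functor A G F), FA = FA (comp_functor A G F),
     Mul = (\<lambda>x y. FA G (Mul F x y) \<bullet>\<^bsub>E\<^esub> Mul G (FO F x) (FO F y)),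
     Eps = FA G (Eps F) \<bullet>\<^bsub>E\<^esub> Eps G\<rparr>"

definition monoidal_natural_iso :: "('k, 'o, 'a, 'y) moncat_scheme \<Rightarrow> ('k, 'p, 'b, 'z) moncat_scheme \<Rightarrow>
    ('o, 'a, 'p, 'b) monfun \<Rightarrow> ('o, 'a, 'p, 'b) monfun \<Rightarrow> ('o \<Rightarrow> 'b) \<Rightarrow> bool" where
  "monoidal_natural_iso A B F G \<theta> \<longleftrightarrow>
    natural A B F G \<theta> \<and>
    (\<forall>x\<in>Ob A. iso_arr B (FO F x) (FO G x) (\<theta> x)) \<and>
    (\<forall>x\<in>Ob A. \<forall>y\<in>Ob A. \<theta> (x \<boxtimes>\<^bsub>A\<^esub> y) \<bullet>\<^bsub>B\<^esub> Mul F x y = Mul G x y \<bullet>\<^bsub>B\<^esub> (\<theta> x \<boxdot>\<^bsub>B\<^esub> \<theta> y)) \<and>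
    \<theta> (Unit A) \<bullet>\<^bsub>B\<^esub> Eps F = Eps G"


section \<open>The monoidal category of endofunctors\<close>

text \<open>The tensor product is composition in diagrammatic order, i.e. \<open>F \<boxtimes> G\<close> is first \<open>F\<close>, then \<open>G\<close>.
  This is the order for which \<open>X \<mapsto> (- \<otimes> X)\<close> is monoidal, and for which the natural transformations
  \<open>x\<close> and \<open>c\<close> below satisfy the relation \<open>t\<^sub>1 y\<^sub>1 t\<^sub>1 = y\<^sub>2\<close>: here \<open>y\<^sub>1\<close> acts on \<open>(Y \<otimes> X) \<otimes> X\<close> by the
  double braiding of \<open>Y\<close> with the inner \<open>X\<close>, and \<open>y\<^sub>2\<close> by that of \<open>Y \<otimes> X\<close> with the outer \<open>X\<close>.\<close>

definition endofunctor_category :: "'k ring \<Rightarrow> ('k, 'o, 'a, 'z) lincat_scheme \<Rightarrow>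
    ('k, ('o, 'a, 'o, 'a) funct, (('o, 'a, 'o, 'a) funct, 'o \<Rightarrow> 'a) trans) moncat" where
  "endofunctor_category K C =
    (let E = functor_category K C C in
    \<lparr>Ob = Ob E, Hom = Hom E, Id = Id E, Comp = Comp E,
     TO = (\<lambda>F G. comp_functor C G F),
     TA = (\<lambda>\<alpha> \<beta>. \<lparr>Src = comp_functor C (Src \<beta>) (Src \<alpha>), Tgt = comp_functor C (Tgt \<beta>) (Tgt \<alpha>),
        At = (\<lambda>Y\<in>Ob C. At \<beta> (FO (Tgt \<alpha>) Y) \<bullet>\<^bsub>C\<^esub> FA (Src \<beta>) (At \<alpha> Y))\<rparr>),
     Unit = id_functor C,
     Assoc = (\<lambda>F G H. Id E (comp_functor C H (comp_functor C G F))),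
     Lun = Id E,
     Run = Id E\<rparr>)"


section \<open>The category of vector spaces\<close>

record ('k, 'v) lmap =
  ldom :: "('k, 'v) module"
  lcod :: "('k, 'v) module"
  lapp :: "'v \<Rightarrow> 'v"

definition lmap_of :: "('k, 'v) module \<Rightarrow> ('k, 'v) module \<Rightarrow> ('v \<Rightarrow> 'v) \<Rightarrow> ('k, 'v) lmap" where
  "lmap_of V W f = \<lparr>ldom = V, lcod = W, lapp = restrict f (carrier V)\<rparr>"

definition linear_map :: "'k ring \<Rightarrow> ('k, 'v) module \<Rightarrow> ('k, 'v) module \<Rightarrow> ('v \<Rightarrow> 'v) \<Rightarrow> bool" where
  "linear_map K V W f \<longleftrightarrow>
    f \<in> carrier V \<rightarrow>\<^sub>E carrier W \<and>
    (\<forall>v\<in>carrier V. \<forall>w\<in>carrier V. f (v \<oplus>\<^bsub>V\<^esub> w) = f v \<oplus>\<^bsub>W\<^esub> f w) \<and>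
    (\<forall>r\<in>carrier K. \<forall>v\<in>carrier V. f (r \<odot>\<^bsub>V\<^esub> v) = r \<odot>\<^bsub>W\<^esub> f v)"

definition vect :: "'k ring \<Rightarrow> ('k, ('k, 'v) module, ('k, 'v) lmap) lincat" where
  "vect K =
    \<lparr>Ob = {V. module K V},
     Hom = (\<lambda>V W. linear_space {f. ldom f = V \<and> lcod f = W \<and> linear_map K V W (lapp f)}
        (lmap_of V W (\<lambda>v. \<zero>\<^bsub>W\<^esub>))
        (\<lambda>f g. lmap_of V W (\<lambda>v. lapp f v \<oplus>\<^bsub>W\<^esub> lapp g v))
        (\<lambda>r f. lmap_of V W (\<lambda>v. r \<odot>\<^bsub>W\<^esub> lapp f v))),
     Id = (\<lambda>V. lmap_of V V (\<lambda>v. v)),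
     Comp = (\<lambda>g f. lmap_of (ldom f) (lcod g) (\<lambda>v. lapp g (lapp f v)))\<rparr>"


section \<open>Affine braid groups and affine Hecke algebras\<close>

text \<open>A letter \<open>(b, g)\<close> is the generator \<open>g\<close> if \<open>b\<close> is false and its inverse if \<open>b\<close> is true.\<close>

type_synonym 'g word = "(bool \<times> 'g) list"

inductive word_eq :: "'g set \<Rightarrow> ('g word \<times> 'g word) set \<Rightarrow> 'g word \<Rightarrow> 'g word \<Rightarrow> bool"
  for S R where
  rel: "(u, v) \<in> R \<Longrightarrow> word_eq S R u v"
| cancel: "g \<in> S \<Longrightarrow> word_eq S R [(b, g), (\<not> b, g)] []"
| refl: "word_eq S R u u"
| sym: "word_eq S R u v \<Longrightarrow> word_eq S R v u"
| trans: "\<lbrakk>word_eq S R u v; word_eq S R v w\<rbrakk> \<Longrightarrow> word_eq S R u w"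
| append: "\<lbrakk>word_eq S R u u'; word_eq S R v v'\<rbrakk> \<Longrightarrow> word_eq S R (u @ v) (u' @ v')"

definition presented_group :: "'g set \<Rightarrow> ('g word \<times> 'g word) set \<Rightarrow> 'g word set monoid" where
  "presented_group S R =
    \<lparr>carrier = {Collect (word_eq S R w) |w. snd ` set w \<subseteq> S},
     mult = (\<lambda>x y. {w. \<exists>u\<in>x. \<exists>v\<in>y. word_eq S R (u @ v) w}),
     one = Collect (word_eq S R [])\<rparr>"

datatype bgen = T nat | Y nat

definition bgens :: "nat \<Rightarrow> bgen set" where
  "bgens n = {T i |i. 1 \<le> i \<and> i < n} \<union> {Y i |i. 1 \<le> i \<and> i \<le> n}"

abbreviation t_word :: "nat \<Rightarrow> bgen word" where "t_word i \<equiv> [(False, T i)]"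
abbreviation y_word :: "nat \<Rightarrow> bgen word" where "y_word i \<equiv> [(False, Y i)]"

definition brels :: "nat \<Rightarrow> (bgen word \<times> bgen word) set" where
  "brels n =
    {(t_word i @ t_word (i + 1) @ t_word i, t_word (i + 1) @ t_word i @ t_word (i + 1)) |i.
       1 \<le> i \<and> i + 1 < n} \<union>
    {(t_word i @ t_word j, t_word j @ t_word i) |i j.
       1 \<le> i \<and> i < n \<and> 1 \<le> j \<and> j < n \<and> (i + 1 < j \<or> j + 1 < i)} \<union>
    {(t_word i @ y_word i @ t_word i, y_word (i + 1)) |i. 1 \<le> i \<and> i < n} \<union>
    {(y_word i @ y_word j, y_word j @ y_word i) |i j. 1 \<le> i \<and> i \<le> n \<and> 1 \<le> j \<and> j \<le> n} \<union>
    {(t_word i @ y_word j, y_word j @ t_word i) |i j.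
       1 \<le> i \<and> i < n \<and> 1 \<le> j \<and> j \<le> n \<and> j \<noteq> i \<and> j \<noteq> i + 1}"

definition affine_braid_group :: "nat \<Rightarrow> bgen word set monoid" where
  "affine_braid_group n = presented_group (bgens n) (brels n)"

definition braid_class :: "nat \<Rightarrow> bgen word \<Rightarrow> bgen word set" where
  "braid_class n w = Collect (word_eq (bgens n) (brels n) w)"

text \<open>Elements of a group algebra are finitely supported functions on the group.\<close>

definition group_algebra :: "'k ring \<Rightarrow> 'g monoid \<Rightarrow> ('k, 'g \<Rightarrow> 'k) module" where
  "group_algebra K G =
    \<lparr>carrier = {f. range f \<subseteq> carrier K \<and> finite {x. f x \<noteq> \<zero>\<^bsub>K\<^esub>} \<and> {x. f x \<noteq> \<zero>\<^bsub>K\<^esub>} \<subseteq> carrier G},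
     mult = (\<lambda>f g z. finsum K (\<lambda>(x, y). f x \<otimes>\<^bsub>K\<^esub> g y)
       {(x, y). f x \<noteq> \<zero>\<^bsub>K\<^esub> \<and> g y \<noteq> \<zero>\<^bsub>K\<^esub> \<and> x \<otimes>\<^bsub>G\<^esub> y = z}),
     one = (\<lambda>x. if x = \<one>\<^bsub>G\<^esub> then \<one>\<^bsub>K\<^esub> else \<zero>\<^bsub>K\<^esub>),
     zero = (\<lambda>x. \<zero>\<^bsub>K\<^esub>),
     add = (\<lambda>f g x. f x \<oplus>\<^bsub>K\<^esub> g x),
     smult = (\<lambda>r f x. r \<otimes>\<^bsub>K\<^esub> f x)\<rparr>"

type_synonym 'k braid_elt = "bgen word set \<Rightarrow> 'k"
type_synonym 'k hecke_elt = "'k braid_elt set"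

definition braid_algebra :: "'k ring \<Rightarrow> nat \<Rightarrow> ('k, 'k braid_elt) module" where
  "braid_algebra K n = group_algebra K (affine_braid_group n)"

definition braid_elt :: "'k ring \<Rightarrow> nat \<Rightarrow> bgen word \<Rightarrow> 'k braid_elt" where
  "braid_elt K n w = (\<lambda>x. if x = braid_class n w then \<one>\<^bsub>K\<^esub> else \<zero>\<^bsub>K\<^esub>)"

text \<open>The homomorphism \<open>\<mu>\<^sub>m\<^sub>,\<^sub>n\<close> is written as the bilinear map \<open>(a, b) \<mapsto> \<mu>\<^sub>m\<^sub>,\<^sub>n (a \<otimes> b)\<close>. On words it is
  \<open>(u, v) \<mapsto> u v'\<close>, where \<open>v'\<close> is \<open>v\<close> with all indices raised by \<open>m\<close>.\<close>

fun shift_gen :: "nat \<Rightarrow> bgen \<Rightarrow> bgen" where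
  "shift_gen m (T i) = T (i + m)"
| "shift_gen m (Y i) = Y (i + m)"

definition shift_word :: "nat \<Rightarrow> bgen word \<Rightarrow> bgen word" where
  "shift_word m w = map (\<lambda>(b, g). (b, shift_gen m g)) w"

definition group_mu :: "nat \<Rightarrow> nat \<Rightarrow> bgen word set \<Rightarrow> bgen word set \<Rightarrow> bgen word set" where
  "group_mu m n x y =
    {w. \<exists>u\<in>x. \<exists>v\<in>y. word_eq (bgens (m + n)) (brels (m + n)) (u @ shift_word m v) w}"

definition braid_mu :: "'k ring \<Rightarrow> nat \<Rightarrow> nat \<Rightarrow> 'k braid_elt \<Rightarrow> 'k braid_elt \<Rightarrow> 'k braid_elt" where
  "braid_mu K m n f g =
    (\<lambda>z. finsum K (\<lambda>(x, y). f x \<otimes>\<^bsub>K\<^esub> g y)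
      {(x, y). f x \<noteq> \<zero>\<^bsub>K\<^esub> \<and> g y \<noteq> \<zero>\<^bsub>K\<^esub> \<and> group_mu m n x y = z})"

definition hecke_ideal :: "'k ring \<Rightarrow> 'k \<Rightarrow> nat \<Rightarrow> 'k braid_elt set" where
  "hecke_ideal K q n =
    (let A = braid_algebra K n in
     Idl\<^bsub>A\<^esub> {(braid_elt K n (t_word i) \<ominus>\<^bsub>A\<^esub> q \<odot>\<^bsub>A\<^esub> \<one>\<^bsub>A\<^esub>) \<otimes>\<^bsub>A\<^esub>
            (braid_elt K n (t_word i) \<oplus>\<^bsub>A\<^esub> inv\<^bsub>K\<^esub> q \<odot>\<^bsub>A\<^esub> \<one>\<^bsub>A\<^esub>) |i. 1 \<le> i \<and> i < n})"

definition hecke_proj :: "'k ring \<Rightarrow> 'k \<Rightarrow> nat \<Rightarrow> 'k braid_elt \<Rightarrow> 'k hecke_elt" where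
  "hecke_proj K q n f = hecke_ideal K q n +>\<^bsub>braid_algebra K n\<^esub> f"

definition affine_hecke_algebra :: "'k ring \<Rightarrow> 'k \<Rightarrow> nat \<Rightarrow> ('k, 'k hecke_elt) module" where
  "affine_hecke_algebra K q n =
    ring.extend (braid_algebra K n Quot hecke_ideal K q n)
      \<lparr>smult = (\<lambda>r X. \<Union>f\<in>X. hecke_proj K q n (r \<odot>\<^bsub>braid_algebra K n\<^esub> f))\<rparr>"

definition hecke_mu :: "'k ring \<Rightarrow> 'k \<Rightarrow> nat \<Rightarrow> nat \<Rightarrow> 'k hecke_elt \<Rightarrow> 'k hecke_elt \<Rightarrow> 'k hecke_elt" where
  "hecke_mu K q m n X Z = (\<Union>f\<in>X. \<Union>g\<in>Z. hecke_proj K q (m + n) (braid_mu K m n f g))"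


section \<open>A universe for the underlying sets of modules\<close>

text \<open>The underlying sets of the vector spaces considered below are subsets of the following type,
  where the atoms \<open>'u\<close> are arbitrary. It contains the algebras and is closed under the tensor products
  that are needed: an element of a tensor product is a formal sum of pure tensors, chosen in its
  equivalence class.\<close>

datatype ('k, 'u) univ =
    Atom 'u
  | InB "'k braid_elt"
  | InH "'k hecke_elt"
  | DayTerms (day_terms: "(nat \<times> ('k, 'u) univ \<times> nat \<times> ('k, 'u) univ \<times> ('k, 'u) univ) list")
  | ExtTerms (ext_terms: "(('k, 'u) univ \<times> ('k, 'u) univ) list")

text \<open>The least congruence on formal sums (concatenation is addition) containing \<open>R\<close>.\<close>

inductive sum_eq :: "('g list \<Rightarrow> 'g list \<Rightarrow> bool) \<Rightarrow> 'g list \<Rightarrow> 'g list \<Rightarrow> bool" for R where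
  rel: "R P Q \<Longrightarrow> sum_eq R P Q"
| swap: "sum_eq R (P @ Q) (Q @ P)"
| refl: "sum_eq R P P"
| sym: "sum_eq R P Q \<Longrightarrow> sum_eq R Q P"
| trans: "\<lbrakk>sum_eq R P Q; sum_eq R Q W\<rbrakk> \<Longrightarrow> sum_eq R P W"
| append: "\<lbrakk>sum_eq R P P'; sum_eq R Q Q'\<rbrakk> \<Longrightarrow> sum_eq R (P @ Q) (P' @ Q')"

definition sum_rep :: "('g list \<Rightarrow> 'g list \<Rightarrow> bool) \<Rightarrow> 'g list \<Rightarrow> 'g list" where
  "sum_rep R P = (SOME Q. sum_eq R P Q)"

text \<open>Formal sums of elements of \<open>S\<close> modulo \<open>R\<close>, encoded by \<open>e\<close> (with inverse \<open>d\<close>);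
  \<open>s r\<close> is multiplication by the scalar \<open>r\<close> on generators.\<close>

definition sum_space :: "('g list \<Rightarrow> 'v) \<Rightarrow> ('v \<Rightarrow> 'g list) \<Rightarrow> 'g set \<Rightarrow> ('g list \<Rightarrow> 'g list \<Rightarrow> bool) \<Rightarrow>
    ('k \<Rightarrow> 'g \<Rightarrow> 'g) \<Rightarrow> ('k, 'v) module" where
  "sum_space e d S R s =
    linear_space {e (sum_rep R P) |P. set P \<subseteq> S} (e (sum_rep R []))
      (\<lambda>x y. e (sum_rep R (d x @ d y))) (\<lambda>r x. e (sum_rep R (map (s r) (d x))))"


section \<open>The monoidal category of modules over a sequence of algebras\<close>

record ('k, 'u, 'x) algseq =
  Alg :: "nat \<Rightarrow> ('k, 'x) module"
  Mu :: "nat \<Rightarrow> nat \<Rightarrow> 'x \<Rightarrow> 'x \<Rightarrow> 'x"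
  Emb :: "'x \<Rightarrow> ('k, 'u) univ"

abbreviation Unemb :: "('k, 'u, 'x) algseq \<Rightarrow> ('k, 'u) univ \<Rightarrow> 'x" where
  "Unemb A \<equiv> Hilbert_Choice.inv (Emb A)"

definition braid_seq :: "'k ring \<Rightarrow> ('k, 'u, 'k braid_elt) algseq" where
  "braid_seq K = \<lparr>Alg = braid_algebra K, Mu = braid_mu K, Emb = InB\<rparr>"

definition hecke_seq :: "'k ring \<Rightarrow> 'k \<Rightarrow> ('k, 'u, 'k hecke_elt) algseq" where
  "hecke_seq K q = \<lparr>Alg = affine_hecke_algebra K q, Mu = hecke_mu K q, Emb = InH\<rparr>"

text \<open>The category with objects the natural numbers, \<open>End n = A\<^sub>n\<close> and only zero morphisms between
  different objects. The arrow \<open>(m, n, a)\<close> goes from \<open>m\<close> to \<open>n\<close>.\<close>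

type_synonym 'x bar_arr = "nat \<times> nat \<times> 'x"

definition bar_category :: "('k, 'u, 'x) algseq \<Rightarrow> ('k, nat, 'x bar_arr) lincat" where
  "bar_category A =
    \<lparr>Ob = UNIV,
     Hom = (\<lambda>m n. linear_space
       {(m, n, a) |a. a \<in> carrier (Alg A m) \<and> (m = n \<or> a = \<zero>\<^bsub>Alg A m\<^esub>)}
       (m, n, \<zero>\<^bsub>Alg A m\<^esub>)
       (\<lambda>(_, _, a) (_, _, b). (m, n, a \<oplus>\<^bsub>Alg A m\<^esub> b))
       (\<lambda>r (_, _, a). (m, n, r \<odot>\<^bsub>Alg A m\<^esub> a))),
     Id = (\<lambda>n. (n, n, \<one>\<^bsub>Alg A n\<^esub>)),
     Comp = (\<lambda>(n', p, b) (m, n, a).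
       (m, p, if m = n \<and> n = p then b \<otimes>\<^bsub>Alg A m\<^esub> a else \<zero>\<^bsub>Alg A m\<^esub>))\<rparr>"

type_synonym ('k, 'u) space = "('k, ('k, 'u) univ) module"
type_synonym ('k, 'u) map = "('k, ('k, 'u) univ) lmap"
type_synonym ('k, 'u, 'x) mobj = "(nat, 'x bar_arr, ('k, 'u) space, ('k, 'u) map) funct"
type_synonym ('k, 'u, 'x) marr = "(('k, 'u, 'x) mobj, nat \<Rightarrow> ('k, 'u) map) trans"

text \<open>A functor \<open>M\<close> from the opposite category to vector spaces is a sequence of right \<open>A\<^sub>n\<close>-modules
  \<open>FO M n\<close>; \<open>act M n v a\<close> is \<open>v\<close> times \<open>a\<close>.\<close>

abbreviation act :: "('k, 'u, 'x) mobj \<Rightarrow> nat \<Rightarrow> ('k, 'u) univ \<Rightarrow> 'x \<Rightarrow> ('k, 'u) univ" where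
  "act M n v a \<equiv> lapp (FA M (n, n, a)) v"

definition rep_obj :: "('k, 'u, 'x) algseq \<Rightarrow> nat \<Rightarrow> ('k, 'u, 'x) mobj" where
  "rep_obj A n =
    (let B = bar_category A;
         V = (\<lambda>m. linear_space
           {Emb A a |a. (m, n, a) \<in> mor B m n} (Emb A \<zero>\<^bsub>Alg A m\<^esub>)
           (\<lambda>x y. Emb A (Unemb A x \<oplus>\<^bsub>Alg A m\<^esub> Unemb A y))
           (\<lambda>r x. Emb A (r \<odot>\<^bsub>Alg A m\<^esub> Unemb A x)))
     in \<lparr>FO = V,
         FA = (\<lambda>(m', m, b)\<in>arrows B.
           lmap_of (V m) (V m') (\<lambda>x. Emb A (snd (snd ((m, n, Unemb A x) \<bullet>\<^bsub>B\<^esub> (m', m, b))))))\<rparr>)"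

definition rep_arr :: "('k, 'u, 'x) algseq \<Rightarrow> nat \<Rightarrow> 'x \<Rightarrow> ('k, 'u, 'x) marr" where
  "rep_arr A n a =
    \<lparr>Src = rep_obj A n, Tgt = rep_obj A n,
     At = (\<lambda>m. lmap_of (FO (rep_obj A n) m) (FO (rep_obj A n) m)
       (\<lambda>x. Emb A (snd (snd ((n, n, a) \<bullet>\<^bsub>bar_category A\<^esub> (m, n, Unemb A x))))))\<rparr>"

text \<open>The tuple \<open>(i, v, j, w, Emb a)\<close> with \<open>i + j = p\<close> stands for the element \<open>v \<otimes> w \<otimes> a\<close> of
  \<open>(M\<^sub>i \<otimes>\<^sub>k N\<^sub>j) \<otimes> A\<^sub>p\<close>, the last tensor product being over \<open>A\<^sub>i \<otimes> A\<^sub>j\<close>. The component of the Day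
  convolution in degree \<open>p\<close> is the direct sum of these spaces over all \<open>(i, j)\<close> with \<open>i + j = p\<close>.\<close>

type_synonym ('k, 'u) day_gen = "nat \<times> ('k, 'u) univ \<times> nat \<times> ('k, 'u) univ \<times> ('k, 'u) univ"

definition day_gens :: "('k, 'u, 'x) algseq \<Rightarrow> ('k, 'u, 'x) mobj \<Rightarrow> ('k, 'u, 'x) mobj \<Rightarrow> nat \<Rightarrow>
    ('k, 'u) day_gen set" where
  "day_gens A M N p =
    {(i, v, j, w, Emb A a) |i v j w a.
       i + j = p \<and> v \<in> carrier (FO M i) \<and> w \<in> carrier (FO N j) \<and> a \<in> carrier (Alg A p)}"

inductive day_rel :: "'k ring \<Rightarrow> ('k, 'u, 'x) algseq \<Rightarrow> ('k, 'u, 'x) mobj \<Rightarrow> ('k, 'u, 'x) mobj \<Rightarrow>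
    nat \<Rightarrow> ('k, 'u) day_gen list \<Rightarrow> ('k, 'u) day_gen list \<Rightarrow> bool"
  for K A M N p where
  add_left: "\<lbrakk>i + j = p; v \<in> carrier (FO M i); v' \<in> carrier (FO M i); w \<in> carrier (FO N j);
      a \<in> carrier (Alg A p)\<rbrakk> \<Longrightarrow> day_rel K A M N p
        [(i, v \<oplus>\<^bsub>FO M i\<^esub> v', j, w, Emb A a)] [(i, v, j, w, Emb A a), (i, v', j, w, Emb A a)]"
| add_right: "\<lbrakk>i + j = p; v \<in> carrier (FO M i); w \<in> carrier (FO N j); w' \<in> carrier (FO N j);
      a \<in> carrier (Alg A p)\<rbrakk> \<Longrightarrow> day_rel K A M N p
        [(i, v, j, w \<oplus>\<^bsub>FO N j\<^esub> w', Emb A a)] [(i, v, j, w, Emb A a), (i, v, j, w', Emb A a)]"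
| add_alg: "\<lbrakk>i + j = p; v \<in> carrier (FO M i); w \<in> carrier (FO N j);
      a \<in> carrier (Alg A p); a' \<in> carrier (Alg A p)\<rbrakk> \<Longrightarrow> day_rel K A M N p
        [(i, v, j, w, Emb A (a \<oplus>\<^bsub>Alg A p\<^esub> a'))] [(i, v, j, w, Emb A a), (i, v, j, w, Emb A a')]"
| zero: "\<lbrakk>i + j = p; w \<in> carrier (FO N j); a \<in> carrier (Alg A p)\<rbrakk> \<Longrightarrow> day_rel K A M N p
        [(i, \<zero>\<^bsub>FO M i\<^esub>, j, w, Emb A a)] []"
| scalar: "\<lbrakk>i + j = p; v \<in> carrier (FO M i); w \<in> carrier (FO N j); a \<in> carrier (Alg A p);
      r \<in> carrier K\<rbrakk> \<Longrightarrow> day_rel K A M N p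
        [(i, r \<odot>\<^bsub>FO M i\<^esub> v, j, w, Emb A a)] [(i, v, j, r \<odot>\<^bsub>FO N j\<^esub> w, Emb A a)]"
| balanced: "\<lbrakk>i + j = p; v \<in> carrier (FO M i); w \<in> carrier (FO N j); a \<in> carrier (Alg A p);
      b \<in> carrier (Alg A i); b' \<in> carrier (Alg A j)\<rbrakk> \<Longrightarrow> day_rel K A M N p
        [(i, act M i v b, j, act N j w b', Emb A a)]
        [(i, v, j, w, Emb A (Mu A i j b b' \<otimes>\<^bsub>Alg A p\<^esub> a))]"

definition day_elt :: "'k ring \<Rightarrow> ('k, 'u, 'x) algseq \<Rightarrow> ('k, 'u, 'x) mobj \<Rightarrow> ('k, 'u, 'x) mobj \<Rightarrow>
    nat \<Rightarrow> ('k, 'u) day_gen list \<Rightarrow> ('k, 'u) univ" where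
  "day_elt K A M N p P = DayTerms (sum_rep (day_rel K A M N p) P)"

definition day_space :: "'k ring \<Rightarrow> ('k, 'u, 'x) algseq \<Rightarrow> ('k, 'u, 'x) mobj \<Rightarrow> ('k, 'u, 'x) mobj \<Rightarrow>
    nat \<Rightarrow> ('k, 'u) space" where
  "day_space K A M N p =
    sum_space DayTerms day_terms (day_gens A M N p) (day_rel K A M N p)
      (\<lambda>r (i, v, j, w, a). (i, r \<odot>\<^bsub>FO M i\<^esub> v, j, w, a))"

definition day_obj :: "'k ring \<Rightarrow> ('k, 'u, 'x) algseq \<Rightarrow> ('k, 'u, 'x) mobj \<Rightarrow> ('k, 'u, 'x) mobj \<Rightarrow>
    ('k, 'u, 'x) mobj" where
  "day_obj K A M N =
    \<lparr>FO = day_space K A M N,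
     FA = (\<lambda>(m, n, b)\<in>arrows (bar_category A).
       lmap_of (day_space K A M N n) (day_space K A M N m)
         (\<lambda>x. if m = n
            then day_elt K A M N m
              (map (\<lambda>(i, v, j, w, a). (i, v, j, w, Emb A (Unemb A a \<otimes>\<^bsub>Alg A m\<^esub> b))) (day_terms x))
            else \<zero>\<^bsub>day_space K A M N m\<^esub>))\<rparr>"

definition day_arr :: "'k ring \<Rightarrow> ('k, 'u, 'x) algseq \<Rightarrow> ('k, 'u, 'x) marr \<Rightarrow> ('k, 'u, 'x) marr \<Rightarrow>
    ('k, 'u, 'x) marr" where
  "day_arr K A \<alpha> \<beta> =
    \<lparr>Src = day_obj K A (Src \<alpha>) (Src \<beta>), Tgt = day_obj K A (Tgt \<alpha>) (Tgt \<beta>),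
     At = (\<lambda>p. lmap_of (day_space K A (Src \<alpha>) (Src \<beta>) p) (day_space K A (Tgt \<alpha>) (Tgt \<beta>) p)
       (\<lambda>x. day_elt K A (Tgt \<alpha>) (Tgt \<beta>) p
          (map (\<lambda>(i, v, j, w, a). (i, lapp (At \<alpha> i) v, j, lapp (At \<beta> j) w, a)) (day_terms x))))\<rparr>"

text \<open>The associativity constraint is
  \<open>(u \<otimes> v \<otimes> a) \<otimes> w \<otimes> b \<mapsto> u \<otimes> (v \<otimes> w \<otimes> 1) \<otimes> \<mu> (a \<otimes> 1) b\<close>.\<close>

definition day_assoc :: "'k ring \<Rightarrow> ('k, 'u, 'x) algseq \<Rightarrow> ('k, 'u, 'x) mobj \<Rightarrow> ('k, 'u, 'x) mobj \<Rightarrow>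
    ('k, 'u, 'x) mobj \<Rightarrow> ('k, 'u, 'x) marr" where
  "day_assoc K A M N P =
    (let S = day_obj K A (day_obj K A M N) P; S' = day_obj K A M (day_obj K A N P) in
    \<lparr>Src = S, Tgt = S',
     At = (\<lambda>p. lmap_of (FO S p) (FO S' p) (\<lambda>x. day_elt K A M (day_obj K A N P) p
       (concat (map (\<lambda>(l, y, k, w, b).
          map (\<lambda>(i, u, j, v, a).
            (i, u, j + k, day_elt K A N P (j + k) [(j, v, k, w, Emb A \<one>\<^bsub>Alg A (j + k)\<^esub>)],
             Emb A (Mu A l k (Unemb A a) \<one>\<^bsub>Alg A k\<^esub> \<otimes>\<^bsub>Alg A p\<^esub> Unemb A b)))
            (day_terms y))
          (day_terms x)))))\<rparr>)"

definition term_sum :: "('k, 'v) module \<Rightarrow> ('g \<Rightarrow> 'v) \<Rightarrow> 'g list \<Rightarrow> 'v" where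
  "term_sum V f P = foldr (\<lambda>t v. f t \<oplus>\<^bsub>V\<^esub> v) P \<zero>\<^bsub>V\<^esub>"

text \<open>The unit constraints are \<open>a \<otimes> v \<otimes> b \<mapsto> v \<mu> (a \<otimes> 1) b\<close> and \<open>v \<otimes> a \<otimes> b \<mapsto> v \<mu> (1 \<otimes> a) b\<close> for
  \<open>a\<close> in \<open>A\<^sub>0\<close>; the unit object vanishes in positive degrees.\<close>

definition day_lun :: "'k ring \<Rightarrow> ('k, 'u, 'x) algseq \<Rightarrow> ('k, 'u, 'x) mobj \<Rightarrow> ('k, 'u, 'x) marr" where
  "day_lun K A M =
    (let S = day_obj K A (rep_obj A 0) M in
    \<lparr>Src = S, Tgt = M,
     At = (\<lambda>p. lmap_of (FO S p) (FO M p) (\<lambda>x. term_sum (FO M p)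
       (\<lambda>(i, a, j, v, b). if i = 0
          then act M p v (Mu A 0 p (Unemb A a) \<one>\<^bsub>Alg A p\<^esub> \<otimes>\<^bsub>Alg A p\<^esub> Unemb A b) else \<zero>\<^bsub>FO M p\<^esub>)
       (day_terms x)))\<rparr>)"

definition day_run :: "'k ring \<Rightarrow> ('k, 'u, 'x) algseq \<Rightarrow> ('k, 'u, 'x) mobj \<Rightarrow> ('k, 'u, 'x) marr" where
  "day_run K A M =
    (let S = day_obj K A M (rep_obj A 0) in
    \<lparr>Src = S, Tgt = M,
     At = (\<lambda>p. lmap_of (FO S p) (FO M p) (\<lambda>x. term_sum (FO M p)
       (\<lambda>(i, v, j, a, b). if j = 0
          then act M p v (Mu A p 0 \<one>\<^bsub>Alg A p\<^esub> (Unemb A a) \<otimes>\<^bsub>Alg A p\<^esub> Unemb A b) else \<zero>\<^bsub>FO M p\<^esub>)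
       (day_terms x)))\<rparr>)"

definition module_category :: "'k ring \<Rightarrow> ('k, 'u, 'x) algseq \<Rightarrow>
    ('k, ('k, 'u, 'x) mobj, ('k, 'u, 'x) marr) moncat" where
  "module_category K A =
    (let E = functor_category K (op_cat (bar_category A)) (vect K) in
    \<lparr>Ob = Ob E, Hom = Hom E, Id = Id E, Comp = Comp E,
     TO = day_obj K A, TA = day_arr K A, Unit = rep_obj A 0,
     Assoc = day_assoc K A, Lun = day_lun K A, Run = day_run K A\<rparr>)"

type_synonym ('k, 'u) braid_mobj = "('k, 'u, 'k braid_elt) mobj"
type_synonym ('k, 'u) braid_marr = "('k, 'u, 'k braid_elt) marr"
type_synonym ('k, 'u) hecke_mobj = "('k, 'u, 'k hecke_elt) mobj"
type_synonym ('k, 'u) hecke_marr = "('k, 'u, 'k hecke_elt) marr"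

definition affine_braid_category ::
    "'k ring \<Rightarrow> ('k, ('k, 'u) braid_mobj, ('k, 'u) braid_marr) moncat" where
  "affine_braid_category K = module_category K (braid_seq K)"

definition affine_hecke_category ::
    "'k ring \<Rightarrow> 'k \<Rightarrow> ('k, ('k, 'u) hecke_mobj, ('k, 'u) hecke_marr) moncat" where
  "affine_hecke_category K q = module_category K (hecke_seq K q)"


section \<open>The quotient functor\<close>

text \<open>The pair \<open>(v, InH h)\<close> stands for the element \<open>v \<otimes> h\<close> of the tensor product of \<open>M\<^sub>n\<close> with the affine
  Hecke algebra over the group algebra.\<close>

type_synonym ('k, 'u) ext_gen = "('k, 'u) univ \<times> ('k, 'u) univ"

definition ext_gens :: "'k ring \<Rightarrow> 'k \<Rightarrow> ('k, 'u) braid_mobj \<Rightarrow> nat \<Rightarrow> ('k, 'u) ext_gen set" where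
  "ext_gens K q M n =
    {(v, InH h) |v h. v \<in> carrier (FO M n) \<and> h \<in> carrier (affine_hecke_algebra K q n)}"

inductive ext_rel :: "'k ring \<Rightarrow> 'k \<Rightarrow> ('k, 'u) braid_mobj \<Rightarrow> nat \<Rightarrow>
    ('k, 'u) ext_gen list \<Rightarrow> ('k, 'u) ext_gen list \<Rightarrow> bool"
  for K q M n where
  add_left: "\<lbrakk>v \<in> carrier (FO M n); v' \<in> carrier (FO M n); h \<in> carrier (affine_hecke_algebra K q n)\<rbrakk>
      \<Longrightarrow> ext_rel K q M n [(v \<oplus>\<^bsub>FO M n\<^esub> v', InH h)] [(v, InH h), (v', InH h)]"
| add_right: "\<lbrakk>v \<in> carrier (FO M n); h \<in> carrier (affine_hecke_algebra K q n);
      h' \<in> carrier (affine_hecke_algebra K q n)\<rbrakk>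
      \<Longrightarrow> ext_rel K q M n [(v, InH (h \<oplus>\<^bsub>affine_hecke_algebra K q n\<^esub> h'))] [(v, InH h), (v, InH h')]"
| zero: "h \<in> carrier (affine_hecke_algebra K q n) \<Longrightarrow> ext_rel K q M n [(\<zero>\<^bsub>FO M n\<^esub>, InH h)] []"
| balanced: "\<lbrakk>v \<in> carrier (FO M n); b \<in> carrier (braid_algebra K n);
      h \<in> carrier (affine_hecke_algebra K q n)\<rbrakk>
      \<Longrightarrow> ext_rel K q M n [(act M n v b, InH h)]
            [(v, InH (hecke_proj K q n b \<otimes>\<^bsub>affine_hecke_algebra K q n\<^esub> h))]"

definition ext_elt :: "'k ring \<Rightarrow> 'k \<Rightarrow> ('k, 'u) braid_mobj \<Rightarrow> nat \<Rightarrow> ('k, 'u) ext_gen list \<Rightarrow>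
    ('k, 'u) univ" where
  "ext_elt K q M n P = ExtTerms (sum_rep (ext_rel K q M n) P)"

definition ext_space :: "'k ring \<Rightarrow> 'k \<Rightarrow> ('k, 'u) braid_mobj \<Rightarrow> nat \<Rightarrow> ('k, 'u) space" where
  "ext_space K q M n =
    sum_space ExtTerms ext_terms (ext_gens K q M n) (ext_rel K q M n) (\<lambda>r (v, h). (r \<odot>\<^bsub>FO M n\<^esub> v, h))"

definition ext_obj :: "'k ring \<Rightarrow> 'k \<Rightarrow> ('k, 'u) braid_mobj \<Rightarrow> ('k, 'u) hecke_mobj" where
  "ext_obj K q M =
    \<lparr>FO = ext_space K q M,
     FA = (\<lambda>(m, n, b)\<in>arrows (bar_category (hecke_seq K q :: ('k, 'u, 'k hecke_elt) algseq)).
       lmap_of (ext_space K q M n) (ext_space K q M m)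
         (\<lambda>x. if m = n
            then ext_elt K q M m
              (map (\<lambda>(v, h). (v, InH (Hilbert_Choice.inv InH h \<otimes>\<^bsub>affine_hecke_algebra K q m\<^esub> b)))
                (ext_terms x))
            else \<zero>\<^bsub>ext_space K q M m\<^esub>))\<rparr>"

definition ext_arr :: "'k ring \<Rightarrow> 'k \<Rightarrow> ('k, 'u) braid_marr \<Rightarrow> ('k, 'u) hecke_marr" where
  "ext_arr K q \<alpha> =
    \<lparr>Src = ext_obj K q (Src \<alpha>), Tgt = ext_obj K q (Tgt \<alpha>),
     At = (\<lambda>n. lmap_of (ext_space K q (Src \<alpha>) n) (ext_space K q (Tgt \<alpha>) n)
       (\<lambda>x. ext_elt K q (Tgt \<alpha>) n (map (\<lambda>(v, h). (lapp (At \<alpha> n) v, h)) (ext_terms x))))\<rparr>"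

text \<open>The monoidal structure is \<open>(v \<otimes> h) \<otimes> (w \<otimes> h') \<otimes> g \<mapsto> (v \<otimes> w \<otimes> 1) \<otimes> \<mu> (h \<otimes> h') g\<close> and, on units,
  \<open>h \<mapsto> 1 \<otimes> h\<close>.\<close>

definition ext_mul :: "'k ring \<Rightarrow> 'k \<Rightarrow> ('k, 'u) braid_mobj \<Rightarrow> ('k, 'u) braid_mobj \<Rightarrow>
    ('k, 'u) hecke_marr" where
  "ext_mul K q M N =
    (let S = day_obj K (hecke_seq K q) (ext_obj K q M) (ext_obj K q N);
         MN = day_obj K (braid_seq K) M N; S' = ext_obj K q MN;
         unH = (Hilbert_Choice.inv InH :: ('k, 'u) univ \<Rightarrow> 'k hecke_elt) in
    \<lparr>Src = S, Tgt = S',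
     At = (\<lambda>p. lmap_of (FO S p) (FO S' p) (\<lambda>x. ext_elt K q MN p
       (concat (map (\<lambda>(i, y, j, z, g).
          concat (map (\<lambda>(v, h). map (\<lambda>(w, h').
            (day_elt K (braid_seq K) M N p [(i, v, j, w, InB \<one>\<^bsub>braid_algebra K p\<^esub>)],
             InH (hecke_mu K q i j (unH h) (unH h') \<otimes>\<^bsub>affine_hecke_algebra K q p\<^esub> unH g)))
            (ext_terms z)) (ext_terms y)))
          (day_terms x)))))\<rparr>)"

definition ext_eps :: "'k ring \<Rightarrow> 'k \<Rightarrow> ('k, 'u) hecke_marr" where
  "ext_eps K q =
    (let S = rep_obj (hecke_seq K q) 0; I = rep_obj (braid_seq K) 0; S' = ext_obj K q I in
    \<lparr>Src = S, Tgt = S',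
     At = (\<lambda>n. lmap_of (FO S n) (FO S' n)
       (\<lambda>x. if n = 0 then ext_elt K q I 0 [(InB \<one>\<^bsub>braid_algebra K 0\<^esub>, x)] else \<zero>\<^bsub>FO S' n\<^esub>))\<rparr>)"

definition hecke_quotient :: "'k ring \<Rightarrow> 'k \<Rightarrow>
    (('k, 'u) braid_mobj, ('k, 'u) braid_marr, ('k, 'u) hecke_mobj, ('k, 'u) hecke_marr) monfun" where
  "hecke_quotient K q =
    (let B = affine_braid_category K in
    \<lparr>FO = (\<lambda>M\<in>Ob B. ext_obj K q M), FA = (\<lambda>\<alpha>\<in>arrows B. ext_arr K q \<alpha>),
     Mul = ext_mul K q, Eps = ext_eps K q\<rparr>)"


section \<open>Hecke objects and Orellana--Ram functors\<close>

definition hecke_object :: "'k ring \<Rightarrow> ('k, 'o, 'a, 'z) braidcat_scheme \<Rightarrow> 'k \<Rightarrow> 'o \<Rightarrow> bool" where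
  "hecke_object K C q X \<longleftrightarrow>
    q \<in> carrier K \<and> q \<noteq> \<zero>\<^bsub>K\<^esub> \<and> X \<in> Ob C \<and>
    (let XX = X \<boxtimes>\<^bsub>C\<^esub> X; E = Hom C XX XX in
     (Braid C X X \<ominus>\<^bsub>E\<^esub> q \<odot>\<^bsub>E\<^esub> Id C XX) \<bullet>\<^bsub>C\<^esub> (Braid C X X \<oplus>\<^bsub>E\<^esub> inv\<^bsub>K\<^esub> q \<odot>\<^bsub>E\<^esub> Id C XX) = \<zero>\<^bsub>E\<^esub>)"

definition or_O :: "('k, 'o, 'a, 'z) braidcat_scheme \<Rightarrow> 'o \<Rightarrow> ('o, 'a, 'o, 'a) funct" where
  "or_O C X = \<lparr>FO = (\<lambda>Y\<in>Ob C. Y \<boxtimes>\<^bsub>C\<^esub> X), FA = (\<lambda>f\<in>arrows C. f \<boxdot>\<^bsub>C\<^esub> Id C X)\<rparr>"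

definition or_x :: "('k, 'o, 'a, 'z) braidcat_scheme \<Rightarrow> 'o \<Rightarrow> (('o, 'a, 'o, 'a) funct, 'o \<Rightarrow> 'a) trans" where
  "or_x C X = \<lparr>Src = or_O C X, Tgt = or_O C X, At = (\<lambda>Y\<in>Ob C. Braid C X Y \<bullet>\<^bsub>C\<^esub> Braid C Y X)\<rparr>"

definition or_c :: "('k, 'o, 'a, 'z) braidcat_scheme \<Rightarrow> 'o \<Rightarrow> (('o, 'a, 'o, 'a) funct, 'o \<Rightarrow> 'a) trans" where
  "or_c C X =
    \<lparr>Src = comp_functor C (or_O C X) (or_O C X), Tgt = comp_functor C (or_O C X) (or_O C X),
     At = (\<lambda>Y\<in>Ob C. inv_arr C ((Y \<boxtimes>\<^bsub>C\<^esub> X) \<boxtimes>\<^bsub>C\<^esub> X) (Y \<boxtimes>\<^bsub>C\<^esub> (X \<boxtimes>\<^bsub>C\<^esub> X)) (Assoc C Y X X) \<bullet>\<^bsub>C\<^esub>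
       (Id C Y \<boxdot>\<^bsub>C\<^esub> Braid C X X) \<bullet>\<^bsub>C\<^esub> Assoc C Y X X)\<rparr>"

text \<open>The generating object \<open>[1]\<close>, its endomorphism \<open>y\<^sub>1\<close>, and the endomorphism of \<open>[1] \<otimes> [1]\<close>
  corresponding to \<open>t\<^sub>1\<close> under the canonical isomorphism \<open>a \<mapsto> 1 \<otimes> 1 \<otimes> a\<close> from \<open>[2]\<close> to \<open>[1] \<otimes> [1]\<close>.\<close>

definition gen_obj :: "'k ring \<Rightarrow> ('k, 'u) braid_mobj" where
  "gen_obj K = rep_obj (braid_seq K) 1"

definition gen_y :: "'k ring \<Rightarrow> ('k, 'u) braid_marr" where
  "gen_y K = rep_arr (braid_seq K) 1 (braid_elt K 1 (y_word 1))"

definition square_iso :: "'k ring \<Rightarrow> ('k, 'u) braid_marr" where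
  "square_iso K =
    (let S = rep_obj (braid_seq K) 2; G = gen_obj K; S' = day_obj K (braid_seq K) G G;
         e = InB \<one>\<^bsub>braid_algebra K 1\<^esub> in
    \<lparr>Src = S, Tgt = S',
     At = (\<lambda>n. lmap_of (FO S n) (FO S' n)
       (\<lambda>a. if n = 2 then day_elt K (braid_seq K) G G 2 [(1, e, 1, e, a)] else \<zero>\<^bsub>FO S' n\<^esub>))\<rparr>)"

definition gen_t :: "'k ring \<Rightarrow> ('k, 'u) braid_marr" where
  "gen_t K =
    (let B = affine_braid_category K; G = gen_obj K in
     square_iso K \<bullet>\<^bsub>B\<^esub> rep_arr (braid_seq K) 2 (braid_elt K 2 (t_word 1)) \<bullet>\<^bsub>B\<^esub>
     inv_arr B (rep_obj (braid_seq K) 2) (G \<boxtimes>\<^bsub>B\<^esub> G) (square_iso K))"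

text \<open>A monoidal functor on modules is determined by its values on the generators once it preserves
  colimits: every object is a colimit of representable ones. This is the sense in which the
  Orellana--Ram functor is defined by the triple \<open>(O, x, c)\<close>. The generator is sent to \<open>O\<close> along an
  isomorphism \<open>\<iota>\<close>, and endomorphisms are compared through \<open>\<iota>\<close> and the monoidal structure.\<close>

definition orellana_ram_functor :: "'k ring \<Rightarrow> ('k, 'o, 'a, 'z) braidcat_scheme \<Rightarrow> 'o \<Rightarrow>
    (('k, 'u) braid_mobj, ('k, 'u) braid_marr,
     ('o, 'a, 'o, 'a) funct, (('o, 'a, 'o, 'a) funct, 'o \<Rightarrow> 'a) trans) monfun \<Rightarrow> bool" where
  "orellana_ram_functor K C X R \<longleftrightarrow>
    (let B = affine_braid_category K; E = endofunctor_category K C; G = gen_obj K in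
     strong_monoidal_functor K B E R \<and>
     cocontinuous TYPE(('k, 'u) univ) B E R \<and>
     (\<exists>\<iota>. iso_arr E (or_O C X) (FO R G) \<iota> \<and>
        FA R (gen_y K) \<bullet>\<^bsub>E\<^esub> \<iota> = \<iota> \<bullet>\<^bsub>E\<^esub> or_x C X \<and>
        FA R (gen_t K) \<bullet>\<^bsub>E\<^esub> Mul R G G \<bullet>\<^bsub>E\<^esub> (\<iota> \<boxdot>\<^bsub>E\<^esub> \<iota>) =
          (Mul R G G \<bullet>\<^bsub>E\<^esub> (\<iota> \<boxdot>\<^bsub>E\<^esub> \<iota>)) \<bullet>\<^bsub>E\<^esub> or_c C X))"

end

theory Submission
  imports Defs
begin

text \<open>Restriction of scalars from the affine Hecke algebras to the braid group algebras is a lax monoidal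
  functor from the Hecke category to the braid category, and the factorization is its composite with the
  Orellana--Ram functor. The composite is strong monoidal, and it becomes the Orellana--Ram functor after
  extension of scalars, because the structure maps of the restriction and the units of the adjunction
  between extension and restriction are inverted by the Orellana--Ram functor. Indeed each of them is the
  quotient of a module by the image of the Hecke ideals, hence a colimit of a diagram of representable
  modules and of arrows that factor through left multiplications by elements of the ideals. The
  functor preserves this colimit and kills these multiplications: the elements whose left multiplication
  is killed form ideals, stable under the maps \<open>\<mu>\<close>, and they
  contain the Hecke relation for \<open>t\<^sub>1\<close> since \<open>X\<close> is a Hecke object.\<close>

section \<open>Linear categories\<close>

text \<open>The Orellana--Ram functor is given on all modules and not only on generators, so no
  functor has to be built from a presentation of the Hecke category: a Hecke module is a braid
  module on which the Hecke ideals act by zero, and the given functor applies to it. The obstacle is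
  that restriction is not strong monoidal, as the Day convolution of restricted modules over the
  braid algebras is in general larger than the one over the Hecke algebras. Since the quotient maps
  are surjective, the difference is the image of a kernel, and it disappears under a cocontinuous
  functor that kills this kernel. The diagram that shows this has one edge for each pair of a module
  element and an element of the ideal, so the index sets have to be as large as the modules; small
  sets are therefore taken in \<open>univ\<close>, where the modules themselves live. The coherence
  equations of the composite are those of its two factors, one transported by the other; of the
  categories involved only linearity, bifunctoriality and the types of the constraints are recorded
  for this purpose.\<close>

lemma linear_space_simps [simp]:
  "carrier (linear_space V z p s) = V"
  "zero (linear_space V z p s) = z"
  "add (linear_space V z p s) = p"
  "smult (linear_space V z p s) = s"
  by (simp_all add: linear_space_def)

text \<open>Negatives come from multiplication by -1, by \<open>sl\<close>, \<open>s1\<close> and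
  \<open>s0\<close>. Hence the vector spaces below can be built from a zero, a sum and scalar
  multiples alone.\<close>

lemma module_linear_space:
  assumes "field K" and zc: "z \<in> V" and pc: "\<And>x y. \<lbrakk>x \<in> V; y \<in> V\<rbrakk> \<Longrightarrow> p x y \<in> V"
    and sc: "\<And>r x. \<lbrakk>r \<in> carrier K; x \<in> V\<rbrakk> \<Longrightarrow> s r x \<in> V"
    and assoc: "\<And>x y w. \<lbrakk>x \<in> V; y \<in> V; w \<in> V\<rbrakk> \<Longrightarrow> p (p x y) w = p x (p y w)"
    and comm: "\<And>x y. \<lbrakk>x \<in> V; y \<in> V\<rbrakk> \<Longrightarrow> p x y = p y x"
    and z: "\<And>x. x \<in> V \<Longrightarrow> p z x = x"
    and s0: "\<And>x. x \<in> V \<Longrightarrow> s \<zero>\<^bsub>K\<^esub> x = z"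
    and s1: "\<And>x. x \<in> V \<Longrightarrow> s \<one>\<^bsub>K\<^esub> x = x"
    and sl: "\<And>r t x. \<lbrakk>r \<in> carrier K; t \<in> carrier K; x \<in> V\<rbrakk> \<Longrightarrow> s (r \<oplus>\<^bsub>K\<^esub> t) x = p (s r x) (s t x)"
    and sr: "\<And>r x y. \<lbrakk>r \<in> carrier K; x \<in> V; y \<in> V\<rbrakk> \<Longrightarrow> s r (p x y) = p (s r x) (s r y)"
    and sm: "\<And>r t x. \<lbrakk>r \<in> carrier K; t \<in> carrier K; x \<in> V\<rbrakk> \<Longrightarrow> s (r \<otimes>\<^bsub>K\<^esub> t) x = s r (s t x)"
  shows "module K (linear_space V z p s)"
proof -
  interpret field K by fact
  have "p (s (\<ominus>\<^bsub>K\<^esub> \<one>\<^bsub>K\<^esub>) x) x = z" if x: "x \<in> V" for x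
    using sl[of "\<ominus>\<^bsub>K\<^esub> \<one>\<^bsub>K\<^esub>" "\<one>\<^bsub>K\<^esub>" x] s1[OF x] s0[OF x] x by (simp add: l_neg)
  then have inv: "\<exists>y\<in>V. p y x = z" if x: "x \<in> V" for x
    using that sc[of "\<ominus>\<^bsub>K\<^esub> \<one>\<^bsub>K\<^esub>" x] by auto
  have "abelian_group (linear_space V z p s)"
    by (rule abelian_groupI) (auto simp: zc pc assoc z inv intro: comm)
  then show ?thesis
    by (intro module.intro is_cring module_axioms.intro) (simp_all add: sc s1 sl sr sm)
qed

context linear_category
begin

sublocale K: field K by (rule field)

lemma
  assumes "a \<in> Ob C" "b \<in> Ob C"
  shows hom_zero: "\<zero>\<^bsub>Hom C a b\<^esub> \<in> mor C a b"
    and hom_add: "\<And>f g. \<lbrakk>f \<in> mor C a b; g \<in> mor C a b\<rbrakk> \<Longrightarrow> f \<oplus>\<^bsub>Hom C a b\<^esub> g \<in> mor C a b"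
    and hom_smult: "\<And>r f. \<lbrakk>r \<in> carrier K; f \<in> mor C a b\<rbrakk> \<Longrightarrow> r \<odot>\<^bsub>Hom C a b\<^esub> f \<in> mor C a b"
    and hom_add_assoc: "\<And>f g h. \<lbrakk>f \<in> mor C a b; g \<in> mor C a b; h \<in> mor C a b\<rbrakk> \<Longrightarrow>
      f \<oplus>\<^bsub>Hom C a b\<^esub> g \<oplus>\<^bsub>Hom C a b\<^esub> h = f \<oplus>\<^bsub>Hom C a b\<^esub> (g \<oplus>\<^bsub>Hom C a b\<^esub> h)"
    and hom_add_comm: "\<And>f g. \<lbrakk>f \<in> mor C a b; g \<in> mor C a b\<rbrakk> \<Longrightarrow>
      f \<oplus>\<^bsub>Hom C a b\<^esub> g = g \<oplus>\<^bsub>Hom C a b\<^esub> f"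
    and hom_l_zero: "\<And>f. f \<in> mor C a b \<Longrightarrow> \<zero>\<^bsub>Hom C a b\<^esub> \<oplus>\<^bsub>Hom C a b\<^esub> f = f"
    and hom_smult_zero: "\<And>f. f \<in> mor C a b \<Longrightarrow> \<zero>\<^bsub>K\<^esub> \<odot>\<^bsub>Hom C a b\<^esub> f = \<zero>\<^bsub>Hom C a b\<^esub>"
proof -
  interpret M: module K "Hom C a b" using assms by (rule hom_space)
  show "\<zero>\<^bsub>Hom C a b\<^esub> \<in> mor C a b" by simp
  fix f g h r
  show "f \<oplus>\<^bsub>Hom C a b\<^esub> g \<in> mor C a b" if "f \<in> mor C a b" "g \<in> mor C a b" using that by simp
  show "r \<odot>\<^bsub>Hom C a b\<^esub> f \<in> mor C a b" if "r \<in> carrier K" "f \<in> mor C a b" using that by simp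
  show "f \<oplus>\<^bsub>Hom C a b\<^esub> g \<oplus>\<^bsub>Hom C a b\<^esub> h = f \<oplus>\<^bsub>Hom C a b\<^esub> (g \<oplus>\<^bsub>Hom C a b\<^esub> h)"
    if "f \<in> mor C a b" "g \<in> mor C a b" "h \<in> mor C a b" using that by (rule M.a_assoc)
  show "f \<oplus>\<^bsub>Hom C a b\<^esub> g = g \<oplus>\<^bsub>Hom C a b\<^esub> f" if "f \<in> mor C a b" "g \<in> mor C a b"
    using that by (rule M.a_comm)
  show "\<zero>\<^bsub>Hom C a b\<^esub> \<oplus>\<^bsub>Hom C a b\<^esub> f = f" if "f \<in> mor C a b" using that by simp
  show "\<zero>\<^bsub>K\<^esub> \<odot>\<^bsub>Hom C a b\<^esub> f = \<zero>\<^bsub>Hom C a b\<^esub>" if "f \<in> mor C a b" using that by simp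
qed

lemma comp_zero_left:
  assumes "a \<in> Ob C" "b \<in> Ob C" "c \<in> Ob C" "f \<in> mor C a b"
  shows "\<zero>\<^bsub>Hom C b c\<^esub> \<bullet>\<^bsub>C\<^esub> f = \<zero>\<^bsub>Hom C a c\<^esub>"
  using comp_smult_left[OF assms hom_zero K.zero_closed] assms
  by (simp add: hom_smult_zero hom_zero comp_mor)

lemma comp_zero_right:
  assumes "a \<in> Ob C" "b \<in> Ob C" "c \<in> Ob C" "g \<in> mor C b c"
  shows "g \<bullet>\<^bsub>C\<^esub> \<zero>\<^bsub>Hom C a b\<^esub> = \<zero>\<^bsub>Hom C a c\<^esub>"
  using comp_smult_right[OF assms(1-3) hom_zero assms(4) K.zero_closed] assms
  by (simp add: hom_smult_zero hom_zero comp_mor)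

lemma inv_arr:
  assumes "a \<in> Ob C" "b \<in> Ob C" and f: "iso_arr C a b f"
  shows "inv_arr C a b f \<in> mor C b a"
    and "inv_arr C a b f \<bullet>\<^bsub>C\<^esub> f = Id C a" and "f \<bullet>\<^bsub>C\<^esub> inv_arr C a b f = Id C b"
proof -
  from f obtain g where g: "g \<in> mor C b a" "g \<bullet>\<^bsub>C\<^esub> f = Id C a" "f \<bullet>\<^bsub>C\<^esub> g = Id C b"
    and f': "f \<in> mor C a b" unfolding iso_arr_def by auto
  have "\<exists>!g. g \<in> mor C b a \<and> g \<bullet>\<^bsub>C\<^esub> f = Id C a \<and> f \<bullet>\<^bsub>C\<^esub> g = Id C b"
  proof (rule ex1I[of _ g])
    fix h assume h: "h \<in> mor C b a \<and> h \<bullet>\<^bsub>C\<^esub> f = Id C a \<and> f \<bullet>\<^bsub>C\<^esub> h = Id C b"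
    then have "h = h \<bullet>\<^bsub>C\<^esub> (f \<bullet>\<^bsub>C\<^esub> g)" using assms g by (simp add: id_right)
    also have "\<dots> = g" using comp_assoc[of b a b a g f h] h f' g assms by (simp add: id_left)
    finally show "h = g" .
  qed (use g in auto)
  from theI'[OF this] show "inv_arr C a b f \<in> mor C b a"
    "inv_arr C a b f \<bullet>\<^bsub>C\<^esub> f = Id C a" "f \<bullet>\<^bsub>C\<^esub> inv_arr C a b f = Id C b"
    unfolding inv_arr_def by auto
qed

lemma iso_comp:
  assumes o: "a \<in> Ob C" "b \<in> Ob C" "c \<in> Ob C" and f: "iso_arr C a b f" and g: "iso_arr C b c g"
  shows "iso_arr C a c (g \<bullet>\<^bsub>C\<^esub> f)"
proof -
  let ?f = "inv_arr C a b f" and ?g = "inv_arr C b c g"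
  note m = inv_arr[OF o(1,2) f] inv_arr[OF o(2,3) g]
  have m': "f \<in> mor C a b" "g \<in> mor C b c" using f g by (auto simp: iso_arr_def)
  have gf: "g \<bullet>\<^bsub>C\<^esub> f \<in> mor C a c" and fg: "?f \<bullet>\<^bsub>C\<^esub> ?g \<in> mor C c a"
    by (rule comp_mor[of _ b]; simp add: o m m')+
  have "(?f \<bullet>\<^bsub>C\<^esub> ?g) \<bullet>\<^bsub>C\<^esub> (g \<bullet>\<^bsub>C\<^esub> f) = ?f \<bullet>\<^bsub>C\<^esub> (?g \<bullet>\<^bsub>C\<^esub> (g \<bullet>\<^bsub>C\<^esub> f))"
    by (rule comp_assoc[of a c b a]) (simp_all add: o m m' gf)
  also have "?g \<bullet>\<^bsub>C\<^esub> (g \<bullet>\<^bsub>C\<^esub> f) = f"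
    using comp_assoc[of a b c b f g ?g] id_left[OF o(1,2) m'(1)] by (simp add: o m m')
  finally have 1: "(?f \<bullet>\<^bsub>C\<^esub> ?g) \<bullet>\<^bsub>C\<^esub> (g \<bullet>\<^bsub>C\<^esub> f) = Id C a" by (simp add: m)
  have "(g \<bullet>\<^bsub>C\<^esub> f) \<bullet>\<^bsub>C\<^esub> (?f \<bullet>\<^bsub>C\<^esub> ?g) = g \<bullet>\<^bsub>C\<^esub> (f \<bullet>\<^bsub>C\<^esub> (?f \<bullet>\<^bsub>C\<^esub> ?g))"
    by (rule comp_assoc[of c a b c]) (simp_all add: o m m' fg)
  also have "f \<bullet>\<^bsub>C\<^esub> (?f \<bullet>\<^bsub>C\<^esub> ?g) = ?g"
    using comp_assoc[of c b a b ?g ?f f] id_left[OF o(3,2) m(4)] by (simp add: o m m')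
  finally have "(g \<bullet>\<^bsub>C\<^esub> f) \<bullet>\<^bsub>C\<^esub> (?f \<bullet>\<^bsub>C\<^esub> ?g) = Id C c" by (simp add: m)
  with 1 gf fg show ?thesis
    unfolding iso_arr_def by blast
qed

lemma iso_epi:
  assumes "a \<in> Ob C" "b \<in> Ob C" "c \<in> Ob C" and f: "iso_arr C a b f"
    and "g \<in> mor C b c" "h \<in> mor C b c" "g \<bullet>\<^bsub>C\<^esub> f = h \<bullet>\<^bsub>C\<^esub> f"
  shows "g = h"
proof -
  have f': "f \<in> mor C a b" using f by (auto simp: iso_arr_def)
  have *: "k = (k \<bullet>\<^bsub>C\<^esub> f) \<bullet>\<^bsub>C\<^esub> inv_arr C a b f" if "k \<in> mor C b c" for k
    using that assms f' inv_arr[OF assms(1,2) f] by (simp add: comp_assoc[of b a b c] id_right)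
  show ?thesis using *[OF assms(5)] *[OF assms(6)] assms(7) by simp
qed

end

lemma linear_category_cong:
  assumes "linear_category K C" "Ob D = Ob C" "Hom D = Hom C" "Id D = Id C" "Comp D = Comp C"
  shows "linear_category K D"
  using assms unfolding linear_category_def by simp

lemma (in linear_functor) obj_closed: "a \<in> Ob A \<Longrightarrow> FO F a \<in> Ob B"
  using obj by auto

lemma linear_functor_zero:
  assumes A: "linear_category K A" and B: "linear_category K B" and F: "linear_functor K A B F"
    and o: "a \<in> Ob A" "b \<in> Ob A"
  shows "FA F \<zero>\<^bsub>Hom A a b\<^esub> = \<zero>\<^bsub>Hom B (FO F a) (FO F b)\<^esub>"
proof -
  interpret A: linear_category K A by fact
  interpret B: linear_category K B by fact
  interpret F: linear_functor K A B F by fact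
  show ?thesis
    using F.smult[OF o A.hom_zero[OF o], of "\<zero>\<^bsub>K\<^esub>"] o
    by (simp add: A.hom_smult_zero A.hom_zero B.hom_smult_zero F.obj_closed
      F.arr[OF o A.hom_zero[OF o]])
qed

lemma linear_functor_iso:
  assumes A: "linear_category K A" and F: "linear_functor K A B F"
    and o: "a \<in> Ob A" "b \<in> Ob A" and f: "iso_arr A a b f"
  shows "iso_arr B (FO F a) (FO F b) (FA F f)"
proof -
  interpret A: linear_category K A by fact
  interpret F: linear_functor K A B F by fact
  from f obtain g where g: "g \<in> mor A b a" "g \<bullet>\<^bsub>A\<^esub> f = Id A a" "f \<bullet>\<^bsub>A\<^esub> g = Id A b"
    and f': "f \<in> mor A a b" unfolding iso_arr_def by auto
  have "FA F g \<bullet>\<^bsub>B\<^esub> FA F f = Id B (FO F a)" "FA F f \<bullet>\<^bsub>B\<^esub> FA F g = Id B (FO F b)"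
    using F.comp[of a b a f g] F.comp[of b a b g f] g f' o by (simp_all add: F.ident)
  then show ?thesis
    unfolding iso_arr_def using F.arr[OF o f'] F.arr[OF o(2,1) g(1)] by blast
qed

section \<open>Functor categories\<close>

lemma functor_category_simps:
  "Ob (functor_category K A B) = {F. linear_functor K A B F}"
  "mor (functor_category K A B) F G = {\<alpha>. Src \<alpha> = F \<and> Tgt \<alpha> = G \<and> natural A B F G (At \<alpha>)}"
  "\<zero>\<^bsub>Hom (functor_category K A B) F G\<^esub> =
    \<lparr>Src = F, Tgt = G, At = (\<lambda>a\<in>Ob A. \<zero>\<^bsub>Hom B (FO F a) (FO G a)\<^esub>)\<rparr>"
  "\<alpha> \<oplus>\<^bsub>Hom (functor_category K A B) F G\<^esub> \<beta> = \<lparr>Src = F, Tgt = G,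
       At = (\<lambda>a\<in>Ob A. At \<alpha> a \<oplus>\<^bsub>Hom B (FO F a) (FO G a)\<^esub> At \<beta> a)\<rparr>"
  "r \<odot>\<^bsub>Hom (functor_category K A B) F G\<^esub> \<alpha> = \<lparr>Src = F, Tgt = G,
       At = (\<lambda>a\<in>Ob A. r \<odot>\<^bsub>Hom B (FO F a) (FO G a)\<^esub> At \<alpha> a)\<rparr>"
  "Id (functor_category K A B) F = \<lparr>Src = F, Tgt = F, At = (\<lambda>a\<in>Ob A. Id B (FO F a))\<rparr>"
  "\<beta> \<bullet>\<^bsub>functor_category K A B\<^esub> \<alpha> =
    \<lparr>Src = Src \<alpha>, Tgt = Tgt \<beta>, At = (\<lambda>a\<in>Ob A. At \<beta> a \<bullet>\<^bsub>B\<^esub> At \<alpha> a)\<rparr>"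
  by (simp_all add: functor_category_def)

lemma trans_eqI:
  fixes \<alpha> \<beta> :: "('f, 'o \<Rightarrow> 'a) trans"
  assumes "Src \<alpha> = Src \<beta>" "Tgt \<alpha> = Tgt \<beta>" "At \<alpha> \<in> extensional S" "At \<beta> \<in> extensional S"
    and "\<And>a. a \<in> S \<Longrightarrow> At \<alpha> a = At \<beta> a"
  shows "\<alpha> = \<beta>"
  using assms by (intro trans.equality) (auto intro: extensionalityI)

lemma naturalD:
  assumes "natural A B F G \<eta>"
  shows "a \<in> Ob A \<Longrightarrow> \<eta> a \<in> mor B (FO F a) (FO G a)" and "\<eta> \<in> extensional (Ob A)"
    and "\<lbrakk>a \<in> Ob A; b \<in> Ob A; f \<in> mor A a b\<rbrakk> \<Longrightarrow> \<eta> b \<bullet>\<^bsub>B\<^esub> FA F f = FA G f \<bullet>\<^bsub>B\<^esub> \<eta> a"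
  using assms unfolding natural_def by (auto simp: PiE_def)

lemma naturalI:
  assumes "\<And>a. a \<in> Ob A \<Longrightarrow> \<eta> a \<in> mor B (FO F a) (FO G a)" "\<eta> \<in> extensional (Ob A)"
    and "\<And>a b f. \<lbrakk>a \<in> Ob A; b \<in> Ob A; f \<in> mor A a b\<rbrakk> \<Longrightarrow> \<eta> b \<bullet>\<^bsub>B\<^esub> FA F f = FA G f \<bullet>\<^bsub>B\<^esub> \<eta> a"
  shows "natural A B F G \<eta>"
  using assms unfolding natural_def by (auto simp: PiE_def)

text \<open>Sums and multiples of transformations are taken pointwise; naturality survives because
  composition in \<open>B\<close> is bilinear. With vector spaces as \<open>B\<close> this makes the
  module categories linear, with the braided category as \<open>B\<close> the category of its
  endofunctors.\<close>

lemma functor_category_linear: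
  assumes "linear_category K B"
  shows "linear_category K (functor_category K A B)"
proof -
  interpret B: linear_category K B by fact
  have hom: "module K (Hom (functor_category K A B) F G)"
    if "linear_functor K A B F" "linear_functor K A B G" for F G
  proof -
    interpret F: linear_functor K A B F by fact
    interpret G: linear_functor K A B G by fact
    note o = F.obj_closed G.obj_closed
    have ext: "\<alpha> = \<beta>" if "\<alpha> \<in> {\<alpha>. Src \<alpha> = F \<and> Tgt \<alpha> = G \<and> natural A B F G (At \<alpha>)}"
      "Src \<beta> = F" "Tgt \<beta> = G" "At \<beta> \<in> extensional (Ob A)"
      "\<And>a. a \<in> Ob A \<Longrightarrow> At \<beta> a = At \<alpha> a" for \<alpha> \<beta> :: "((_, _, _, _) funct, _) trans"
     by (rule trans_eqI[of _ _ "Ob A"]) (use that naturalD(2) in auto)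
    have mm: "At \<alpha> a \<in> mor B (FO F a) (FO G a)"
     if "\<alpha> \<in> {\<alpha>. Src \<alpha> = F \<and> Tgt \<alpha> = G \<and> natural A B F G (At \<alpha>)}" "a \<in> Ob A"
     for \<alpha> :: "((_, _, _, _) funct, _) trans" and a
     using that by (auto intro: naturalD(1))
    show ?thesis
     unfolding functor_category_def lincat.select_convs
    proof (rule module_linear_space[OF B.field], goal_cases)
     case 1
     have "natural A B F G (\<lambda>a\<in>Ob A. \<zero>\<^bsub>Hom B (FO F a) (FO G a)\<^esub>)"
     proof (rule naturalI)
      fix a b f assume f: "a \<in> Ob A" "b \<in> Ob A" "f \<in> mor A a b"
      show "(\<lambda>a\<in>Ob A. \<zero>\<^bsub>Hom B (FO F a) (FO G a)\<^esub>) b \<bullet>\<^bsub>B\<^esub> FA F f =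
       FA G f \<bullet>\<^bsub>B\<^esub> (\<lambda>a\<in>Ob A. \<zero>\<^bsub>Hom B (FO F a) (FO G a)\<^esub>) a"
       using B.comp_zero_left[OF _ _ _ F.arr[OF f], of "FO G b"]
        B.comp_zero_right[OF _ _ _ G.arr[OF f], of "FO F a"] f by (simp add: o)
     qed (auto simp: o B.hom_zero)
     then show ?case by simp
    next
     case (2 x y)
     then have n: "natural A B F G (At x)" "natural A B F G (At y)" by auto
     have "natural A B F G (\<lambda>a\<in>Ob A. At x a \<oplus>\<^bsub>Hom B (FO F a) (FO G a)\<^esub> At y a)"
     proof (rule naturalI)
      fix a b f assume f: "a \<in> Ob A" "b \<in> Ob A" "f \<in> mor A a b"
      show "(\<lambda>a\<in>Ob A. At x a \<oplus>\<^bsub>Hom B (FO F a) (FO G a)\<^esub> At y a) b \<bullet>\<^bsub>B\<^esub> FA F f =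
       FA G f \<bullet>\<^bsub>B\<^esub> (\<lambda>a\<in>Ob A. At x a \<oplus>\<^bsub>Hom B (FO F a) (FO G a)\<^esub> At y a) a"
       using B.comp_add_left[OF _ _ _ F.arr[OF f] n[THEN naturalD(1)]]
        B.comp_add_right[OF _ _ _ n[THEN naturalD(1)] G.arr[OF f]]
        f n[THEN naturalD(3), OF f] by (simp add: o)
     qed (auto simp: o B.hom_add n[THEN naturalD(1)])
     then show ?case by simp
    next
     case (3 r x)
     then have n: "natural A B F G (At x)" by auto
     have "natural A B F G (\<lambda>a\<in>Ob A. r \<odot>\<^bsub>Hom B (FO F a) (FO G a)\<^esub> At x a)"
     proof (rule naturalI)
      fix a b f assume f: "a \<in> Ob A" "b \<in> Ob A" "f \<in> mor A a b"
      show "(\<lambda>a\<in>Ob A. r \<odot>\<^bsub>Hom B (FO F a) (FO G a)\<^esub> At x a) b \<bullet>\<^bsub>B\<^esub> FA F f =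
       FA G f \<bullet>\<^bsub>B\<^esub> (\<lambda>a\<in>Ob A. r \<odot>\<^bsub>Hom B (FO F a) (FO G a)\<^esub> At x a) a"
       using B.comp_smult_left[OF _ _ _ F.arr[OF f] n[THEN naturalD(1)] 3(1)]
        B.comp_smult_right[OF _ _ _ n[THEN naturalD(1)] G.arr[OF f] 3(1)]
        f n[THEN naturalD(3), OF f] by (simp add: o)
     qed (auto simp: o B.hom_smult n[THEN naturalD(1)] 3(1))
     then show ?case by simp
    next
     case (4 x y w)
     note m = 4[THEN mm]
     show ?case by (simp add: fun_eq_iff o m B.hom_add_assoc split: if_split)
    next
     case (5 x y)
     note m = 5[THEN mm]
     show ?case using B.hom_add_comm[OF o m] by (simp add: fun_eq_iff restrict_def)
    next
     case (6 x)
     show ?case by (rule ext[OF 6, symmetric]) (simp_all add: o B.hom_l_zero mm[OF 6])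
    next
     case (7 x)
     show ?case by (simp add: fun_eq_iff restrict_def o mm[OF 7] B.hom_smult_zero)
    next
     case (8 x)
     show ?case
      by (rule ext[OF 8, symmetric]) (simp_all add: o mm[OF 8] module.smult_one[OF B.hom_space])
    next
     case (9 r t x)
     show ?case
      by (simp add: fun_eq_iff restrict_def o mm[OF 9(3)] 9(1,2) module.smult_l_distr[OF B.hom_space])
    next
     case (10 r x y)
     show ?case
      by (simp add: fun_eq_iff restrict_def o 10(2,3)[THEN mm] 10(1) module.smult_r_distr[OF B.hom_space])
    next
     case (11 r t x)
     show ?case
      by (simp add: fun_eq_iff restrict_def o mm[OF 11(3)] 11(1,2) module.smult_assoc1[OF B.hom_space])
    qed
  qed
  have ob: "FO F a \<in> Ob B" if "F \<in> Ob (functor_category K A B)" "a \<in> Ob A" for F a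
    using that by (simp add: functor_category_simps linear_functor.obj_closed)
  have at: "At \<alpha> a \<in> mor B (FO F a) (FO G a)" if "\<alpha> \<in> mor (functor_category K A B) F G" "a \<in> Ob A" for \<alpha> F G a
    using that by (auto simp: functor_category_simps intro: naturalD(1))
  show ?thesis
  proof (rule linear_category.intro, goal_cases)
    case 1 show ?case by (rule B.field)
  next
    case (2 a b) then show ?case using hom by (simp add: functor_category_simps)
  next
    case (3 a b a' b' f) then show ?case by (auto simp: functor_category_simps)
  next
    case (4 F)
    then interpret F: linear_functor K A B F by (simp add: functor_category_simps)
    show ?case
     by (auto simp: functor_category_simps F.obj_closed B.id_mor intro!: naturalI)
      (metis B.id_left B.id_right F.arr F.obj_closed)
  next
    case (5 F G H \<alpha> \<beta>)
    then interpret F: linear_functor K A B F by (simp add: functor_category_simps)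
    interpret G: linear_functor K A B G using 5 by (simp add: functor_category_simps)
    interpret H: linear_functor K A B H using 5 by (simp add: functor_category_simps)
    note o = F.obj_closed G.obj_closed H.obj_closed
    have n: "natural A B F G (At \<alpha>)" "natural A B G H (At \<beta>)" "Src \<alpha> = F" "Tgt \<beta> = H"
     using 5 by (auto simp: functor_category_simps)
    have "natural A B F H (\<lambda>a\<in>Ob A. At \<beta> a \<bullet>\<^bsub>B\<^esub> At \<alpha> a)"
    proof (rule naturalI)
     fix a b f assume f: "a \<in> Ob A" "b \<in> Ob A" "f \<in> mor A a b"
     note m = f n(1,2)[THEN naturalD(1)] o F.arr[OF f] G.arr[OF f] H.arr[OF f]
     have "(At \<beta> b \<bullet>\<^bsub>B\<^esub> At \<alpha> b) \<bullet>\<^bsub>B\<^esub> FA F f = At \<beta> b \<bullet>\<^bsub>B\<^esub> (FA G f \<bullet>\<^bsub>B\<^esub> At \<alpha> a)"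
      using naturalD(3)[OF n(1) f] by (subst B.comp_assoc[of "FO F a" "FO F b" "FO G b" "FO H b"]) (simp_all add: m)
     also have "\<dots> = (FA H f \<bullet>\<^bsub>B\<^esub> At \<beta> a) \<bullet>\<^bsub>B\<^esub> At \<alpha> a"
      using naturalD(3)[OF n(2) f] B.comp_assoc[of "FO F a" "FO G a" "FO G b" "FO H b" "At \<alpha> a" "FA G f" "At \<beta> b"] by (simp add: m)
     also have "\<dots> = FA H f \<bullet>\<^bsub>B\<^esub> (At \<beta> a \<bullet>\<^bsub>B\<^esub> At \<alpha> a)"
      by (subst B.comp_assoc[of "FO F a" "FO G a" "FO H a" "FO H b"]) (simp_all add: m)
     finally show "(\<lambda>a\<in>Ob A. At \<beta> a \<bullet>\<^bsub>B\<^esub> At \<alpha> a) b \<bullet>\<^bsub>B\<^esub> FA F f = FA H f \<bullet>\<^bsub>B\<^esub> (\<lambda>a\<in>Ob A. At \<beta> a \<bullet>\<^bsub>B\<^esub> At \<alpha> a) a"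
      using f by simp
    qed (auto intro!: B.comp_mor[OF _ _ _ n(1)[THEN naturalD(1)] n(2)[THEN naturalD(1)]] simp: o)
    then show ?case using n by (simp add: functor_category_simps)
  next
    case (6 F G \<alpha>)
    then have o: "\<And>a. a \<in> Ob A \<Longrightarrow> FO F a \<in> Ob B" "\<And>a. a \<in> Ob A \<Longrightarrow> FO G a \<in> Ob B"
     and m: "Src \<alpha> = F" "Tgt \<alpha> = G" "natural A B F G (At \<alpha>)"
     by (auto simp: functor_category_simps linear_functor.obj_closed)
    show ?case
     by (rule trans_eqI[of _ _ "Ob A"])
      (simp_all add: functor_category_simps m naturalD(2)[OF m(3)] B.id_left[OF o naturalD(1)[OF m(3)]])
  next
    case (7 F G \<alpha>)
    then have o: "\<And>a. a \<in> Ob A \<Longrightarrow> FO F a \<in> Ob B" "\<And>a. a \<in> Ob A \<Longrightarrow> FO G a \<in> Ob B"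
     and m: "Src \<alpha> = F" "Tgt \<alpha> = G" "natural A B F G (At \<alpha>)"
     by (auto simp: functor_category_simps linear_functor.obj_closed)
    show ?case
     by (rule trans_eqI[of _ _ "Ob A"])
      (simp_all add: functor_category_simps m naturalD(2)[OF m(3)] B.id_right[OF o naturalD(1)[OF m(3)]])
  next
    case (8 F G H L \<alpha> \<beta> \<gamma>)
    show ?case using B.comp_assoc[OF 8(1-4)[THEN ob] 8(5-7)[THEN at]]
     by (simp add: functor_category_simps fun_eq_iff restrict_def)
  next
    case (9 F G H \<alpha> \<beta> \<gamma>)
    show ?case using B.comp_add_left[OF 9(1-3)[THEN ob] 9(4-6)[THEN at]] 9(4-6)
     by (simp add: functor_category_simps fun_eq_iff restrict_def)
  next
    case (10 F G H \<alpha> \<beta> \<gamma>)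
    show ?case using B.comp_add_right[OF 10(1-3)[THEN ob] 10(4-6)[THEN at]] 10(4-6)
     by (simp add: functor_category_simps fun_eq_iff restrict_def)
  next
    case (11 F G H \<alpha> \<beta> r)
    show ?case using B.comp_smult_left[OF 11(1-3)[THEN ob] 11(4,5)[THEN at] 11(6)] 11(4,5)
     by (simp add: functor_category_simps fun_eq_iff restrict_def)
  next
    case (12 F G H \<alpha> \<beta> r)
    show ?case using B.comp_smult_right[OF 12(1-3)[THEN ob] 12(4,5)[THEN at] 12(6)] 12(4,5)
     by (simp add: functor_category_simps fun_eq_iff restrict_def)
  qed
qed

lemma (in linear_category) endofunctor_category_linear: "linear_category K (endofunctor_category K C)"
  by (rule linear_category_cong[OF functor_category_linear[OF linear_category_axioms]])
    (simp_all add: endofunctor_category_def Let_def)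

lemma endofunctor_category_simps:
  "Ob (endofunctor_category K C) = {F. linear_functor K C C F}"
  "mor (endofunctor_category K C) F G = {\<alpha>. Src \<alpha> = F \<and> Tgt \<alpha> = G \<and> natural C C F G (At \<alpha>)}"
  "\<zero>\<^bsub>Hom (endofunctor_category K C) F G\<^esub> =
    \<lparr>Src = F, Tgt = G, At = (\<lambda>a\<in>Ob C. \<zero>\<^bsub>Hom C (FO F a) (FO G a)\<^esub>)\<rparr>"
  "\<alpha> \<oplus>\<^bsub>Hom (endofunctor_category K C) F G\<^esub> \<beta> = \<lparr>Src = F, Tgt = G,
       At = (\<lambda>a\<in>Ob C. At \<alpha> a \<oplus>\<^bsub>Hom C (FO F a) (FO G a)\<^esub> At \<beta> a)\<rparr>"
  "r \<odot>\<^bsub>Hom (endofunctor_category K C) F G\<^esub> \<alpha> = \<lparr>Src = F, Tgt = G,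
       At = (\<lambda>a\<in>Ob C. r \<odot>\<^bsub>Hom C (FO F a) (FO G a)\<^esub> At \<alpha> a)\<rparr>"
  "Id (endofunctor_category K C) F = \<lparr>Src = F, Tgt = F, At = (\<lambda>a\<in>Ob C. Id C (FO F a))\<rparr>"
  "\<beta> \<bullet>\<^bsub>endofunctor_category K C\<^esub> \<alpha> =
    \<lparr>Src = Src \<alpha>, Tgt = Tgt \<beta>, At = (\<lambda>a\<in>Ob C. At \<beta> a \<bullet>\<^bsub>C\<^esub> At \<alpha> a)\<rparr>"
  "F \<boxtimes>\<^bsub>endofunctor_category K C\<^esub> G = comp_functor C G F"
  "\<alpha> \<boxdot>\<^bsub>endofunctor_category K C\<^esub> \<beta> =
    \<lparr>Src = comp_functor C (Src \<beta>) (Src \<alpha>), Tgt = comp_functor C (Tgt \<beta>) (Tgt \<alpha>),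
    At = (\<lambda>y\<in>Ob C. At \<beta> (FO (Tgt \<alpha>) y) \<bullet>\<^bsub>C\<^esub> FA (Src \<beta>) (At \<alpha> y))\<rparr>"
  "Unit (endofunctor_category K C) = id_functor C"
  "Assoc (endofunctor_category K C) F G H =
    Id (endofunctor_category K C) (comp_functor C H (comp_functor C G F))"
  "Lun (endofunctor_category K C) = Id (endofunctor_category K C)"
  "Run (endofunctor_category K C) = Id (endofunctor_category K C)"
  by (simp_all add: endofunctor_category_def Let_def functor_category_simps functor_category_def)

lemma arrowsI: "\<lbrakk>a \<in> Ob C; b \<in> Ob C; f \<in> mor C a b\<rbrakk> \<Longrightarrow> f \<in> arrows C"
  by (auto simp: arrows_def)

lemma comp_functor_apply:
  "a \<in> Ob A \<Longrightarrow> FO (comp_functor A G F) a = FO G (FO F a)"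
  "\<lbrakk>a \<in> Ob A; b \<in> Ob A; f \<in> mor A a b\<rbrakk> \<Longrightarrow> FA (comp_functor A G F) f = FA G (FA F f)"
  by (auto simp: comp_functor_def arrowsI)

lemma linear_functor_comp:
  assumes A: "linear_category K A"
    and F: "linear_functor K A B F" and G: "linear_functor K B D G"
  shows "linear_functor K A D (comp_functor A G F)"
proof -
  interpret A: linear_category K A by fact
  interpret F: linear_functor K A B F by fact
  interpret G: linear_functor K B D G by fact
  note o = F.obj_closed G.obj_closed
  show ?thesis
  proof (rule linear_functor.intro, goal_cases)
    case 1 show ?case by (auto simp: comp_functor_def o)
  next
    case 2 show ?case by (simp add: comp_functor_def)
  next
    case (3 a b f)
    then show ?case by (simp add: comp_functor_apply o G.arr[OF _ _ F.arr[OF 3]])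
  next
    case (4 a)
    then show ?case by (simp add: comp_functor_apply o A.id_mor F.ident G.ident)
  next
    case (5 a b c f g)
    then show ?case
     using G.comp[OF _ _ _ F.arr[OF 5(1,2,4)] F.arr[OF 5(2,3,5)]] A.comp_mor[OF 5]
     by (simp add: comp_functor_apply(1) comp_functor_apply(2)[of a A c] comp_functor_apply(2)[of a A b]
      comp_functor_apply(2)[of b A c] o F.comp)
  next
    case (6 a b f g)
    then show ?case
     using G.add[OF _ _ F.arr[OF 6(1,2,3)] F.arr[OF 6(1,2,4)]] A.hom_add[OF 6]
     by (simp add: comp_functor_apply(2)[of a A b] comp_functor_apply(1) o F.add)
  next
    case (7 a b f r)
    then show ?case
     using G.smult[OF _ _ F.arr[OF 7(1,2,3)] 7(4)] A.hom_smult[OF 7(1,2,4,3)]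
     by (simp add: comp_functor_apply(2)[of a A b] comp_functor_apply(1) o F.smult)
  qed
qed

lemma linear_functor_id:
  assumes "linear_category K A"
  shows "linear_functor K A A (id_functor A)"
proof -
  interpret A: linear_category K A by fact
  show ?thesis
    by (rule linear_functor.intro)
     (auto simp: id_functor_def A.id_mor arrowsI[OF _ _ A.id_mor] arrowsI
      arrowsI[OF _ _ A.comp_mor] arrowsI[OF _ _ A.hom_add] arrowsI[OF _ _ A.hom_smult])
qed

text \<open>The structure that the coherence computations use in the target of the functors: a
  bifunctor and associators of the right type. The zero laws make a tensor product of arrows vanish
  as soon as one factor does, which later spreads the Hecke relation to more strands.\<close>

locale bifunctor_category = linear_category K C
  for K :: "'k ring" and C :: "('k, 'o, 'a, 'z) moncat_scheme" +
  assumes tensor_obj: "\<And>a b. \<lbrakk>a \<in> Ob C; b \<in> Ob C\<rbrakk> \<Longrightarrow> a \<boxtimes>\<^bsub>C\<^esub> b \<in> Ob C"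
    and unit_obj: "Unit C \<in> Ob C"
    and tensor_arr: "\<And>a b a' b' f g. \<lbrakk>a \<in> Ob C; b \<in> Ob C; a' \<in> Ob C; b' \<in> Ob C;
       f \<in> mor C a a'; g \<in> mor C b b'\<rbrakk> \<Longrightarrow> f \<boxdot>\<^bsub>C\<^esub> g \<in> mor C (a \<boxtimes>\<^bsub>C\<^esub> b) (a' \<boxtimes>\<^bsub>C\<^esub> b')"
    and tensor_id: "\<And>a b. \<lbrakk>a \<in> Ob C; b \<in> Ob C\<rbrakk> \<Longrightarrow> Id C a \<boxdot>\<^bsub>C\<^esub> Id C b = Id C (a \<boxtimes>\<^bsub>C\<^esub> b)"
    and tensor_comp: "\<And>a b a' b' a'' b'' f g f' g'. \<lbrakk>a \<in> Ob C; b \<in> Ob C; a' \<in> Ob C; b' \<in> Ob C;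
       a'' \<in> Ob C; b'' \<in> Ob C; f \<in> mor C a a'; g \<in> mor C b b'; f' \<in> mor C a' a''; g' \<in> mor C b' b''\<rbrakk>
       \<Longrightarrow> (f' \<bullet>\<^bsub>C\<^esub> f) \<boxdot>\<^bsub>C\<^esub> (g' \<bullet>\<^bsub>C\<^esub> g) = (f' \<boxdot>\<^bsub>C\<^esub> g') \<bullet>\<^bsub>C\<^esub> (f \<boxdot>\<^bsub>C\<^esub> g)"
    and tensor_zero_left: "\<And>a b a' b' g. \<lbrakk>a \<in> Ob C; b \<in> Ob C; a' \<in> Ob C; b' \<in> Ob C; g \<in> mor C b b'\<rbrakk>
       \<Longrightarrow> \<zero>\<^bsub>Hom C a a'\<^esub> \<boxdot>\<^bsub>C\<^esub> g = \<zero>\<^bsub>Hom C (a \<boxtimes>\<^bsub>C\<^esub> b) (a' \<boxtimes>\<^bsub>C\<^esub> b')\<^esub>"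
    and tensor_zero_right: "\<And>a b a' b' f. \<lbrakk>a \<in> Ob C; b \<in> Ob C; a' \<in> Ob C; b' \<in> Ob C; f \<in> mor C a a'\<rbrakk>
       \<Longrightarrow> f \<boxdot>\<^bsub>C\<^esub> \<zero>\<^bsub>Hom C b b'\<^esub> = \<zero>\<^bsub>Hom C (a \<boxtimes>\<^bsub>C\<^esub> b) (a' \<boxtimes>\<^bsub>C\<^esub> b')\<^esub>"
    and assoc_mor: "\<And>a b c. \<lbrakk>a \<in> Ob C; b \<in> Ob C; c \<in> Ob C\<rbrakk>
       \<Longrightarrow> Assoc C a b c \<in> mor C ((a \<boxtimes>\<^bsub>C\<^esub> b) \<boxtimes>\<^bsub>C\<^esub> c) (a \<boxtimes>\<^bsub>C\<^esub> (b \<boxtimes>\<^bsub>C\<^esub> c))"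

section \<open>Composition of endofunctors as a tensor product\<close>

context linear_category
begin

abbreviation "cmp \<equiv> comp_functor C"
abbreviation "endo \<equiv> linear_functor K C C"
abbreviation "End \<equiv> endofunctor_category K C"

lemma arrowsE:
  assumes "f \<in> arrows C" obtains a b where "a \<in> Ob C" "b \<in> Ob C" "f \<in> mor C a b"
  using assms by (auto simp: arrows_def)

lemma linear_functor_arrows: "endo F \<Longrightarrow> f \<in> arrows C \<Longrightarrow> FA F f \<in> arrows C"
  by (elim arrowsE) (auto intro: arrowsI linear_functor.arr linear_functor.obj_closed)

text \<open>Extensionality makes composition of functors strictly associative. So the identity
  transformations declared as associators of the endofunctor category have the required source and
  target.\<close>

lemma comp_functor_assoc:
  "endo F \<Longrightarrow> cmp (cmp H G) F = cmp H (cmp G F)"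
  by (auto simp: comp_functor_def restrict_def fun_eq_iff linear_functor.obj_closed linear_functor_arrows)

lemma End_eqI:
  assumes "\<alpha> \<in> mor End F G" "\<beta> \<in> mor End F G" "\<And>y. y \<in> Ob C \<Longrightarrow> At \<alpha> y = At \<beta> y"
  shows "\<alpha> = \<beta>"
  by (rule trans_eqI[of _ _ "Ob C"]) (use assms naturalD(2) in \<open>auto simp: endofunctor_category_simps\<close>)

lemma End_morD:
  assumes "\<alpha> \<in> mor End F G"
  shows "Src \<alpha> = F" "Tgt \<alpha> = G" "y \<in> Ob C \<Longrightarrow> At \<alpha> y \<in> mor C (FO F y) (FO G y)"
    "\<lbrakk>a \<in> Ob C; b \<in> Ob C; f \<in> mor C a b\<rbrakk> \<Longrightarrow> At \<alpha> b \<bullet>\<^bsub>C\<^esub> FA F f = FA G f \<bullet>\<^bsub>C\<^esub> At \<alpha> a"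
  using assms by (auto simp: endofunctor_category_simps naturalD)

text \<open>A naturality square of the horizontal composite is pasted from the image under
  \<open>G\<close> of the square of \<alpha>, which is the fact \<open>1\<close>, and the square of
  \<beta> at \<open>FA F' f\<close>.\<close>

lemma End_tensor_arr:
  assumes "endo F" "endo F'" "endo G" "endo G'"
    and \<alpha>: "\<alpha> \<in> mor End F F'" and \<beta>: "\<beta> \<in> mor End G G'"
  shows "\<alpha> \<boxdot>\<^bsub>End\<^esub> \<beta> \<in> mor End (cmp G F) (cmp G' F')"
proof -
  interpret F: linear_functor K C C F by fact
  interpret F': linear_functor K C C F' by fact
  interpret G: linear_functor K C C G by fact
  interpret G': linear_functor K C C G' by fact
  note o = F.obj_closed F'.obj_closed G.obj_closed G'.obj_closed
  have "natural C C (cmp G F) (cmp G' F')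
    (\<lambda>y\<in>Ob C. At \<beta> (FO F' y) \<bullet>\<^bsub>C\<^esub> FA G (At \<alpha> y))" (is "natural _ _ _ _ ?t")
  proof (rule naturalI)
    fix a assume a: "a \<in> Ob C"
    then show "?t a \<in> mor C (FO (cmp G F) a) (FO (cmp G' F') a)"
     by (auto simp: comp_functor_apply o
       intro: comp_mor[OF _ _ _ G.arr[OF _ _ End_morD(3)[OF \<alpha>]] End_morD(3)[OF \<beta>]])
  next
    fix a b f assume f: "a \<in> Ob C" "b \<in> Ob C" "f \<in> mor C a b"
    note m = End_morD(3)[OF \<alpha>] End_morD(3)[OF \<beta>]
    have 1: "FA G (At \<alpha> b) \<bullet>\<^bsub>C\<^esub> FA G (FA F f) = FA G (FA F' f) \<bullet>\<^bsub>C\<^esub> FA G (At \<alpha> a)"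
     using G.comp[OF _ _ _ F.arr[OF f] m(1)[OF f(2)]] G.comp[OF _ _ _ m(1)[OF f(1)] F'.arr[OF f]]
      End_morD(4)[OF \<alpha> f] f by (simp add: o)
    have "(At \<beta> (FO F' b) \<bullet>\<^bsub>C\<^esub> FA G (At \<alpha> b)) \<bullet>\<^bsub>C\<^esub> FA G (FA F f) =
     At \<beta> (FO F' b) \<bullet>\<^bsub>C\<^esub> (FA G (FA F' f) \<bullet>\<^bsub>C\<^esub> FA G (At \<alpha> a))"
     unfolding 1[symmetric] using f
     by (intro comp_assoc[OF _ _ _ _ G.arr[OF _ _ F.arr[OF f]] G.arr[OF _ _ m(1)] m(2)]) (auto simp: o)
    also have "\<dots> = (At \<beta> (FO F' b) \<bullet>\<^bsub>C\<^esub> FA G (FA F' f)) \<bullet>\<^bsub>C\<^esub> FA G (At \<alpha> a)"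
     using f by (intro comp_assoc[symmetric, OF _ _ _ _ G.arr[OF _ _ m(1)] G.arr[OF _ _ F'.arr[OF f]] m(2)]) (auto simp: o)
    also have "\<dots> = (FA G' (FA F' f) \<bullet>\<^bsub>C\<^esub> At \<beta> (FO F' a)) \<bullet>\<^bsub>C\<^esub> FA G (At \<alpha> a)"
     using End_morD(4)[OF \<beta> _ _ F'.arr[OF f]] f by (simp add: o)
    also have "\<dots> = FA G' (FA F' f) \<bullet>\<^bsub>C\<^esub> (At \<beta> (FO F' a) \<bullet>\<^bsub>C\<^esub> FA G (At \<alpha> a))"
     using f by (intro comp_assoc[OF _ _ _ _ G.arr[OF _ _ m(1)] m(2) G'.arr[OF _ _ F'.arr[OF f]]]) (auto simp: o)
    finally show "?t b \<bullet>\<^bsub>C\<^esub> FA (cmp G F) f = FA (cmp G' F') f \<bullet>\<^bsub>C\<^esub> ?t a"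
     using f by (simp add: comp_functor_apply(2)[OF f] comp_functor_apply(1))
  qed simp
  then show ?thesis
    using End_morD(1,2)[OF \<alpha>] End_morD(1,2)[OF \<beta>] by (simp add: endofunctor_category_simps)
qed

lemma End_tensor_at:
  assumes "\<alpha> \<in> mor End F F'" "\<beta> \<in> mor End G G'" "y \<in> Ob C"
  shows "At (\<alpha> \<boxdot>\<^bsub>End\<^esub> \<beta>) y = At \<beta> (FO F' y) \<bullet>\<^bsub>C\<^esub> FA G (At \<alpha> y)"
  using assms End_morD(1,2)[OF assms(1)] End_morD(1,2)[OF assms(2)]
  by (simp add: endofunctor_category_simps)

lemma End_at [simp]:
  assumes "y \<in> Ob C"
  shows "At (Id End F) y = Id C (FO F y)" "At (\<beta> \<bullet>\<^bsub>End\<^esub> \<alpha>) y = At \<beta> y \<bullet>\<^bsub>C\<^esub> At \<alpha> y"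
    "At (\<alpha> \<oplus>\<^bsub>Hom End F G\<^esub> \<beta>) y = At \<alpha> y \<oplus>\<^bsub>Hom C (FO F y) (FO G y)\<^esub> At \<beta> y"
    "At (r \<odot>\<^bsub>Hom End F G\<^esub> \<alpha>) y = r \<odot>\<^bsub>Hom C (FO F y) (FO G y)\<^esub> At \<alpha> y"
    "At \<zero>\<^bsub>Hom End F G\<^esub> y = \<zero>\<^bsub>Hom C (FO F y) (FO G y)\<^esub>"
  using assms by (simp_all add: endofunctor_category_simps)

text \<open>Apart from functoriality of \<open>G\<close>, the interchange law comes down to one
  instance of naturality, that of \<beta> along the component of \<open>\<alpha>'\<close>; this is
  the fact \<open>nat\<close>, and the rest is reassociation.\<close>

lemma End_tensor_comp:
  assumes fn: "endo F" "endo F'" "endo F''"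
    "endo G" "endo G'" "endo G''"
    and m: "\<alpha> \<in> mor End F F'" "\<beta> \<in> mor End G G'" "\<alpha>' \<in> mor End F' F''" "\<beta>' \<in> mor End G' G''"
  shows "(\<alpha>' \<bullet>\<^bsub>End\<^esub> \<alpha>) \<boxdot>\<^bsub>End\<^esub> (\<beta>' \<bullet>\<^bsub>End\<^esub> \<beta>) = (\<alpha>' \<boxdot>\<^bsub>End\<^esub> \<beta>') \<bullet>\<^bsub>End\<^esub> (\<alpha> \<boxdot>\<^bsub>End\<^esub> \<beta>)"
proof -
  interpret E: linear_category K End by (rule endofunctor_category_linear)
  interpret F: linear_functor K C C F by fact
  interpret F': linear_functor K C C F' by fact
  interpret F'': linear_functor K C C F'' by fact
  interpret G: linear_functor K C C G by fact
  interpret G': linear_functor K C C G' by fact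
  interpret G'': linear_functor K C C G'' by fact
  note o = F.obj_closed F'.obj_closed F''.obj_closed G.obj_closed G'.obj_closed G''.obj_closed
  have fE: "F \<in> Ob End" "F' \<in> Ob End" "F'' \<in> Ob End" "G \<in> Ob End" "G' \<in> Ob End" "G'' \<in> Ob End"
    using fn by (simp_all add: endofunctor_category_simps)
  have cE: "cmp G F \<in> Ob End" "cmp G' F' \<in> Ob End" "cmp G'' F'' \<in> Ob End"
    using fn linear_functor_comp[OF linear_category_axioms, where B=C and D=C] by (simp_all add: endofunctor_category_simps)
  have ca: "\<alpha>' \<bullet>\<^bsub>End\<^esub> \<alpha> \<in> mor End F F''" "\<beta>' \<bullet>\<^bsub>End\<^esub> \<beta> \<in> mor End G G''"
    using m fE by (auto intro: E.comp_mor)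
  show ?thesis
  proof (rule End_eqI)
    show "(\<alpha>' \<bullet>\<^bsub>End\<^esub> \<alpha>) \<boxdot>\<^bsub>End\<^esub> (\<beta>' \<bullet>\<^bsub>End\<^esub> \<beta>) \<in> mor End (cmp G F) (cmp G'' F'')"
     using ca fn by (intro End_tensor_arr)
    show "(\<alpha>' \<boxdot>\<^bsub>End\<^esub> \<beta>') \<bullet>\<^bsub>End\<^esub> (\<alpha> \<boxdot>\<^bsub>End\<^esub> \<beta>) \<in> mor End (cmp G F) (cmp G'' F'')"
     using m fn cE by (intro E.comp_mor[of _ "cmp G' F'"] End_tensor_arr)
  next
    fix y assume y: "y \<in> Ob C"
    note n = End_morD(3)[OF m(1)] End_morD(3)[OF m(2)] End_morD(3)[OF m(3)] End_morD(3)[OF m(4)]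
    let ?c = "\<lambda>g f. g \<bullet>\<^bsub>C\<^esub> f"
    let ?a = "FA G (At \<alpha> y)" and ?a' = "FA G (At \<alpha>' y)" and ?b = "At \<beta> (FO F'' y)" and ?b' = "At \<beta>' (FO F'' y)"
     and ?u = "FA G' (At \<alpha>' y)" and ?v = "At \<beta> (FO F' y)"
    have a: "?a \<in> mor C (FO G (FO F y)) (FO G (FO F' y))" "?a' \<in> mor C (FO G (FO F' y)) (FO G (FO F'' y))"
     "?b \<in> mor C (FO G (FO F'' y)) (FO G' (FO F'' y))" "?b' \<in> mor C (FO G' (FO F'' y)) (FO G'' (FO F'' y))"
     "?u \<in> mor C (FO G' (FO F' y)) (FO G' (FO F'' y))" "?v \<in> mor C (FO G (FO F' y)) (FO G' (FO F' y))"
     using y by (auto intro!: G.arr G'.arr n simp: o)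
    have oo: "FO G (FO F y) \<in> Ob C" "FO G (FO F' y) \<in> Ob C" "FO G (FO F'' y) \<in> Ob C"
     "FO G' (FO F' y) \<in> Ob C" "FO G' (FO F'' y) \<in> Ob C" "FO G'' (FO F'' y) \<in> Ob C"
     using y by (auto simp: o)
    have nat: "?b \<bullet>\<^bsub>C\<^esub> ?a' = ?u \<bullet>\<^bsub>C\<^esub> ?v"
     using End_morD(4)[OF m(2) _ _ n(3)[OF y]] y by (simp add: o)
    have "(?b' \<bullet>\<^bsub>C\<^esub> ?b) \<bullet>\<^bsub>C\<^esub> (?a' \<bullet>\<^bsub>C\<^esub> ?a) = ?b' \<bullet>\<^bsub>C\<^esub> (?b \<bullet>\<^bsub>C\<^esub> (?a' \<bullet>\<^bsub>C\<^esub> ?a))"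
     using comp_assoc[OF oo(1,3,5,6) comp_mor[OF oo(1,2,3) a(1,2)] a(3,4)] .
    also have "?b \<bullet>\<^bsub>C\<^esub> (?a' \<bullet>\<^bsub>C\<^esub> ?a) = (?b \<bullet>\<^bsub>C\<^esub> ?a') \<bullet>\<^bsub>C\<^esub> ?a"
     using comp_assoc[OF oo(1,2,3,5) a(1,2,3)] by simp
    also have "\<dots> = ?u \<bullet>\<^bsub>C\<^esub> (?v \<bullet>\<^bsub>C\<^esub> ?a)"
     unfolding nat using comp_assoc[OF oo(1,2,4,5) a(1,6,5)] .
    also have "?b' \<bullet>\<^bsub>C\<^esub> \<dots> = (?b' \<bullet>\<^bsub>C\<^esub> ?u) \<bullet>\<^bsub>C\<^esub> (?v \<bullet>\<^bsub>C\<^esub> ?a)"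
     using comp_assoc[OF oo(1,4,5,6) comp_mor[OF oo(1,2,4) a(1,6)] a(5,4)] by simp
    finally show "At ((\<alpha>' \<bullet>\<^bsub>End\<^esub> \<alpha>) \<boxdot>\<^bsub>End\<^esub> (\<beta>' \<bullet>\<^bsub>End\<^esub> \<beta>)) y = At ((\<alpha>' \<boxdot>\<^bsub>End\<^esub> \<beta>') \<bullet>\<^bsub>End\<^esub> (\<alpha> \<boxdot>\<^bsub>End\<^esub> \<beta>)) y"
     using G.comp[OF _ _ _ n(1)[OF y] n(3)[OF y]] y
     by (simp add: o End_tensor_at[OF ca] End_tensor_at[OF m(1,2)] End_tensor_at[OF m(3,4)])
  qed
qed

lemma End_tensor_id:
  assumes fn: "endo F" "endo G"
  shows "Id End F \<boxdot>\<^bsub>End\<^esub> Id End G = Id End (cmp G F)"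
proof -
  interpret F: linear_functor K C C F by fact
  interpret G: linear_functor K C C G by fact
  show ?thesis
    by (auto simp: endofunctor_category_simps fun_eq_iff restrict_def comp_functor_apply
     F.obj_closed G.obj_closed G.ident intro!: id_left[OF _ _ id_mor])
qed

text \<open>The two zero laws hold for different reasons: a zero in the first factor is sent to zero
  by the linear functor \<open>G\<close> before it is composed, a zero in the second factor is
  composed directly. The associators are well typed by \<open>comp_functor_assoc\<close>.\<close>

lemma endofunctor_category_bifunctor: "bifunctor_category K End"
proof -
  interpret E: linear_category K End by (rule endofunctor_category_linear)
  note lc = linear_functor_comp[OF linear_category_axioms, where B=C and D=C] linear_functor_id[OF linear_category_axioms]
  have Ob: "F \<in> Ob End \<longleftrightarrow> endo F" for F by (simp add: endofunctor_category_simps)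
  have TO: "F \<boxtimes>\<^bsub>End\<^esub> G = cmp G F" for F G by (simp add: endofunctor_category_simps)
  have str: "Unit End = id_functor C" "Assoc End F G H = Id End (cmp H (cmp G F))" for F G H
    by (simp_all add: endofunctor_category_simps)
  show ?thesis
  proof (intro bifunctor_category.intro E.linear_category_axioms bifunctor_category_axioms.intro, goal_cases)
    case 1 then show ?case by (simp add: Ob TO lc)
  next
    case 2 then show ?case by (simp add: Ob str lc)
  next
    case 3 then show ?case by (simp add: Ob TO End_tensor_arr)
  next
    case 4 then show ?case by (simp add: Ob TO End_tensor_id)
  next
    case (5 F G F' G' F'' G'' \<alpha> \<beta> \<alpha>' \<beta>') then show ?case by (intro End_tensor_comp) (simp_all add: Ob)
  next
    case (6 F G F' G' \<beta>)
    then have fn: "endo F" "endo F'" "endo G" "endo G'"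
     by (simp_all add: Ob)
    have z: "\<zero>\<^bsub>Hom End F F'\<^esub> \<in> mor End F F'" using 6 by (simp add: E.hom_zero)
    show ?case unfolding TO
    proof (rule End_eqI)
     fix y assume y: "y \<in> Ob C"
     note o = fn[THEN linear_functor.obj_closed]
     show "At (\<zero>\<^bsub>Hom End F F'\<^esub> \<boxdot>\<^bsub>End\<^esub> \<beta>) y = At \<zero>\<^bsub>Hom End (cmp G F) (cmp G' F')\<^esub> y"
      using y linear_functor_zero[OF linear_category_axioms linear_category_axioms fn(3)]
       comp_zero_right[OF _ _ _ End_morD(3)[OF 6(5)]]
      by (simp add: End_tensor_at[OF z 6(5)] comp_functor_apply o)
    qed (use 6 z fn in \<open>auto intro!: End_tensor_arr E.hom_zero simp: Ob lc\<close>)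
  next
    case (7 F G F' G' \<alpha>)
    then have fn: "endo F" "endo F'" "endo G" "endo G'"
     by (simp_all add: Ob)
    have z: "\<zero>\<^bsub>Hom End G G'\<^esub> \<in> mor End G G'" using 7 by (simp add: E.hom_zero)
    show ?case unfolding TO
    proof (rule End_eqI)
     fix y assume y: "y \<in> Ob C"
     note o = fn[THEN linear_functor.obj_closed]
     show "At (\<alpha> \<boxdot>\<^bsub>End\<^esub> \<zero>\<^bsub>Hom End G G'\<^esub>) y = At \<zero>\<^bsub>Hom End (cmp G F) (cmp G' F')\<^esub> y"
      using y comp_zero_left[OF _ _ _ linear_functor.arr[OF fn(3) _ _ End_morD(3)[OF 7(5)]]]
      by (simp add: End_tensor_at[OF 7(5) z] comp_functor_apply o)
    qed (use 7 z fn in \<open>auto intro!: End_tensor_arr E.hom_zero simp: Ob lc\<close>)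
  next
    case (8 F G H)
    then show ?case by (simp add: Ob TO str comp_functor_assoc) (rule E.id_mor, simp add: Ob lc)
  qed
qed

end

lemma (in bifunctor_category) tensor_iso:
  assumes o: "a \<in> Ob C" "b \<in> Ob C" "a' \<in> Ob C" "b' \<in> Ob C"
    and f: "iso_arr C a a' f" and g: "iso_arr C b b' g"
  shows "iso_arr C (a \<boxtimes>\<^bsub>C\<^esub> b) (a' \<boxtimes>\<^bsub>C\<^esub> b') (f \<boxdot>\<^bsub>C\<^esub> g)"
proof -
  from f g obtain f' g' where
    m: "f \<in> mor C a a'" "g \<in> mor C b b'" "f' \<in> mor C a' a" "g' \<in> mor C b' b"
    and e: "f' \<bullet>\<^bsub>C\<^esub> f = Id C a" "f \<bullet>\<^bsub>C\<^esub> f' = Id C a'" "g' \<bullet>\<^bsub>C\<^esub> g = Id C b" "g \<bullet>\<^bsub>C\<^esub> g' = Id C b'"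
    unfolding iso_arr_def by auto
  have "(f' \<boxdot>\<^bsub>C\<^esub> g') \<bullet>\<^bsub>C\<^esub> (f \<boxdot>\<^bsub>C\<^esub> g) = Id C (a \<boxtimes>\<^bsub>C\<^esub> b)"
    "(f \<boxdot>\<^bsub>C\<^esub> g) \<bullet>\<^bsub>C\<^esub> (f' \<boxdot>\<^bsub>C\<^esub> g') = Id C (a' \<boxtimes>\<^bsub>C\<^esub> b')"
    using tensor_comp[OF o o(1,2) m] tensor_comp[OF o(3,4,1,2,3,4) m(3,4,1,2)] e o
    by (simp_all add: tensor_id)
  moreover have "f \<boxdot>\<^bsub>C\<^esub> g \<in> mor C (a \<boxtimes>\<^bsub>C\<^esub> b) (a' \<boxtimes>\<^bsub>C\<^esub> b')" "f' \<boxdot>\<^bsub>C\<^esub> g' \<in> mor C (a' \<boxtimes>\<^bsub>C\<^esub> b') (a \<boxtimes>\<^bsub>C\<^esub> b)"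
    using o m by (auto intro: tensor_arr)
  ultimately show ?thesis unfolding iso_arr_def by blast
qed

lemma (in monoidal_category) tensor_zero_right:
  assumes "a \<in> Ob C" "b \<in> Ob C" "a' \<in> Ob C" "b' \<in> Ob C" "f \<in> mor C a a'"
  shows "f \<boxdot>\<^bsub>C\<^esub> \<zero>\<^bsub>Hom C b b'\<^esub> = \<zero>\<^bsub>Hom C (a \<boxtimes>\<^bsub>C\<^esub> b) (a' \<boxtimes>\<^bsub>C\<^esub> b')\<^esub>"
  using tensor_smult_right[OF assms(1-5) hom_zero K.zero_closed] assms
  by (simp add: hom_smult_zero hom_zero tensor_obj tensor_arr)

section \<open>Lax monoidal functors\<close>

text \<open>Records the types of the structure maps of the source categories. In the coherence
  equations of a composite functor these maps occur as arrows to which the functors are applied, and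
  the equations themselves come from the two factors.\<close>

locale tensor_category = linear_category K C
  for K :: "'k ring" and C :: "('k, 'o, 'a, 'z) moncat_scheme" +
  assumes tensor_obj: "\<And>a b. \<lbrakk>a \<in> Ob C; b \<in> Ob C\<rbrakk> \<Longrightarrow> a \<boxtimes>\<^bsub>C\<^esub> b \<in> Ob C"
    and unit_obj: "Unit C \<in> Ob C"
    and tensor_arr: "\<And>a b a' b' f g. \<lbrakk>a \<in> Ob C; b \<in> Ob C; a' \<in> Ob C; b' \<in> Ob C;
       f \<in> mor C a a'; g \<in> mor C b b'\<rbrakk> \<Longrightarrow> f \<boxdot>\<^bsub>C\<^esub> g \<in> mor C (a \<boxtimes>\<^bsub>C\<^esub> b) (a' \<boxtimes>\<^bsub>C\<^esub> b')"
    and assoc_mor: "\<And>a b c. \<lbrakk>a \<in> Ob C; b \<in> Ob C; c \<in> Ob C\<rbrakk>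
       \<Longrightarrow> Assoc C a b c \<in> mor C ((a \<boxtimes>\<^bsub>C\<^esub> b) \<boxtimes>\<^bsub>C\<^esub> c) (a \<boxtimes>\<^bsub>C\<^esub> (b \<boxtimes>\<^bsub>C\<^esub> c))"
    and lun_mor: "\<And>a. a \<in> Ob C \<Longrightarrow> Lun C a \<in> mor C (Unit C \<boxtimes>\<^bsub>C\<^esub> a) a"
    and run_mor: "\<And>a. a \<in> Ob C \<Longrightarrow> Run C a \<in> mor C (a \<boxtimes>\<^bsub>C\<^esub> Unit C) a"

text \<open>Same equations as in \<open>strong_monoidal_functor\<close>, for structure maps that may
  fail to be invertible. Restriction of scalars is of this kind: its structure maps are quotient
  maps.\<close>

locale lax_monoidal_functor = linear_functor K A B F
  for K :: "'k ring" and A :: "('k, 'o, 'a, 'y) moncat_scheme"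
    and B :: "('k, 'p, 'b, 'z) moncat_scheme" and F :: "('o, 'a, 'p, 'b, 'w) monfun_scheme" +
  assumes mul_mor: "\<And>x y. \<lbrakk>x \<in> Ob A; y \<in> Ob A\<rbrakk>
       \<Longrightarrow> Mul F x y \<in> mor B (FO F x \<boxtimes>\<^bsub>B\<^esub> FO F y) (FO F (x \<boxtimes>\<^bsub>A\<^esub> y))"
    and mul_nat: "\<And>x y x' y' f g. \<lbrakk>x \<in> Ob A; y \<in> Ob A; x' \<in> Ob A; y' \<in> Ob A;
       f \<in> mor A x x'; g \<in> mor A y y'\<rbrakk>
       \<Longrightarrow> Mul F x' y' \<bullet>\<^bsub>B\<^esub> (FA F f \<boxdot>\<^bsub>B\<^esub> FA F g) = FA F (f \<boxdot>\<^bsub>A\<^esub> g) \<bullet>\<^bsub>B\<^esub> Mul F x y"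
    and eps_mor: "Eps F \<in> mor B (Unit B) (FO F (Unit A))"
    and mul_assoc: "\<And>x y z. \<lbrakk>x \<in> Ob A; y \<in> Ob A; z \<in> Ob A\<rbrakk>
       \<Longrightarrow> FA F (Assoc A x y z) \<bullet>\<^bsub>B\<^esub> Mul F (x \<boxtimes>\<^bsub>A\<^esub> y) z \<bullet>\<^bsub>B\<^esub> (Mul F x y \<boxdot>\<^bsub>B\<^esub> Id B (FO F z)) =
         Mul F x (y \<boxtimes>\<^bsub>A\<^esub> z) \<bullet>\<^bsub>B\<^esub> (Id B (FO F x) \<boxdot>\<^bsub>B\<^esub> Mul F y z) \<bullet>\<^bsub>B\<^esub>
         Assoc B (FO F x) (FO F y) (FO F z)"
    and mul_lun: "\<And>x. x \<in> Ob A
       \<Longrightarrow> FA F (Lun A x) \<bullet>\<^bsub>B\<^esub> Mul F (Unit A) x \<bullet>\<^bsub>B\<^esub> (Eps F \<boxdot>\<^bsub>B\<^esub> Id B (FO F x)) = Lun B (FO F x)"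
    and mul_run: "\<And>x. x \<in> Ob A
       \<Longrightarrow> FA F (Run A x) \<bullet>\<^bsub>B\<^esub> Mul F x (Unit A) \<bullet>\<^bsub>B\<^esub> (Id B (FO F x) \<boxdot>\<^bsub>B\<^esub> Eps F) = Run B (FO F x)"

text \<open>A lax functor \<open>R\<close> followed by a strong functor \<open>F\<close> is strong
  as soon as \<open>F\<close> inverts the structure maps of \<open>R\<close>, which is what the two
  assumptions demand. In the application \<open>R\<close> is restriction of scalars and
  \<open>F\<close> the Orellana--Ram functor.\<close>

locale inverting_pair =
  A: tensor_category K A + D: tensor_category K D + E: bifunctor_category K E +
  R: lax_monoidal_functor K D A R + F: strong_monoidal_functor K A E F
  for K :: "'k ring" and A :: "('k, 'o, 'a) moncat" and D :: "('k, 'p, 'b) moncat"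
    and E :: "('k, 'q, 'c) moncat" (structure) and R :: "('p, 'b, 'o, 'a) monfun" and F :: "('o, 'a, 'q, 'c) monfun" +
  assumes mul_inverted: "\<And>x y. \<lbrakk>x \<in> Ob D; y \<in> Ob D\<rbrakk> \<Longrightarrow>
     iso_arr E (FO F (FO R x \<boxtimes>\<^bsub>A\<^esub> FO R y)) (FO F (FO R (x \<boxtimes>\<^bsub>D\<^esub> y))) (FA F (Mul R x y))"
    and eps_inverted: "iso_arr E (FO F (Unit A)) (FO F (FO R (Unit D))) (FA F (Eps R))"
begin

abbreviation "G \<equiv> comp_monfun D E F R"

lemma G_apply:
  "x \<in> Ob D \<Longrightarrow> FO G x = FO F (FO R x)"
  "\<lbrakk>x \<in> Ob D; y \<in> Ob D; f \<in> mor D x y\<rbrakk> \<Longrightarrow> FA G f = FA F (FA R f)"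
  "Mul G x y = FA F (Mul R x y) \<bullet> Mul F (FO R x) (FO R y)"
  "Eps G = FA F (Eps R) \<bullet> Eps F"
  by (simp_all add: comp_monfun_def comp_functor_apply)

lemma G_functor: "linear_functor K D E G"
proof -
  have "linear_functor K D E (comp_functor D F R)"
    using D.linear_category_axioms R.linear_functor_axioms F.linear_functor_axioms
    by (rule linear_functor_comp)
  then show ?thesis unfolding linear_functor_def comp_monfun_def by simp
qed

lemma mulF: "\<lbrakk>x \<in> Ob A; y \<in> Ob A\<rbrakk> \<Longrightarrow> Mul F x y \<in> mor E (FO F x \<boxtimes> FO F y) (FO F (x \<boxtimes>\<^bsub>A\<^esub> y))"
  using F.mul_iso by (simp add: iso_arr_def)

lemma epsF: "Eps F \<in> mor E (Unit E) (FO F (Unit A))"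
  using F.eps_iso by (simp add: iso_arr_def)

lemmas obs = A.tensor_obj D.tensor_obj E.tensor_obj A.unit_obj D.unit_obj E.unit_obj
  R.obj_closed F.obj_closed

text \<open>Naturality of \<open>Mul F\<close> with arrows \<open>u\<close> and \<open>v\<close>
  precomposed in the two factors; the interchange law of \<open>E\<close> separates them from the
  images under \<open>F\<close>.\<close>

lemma mulF_tensor:
  assumes o: "x \<in> Ob A" "x' \<in> Ob A" "y \<in> Ob A" "y' \<in> Ob A"
    and f: "f \<in> mor A x x'" and g: "g \<in> mor A y y'"
    and u: "u \<in> mor E a (FO F x)" and v: "v \<in> mor E b (FO F y)" and ab: "a \<in> Ob E" "b \<in> Ob E"
  shows "Mul F x' y' \<bullet> ((FA F f \<bullet> u) \<boxdot> (FA F g \<bullet> v)) =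
    FA F (f \<boxdot>\<^bsub>A\<^esub> g) \<bullet> (Mul F x y \<bullet> (u \<boxdot> v))"
proof -
  have uv: "u \<boxdot> v \<in> mor E (a \<boxtimes> b) (FO F x \<boxtimes> FO F y)"
    and fg: "FA F f \<boxdot> FA F g \<in> mor E (FO F x \<boxtimes> FO F y) (FO F x' \<boxtimes> FO F y')"
    using o u v ab f g by (auto intro!: E.tensor_arr F.arr simp: obs)
  have "Mul F x' y' \<bullet> ((FA F f \<bullet> u) \<boxdot> (FA F g \<bullet> v)) =
    Mul F x' y' \<bullet> ((FA F f \<boxdot> FA F g) \<bullet> (u \<boxdot> v))"
    using E.tensor_comp[OF ab _ _ _ _ u v F.arr[OF _ _ f] F.arr[OF _ _ g]] o by (simp add: obs)
  also have "\<dots> = (Mul F x' y' \<bullet> (FA F f \<boxdot> FA F g)) \<bullet> (u \<boxdot> v)"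
    using o ab by (intro E.comp_assoc[symmetric, OF _ _ _ _ uv fg mulF]) (auto simp: obs)
  also have "\<dots> = (FA F (f \<boxdot>\<^bsub>A\<^esub> g) \<bullet> Mul F x y) \<bullet> (u \<boxdot> v)"
    using F.mul_nat[OF o(1,3,2,4) f g] by simp
  also have "\<dots> = FA F (f \<boxdot>\<^bsub>A\<^esub> g) \<bullet> (Mul F x y \<bullet> (u \<boxdot> v))"
    using o ab by (intro E.comp_assoc[OF _ _ _ _ uv mulF F.arr[OF _ _ A.tensor_arr[OF _ _ _ _ f g]]])
     (auto simp: obs)
  finally show ?thesis .
qed

text \<open>A normal form: everything that comes from \<open>R\<close> is collected under a single
  \<open>FA F\<close>, and everything that comes from \<open>F\<close> stands to its right. In this
  form each coherence equation of the composite splits into the equation for \<open>R\<close>,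
  mapped by \<open>F\<close>, and the equation for \<open>F\<close>.\<close>

lemma mulG_tensor:
  assumes o: "x \<in> Ob A" "x' \<in> Ob A" "y \<in> Ob D" "y' \<in> Ob D" and f: "f \<in> mor A x (FO R y)" "f' \<in> mor A x' (FO R y')"
    and u: "u \<in> mor E a (FO F x)" "u' \<in> mor E b (FO F x')" and ab: "a \<in> Ob E" "b \<in> Ob E"
  shows "Mul G y y' \<bullet> ((FA F f \<bullet> u) \<boxdot> (FA F f' \<bullet> u')) =
    FA F (Mul R y y' \<bullet>\<^bsub>A\<^esub> (f \<boxdot>\<^bsub>A\<^esub> f')) \<bullet> (Mul F x x' \<bullet> (u \<boxdot> u'))"
proof -
  have fu: "FA F f \<bullet> u \<in> mor E a (FO F (FO R y))" "FA F f' \<bullet> u' \<in> mor E b (FO F (FO R y'))"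
    using E.comp_mor[OF _ _ _ u(1) F.arr[OF _ _ f(1)]] E.comp_mor[OF _ _ _ u(2) F.arr[OF _ _ f(2)]] o ab by (simp_all add: obs)
  have t: "f \<boxdot>\<^bsub>A\<^esub> f' \<in> mor A (x \<boxtimes>\<^bsub>A\<^esub> x') (FO R y \<boxtimes>\<^bsub>A\<^esub> FO R y')"
    and m: "Mul R y y' \<in> mor A (FO R y \<boxtimes>\<^bsub>A\<^esub> FO R y') (FO R (y \<boxtimes>\<^bsub>D\<^esub> y'))"
    using o by (auto intro!: A.tensor_arr f R.mul_mor simp: obs)
  have T: "FA F (f \<boxdot>\<^bsub>A\<^esub> f') \<in> mor E (FO F (x \<boxtimes>\<^bsub>A\<^esub> x')) (FO F (FO R y \<boxtimes>\<^bsub>A\<^esub> FO R y'))"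
    and Mm: "FA F (Mul R y y') \<in> mor E (FO F (FO R y \<boxtimes>\<^bsub>A\<^esub> FO R y')) (FO F (FO R (y \<boxtimes>\<^bsub>D\<^esub> y')))"
    using o by (auto intro!: F.arr t m simp: obs)
  have MU: "Mul F x x' \<bullet> (u \<boxdot> u') \<in> mor E (a \<boxtimes> b) (FO F (x \<boxtimes>\<^bsub>A\<^esub> x'))"
    using o ab by (intro E.comp_mor[OF _ _ _ E.tensor_arr[OF _ _ _ _ u] mulF]) (auto simp: obs)
  have "Mul G y y' \<bullet> ((FA F f \<bullet> u) \<boxdot> (FA F f' \<bullet> u')) =
    FA F (Mul R y y') \<bullet> (Mul F (FO R y) (FO R y') \<bullet> ((FA F f \<bullet> u) \<boxdot> (FA F f' \<bullet> u')))"
    unfolding G_apply(3) using o ab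
    by (intro E.comp_assoc[OF _ _ _ _ E.tensor_arr[OF _ _ _ _ fu] mulF Mm]) (auto simp: obs)
  also have "\<dots> = (FA F (Mul R y y') \<bullet> FA F (f \<boxdot>\<^bsub>A\<^esub> f')) \<bullet> (Mul F x x' \<bullet> (u \<boxdot> u'))"
    unfolding mulF_tensor[OF o(1) R.obj_closed[OF o(3)] o(2) R.obj_closed[OF o(4)] f u ab]
    using o ab by (intro E.comp_assoc[symmetric, OF _ _ _ _ MU T Mm]) (auto simp: obs)
  also have "FA F (Mul R y y') \<bullet> FA F (f \<boxdot>\<^bsub>A\<^esub> f') = FA F (Mul R y y' \<bullet>\<^bsub>A\<^esub> (f \<boxdot>\<^bsub>A\<^esub> f'))"
    using o by (intro F.comp[symmetric, OF _ _ _ t m]) (auto simp: obs)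
  finally show ?thesis .
qed

text \<open>Brings an identity into the shape \<open>FA F f \<bullet> u\<close> that
  \<open>mulG_tensor\<close> expects; in each associativity and unit equation one tensor factor is
  an identity.\<close>

lemma G_id:
  assumes "w \<in> Ob D"
  shows "Id E (FO G w) = FA F (Id A (FO R w)) \<bullet> Id E (FO F (FO R w))"
    and "Id A (FO R w) \<in> mor A (FO R w) (FO R w)" "Id E (FO F (FO R w)) \<in> mor E (FO F (FO R w)) (FO F (FO R w))"
    and "FO R w \<in> Ob A" "FO F (FO R w) \<in> Ob E"
  using assms by (simp_all add: obs A.id_mor E.id_mor G_apply(1) F.ident E.id_left[OF _ _ E.id_mor])

lemma G_assoc:
  assumes o: "x \<in> Ob D" "y \<in> Ob D" "z \<in> Ob D"
  shows "FA G (Assoc D x y z) \<bullet> Mul G (x \<boxtimes>\<^bsub>D\<^esub> y) z \<bullet> (Mul G x y \<boxdot> Id E (FO G z)) =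
         Mul G x (y \<boxtimes>\<^bsub>D\<^esub> z) \<bullet> (Id E (FO G x) \<boxdot> Mul G y z) \<bullet>
         Assoc E (FO G x) (FO G y) (FO G z)"
proof -
  let ?x = "FO R x" and ?y = "FO R y" and ?z = "FO R z"
  let ?L = "Mul R (x \<boxtimes>\<^bsub>D\<^esub> y) z \<bullet>\<^bsub>A\<^esub> (Mul R x y \<boxdot>\<^bsub>A\<^esub> Id A ?z)"
  let ?L' = "Mul R x (y \<boxtimes>\<^bsub>D\<^esub> z) \<bullet>\<^bsub>A\<^esub> (Id A ?x \<boxdot>\<^bsub>A\<^esub> Mul R y z)"
  let ?U = "Mul F (?x \<boxtimes>\<^bsub>A\<^esub> ?y) ?z \<bullet> (Mul F ?x ?y \<boxdot> Id E (FO F ?z))"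
  let ?V = "Mul F ?x (?y \<boxtimes>\<^bsub>A\<^esub> ?z) \<bullet> (Id E (FO F ?x) \<boxdot> Mul F ?y ?z)"
  note as = D.assoc_mor[OF o] R.arr[OF _ _ D.assoc_mor[OF o]]
  have as: "FA R (Assoc D x y z) \<in> mor A (FO R ((x \<boxtimes>\<^bsub>D\<^esub> y) \<boxtimes>\<^bsub>D\<^esub> z)) (FO R (x \<boxtimes>\<^bsub>D\<^esub> (y \<boxtimes>\<^bsub>D\<^esub> z)))"
    using o by (intro R.arr D.assoc_mor) (auto simp: obs)
  have t: "Mul R x y \<boxdot>\<^bsub>A\<^esub> Id A ?z \<in> mor A ((?x \<boxtimes>\<^bsub>A\<^esub> ?y) \<boxtimes>\<^bsub>A\<^esub> ?z) (FO R (x \<boxtimes>\<^bsub>D\<^esub> y) \<boxtimes>\<^bsub>A\<^esub> ?z)"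
    "Id A ?x \<boxdot>\<^bsub>A\<^esub> Mul R y z \<in> mor A (?x \<boxtimes>\<^bsub>A\<^esub> (?y \<boxtimes>\<^bsub>A\<^esub> ?z)) (?x \<boxtimes>\<^bsub>A\<^esub> FO R (y \<boxtimes>\<^bsub>D\<^esub> z))"
    using o by (auto intro!: A.tensor_arr A.id_mor R.mul_mor simp: obs)
  have L: "?L \<in> mor A ((?x \<boxtimes>\<^bsub>A\<^esub> ?y) \<boxtimes>\<^bsub>A\<^esub> ?z) (FO R ((x \<boxtimes>\<^bsub>D\<^esub> y) \<boxtimes>\<^bsub>D\<^esub> z))"
    "?L' \<in> mor A (?x \<boxtimes>\<^bsub>A\<^esub> (?y \<boxtimes>\<^bsub>A\<^esub> ?z)) (FO R (x \<boxtimes>\<^bsub>D\<^esub> (y \<boxtimes>\<^bsub>D\<^esub> z)))"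
    using o by (auto intro!: A.comp_mor[OF _ _ _ t(1) R.mul_mor] A.comp_mor[OF _ _ _ t(2) R.mul_mor] simp: obs)
  have T: "Mul F ?x ?y \<boxdot> Id E (FO F ?z) \<in> mor E ((FO F ?x \<boxtimes> FO F ?y) \<boxtimes> FO F ?z) (FO F (?x \<boxtimes>\<^bsub>A\<^esub> ?y) \<boxtimes> FO F ?z)"
    "Id E (FO F ?x) \<boxdot> Mul F ?y ?z \<in> mor E (FO F ?x \<boxtimes> (FO F ?y \<boxtimes> FO F ?z)) (FO F ?x \<boxtimes> FO F (?y \<boxtimes>\<^bsub>A\<^esub> ?z))"
    using o by (auto intro!: E.tensor_arr E.id_mor mulF simp: obs)
  have U: "?U \<in> mor E ((FO F ?x \<boxtimes> FO F ?y) \<boxtimes> FO F ?z) (FO F ((?x \<boxtimes>\<^bsub>A\<^esub> ?y) \<boxtimes>\<^bsub>A\<^esub> ?z))"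
    "?V \<in> mor E (FO F ?x \<boxtimes> (FO F ?y \<boxtimes> FO F ?z)) (FO F (?x \<boxtimes>\<^bsub>A\<^esub> (?y \<boxtimes>\<^bsub>A\<^esub> ?z)))"
    using o by (auto intro!: E.comp_mor[OF _ _ _ T(1) mulF] E.comp_mor[OF _ _ _ T(2) mulF] simp: obs)
  have aE: "Assoc E (FO F ?x) (FO F ?y) (FO F ?z) \<in> mor E ((FO F ?x \<boxtimes> FO F ?y) \<boxtimes> FO F ?z) (FO F ?x \<boxtimes> (FO F ?y \<boxtimes> FO F ?z))"
    using o by (intro E.assoc_mor) (auto simp: obs)
  have aA: "Assoc A ?x ?y ?z \<in> mor A ((?x \<boxtimes>\<^bsub>A\<^esub> ?y) \<boxtimes>\<^bsub>A\<^esub> ?z) (?x \<boxtimes>\<^bsub>A\<^esub> (?y \<boxtimes>\<^bsub>A\<^esub> ?z))"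
    using o by (intro A.assoc_mor) (auto simp: obs)
  have FF: "FA F (FA R (Assoc D x y z)) \<in> mor E (FO F (FO R ((x \<boxtimes>\<^bsub>D\<^esub> y) \<boxtimes>\<^bsub>D\<^esub> z))) (FO F (FO R (x \<boxtimes>\<^bsub>D\<^esub> (y \<boxtimes>\<^bsub>D\<^esub> z))))"
    "FA F ?L \<in> mor E (FO F ((?x \<boxtimes>\<^bsub>A\<^esub> ?y) \<boxtimes>\<^bsub>A\<^esub> ?z)) (FO F (FO R ((x \<boxtimes>\<^bsub>D\<^esub> y) \<boxtimes>\<^bsub>D\<^esub> z)))"
    "FA F ?L' \<in> mor E (FO F (?x \<boxtimes>\<^bsub>A\<^esub> (?y \<boxtimes>\<^bsub>A\<^esub> ?z))) (FO F (FO R (x \<boxtimes>\<^bsub>D\<^esub> (y \<boxtimes>\<^bsub>D\<^esub> z))))"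
    "FA F (Assoc A ?x ?y ?z) \<in> mor E (FO F ((?x \<boxtimes>\<^bsub>A\<^esub> ?y) \<boxtimes>\<^bsub>A\<^esub> ?z)) (FO F (?x \<boxtimes>\<^bsub>A\<^esub> (?y \<boxtimes>\<^bsub>A\<^esub> ?z)))"
    using o by (auto intro!: F.arr as L aA simp: obs)
  have oo: "?x \<in> Ob A" "?y \<in> Ob A" "?z \<in> Ob A" using o by (auto simp: obs)
  have 1: "Mul G (x \<boxtimes>\<^bsub>D\<^esub> y) z \<bullet> (Mul G x y \<boxdot> Id E (FO G z)) = FA F ?L \<bullet> ?U"
    using mulG_tensor[OF A.tensor_obj[OF oo(1,2)] oo(3) D.tensor_obj[OF o(1,2)] o(3) R.mul_mor[OF o(1,2)] G_id(2)[OF o(3)]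
     mulF[OF oo(1,2)] G_id(3)[OF o(3)]] oo
    by (simp add: obs G_apply(3)[of x y] G_id(1)[OF o(3), symmetric])
  have 2: "Mul G x (y \<boxtimes>\<^bsub>D\<^esub> z) \<bullet> (Id E (FO G x) \<boxdot> Mul G y z) = FA F ?L' \<bullet> ?V"
    using mulG_tensor[OF oo(1) A.tensor_obj[OF oo(2,3)] o(1) D.tensor_obj[OF o(2,3)] G_id(2)[OF o(1)] R.mul_mor[OF o(2,3)]
     G_id(3)[OF o(1)] mulF[OF oo(2,3)]] oo
    by (simp add: obs G_apply(3)[of y z] G_id(1)[OF o(1), symmetric])
  \<comment> \<open>The equation \<open>3\<close> is the associativity of \<open>R\<close> and
    \<open>4\<close> that of \<open>F\<close>; both are regrouped so that the maps built from
    \<open>Mul\<close> form single arrows \<open>?L\<close>, \<open>?L'\<close>, \<open>?U\<close>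
    and \<open>?V\<close>.\<close>
  have 3: "FA R (Assoc D x y z) \<bullet>\<^bsub>A\<^esub> ?L = ?L' \<bullet>\<^bsub>A\<^esub> Assoc A ?x ?y ?z"
  proof -
    have "?L' \<bullet>\<^bsub>A\<^esub> Assoc A ?x ?y ?z = Mul R x (y \<boxtimes>\<^bsub>D\<^esub> z) \<bullet>\<^bsub>A\<^esub> ((Id A ?x \<boxdot>\<^bsub>A\<^esub> Mul R y z) \<bullet>\<^bsub>A\<^esub> Assoc A ?x ?y ?z)"
     using o oo by (intro A.comp_assoc[OF _ _ _ _ aA t(2) R.mul_mor]) (auto simp: obs)
    then show ?thesis using R.mul_assoc[OF o] by simp
  qed
  have 4: "FA F (Assoc A ?x ?y ?z) \<bullet> ?U = ?V \<bullet> Assoc E (FO F ?x) (FO F ?y) (FO F ?z)"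
  proof -
    have "?V \<bullet> Assoc E (FO F ?x) (FO F ?y) (FO F ?z) = Mul F ?x (?y \<boxtimes>\<^bsub>A\<^esub> ?z) \<bullet>
     ((Id E (FO F ?x) \<boxdot> Mul F ?y ?z) \<bullet> Assoc E (FO F ?x) (FO F ?y) (FO F ?z))"
     using oo by (intro E.comp_assoc[OF _ _ _ _ aE T(2) mulF]) (auto simp: obs)
    then show ?thesis using F.mul_assoc[OF oo] by simp
  qed
  \<comment> \<open>The associator moves from \<open>D\<close> to \<open>A\<close> by
    \<open>3\<close>, under \<open>F\<close>, and from \<open>A\<close> to \<open>E\<close> by
    \<open>4\<close>.\<close>
  have "FA G (Assoc D x y z) \<bullet> (FA F ?L \<bullet> ?U) = (FA F (FA R (Assoc D x y z)) \<bullet> FA F ?L) \<bullet> ?U"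
    using G_apply(2)[OF _ _ D.assoc_mor[OF o]] o
     E.comp_assoc[OF _ _ _ _ U(1) FF(2,1)] oo by (simp add: obs)
  also have "\<dots> = (FA F ?L' \<bullet> FA F (Assoc A ?x ?y ?z)) \<bullet> ?U"
    using F.comp[OF _ _ _ L(1) as] F.comp[OF _ _ _ aA L(2)] 3 o oo by (simp add: obs)
  also have "\<dots> = FA F ?L' \<bullet> (FA F (Assoc A ?x ?y ?z) \<bullet> ?U)"
    using o oo by (intro E.comp_assoc[OF _ _ _ _ U(1) FF(4,3)]) (auto simp: obs)
  also have "\<dots> = (FA F ?L' \<bullet> ?V) \<bullet> Assoc E (FO F ?x) (FO F ?y) (FO F ?z)"
    unfolding 4 using o oo by (intro E.comp_assoc[symmetric, OF _ _ _ _ aE U(2) FF(3)]) (auto simp: obs)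
  also have "\<dots> = Mul G x (y \<boxtimes>\<^bsub>D\<^esub> z) \<bullet> (Id E (FO G x) \<boxdot> Mul G y z) \<bullet>
         Assoc E (FO G x) (FO G y) (FO G z)"
  proof -
    have m: "Mul G y z \<in> mor E (FO G y \<boxtimes> FO G z) (FO G (y \<boxtimes>\<^bsub>D\<^esub> z))"
     "Mul G x (y \<boxtimes>\<^bsub>D\<^esub> z) \<in> mor E (FO G x \<boxtimes> FO G (y \<boxtimes>\<^bsub>D\<^esub> z)) (FO G (x \<boxtimes>\<^bsub>D\<^esub> (y \<boxtimes>\<^bsub>D\<^esub> z)))"
     using o oo by (simp_all add: G_apply(1,3) obs)
      (auto intro!: E.comp_mor[OF _ _ _ mulF F.arr[OF _ _ R.mul_mor]] simp: obs)
    have "Id E (FO G x) \<boxdot> Mul G y z \<in> mor E (FO G x \<boxtimes> (FO G y \<boxtimes> FO G z)) (FO G x \<boxtimes> FO G (y \<boxtimes>\<^bsub>D\<^esub> z))"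
     using o m(1) by (intro E.tensor_arr E.id_mor) (auto simp: obs G_apply(1))
    from E.comp_assoc[OF _ _ _ _ aE this[unfolded G_apply(1)[OF o(1)] G_apply(1)[OF o(2)] G_apply(1)[OF o(3)]] m(2)[unfolded G_apply(1)[OF o(1)]]] 2 o show ?thesis
     by (simp add: obs G_apply(1))
  qed
  finally show ?thesis unfolding 1 .
qed

lemma G_lun:
  assumes x: "x \<in> Ob D"
  shows "FA G (Lun D x) \<bullet> Mul G (Unit D) x \<bullet> (Eps G \<boxdot> Id E (FO G x)) = Lun E (FO G x)"
proof -
  let ?x = "FO R x"
  let ?L = "Mul R (Unit D) x \<bullet>\<^bsub>A\<^esub> (Eps R \<boxdot>\<^bsub>A\<^esub> Id A ?x)"
  let ?U = "Mul F (Unit A) ?x \<bullet> (Eps F \<boxdot> Id E (FO F ?x))"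
  have xx: "?x \<in> Ob A" using x by (simp add: obs)
  have t: "Eps R \<boxdot>\<^bsub>A\<^esub> Id A ?x \<in> mor A (Unit A \<boxtimes>\<^bsub>A\<^esub> ?x) (FO R (Unit D) \<boxtimes>\<^bsub>A\<^esub> ?x)"
    and T: "Eps F \<boxdot> Id E (FO F ?x) \<in> mor E (Unit E \<boxtimes> FO F ?x) (FO F (Unit A) \<boxtimes> FO F ?x)"
    using x by (auto intro!: A.tensor_arr E.tensor_arr A.id_mor E.id_mor R.eps_mor epsF simp: obs)
  have L: "?L \<in> mor A (Unit A \<boxtimes>\<^bsub>A\<^esub> ?x) (FO R (Unit D \<boxtimes>\<^bsub>D\<^esub> x))"
    using x by (intro A.comp_mor[OF _ _ _ t R.mul_mor]) (auto simp: obs)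
  have U: "?U \<in> mor E (Unit E \<boxtimes> FO F ?x) (FO F (Unit A \<boxtimes>\<^bsub>A\<^esub> ?x))"
    using x by (intro E.comp_mor[OF _ _ _ T mulF]) (auto simp: obs)
  have l: "FA R (Lun D x) \<in> mor A (FO R (Unit D \<boxtimes>\<^bsub>D\<^esub> x)) ?x"
    using x by (intro R.arr D.lun_mor) (auto simp: obs)
  have "Mul G (Unit D) x \<bullet> (Eps G \<boxdot> Id E (FO G x)) = FA F ?L \<bullet> ?U"
    using mulG_tensor[OF A.unit_obj xx D.unit_obj x R.eps_mor G_id(2)[OF x] epsF G_id(3)[OF x] E.unit_obj] xx
    by (simp add: obs G_apply(4) G_id(1)[OF x, symmetric])
  then have "FA G (Lun D x) \<bullet> Mul G (Unit D) x \<bullet> (Eps G \<boxdot> Id E (FO G x)) =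
    (FA F (FA R (Lun D x)) \<bullet> FA F ?L) \<bullet> ?U"
    using G_apply(2)[OF _ _ D.lun_mor[OF x]] x
     E.comp_assoc[OF _ _ _ _ U F.arr[OF _ _ L] F.arr[OF _ _ l]] by (simp add: obs)
  also have "\<dots> = Lun E (FO G x)"
    using F.comp[OF _ _ _ L l] R.mul_lun[OF x] F.mul_lun[OF xx] x by (simp add: obs G_apply(1))
  finally show ?thesis .
qed

lemma G_run:
  assumes x: "x \<in> Ob D"
  shows "FA G (Run D x) \<bullet> Mul G x (Unit D) \<bullet> (Id E (FO G x) \<boxdot> Eps G) = Run E (FO G x)"
proof -
  let ?x = "FO R x"
  let ?L = "Mul R x (Unit D) \<bullet>\<^bsub>A\<^esub> (Id A ?x \<boxdot>\<^bsub>A\<^esub> Eps R)"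
  let ?U = "Mul F ?x (Unit A) \<bullet> (Id E (FO F ?x) \<boxdot> Eps F)"
  have xx: "?x \<in> Ob A" using x by (simp add: obs)
  have t: "Id A ?x \<boxdot>\<^bsub>A\<^esub> Eps R \<in> mor A (?x \<boxtimes>\<^bsub>A\<^esub> Unit A) (?x \<boxtimes>\<^bsub>A\<^esub> FO R (Unit D))"
    and T: "Id E (FO F ?x) \<boxdot> Eps F \<in> mor E (FO F ?x \<boxtimes> Unit E) (FO F ?x \<boxtimes> FO F (Unit A))"
    using x by (auto intro!: A.tensor_arr E.tensor_arr A.id_mor E.id_mor R.eps_mor epsF simp: obs)
  have L: "?L \<in> mor A (?x \<boxtimes>\<^bsub>A\<^esub> Unit A) (FO R (x \<boxtimes>\<^bsub>D\<^esub> Unit D))"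
    using x by (intro A.comp_mor[OF _ _ _ t R.mul_mor]) (auto simp: obs)
  have U: "?U \<in> mor E (FO F ?x \<boxtimes> Unit E) (FO F (?x \<boxtimes>\<^bsub>A\<^esub> Unit A))"
    using x by (intro E.comp_mor[OF _ _ _ T mulF]) (auto simp: obs)
  have l: "FA R (Run D x) \<in> mor A (FO R (x \<boxtimes>\<^bsub>D\<^esub> Unit D)) ?x"
    using x by (intro R.arr D.run_mor) (auto simp: obs)
  have "Mul G x (Unit D) \<bullet> (Id E (FO G x) \<boxdot> Eps G) = FA F ?L \<bullet> ?U"
    using mulG_tensor[OF xx A.unit_obj x D.unit_obj G_id(2)[OF x] R.eps_mor G_id(3)[OF x] epsF _ E.unit_obj] xx
    by (simp add: obs G_apply(4) G_id(1)[OF x, symmetric])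
  then have "FA G (Run D x) \<bullet> Mul G x (Unit D) \<bullet> (Id E (FO G x) \<boxdot> Eps G) =
    (FA F (FA R (Run D x)) \<bullet> FA F ?L) \<bullet> ?U"
    using G_apply(2)[OF _ _ D.run_mor[OF x]] x
     E.comp_assoc[OF _ _ _ _ U F.arr[OF _ _ L] F.arr[OF _ _ l]] by (simp add: obs)
  also have "\<dots> = Run E (FO G x)"
    using F.comp[OF _ _ _ L l] R.mul_run[OF x] F.mul_run[OF xx] x by (simp add: obs G_apply(1))
  finally show ?thesis .
qed

lemma G_mul_nat:
  assumes o: "x \<in> Ob D" "y \<in> Ob D" "x' \<in> Ob D" "y' \<in> Ob D" and f: "f \<in> mor D x x'" and g: "g \<in> mor D y y'"
  shows "Mul G x' y' \<bullet> (FA G f \<boxdot> FA G g) = FA G (f \<boxdot>\<^bsub>D\<^esub> g) \<bullet> Mul G x y"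
proof -
  have r: "FA R f \<in> mor A (FO R x) (FO R x')" "FA R g \<in> mor A (FO R y) (FO R y')"
    using o f g by (auto intro: R.arr)
  have fg: "f \<boxdot>\<^bsub>D\<^esub> g \<in> mor D (x \<boxtimes>\<^bsub>D\<^esub> y) (x' \<boxtimes>\<^bsub>D\<^esub> y')" using o f g by (auto intro: D.tensor_arr)
  have rfg: "FA R (f \<boxdot>\<^bsub>D\<^esub> g) \<in> mor A (FO R (x \<boxtimes>\<^bsub>D\<^esub> y)) (FO R (x' \<boxtimes>\<^bsub>D\<^esub> y'))"
    using o fg by (auto intro: R.arr simp: obs)
  have t: "FA R f \<boxdot>\<^bsub>A\<^esub> FA R g \<in> mor A (FO R x \<boxtimes>\<^bsub>A\<^esub> FO R y) (FO R x' \<boxtimes>\<^bsub>A\<^esub> FO R y')"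
    using o r by (auto intro: A.tensor_arr simp: obs)
  have T: "FA F (FA R f) \<boxdot> FA F (FA R g) \<in> mor E (FO F (FO R x) \<boxtimes> FO F (FO R y)) (FO F (FO R x') \<boxtimes> FO F (FO R y'))"
    using o r by (auto intro!: E.tensor_arr F.arr simp: obs)
  have l: "FA F (Mul R x y) \<in> mor E (FO F (FO R x \<boxtimes>\<^bsub>A\<^esub> FO R y)) (FO F (FO R (x \<boxtimes>\<^bsub>D\<^esub> y)))"
    "FA F (Mul R x' y') \<in> mor E (FO F (FO R x' \<boxtimes>\<^bsub>A\<^esub> FO R y')) (FO F (FO R (x' \<boxtimes>\<^bsub>D\<^esub> y')))"
    using o by (auto intro!: F.arr R.mul_mor simp: obs)
  have "Mul G x' y' \<bullet> (FA G f \<boxdot> FA G g) =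
    FA F (Mul R x' y') \<bullet> (Mul F (FO R x') (FO R y') \<bullet> (FA F (FA R f) \<boxdot> FA F (FA R g)))"
    unfolding G_apply(3) G_apply(2)[OF o(1,3) f] G_apply(2)[OF o(2,4) g] using o
    by (intro E.comp_assoc[OF _ _ _ _ T mulF l(2)]) (auto simp: obs)
  also have "\<dots> = FA F (Mul R x' y') \<bullet> (FA F (FA R f \<boxdot>\<^bsub>A\<^esub> FA R g) \<bullet> Mul F (FO R x) (FO R y))"
    using F.mul_nat[OF _ _ _ _ r] o by (simp add: obs)
  also have "\<dots> = (FA F (Mul R x' y') \<bullet> FA F (FA R f \<boxdot>\<^bsub>A\<^esub> FA R g)) \<bullet> Mul F (FO R x) (FO R y)"
    using o by (intro E.comp_assoc[symmetric, OF _ _ _ _ mulF F.arr[OF _ _ t] l(2)]) (auto simp: obs)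
  also have "FA F (Mul R x' y') \<bullet> FA F (FA R f \<boxdot>\<^bsub>A\<^esub> FA R g) = FA F (FA R (f \<boxdot>\<^bsub>D\<^esub> g)) \<bullet> FA F (Mul R x y)"
    using F.comp[OF _ _ _ t R.mul_mor[OF o(3,4)]] F.comp[OF _ _ _ R.mul_mor[OF o(1,2)] rfg] R.mul_nat[OF o f g] o
    by (simp add: obs)
  also have "\<dots> \<bullet> Mul F (FO R x) (FO R y) = FA F (FA R (f \<boxdot>\<^bsub>D\<^esub> g)) \<bullet> (FA F (Mul R x y) \<bullet> Mul F (FO R x) (FO R y))"
    using o by (intro E.comp_assoc[OF _ _ _ _ mulF l(1) F.arr[OF _ _ rfg]]) (auto simp: obs)
  finally show ?thesis using G_apply(2)[OF _ _ fg] o by (simp add: G_apply(3) obs)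
qed

theorem comp_strong_monoidal: "strong_monoidal_functor K D E G"
proof (intro strong_monoidal_functor.intro strong_monoidal_functor_axioms.intro G_functor G_assoc G_lun G_run G_mul_nat)
  fix x y assume "x \<in> Ob D" "y \<in> Ob D"
  then show "iso_arr E (FO G x \<boxtimes> FO G y) (FO G (x \<boxtimes>\<^bsub>D\<^esub> y)) (Mul G x y)"
    by (simp add: G_apply(1,3) obs) (intro E.iso_comp[OF _ _ _ F.mul_iso mul_inverted], auto simp: obs)
next
  show "iso_arr E (Unit E) (FO G (Unit D)) (Eps G)"
    by (simp add: G_apply(1,4) obs) (intro E.iso_comp[OF _ _ _ F.eps_iso eps_inverted], auto simp: obs)
qed

text \<open>In the application \<open>Q\<close> is extension of scalars and \<eta> the unit of its
  adjunction with the restriction \<open>R\<close>. By \<open>mul\<close> and \<open>eps\<close>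
  this unit is a monoidal transformation from the identity to \<open>Q\<close> followed by
  \<open>R\<close>; \<open>F\<close> turns it into an isomorphism.\<close>

theorem comp_monoidal_natural_iso:
  fixes Q :: "('o, 'a, 'p, 'b) monfun"
  assumes Qo: "\<And>x. x \<in> Ob A \<Longrightarrow> FO Q x \<in> Ob D"
    and Qa: "\<And>x y f. \<lbrakk>x \<in> Ob A; y \<in> Ob A; f \<in> mor A x y\<rbrakk> \<Longrightarrow> FA Q f \<in> mor D (FO Q x) (FO Q y)"
    and Qm: "\<And>x y. \<lbrakk>x \<in> Ob A; y \<in> Ob A\<rbrakk> \<Longrightarrow> Mul Q x y \<in> mor D (FO Q x \<boxtimes>\<^bsub>D\<^esub> FO Q y) (FO Q (x \<boxtimes>\<^bsub>A\<^esub> y))"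
    and Qe: "Eps Q \<in> mor D (Unit D) (FO Q (Unit A))"
    and \<eta>: "\<And>x. x \<in> Ob A \<Longrightarrow> \<eta> x \<in> mor A x (FO R (FO Q x))"
    and nat: "\<And>x y f. \<lbrakk>x \<in> Ob A; y \<in> Ob A; f \<in> mor A x y\<rbrakk> \<Longrightarrow> \<eta> y \<bullet>\<^bsub>A\<^esub> f = FA R (FA Q f) \<bullet>\<^bsub>A\<^esub> \<eta> x"
    and iso: "\<And>x. x \<in> Ob A \<Longrightarrow> iso_arr E (FO F x) (FO F (FO R (FO Q x))) (FA F (\<eta> x))"
    and mul: "\<And>x y. \<lbrakk>x \<in> Ob A; y \<in> Ob A\<rbrakk> \<Longrightarrow>
     \<eta> (x \<boxtimes>\<^bsub>A\<^esub> y) = FA R (Mul Q x y) \<bullet>\<^bsub>A\<^esub> (Mul R (FO Q x) (FO Q y) \<bullet>\<^bsub>A\<^esub> (\<eta> x \<boxdot>\<^bsub>A\<^esub> \<eta> y))"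
    and eps: "\<eta> (Unit A) = FA R (Eps Q) \<bullet>\<^bsub>A\<^esub> Eps R"
  shows "monoidal_natural_iso A E F (comp_monfun A E G Q) (\<lambda>x\<in>Ob A. FA F (\<eta> x))"
proof -
  let ?H = "comp_monfun A E G Q"
  have H: "FO ?H x = FO F (FO R (FO Q x))" if "x \<in> Ob A" for x
    using that by (simp add: comp_monfun_def comp_functor_apply Qo)
  have HA: "FA ?H f = FA F (FA R (FA Q f))" if f: "x \<in> Ob A" "y \<in> Ob A" "f \<in> mor A x y" for x y f
    using G_apply(2)[OF _ _ Qa[OF f]] f by (simp add: comp_monfun_def comp_functor_apply(2)[OF f] Qo)
  show ?thesis
    unfolding monoidal_natural_iso_def
  proof (intro conjI ballI naturalI)
    fix x assume x: "x \<in> Ob A"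
    then show "(\<lambda>x\<in>Ob A. FA F (\<eta> x)) x \<in> mor E (FO F x) (FO ?H x)"
     using F.arr[OF _ _ \<eta>[OF x]] by (simp add: H obs Qo)
    show "iso_arr E (FO F x) (FO ?H x) ((\<lambda>x\<in>Ob A. FA F (\<eta> x)) x)" using x iso by (simp add: H)
  next
    fix x y f assume f: "x \<in> Ob A" "y \<in> Ob A" "f \<in> mor A x y"
    then show "(\<lambda>x\<in>Ob A. FA F (\<eta> x)) y \<bullet> FA F f = FA ?H f \<bullet> (\<lambda>x\<in>Ob A. FA F (\<eta> x)) x"
     using F.comp[OF _ _ _ f(3) \<eta>] F.comp[OF _ _ _ \<eta> R.arr[OF _ _ Qa[OF f]]] nat[OF f]
     by (simp add: HA[OF f] Qo obs)
  next
    show "(\<lambda>x\<in>Ob A. FA F (\<eta> x)) (Unit A) \<bullet> Eps F = Eps ?H"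
     using G_apply(2)[OF _ _ Qe] F.comp[OF _ _ _ R.eps_mor R.arr[OF _ _ Qe]] eps
      E.comp_assoc[OF _ _ _ _ epsF F.arr[OF _ _ R.eps_mor] F.arr[OF _ _ R.arr[OF _ _ Qe]]]
     by (simp add: comp_monfun_def[of A E G Q] G_apply(4) Qo obs)
  next
    fix x y assume xy: "x \<in> Ob A" "y \<in> Ob A"
    let ?m = "Mul R (FO Q x) (FO Q y)" and ?q = "FA R (Mul Q x y)"
    let ?X = "FO R (FO Q x)" and ?Y = "FO R (FO Q y)"
    have o: "?X \<in> Ob A" "?Y \<in> Ob A" using xy by (auto simp: obs Qo)
    have t: "\<eta> x \<boxdot>\<^bsub>A\<^esub> \<eta> y \<in> mor A (x \<boxtimes>\<^bsub>A\<^esub> y) (?X \<boxtimes>\<^bsub>A\<^esub> ?Y)" using xy o by (auto intro: A.tensor_arr \<eta>)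
    have m: "?m \<in> mor A (?X \<boxtimes>\<^bsub>A\<^esub> ?Y) (FO R (FO Q x \<boxtimes>\<^bsub>D\<^esub> FO Q y))" using xy by (auto intro: R.mul_mor Qo)
    have q: "?q \<in> mor A (FO R (FO Q x \<boxtimes>\<^bsub>D\<^esub> FO Q y)) (FO R (FO Q (x \<boxtimes>\<^bsub>A\<^esub> y)))"
     using xy by (auto intro!: R.arr Qm simp: obs Qo)
    have mt: "?m \<bullet>\<^bsub>A\<^esub> (\<eta> x \<boxdot>\<^bsub>A\<^esub> \<eta> y) \<in> mor A (x \<boxtimes>\<^bsub>A\<^esub> y) (FO R (FO Q x \<boxtimes>\<^bsub>D\<^esub> FO Q y))"
     using xy o by (intro A.comp_mor[OF _ _ _ t m]) (auto simp: obs Qo)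
    have T: "FA F (\<eta> x) \<boxdot> FA F (\<eta> y) \<in> mor E (FO F x \<boxtimes> FO F y) (FO F ?X \<boxtimes> FO F ?Y)"
     using xy o by (auto intro!: E.tensor_arr F.arr \<eta> simp: obs)
    have FF: "FA F ?q \<in> mor E (FO F (FO R (FO Q x \<boxtimes>\<^bsub>D\<^esub> FO Q y))) (FO F (FO R (FO Q (x \<boxtimes>\<^bsub>A\<^esub> y))))"
     "FA F ?m \<in> mor E (FO F (?X \<boxtimes>\<^bsub>A\<^esub> ?Y)) (FO F (FO R (FO Q x \<boxtimes>\<^bsub>D\<^esub> FO Q y)))"
     "FA F (\<eta> x \<boxdot>\<^bsub>A\<^esub> \<eta> y) \<in> mor E (FO F (x \<boxtimes>\<^bsub>A\<^esub> y)) (FO F (?X \<boxtimes>\<^bsub>A\<^esub> ?Y))"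
     using xy o by (auto intro!: F.arr q m t simp: obs Qo)
    have M: "Mul F x y \<in> mor E (FO F x \<boxtimes> FO F y) (FO F (x \<boxtimes>\<^bsub>A\<^esub> y))"
     "Mul F ?X ?Y \<in> mor E (FO F ?X \<boxtimes> FO F ?Y) (FO F (?X \<boxtimes>\<^bsub>A\<^esub> ?Y))"
     using xy o by (auto intro: mulF)
    have ob: "FO F x \<boxtimes> FO F y \<in> Ob E" "FO F ?X \<boxtimes> FO F ?Y \<in> Ob E" "FO F (x \<boxtimes>\<^bsub>A\<^esub> y) \<in> Ob E"
     "FO F (?X \<boxtimes>\<^bsub>A\<^esub> ?Y) \<in> Ob E" "FO F (FO R (FO Q x \<boxtimes>\<^bsub>D\<^esub> FO Q y)) \<in> Ob E" "FO F (FO R (FO Q (x \<boxtimes>\<^bsub>A\<^esub> y))) \<in> Ob E"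
     using xy o by (auto simp: obs Qo)
    have "FA F (\<eta> (x \<boxtimes>\<^bsub>A\<^esub> y)) \<bullet> Mul F x y = (FA F ?q \<bullet> (FA F ?m \<bullet> FA F (\<eta> x \<boxdot>\<^bsub>A\<^esub> \<eta> y))) \<bullet> Mul F x y"
     using F.comp[OF _ _ _ mt q] F.comp[OF _ _ _ t m] mul[OF xy] xy o by (simp add: obs Qo)
    also have "\<dots> = FA F ?q \<bullet> ((FA F ?m \<bullet> FA F (\<eta> x \<boxdot>\<^bsub>A\<^esub> \<eta> y)) \<bullet> Mul F x y)"
     by (rule E.comp_assoc[OF ob(1,3,5,6) M(1) E.comp_mor[OF ob(3,4,5) FF(3,2)] FF(1)])
    also have "(FA F ?m \<bullet> FA F (\<eta> x \<boxdot>\<^bsub>A\<^esub> \<eta> y)) \<bullet> Mul F x y = FA F ?m \<bullet> (FA F (\<eta> x \<boxdot>\<^bsub>A\<^esub> \<eta> y) \<bullet> Mul F x y)"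
     by (rule E.comp_assoc[OF ob(1,3,4,5) M(1) FF(3,2)])
    also have "FA F (\<eta> x \<boxdot>\<^bsub>A\<^esub> \<eta> y) \<bullet> Mul F x y = Mul F ?X ?Y \<bullet> (FA F (\<eta> x) \<boxdot> FA F (\<eta> y))"
     using F.mul_nat[OF xy o \<eta>[OF xy(1)] \<eta>[OF xy(2)]] by simp
    also have "FA F ?m \<bullet> (Mul F ?X ?Y \<bullet> (FA F (\<eta> x) \<boxdot> FA F (\<eta> y))) = (FA F ?m \<bullet> Mul F ?X ?Y) \<bullet> (FA F (\<eta> x) \<boxdot> FA F (\<eta> y))"
     by (rule E.comp_assoc[symmetric, OF ob(1,2,4,5) T M(2) FF(2)])
    also have "FA F ?q \<bullet> \<dots> = (FA F ?q \<bullet> (FA F ?m \<bullet> Mul F ?X ?Y)) \<bullet> (FA F (\<eta> x) \<boxdot> FA F (\<eta> y))"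
     by (rule E.comp_assoc[symmetric, OF ob(1,2,5,6) T E.comp_mor[OF ob(2,4,5) M(2) FF(2)] FF(1)])
    also have "FA F ?q \<bullet> (FA F ?m \<bullet> Mul F ?X ?Y) = Mul ?H x y"
     using G_apply(2)[OF _ _ Qm[OF xy]] xy by (simp add: comp_monfun_def[of A E G Q] G_apply(3) Qo obs)
    finally show "(\<lambda>x\<in>Ob A. FA F (\<eta> x)) (x \<boxtimes>\<^bsub>A\<^esub> y) \<bullet> Mul F x y =
     Mul ?H x y \<bullet> ((\<lambda>x\<in>Ob A. FA F (\<eta> x)) x \<boxdot> (\<lambda>x\<in>Ob A. FA F (\<eta> x)) y)"
     using xy by (simp add: obs)
  qed simp
qed

end

section \<open>Vector spaces and modules over sequences of algebras\<close>

text \<open>Unlike \<open>linear_map\<close> this does not ask for extensionality and lets the two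
  spaces have different element types. So lambda terms compose freely, and maps from an algebra to a
  module are covered.\<close>

definition klinear :: "'k ring \<Rightarrow> ('k, 'v) module \<Rightarrow> ('k, 'w) module \<Rightarrow> ('v \<Rightarrow> 'w) \<Rightarrow> bool" where
  "klinear K V W f \<longleftrightarrow>
    (\<forall>v\<in>carrier V. f v \<in> carrier W) \<and>
    (\<forall>v\<in>carrier V. \<forall>w\<in>carrier V. f (v \<oplus>\<^bsub>V\<^esub> w) = f v \<oplus>\<^bsub>W\<^esub> f w) \<and>
    (\<forall>r\<in>carrier K. \<forall>v\<in>carrier V. f (r \<odot>\<^bsub>V\<^esub> v) = r \<odot>\<^bsub>W\<^esub> f v)"

lemma klinearI:
  assumes "\<And>v. v \<in> carrier V \<Longrightarrow> f v \<in> carrier W"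
    and "\<And>v w. \<lbrakk>v \<in> carrier V; w \<in> carrier V\<rbrakk> \<Longrightarrow> f (v \<oplus>\<^bsub>V\<^esub> w) = f v \<oplus>\<^bsub>W\<^esub> f w"
    and "\<And>r v. \<lbrakk>r \<in> carrier K; v \<in> carrier V\<rbrakk> \<Longrightarrow> f (r \<odot>\<^bsub>V\<^esub> v) = r \<odot>\<^bsub>W\<^esub> f v"
  shows "klinear K V W f"
  using assms by (simp add: klinear_def)

lemma klinearD:
  assumes "klinear K V W f"
  shows "v \<in> carrier V \<Longrightarrow> f v \<in> carrier W"
    and "\<lbrakk>v \<in> carrier V; w \<in> carrier V\<rbrakk> \<Longrightarrow> f (v \<oplus>\<^bsub>V\<^esub> w) = f v \<oplus>\<^bsub>W\<^esub> f w"
    and "\<lbrakk>r \<in> carrier K; v \<in> carrier V\<rbrakk> \<Longrightarrow> f (r \<odot>\<^bsub>V\<^esub> v) = r \<odot>\<^bsub>W\<^esub> f v"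
  using assms by (auto simp: klinear_def)

lemma klinear_zero:
  assumes V: "module K V" and W: "module K W" and f: "klinear K V W f"
  shows "f \<zero>\<^bsub>V\<^esub> = \<zero>\<^bsub>W\<^esub>"
proof -
  interpret V: module K V by fact
  interpret W: module K W by fact
  have "f (\<zero>\<^bsub>K\<^esub> \<odot>\<^bsub>V\<^esub> \<zero>\<^bsub>V\<^esub>) = \<zero>\<^bsub>W\<^esub>"
    using klinearD(1)[OF f] by (subst klinearD(3)[OF f]) auto
  then show ?thesis by simp
qed

lemma klinear_comp: "\<lbrakk>klinear K U V f; klinear K V W g\<rbrakk> \<Longrightarrow> klinear K U W (\<lambda>x. g (f x))"
  by (simp add: klinear_def)

lemma klinear_cong: "\<lbrakk>module K V; \<And>x. x \<in> carrier V \<Longrightarrow> f x = g x\<rbrakk> \<Longrightarrow> klinear K V W f \<longleftrightarrow> klinear K V W g"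
  by (simp add: klinear_def module.smult_closed abelian_monoid.a_closed[OF abelian_group.axioms(1)[OF module.axioms(2)]])

lemma linear_map_iff: "module K V \<Longrightarrow> linear_map K V W f \<longleftrightarrow> klinear K V W f \<and> f \<in> extensional (carrier V)"
  by (auto simp: linear_map_def klinear_def PiE_def)

lemma lmap_of_simps [simp]:
  "ldom (lmap_of V W f) = V" "lcod (lmap_of V W f) = W" "v \<in> carrier V \<Longrightarrow> lapp (lmap_of V W f) v = f v"
  "lapp (lmap_of V W f) \<in> extensional (carrier V)"
  by (simp_all add: lmap_of_def)

lemma lmap_eqI:
  fixes f g :: "('k, 'v) lmap"
  assumes "ldom f = V" "ldom g = V" "lcod f = lcod g" "lapp f \<in> extensional (carrier V)"
    "lapp g \<in> extensional (carrier V)" "\<And>v. v \<in> carrier V \<Longrightarrow> lapp f v = lapp g v"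
  shows "f = g"
  using assms by (intro lmap.equality) (auto intro: extensionalityI)

lemma vect_simps:
  "Ob (vect K) = {V. module K V}"
  "mor (vect K) V W = {f. ldom f = V \<and> lcod f = W \<and> linear_map K V W (lapp f)}"
  "\<zero>\<^bsub>Hom (vect K) V W\<^esub> = lmap_of V W (\<lambda>v. \<zero>\<^bsub>W\<^esub>)"
  "f \<oplus>\<^bsub>Hom (vect K) V W\<^esub> g = lmap_of V W (\<lambda>v. lapp f v \<oplus>\<^bsub>W\<^esub> lapp g v)"
  "r \<odot>\<^bsub>Hom (vect K) V W\<^esub> f = lmap_of V W (\<lambda>v. r \<odot>\<^bsub>W\<^esub> lapp f v)"
  "Id (vect K) V = lmap_of V V (\<lambda>v. v)"
  "g \<bullet>\<^bsub>vect K\<^esub> f = lmap_of (ldom f) (lcod g) (\<lambda>v. lapp g (lapp f v))"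
  by (simp_all add: vect_def)

lemma vect_mor_iff:
  "module K V \<Longrightarrow> f \<in> mor (vect K) V W \<longleftrightarrow>
    ldom f = V \<and> lcod f = W \<and> klinear K V W (lapp f) \<and> lapp f \<in> extensional (carrier V)"
  by (simp add: vect_simps linear_map_iff)

lemma lmap_of_mor: "\<lbrakk>module K V; klinear K V W f\<rbrakk> \<Longrightarrow> lmap_of V W f \<in> mor (vect K) V W"
  using klinear_cong[of K V "lapp (lmap_of V W f)" f W] by (simp add: vect_mor_iff)

lemma vect_linear_category:
  fixes K :: "'k ring"
  assumes K: "field K"
  shows "linear_category K (vect K)"
proof -
  have hom: "module K (Hom (vect K) V W)" if V: "module K V" and W: "module K W" for V W :: "('k, 'v) module"
  proof -
    interpret V: module K V by fact
    interpret W: module K W by fact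
    let ?M = "{f. ldom f = V \<and> lcod f = W \<and> linear_map K V W (lapp f)}"
    have M: "?M = mor (vect K) V W" by (simp add: vect_simps)
    have D: "klinear K V W (lapp f)" "ldom f = V" "lcod f = W" "lapp f \<in> extensional (carrier V)"
     if "f \<in> ?M" for f using that by (auto simp: linear_map_iff V)
    have e: "lmap_of V W g = f" if "f \<in> ?M" "\<And>v. v \<in> carrier V \<Longrightarrow> g v = lapp f v" for f g
     using that D[OF that(1)] by (intro lmap_eqI[of _ V]) auto
    have c: "lmap_of V W g = lmap_of V W f" if "\<And>v. v \<in> carrier V \<Longrightarrow> g v = f v" for f g
     using that by (intro lmap_eqI[of _ V]) auto
    show ?thesis
     unfolding vect_def lincat.select_convs
    proof (rule module_linear_space[OF K], goal_cases)
     case 1 show ?case unfolding M by (rule lmap_of_mor[OF V]) (auto intro: klinearI)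
    next
     case (2 x y)
     show ?case unfolding M
      by (rule lmap_of_mor[OF V], rule klinearI)
       (auto simp: klinearD[OF D(1)[OF 2(1)]] klinearD[OF D(1)[OF 2(2)]] W.smult_r_distr W.a_ac)
    next
     case (3 r x)
     show ?case unfolding M
      by (rule lmap_of_mor[OF V], rule klinearI)
       (auto simp: klinearD[OF D(1)[OF 3(2)]] 3(1) W.smult_r_distr W.smult_assoc1[symmetric] V.m_comm)
    next
     case (4 x y w)
     show ?case by (rule c) (simp add: W.a_assoc 4[THEN D(1), THEN klinearD(1)])
    next
     case (5 x y)
     show ?case by (rule c) (simp add: W.a_comm 5[THEN D(1), THEN klinearD(1)])
    next
     case (6 x)
     show ?case by (rule e[OF 6]) (simp add: 6[THEN D(1), THEN klinearD(1)])
    next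
     case (7 x)
     show ?case by (rule c) (simp add: 7[THEN D(1), THEN klinearD(1)])
    next
     case (8 x)
     show ?case by (rule e[OF 8]) (simp add: 8[THEN D(1), THEN klinearD(1)])
    next
     case (9 r t x)
     show ?case by (rule c) (simp add: W.smult_l_distr 9(1,2) 9(3)[THEN D(1), THEN klinearD(1)])
    next
     case (10 r x y)
     show ?case by (rule c) (simp add: W.smult_r_distr 10(1) 10(2,3)[THEN D(1), THEN klinearD(1)])
    next
     case (11 r t x)
     show ?case by (rule c) (simp add: W.smult_assoc1 11(1,2) 11(3)[THEN D(1), THEN klinearD(1)])
    qed
  qed
  have id: "lmap_of V V (\<lambda>v. v) \<in> mor (vect K) V V" if "module K V" for V :: "('k, 'v) module"
    by (rule lmap_of_mor[OF that]) (auto intro: klinearI)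
  show ?thesis
  proof (rule linear_category.intro, goal_cases)
    case 1 show ?case by fact
  next
    case 2 then show ?case by (simp add: vect_simps(1) hom)
  next
    case 3 then show ?case by (auto simp: vect_simps)
  next
    case 4 then show ?case using id by (simp add: vect_simps(1,6))
  next
    case (5 a b c f g)
    then have f: "ldom f = a" "lcod g = c" "klinear K a b (lapp f)" "klinear K b c (lapp g)"
     and a: "module K a" by (auto simp: vect_simps(1) vect_mor_iff)
    show ?case unfolding vect_simps(7) f(1,2) by (rule lmap_of_mor[OF a klinear_comp[OF f(3,4)]])
  next
    case (6 a b f)
    then show ?case unfolding vect_simps(1,6,7) mem_Collect_eq
     by (intro lmap_eqI[of _ a]) (auto simp: vect_mor_iff klinearD(1))
  next
    case (7 a b f)
    then show ?case unfolding vect_simps(1,6,7) mem_Collect_eq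
     by (intro lmap_eqI[of _ a]) (auto simp: vect_mor_iff klinearD(1))
  next
    case (8 a b c d f g h)
    then show ?case unfolding vect_simps(1,7) mem_Collect_eq
     by (intro lmap_eqI[of _ a]) (auto simp: vect_mor_iff klinearD(1))
  next
    case (9 a b c f g g')
    then show ?case unfolding vect_simps(1,4,7) mem_Collect_eq
     by (intro lmap_eqI[of _ a]) (auto simp: vect_mor_iff klinearD(1))
  next
    case (10 a b c f f' g)
    then show ?case unfolding vect_simps(1,4,7) mem_Collect_eq
     by (intro lmap_eqI[of _ a]) (auto simp: vect_mor_iff klinearD(1,2))
  next
    case (11 a b c f g r)
    then show ?case unfolding vect_simps(1,5,7) mem_Collect_eq
     by (intro lmap_eqI[of _ a]) (auto simp: vect_mor_iff klinearD(1))
  next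
    case (12 a b c f g r)
    then show ?case unfolding vect_simps(1,5,7) mem_Collect_eq
     by (intro lmap_eqI[of _ a]) (auto simp: vect_mor_iff klinearD(1,3))
  qed
qed

lemma op_cat_simps:
  "Ob (op_cat C) = Ob C" "Hom (op_cat C) a b = Hom C b a" "Id (op_cat C) = Id C"
  "g \<bullet>\<^bsub>op_cat C\<^esub> f = f \<bullet>\<^bsub>C\<^esub> g" "arrows (op_cat C) = arrows C"
  by (auto simp: op_cat_def arrows_def)

lemma op_cat_linear:
  assumes "linear_category K C" shows "linear_category K (op_cat C)"
proof -
  interpret linear_category K C by fact
  show ?thesis
    by (rule linear_category.intro)
     (use hom_disjoint in \<open>auto simp: op_cat_simps field hom_space id_mor comp_mor id_left id_right comp_assoc
      comp_add_left comp_add_right comp_smult_left comp_smult_right\<close>)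
qed

section \<open>Formal sums modulo relations\<close>

lemma term_sum_simps [simp]:
  "term_sum V f [] = \<zero>\<^bsub>V\<^esub>" "term_sum V f (g # P) = f g \<oplus>\<^bsub>V\<^esub> term_sum V f P"
  by (simp_all add: term_sum_def)

lemma term_sum_closed:
  assumes "module K V" "\<And>g. g \<in> set P \<Longrightarrow> f g \<in> carrier V"
  shows "term_sum V f P \<in> carrier V"
proof -
  interpret module K V by fact
  show ?thesis using assms(2) by (induction P) auto
qed

lemma term_sum_append:
  assumes "module K V" "\<And>g. g \<in> set P \<union> set Q \<Longrightarrow> f g \<in> carrier V"
  shows "term_sum V f (P @ Q) = term_sum V f P \<oplus>\<^bsub>V\<^esub> term_sum V f Q"
proof -
  interpret module K V by fact
  show ?thesis using assms(2)
    by (induction P) (auto simp: M.a_assoc term_sum_closed[OF assms(1)])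
qed

lemma term_sum_cong: "(\<And>g. g \<in> set P \<Longrightarrow> f g = f' g) \<Longrightarrow> term_sum V f P = term_sum V f' P"
  by (induction P) auto

text \<open>Sufficient conditions for \<open>sum_space\<close> to be a vector space. The laws for
  scalars are asked on single generators and up to the congruence, since a sum is multiplied term by
  term. The instances are Day convolutions and extension of scalars.\<close>

locale sum_presentation =
  fixes K :: "'k ring" and e :: "'g list \<Rightarrow> 'v" and d :: "'v \<Rightarrow> 'g list" and S :: "'g set"
    and R :: "'g list \<Rightarrow> 'g list \<Rightarrow> bool" and s :: "'k \<Rightarrow> 'g \<Rightarrow> 'g"
  assumes field: "field K"
    and d_e: "\<And>P. d (e P) = P"
    and R_gens: "\<And>P Q. R P Q \<Longrightarrow> set P \<subseteq> S \<and> set Q \<subseteq> S"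
    and s_gens: "\<And>r g. \<lbrakk>r \<in> carrier K; g \<in> S\<rbrakk> \<Longrightarrow> s r g \<in> S"
    and s_rel: "\<And>r P Q. \<lbrakk>r \<in> carrier K; R P Q\<rbrakk> \<Longrightarrow> sum_eq R (map (s r) P) (map (s r) Q)"
    and s_add: "\<And>r t g. \<lbrakk>r \<in> carrier K; t \<in> carrier K; g \<in> S\<rbrakk> \<Longrightarrow> sum_eq R [s (r \<oplus>\<^bsub>K\<^esub> t) g] [s r g, s t g]"
    and s_mult: "\<And>r t g. \<lbrakk>r \<in> carrier K; t \<in> carrier K; g \<in> S\<rbrakk> \<Longrightarrow> sum_eq R [s (r \<otimes>\<^bsub>K\<^esub> t) g] [s r (s t g)]"
    and s_one: "\<And>g. g \<in> S \<Longrightarrow> sum_eq R [s \<one>\<^bsub>K\<^esub> g] [g]"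
    and s_zero: "\<And>g. g \<in> S \<Longrightarrow> sum_eq R [s \<zero>\<^bsub>K\<^esub> g] []"
begin

abbreviation "V \<equiv> sum_space e d S R s"

definition cls :: "'g list \<Rightarrow> 'v" where "cls P = e (sum_rep R P)"

lemma sum_rep: "sum_eq R P (sum_rep R P)"
  unfolding sum_rep_def by (rule someI, rule sum_eq.refl)

text \<open>Congruent sums define the same predicate \<open>sum_eq R P\<close>, hence the choice
  operator picks the same representative for them.\<close>

lemma cls_eq_iff: "cls P = cls Q \<longleftrightarrow> sum_eq R P Q"
proof
  assume "cls P = cls Q"
  then have "sum_rep R P = sum_rep R Q" unfolding cls_def by (metis d_e)
  then show "sum_eq R P Q" using sum_rep[of P] sum_rep[of Q] by (metis sum_eq.sym sum_eq.trans)
next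
  assume "sum_eq R P Q"
  then have "sum_eq R P = sum_eq R Q" by (auto simp: fun_eq_iff intro: sum_eq.sym sum_eq.trans)
  then show "cls P = cls Q" by (simp add: cls_def sum_rep_def)
qed

lemma d_cls: "sum_eq R P (d (cls P))"
  by (simp add: cls_def d_e sum_rep)

text \<open>Representatives are chosen among all lists; this shows that a representative of a sum of
  generators is again a sum of generators.\<close>

lemma sum_eq_gens: "sum_eq R P Q \<Longrightarrow> set P \<subseteq> S \<longleftrightarrow> set Q \<subseteq> S"
  by (induction rule: sum_eq.induct) (use R_gens in auto)

lemma d_cls_gens: "set P \<subseteq> S \<Longrightarrow> set (d (cls P)) \<subseteq> S"
  using sum_eq_gens[OF d_cls] by simp

lemma cls_d: "x \<in> carrier V \<Longrightarrow> cls (d x) = x \<and> set (d x) \<subseteq> S"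
  using d_cls d_cls_gens by (auto simp: sum_space_def cls_def[symmetric]) (metis cls_eq_iff sum_eq.sym)

lemma cls_closed: "set P \<subseteq> S \<Longrightarrow> cls P \<in> carrier V"
  by (auto simp: sum_space_def cls_def)

lemma cls_add: "cls P \<oplus>\<^bsub>V\<^esub> cls Q = cls (P @ Q)"
  by (simp add: sum_space_def cls_def[symmetric] cls_eq_iff)
    (intro sum_eq.append sum_eq.sym[OF d_cls])

lemma sum_eq_smult: "sum_eq R P Q \<Longrightarrow> r \<in> carrier K \<Longrightarrow> sum_eq R (map (s r) P) (map (s r) Q)"
  by (induction rule: sum_eq.induct) (auto intro: s_rel sum_eq.intros)

lemma cls_smult: "r \<in> carrier K \<Longrightarrow> r \<odot>\<^bsub>V\<^esub> cls P = cls (map (s r) P)"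
  by (simp add: sum_space_def cls_def[symmetric] cls_eq_iff)
    (intro sum_eq_smult sum_eq.sym[OF d_cls])

lemma cls_Nil: "\<zero>\<^bsub>V\<^esub> = cls []"
  by (simp add: sum_space_def cls_def)

lemma sum_space_module: "module K V"
proof -
  have carr: "carrier V = {e (sum_rep R P) |P. set P \<subseteq> S}" by (simp add: sum_space_def)
  have smap: "sum_eq R (map f P) (map f' P)" if "\<And>g. g \<in> S \<Longrightarrow> sum_eq R [f g] [f' g]" "set P \<subseteq> S" for f f' P
    using that(2)
  proof (induction P)
    case (Cons g P)
    then show ?case using sum_eq.append[of R "[f g]" "[f' g]" "map f P" "map f' P"] that(1) by simp
  qed (simp add: sum_eq.refl)
  have s0: "sum_eq R (map (s \<zero>\<^bsub>K\<^esub>) P) []" if "set P \<subseteq> S" for P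
    using that
  proof (induction P)
    case (Cons g P)
    then show ?case using sum_eq.append[OF s_zero[of g], of "map (s \<zero>\<^bsub>K\<^esub>) P" "[]"] by simp
  qed (simp add: sum_eq.refl)
  have sl: "sum_eq R (map (s (r \<oplus>\<^bsub>K\<^esub> t)) P) (map (s r) P @ map (s t) P)"
    if "r \<in> carrier K" "t \<in> carrier K" "set P \<subseteq> S" for r t P
    using that(3)
  proof (induction P)
    case (Cons g P)
    have "sum_eq R (map (s (r \<oplus>\<^bsub>K\<^esub> t)) (g # P)) ([s r g, s t g] @ map (s r) P @ map (s t) P)"
     using sum_eq.append[OF s_add[OF that(1,2), of g] Cons.IH] Cons.prems by simp
    \<comment> \<open>The rule \<open>swap\<close> carries the new term \<open>s t g\<close> across
      the terms for \<open>r\<close>, so that the two scalars are separated.\<close>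
    also have "sum_eq R \<dots> ([s r g] @ (map (s r) P @ [s t g]) @ map (s t) P)"
     using sum_eq.append[OF sum_eq.refl[of _ "[s r g]"] sum_eq.append[OF sum_eq.swap[of _ "[s t g]" "map (s r) P"] sum_eq.refl[of _ "map (s t) P"]]]
     by simp
    finally (sum_eq.trans) show ?case by simp
  qed (simp add: sum_eq.refl)
  have obt: "\<exists>P. x = cls P \<and> set P \<subseteq> S" if "x \<in> carrier V" for x
    using cls_d[OF that] by metis
  have "module K (linear_space (carrier V) \<zero>\<^bsub>V\<^esub> (add V) (smult V))"
  proof (rule module_linear_space[OF field], goal_cases)
    case 1 show ?case by (simp add: cls_Nil cls_closed)
  next
    case (2 x y)
    then obtain P Q where "x = cls P" "y = cls Q" "set P \<subseteq> S" "set Q \<subseteq> S" using obt by metis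
    then show ?case by (simp add: cls_add cls_closed)
  next
    case (3 r x)
    then obtain P where "x = cls P" "set P \<subseteq> S" using obt by metis
    then show ?case using 3(1) by (simp add: cls_smult) (rule cls_closed, auto intro!: s_gens)
  next
    case (4 x y w)
    then obtain P Q U where "x = cls P" "y = cls Q" "w = cls U" using obt by metis
    then show ?case by (simp add: cls_add)
  next
    case (5 x y)
    then obtain P Q where "x = cls P" "y = cls Q" using obt by metis
    then show ?case by (simp add: cls_add cls_eq_iff sum_eq.swap)
  next
    case (6 x)
    then obtain P where "x = cls P" using obt by metis
    then show ?case by (simp add: cls_add cls_Nil)
  next
    case (7 x)
    then obtain P where "x = cls P" "set P \<subseteq> S" using obt by metis
    then show ?case using field by (simp add: cls_smult cls_Nil cls_eq_iff s0 field.is_ring ring.ring_simprules)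
  next
    case (8 x)
    then obtain P where "x = cls P" "set P \<subseteq> S" using obt by metis
    then show ?case using smap[of "s \<one>\<^bsub>K\<^esub>" "\<lambda>g. g" P] field s_one
     by (simp add: cls_smult cls_eq_iff field.is_ring ring.ring_simprules)
  next
    case (9 r t x)
    then obtain P where "x = cls P" "set P \<subseteq> S" using obt by metis
    then show ?case using 9 field sl[of r t P]
     by (simp add: cls_smult cls_add cls_eq_iff field.is_ring ring.ring_simprules)
  next
    case (10 r x y)
    then obtain P Q where "x = cls P" "y = cls Q" using obt by metis
    then show ?case using 10 by (simp add: cls_smult cls_add)
  next
    case (11 r t x)
    then obtain P where "x = cls P" "set P \<subseteq> S" using obt by metis
    then show ?case using 11 field smap[of "s (r \<otimes>\<^bsub>K\<^esub> t)" "\<lambda>g. s r (s t g)" P] s_mult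
     by (simp add: cls_smult cls_eq_iff field.is_ring ring.ring_simprules o_def)
  qed
  then show ?thesis by (simp add: sum_space_def linear_space_def)
qed

text \<open>The condition on \<open>P\<close> is carried through the induction because terms outside
  \<open>S\<close> may leave \<open>W\<close>; in the symmetric and transitive cases
  \<open>sum_eq_gens\<close> supplies it for the other sum.\<close>

lemma term_sum_respects:
  assumes W: "module K W" and f: "\<And>g. g \<in> S \<Longrightarrow> f g \<in> carrier W"
    and rel: "\<And>P Q. R P Q \<Longrightarrow> term_sum W f P = term_sum W f Q"
    and PQ: "sum_eq R P Q"
  shows "set P \<subseteq> S \<Longrightarrow> term_sum W f P = term_sum W f Q"
  using PQ
proof (induction rule: sum_eq.induct)
  case (swap P Q)
  interpret module K W by fact
  have "f g \<in> carrier W" if "g \<in> set P \<or> g \<in> set Q" for g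
    using swap f that by auto
  then have "term_sum W f (P @ Q) = term_sum W f P \<oplus>\<^bsub>W\<^esub> term_sum W f Q"
    "term_sum W f (Q @ P) = term_sum W f Q \<oplus>\<^bsub>W\<^esub> term_sum W f P"
    "term_sum W f P \<in> carrier W" "term_sum W f Q \<in> carrier W"
    by (auto intro: term_sum_append[OF W] term_sum_closed[OF W])
  then show ?case by (simp add: M.a_comm)
next
  case (sym P Q)
  then show ?case using sum_eq_gens by metis
next
  case (trans P Q U)
  then show ?case using sum_eq_gens by metis
next
  case (append P P' Q Q')
  have c: "f g \<in> carrier W" if "g \<in> set P \<union> set Q \<union> set P' \<union> set Q'" for g
    using that append.prems sum_eq_gens[OF append.hyps(1)] sum_eq_gens[OF append.hyps(2)] f by auto
  have "term_sum W f (P @ Q) = term_sum W f P \<oplus>\<^bsub>W\<^esub> term_sum W f Q"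
    "term_sum W f (P' @ Q') = term_sum W f P' \<oplus>\<^bsub>W\<^esub> term_sum W f Q'"
    by (auto intro!: term_sum_append[OF W] c)
  then show ?case using append by simp
qed (use rel in auto)

text \<open>Existence in the universal property. The extension is evaluated on the stored
  representative \<open>d x\<close>, so its value on \<open>cls P\<close> is a matter of congruent
  sums, which \<open>term_sum_respects\<close> settles.\<close>

lemma lift:
  assumes W: "module K W" and f: "\<And>g. g \<in> S \<Longrightarrow> f g \<in> carrier W"
    and rel: "\<And>P Q. R P Q \<Longrightarrow> term_sum W f P = term_sum W f Q"
    and fs: "\<And>r g. \<lbrakk>r \<in> carrier K; g \<in> S\<rbrakk> \<Longrightarrow> f (s r g) = r \<odot>\<^bsub>W\<^esub> f g"
  shows "klinear K V W (\<lambda>x. term_sum W f (d x))"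
    and "g \<in> S \<Longrightarrow> term_sum W f (d (cls [g])) = f g"
proof -
  interpret W: module K W by fact
  have eq: "term_sum W f (d (cls P)) = term_sum W f P" if "set P \<subseteq> S" for P
    using term_sum_respects[OF W f rel sum_eq.sym[OF d_cls]] d_cls_gens that by blast
  show "g \<in> S \<Longrightarrow> term_sum W f (d (cls [g])) = f g" using f by (simp add: eq)
  have sm: "term_sum W f (map (s r) P) = r \<odot>\<^bsub>W\<^esub> term_sum W f P" if "set P \<subseteq> S" "r \<in> carrier K" for r P
    using that
  proof (induction P)
    case (Cons g P)
    then have "\<And>g. g \<in> set P \<Longrightarrow> f g \<in> carrier W" using f by auto
    then show ?case using Cons term_sum_closed[OF W, of P f] f[of g]
     by (simp add: fs W.smult_r_distr)
  qed simp
  show "klinear K V W (\<lambda>x. term_sum W f (d x))"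
  proof (rule klinearI)
    fix x assume x: "x \<in> carrier V"
    show "term_sum W f (d x) \<in> carrier W"
     using cls_d[OF x] f by (intro term_sum_closed[OF W]) auto
    fix r assume r: "r \<in> carrier K"
    have "r \<odot>\<^bsub>V\<^esub> x = cls (map (s r) (d x))" using cls_smult[OF r, of "d x"] cls_d[OF x] by simp
    then show "term_sum W f (d (r \<odot>\<^bsub>V\<^esub> x)) = r \<odot>\<^bsub>W\<^esub> term_sum W f (d x)"
     using cls_d[OF x] s_gens[OF r] r by (simp add: sm) (subst eq, auto simp: sm)
  next
    fix x y assume x: "x \<in> carrier V" "y \<in> carrier V"
    have "x \<oplus>\<^bsub>V\<^esub> y = cls (d x @ d y)" using cls_add[of "d x" "d y"] cls_d x by simp
    moreover have "term_sum W f (d x @ d y) = term_sum W f (d x) \<oplus>\<^bsub>W\<^esub> term_sum W f (d y)"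
     by (rule term_sum_append[OF W]) (use cls_d x f in auto)
    ultimately show "term_sum W f (d (x \<oplus>\<^bsub>V\<^esub> y)) = term_sum W f (d x) \<oplus>\<^bsub>W\<^esub> term_sum W f (d y)"
     using cls_d x by (simp add: eq)
  qed
qed

text \<open>Uniqueness in the universal property: induction on a list of generators that represents
  the element.\<close>

lemma klinear_ext:
  assumes W: "module K W" and h: "klinear K V W h" "klinear K V W h'"
    and eq: "\<And>g. g \<in> S \<Longrightarrow> h (cls [g]) = h' (cls [g])" and x: "x \<in> carrier V"
  shows "h x = h' x"
proof -
  have "h (cls P) = h' (cls P)" if "set P \<subseteq> S" for P
    using that
  proof (induction P)
    case Nil
    show ?case using klinear_zero[OF sum_space_module W h(1)] klinear_zero[OF sum_space_module W h(2)]
     by (simp add: cls_Nil)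
  next
    case (Cons g P)
    then show ?case
     using cls_add[of "[g]" P] klinearD(2)[OF h(1), of "cls [g]" "cls P"]
      klinearD(2)[OF h(2), of "cls [g]" "cls P"] eq[of g] by (simp add: cls_closed)
  qed
  then show ?thesis using cls_d[OF x] by metis
qed

text \<open>Links the definitions of the structure maps, which manipulate lists of terms, with sums
  of classes and thus with the maps obtained from \<open>lift\<close>.\<close>

lemma cls_concat:
  assumes "\<And>g. g \<in> set P \<Longrightarrow> set (F g) \<subseteq> S"
  shows "cls (concat (map F P)) = term_sum V (\<lambda>g. cls (F g)) P"
  using assms
proof (induction P)
  case (Cons g P)
  then show ?case using cls_add[of "F g" "concat (map F P)"] by simp
qed (simp add: cls_Nil)

lemma cls_map:
  assumes "\<And>g. g \<in> set P \<Longrightarrow> F g \<in> S"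
  shows "cls (map F P) = term_sum V (\<lambda>g. cls [F g]) P"
  using cls_concat[of P "\<lambda>g. [F g]"] assms by simp

end

section \<open>Sequences of algebras\<close>

abbreviation el :: "('i, 'a, ('k, 'v) module, 'b, 'z) funct_scheme \<Rightarrow> 'i \<Rightarrow> 'v set" where
  "el M n \<equiv> carrier (FO M n)"

abbreviation ap :: "('f, 'i \<Rightarrow> ('k, 'v) lmap) trans \<Rightarrow> 'i \<Rightarrow> 'v \<Rightarrow> 'v" where
  "ap \<alpha> n \<equiv> lapp (At \<alpha> n)"

text \<open>The axioms encode that the algebras, with the products \<open>Mu\<close>, form a strict
  monoidal linear category on the natural numbers. By \<open>inj_Emb\<close> elements of the
  algebras can be recovered from their codes in \<open>univ\<close>.\<close>

locale algebra_sequence =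
  fixes K :: "'k ring" and A :: "('k, 'u, 'x) algseq"
  assumes field_K: "field K"
    and alg_ring: "\<And>n. ring (Alg A n)"
    and alg_module: "\<And>n. module K (Alg A n)"
    and smult_mult_l: "\<And>n r a b. \<lbrakk>r \<in> carrier K; a \<in> carrier (Alg A n); b \<in> carrier (Alg A n)\<rbrakk> \<Longrightarrow>
     (r \<odot>\<^bsub>Alg A n\<^esub> a) \<otimes>\<^bsub>Alg A n\<^esub> b = r \<odot>\<^bsub>Alg A n\<^esub> (a \<otimes>\<^bsub>Alg A n\<^esub> b)"
    and smult_mult_r: "\<And>n r a b. \<lbrakk>r \<in> carrier K; a \<in> carrier (Alg A n); b \<in> carrier (Alg A n)\<rbrakk> \<Longrightarrow>
     a \<otimes>\<^bsub>Alg A n\<^esub> (r \<odot>\<^bsub>Alg A n\<^esub> b) = r \<odot>\<^bsub>Alg A n\<^esub> (a \<otimes>\<^bsub>Alg A n\<^esub> b)"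
    and mu_closed: "\<And>m n a b. \<lbrakk>a \<in> carrier (Alg A m); b \<in> carrier (Alg A n)\<rbrakk> \<Longrightarrow>
     Mu A m n a b \<in> carrier (Alg A (m + n))"
    and mu_add_l: "\<And>m n a a' b. \<lbrakk>a \<in> carrier (Alg A m); a' \<in> carrier (Alg A m); b \<in> carrier (Alg A n)\<rbrakk> \<Longrightarrow>
     Mu A m n (a \<oplus>\<^bsub>Alg A m\<^esub> a') b = Mu A m n a b \<oplus>\<^bsub>Alg A (m + n)\<^esub> Mu A m n a' b"
    and mu_add_r: "\<And>m n a b b'. \<lbrakk>a \<in> carrier (Alg A m); b \<in> carrier (Alg A n); b' \<in> carrier (Alg A n)\<rbrakk> \<Longrightarrow>
     Mu A m n a (b \<oplus>\<^bsub>Alg A n\<^esub> b') = Mu A m n a b \<oplus>\<^bsub>Alg A (m + n)\<^esub> Mu A m n a b'"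
    and mu_smult_l: "\<And>m n r a b. \<lbrakk>r \<in> carrier K; a \<in> carrier (Alg A m); b \<in> carrier (Alg A n)\<rbrakk> \<Longrightarrow>
     Mu A m n (r \<odot>\<^bsub>Alg A m\<^esub> a) b = r \<odot>\<^bsub>Alg A (m + n)\<^esub> Mu A m n a b"
    and mu_smult_r: "\<And>m n r a b. \<lbrakk>r \<in> carrier K; a \<in> carrier (Alg A m); b \<in> carrier (Alg A n)\<rbrakk> \<Longrightarrow>
     Mu A m n a (r \<odot>\<^bsub>Alg A n\<^esub> b) = r \<odot>\<^bsub>Alg A (m + n)\<^esub> Mu A m n a b"
    and mu_mult: "\<And>m n a a' b b'. \<lbrakk>a \<in> carrier (Alg A m); a' \<in> carrier (Alg A m);
      b \<in> carrier (Alg A n); b' \<in> carrier (Alg A n)\<rbrakk> \<Longrightarrow>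
     Mu A m n (a \<otimes>\<^bsub>Alg A m\<^esub> a') (b \<otimes>\<^bsub>Alg A n\<^esub> b') = Mu A m n a b \<otimes>\<^bsub>Alg A (m + n)\<^esub> Mu A m n a' b'"
    and mu_one: "\<And>m n. Mu A m n \<one>\<^bsub>Alg A m\<^esub> \<one>\<^bsub>Alg A n\<^esub> = \<one>\<^bsub>Alg A (m + n)\<^esub>"
    and mu_assoc: "\<And>l m n a b c. \<lbrakk>a \<in> carrier (Alg A l); b \<in> carrier (Alg A m); c \<in> carrier (Alg A n)\<rbrakk> \<Longrightarrow>
     Mu A (l + m) n (Mu A l m a b) c = Mu A l (m + n) a (Mu A m n b c)"
    and mu_unit_l: "\<And>n b. b \<in> carrier (Alg A n) \<Longrightarrow> Mu A 0 n \<one>\<^bsub>Alg A 0\<^esub> b = b"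
    and mu_unit_r: "\<And>n b. b \<in> carrier (Alg A n) \<Longrightarrow> Mu A n 0 b \<one>\<^bsub>Alg A 0\<^esub> = b"
    and inj_Emb: "inj (Emb A)"
begin

sublocale K: field K by (rule field_K)
sublocale alg: ring "Alg A n" for n by (rule alg_ring)
sublocale algm: module K "Alg A n" for n by (rule alg_module)

lemma Unemb_Emb [simp]: "Unemb A (Emb A a) = a"
  using inj_Emb by (rule inv_f_f)

abbreviation "CC \<equiv> module_category K A"
abbreviation "bar \<equiv> bar_category A"
abbreviation "\<e> n \<equiv> \<one>\<^bsub>Alg A n\<^esub>"
abbreviation "\<o> n \<equiv> \<zero>\<^bsub>Alg A n\<^esub>"
abbreviation "rep \<equiv> rep_obj A"
abbreviation "\<A> n \<equiv> carrier (Alg A n)"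
abbreviation "day \<equiv> day_obj K A"

lemma bar_simps:
  "Ob bar = UNIV"
  "mor bar m n = {(m, n, a) |a. a \<in> \<A> m \<and> (m = n \<or> a = (\<o> m))}"
  "Id bar n = (n, n, (\<e> n))"
  "(n', p, b) \<bullet>\<^bsub>bar\<^esub> (m, n, a) = (m, p, if m = n \<and> n = p then b \<otimes>\<^bsub>Alg A m\<^esub> a else (\<o> m))"
  "(m1, n1, a) \<oplus>\<^bsub>Hom bar m n\<^esub> (m2, n2, b) = (m, n, a \<oplus>\<^bsub>Alg A m\<^esub> b)"
  "r \<odot>\<^bsub>Hom bar m n\<^esub> (m1, n1, a) = (m, n, r \<odot>\<^bsub>Alg A m\<^esub> a)"
  "\<zero>\<^bsub>Hom bar m n\<^esub> = (m, n, (\<o> m))"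
  by (simp_all add: bar_category_def)

lemma bar_arrows: "(m, n, a) \<in> arrows bar \<longleftrightarrow> a \<in> \<A> m \<and> (m = n \<or> a = (\<o> m))"
  by (auto simp: arrows_def bar_simps)

lemma bar_linear: "linear_category K bar"
proof (rule linear_category.intro, goal_cases)
  case 1 show ?case by (rule field_K)
next
  case (2 m n)
  show ?case unfolding bar_category_def lincat.select_convs
  proof (rule module_linear_space[OF field_K], goal_cases)
    case 5 then show ?case by (auto simp: alg.a_comm)
  next
    case 9 then show ?case by (auto simp: algm.smult_l_distr)
  next
    case 10 then show ?case by (auto simp: algm.smult_r_distr)
  next
    case 11 then show ?case by (auto simp: algm.smult_assoc1)
  qed (auto simp: alg.a_assoc)
next
  case 3 then show ?case by (auto simp: bar_simps)
next
  case 4 then show ?case by (auto simp: bar_simps)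
next
  case 5 then show ?case by (auto simp: bar_simps)
next
  case 6 then show ?case by (auto simp: bar_simps)
next
  case 7 then show ?case by (auto simp: bar_simps)
next
  case (8 a b c d f g h)
  from 8 obtain x where f: "f = (a, b, x)" "x \<in> \<A> a" "a = b \<or> x = (\<o> a)"
    by (auto simp: bar_simps)
  from 8 obtain y where g: "g = (b, c, y)" "y \<in> \<A> b" "b = c \<or> y = (\<o> b)"
    by (auto simp: bar_simps)
  from 8 obtain z where h: "h = (c, d, z)" "z \<in> \<A> c" "c = d \<or> z = (\<o> c)"
    by (auto simp: bar_simps)
  show ?case using f g h
    by (cases "a = b"; cases "b = c"; cases "c = d"; cases "b = d"; cases "a = c"; simp add: bar_simps alg.m_assoc)
next
  case (9 a b c f g g')
  from 9 obtain x where f: "f = (a, b, x)" "x \<in> \<A> a" "a = b \<or> x = (\<o> a)"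
    by (auto simp: bar_simps)
  from 9 obtain y where g: "g = (b, c, y)" "y \<in> \<A> b" "b = c \<or> y = (\<o> b)"
    by (auto simp: bar_simps)
  from 9 obtain z where g': "g' = (b, c, z)" "z \<in> \<A> b" "b = c \<or> z = (\<o> b)"
    by (auto simp: bar_simps)
  show ?case using f g g'
    by (cases "a = b"; cases "b = c"; simp add: bar_simps alg.l_distr)
next
  case (10 a b c f f' g)
  from 10 obtain x where f: "f = (a, b, x)" "x \<in> \<A> a" "a = b \<or> x = (\<o> a)"
    by (auto simp: bar_simps)
  from 10 obtain z where f': "f' = (a, b, z)" "z \<in> \<A> a" "a = b \<or> z = (\<o> a)"
    by (auto simp: bar_simps)
  from 10 obtain y where g: "g = (b, c, y)" "y \<in> \<A> b" "b = c \<or> y = (\<o> b)"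
    by (auto simp: bar_simps)
  show ?case using f f' g
    by (cases "a = b"; cases "b = c"; simp add: bar_simps alg.r_distr)
next
  case (11 a b c f g r)
  from 11 obtain x where f: "f = (a, b, x)" "x \<in> \<A> a" "a = b \<or> x = (\<o> a)"
    by (auto simp: bar_simps)
  from 11 obtain y where g: "g = (b, c, y)" "y \<in> \<A> b" "b = c \<or> y = (\<o> b)"
    by (auto simp: bar_simps)
  show ?case using f g 11(6)
    by (cases "a = b"; cases "b = c"; simp add: bar_simps smult_mult_l)
next
  case (12 a b c f g r)
  from 12 obtain x where f: "f = (a, b, x)" "x \<in> \<A> a" "a = b \<or> x = (\<o> a)"
    by (auto simp: bar_simps)
  from 12 obtain y where g: "g = (b, c, y)" "y \<in> \<A> b" "b = c \<or> y = (\<o> b)"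
    by (auto simp: bar_simps)
  show ?case using f g 12(6)
    by (cases "a = b"; cases "b = c"; simp add: bar_simps smult_mult_r)
qed

lemma op_bar_linear: "linear_category K (op_cat bar)"
  by (rule op_cat_linear[OF bar_linear])

lemma CC_simps:
  "Ob CC = {M. linear_functor K (op_cat bar) (vect K) M}"
  "mor CC M N = {\<alpha>. Src \<alpha> = M \<and> Tgt \<alpha> = N \<and> natural (op_cat bar) (vect K) M N (At \<alpha>)}"
  "\<zero>\<^bsub>Hom CC M N\<^esub> = \<lparr>Src = M, Tgt = N, At = (\<lambda>n. lmap_of (FO M n) (FO N n) (\<lambda>v. \<zero>\<^bsub>FO N n\<^esub>))\<rparr>"
  "\<alpha> \<oplus>\<^bsub>Hom CC M N\<^esub> \<beta> = \<lparr>Src = M, Tgt = N,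
    At = (\<lambda>n. lmap_of (FO M n) (FO N n) (\<lambda>v. ap \<alpha> n v \<oplus>\<^bsub>FO N n\<^esub> ap \<beta> n v))\<rparr>"
  "r \<odot>\<^bsub>Hom CC M N\<^esub> \<alpha> = \<lparr>Src = M, Tgt = N,
    At = (\<lambda>n. lmap_of (FO M n) (FO N n) (\<lambda>v. r \<odot>\<^bsub>FO N n\<^esub> ap \<alpha> n v))\<rparr>"
  "Id CC M = \<lparr>Src = M, Tgt = M, At = (\<lambda>n. lmap_of (FO M n) (FO M n) (\<lambda>v. v))\<rparr>"
  "\<beta> \<bullet>\<^bsub>CC\<^esub> \<alpha> = \<lparr>Src = Src \<alpha>, Tgt = Tgt \<beta>,
    At = (\<lambda>n. lmap_of (ldom (At \<alpha> n)) (lcod (At \<beta> n)) (\<lambda>v. ap \<beta> n (ap \<alpha> n v)))\<rparr>"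
  "M \<boxtimes>\<^bsub>CC\<^esub> N = day M N"
  "\<alpha> \<boxdot>\<^bsub>CC\<^esub> \<beta> = day_arr K A \<alpha> \<beta>"
  "Unit CC = rep 0"
  "Assoc CC = day_assoc K A" "Lun CC = day_lun K A" "Run CC = day_run K A"
  by (simp_all add: module_category_def Let_def functor_category_def op_cat_simps bar_simps(1) vect_simps restrict_def)

lemma CC_linear: "linear_category K CC"
  by (rule linear_category_cong[OF functor_category_linear[OF vect_linear_category[OF field_K]]])
    (simp_all add: module_category_def Let_def)

sublocale C: linear_category K CC by (rule CC_linear)

lemma lmap_of_cong: "(\<And>v. v \<in> carrier V \<Longrightarrow> f v = g v) \<Longrightarrow> lmap_of V W f = lmap_of V W g"
  by (simp add: lmap_of_def fun_eq_iff restrict_def)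

lemma obj_module: "M \<in> Ob CC \<Longrightarrow> module K (FO M n)"
  using linear_functor.obj_closed[of K "op_cat bar" "vect K" M n]
  by (simp add: CC_simps(1) op_cat_simps bar_simps(1) vect_simps(1))

lemma FA_mor:
  assumes "M \<in> Ob CC" "(m, n, a) \<in> arrows bar"
  shows "FA M (m, n, a) \<in> mor (vect K) (FO M n) (FO M m)"
  using assms linear_functor.arr[of K "op_cat bar" "vect K" M n m "(m, n, a)"]
  by (simp add: CC_simps(1) op_cat_simps bar_simps bar_arrows)

text \<open>Between different degrees there are only zero arrows, so a functor is determined by its
  spaces and the actions \<open>act M n\<close>.\<close>

lemma FA_off_diag: "\<lbrakk>M \<in> Ob CC; m \<noteq> n\<rbrakk> \<Longrightarrow>
    FA M (m, n, (\<o> m)) = lmap_of (FO M n) (FO M m) (\<lambda>v. \<zero>\<^bsub>FO M m\<^esub>)"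
  using linear_functor_zero[OF op_bar_linear vect_linear_category[OF field_K], of M n m]
  by (simp add: CC_simps(1) op_cat_simps bar_simps vect_simps)

lemma act_klinear: "\<lbrakk>M \<in> Ob CC; a \<in> \<A> n\<rbrakk> \<Longrightarrow> klinear K (FO M n) (FO M n) (\<lambda>v. act M n v a)"
  using FA_mor[of M n n a] obj_module[of M n] by (simp add: bar_arrows vect_mor_iff)

lemmas act_closed = act_klinear[THEN klinearD(1)]
lemmas act_smult = act_klinear[THEN klinearD(3)]

lemma act_add_alg:
  assumes "M \<in> Ob CC" "v \<in> el M n" "a \<in> \<A> n" "b \<in> \<A> n"
  shows "act M n v (a \<oplus>\<^bsub>Alg A n\<^esub> b) = act M n v a \<oplus>\<^bsub>FO M n\<^esub> act M n v b"
  using assms linear_functor.add[of K "op_cat bar" "vect K" M n n "(n, n, a)" "(n, n, b)"]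
  by (simp add: CC_simps(1) op_cat_simps bar_simps vect_simps)

lemma act_smult_alg:
  assumes "M \<in> Ob CC" "v \<in> el M n" "a \<in> \<A> n" "r \<in> carrier K"
  shows "act M n v (r \<odot>\<^bsub>Alg A n\<^esub> a) = r \<odot>\<^bsub>FO M n\<^esub> act M n v a"
  using assms linear_functor.smult[of K "op_cat bar" "vect K" M n n "(n, n, a)" r]
  by (simp add: CC_simps(1) op_cat_simps bar_simps vect_simps)

lemma act_one: "\<lbrakk>M \<in> Ob CC; v \<in> el M n\<rbrakk> \<Longrightarrow> act M n v (\<e> n) = v"
  using linear_functor.ident[of K "op_cat bar" "vect K" M n]
  by (simp add: CC_simps(1) op_cat_simps bar_simps vect_simps)

lemma act_mult:
  assumes "M \<in> Ob CC" "v \<in> el M n" "a \<in> \<A> n" "b \<in> \<A> n"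
  shows "act M n (act M n v a) b = act M n v (a \<otimes>\<^bsub>Alg A n\<^esub> b)"
  using assms linear_functor.comp[of K "op_cat bar" "vect K" M n n n "(n, n, a)" "(n, n, b)"] FA_mor[of M n n a] obj_module[of M n]
  by (simp add: CC_simps(1) op_cat_simps bar_simps vect_simps vect_mor_iff bar_arrows)

lemma act_klinear_alg: "\<lbrakk>M \<in> Ob CC; v \<in> el M n\<rbrakk> \<Longrightarrow> klinear K (Alg A n) (FO M n) (act M n v)"
  by (rule klinearI) (simp_all add: act_closed act_add_alg act_smult_alg)

lemma act_zero: "\<lbrakk>M \<in> Ob CC; a \<in> \<A> n\<rbrakk> \<Longrightarrow> act M n \<zero>\<^bsub>FO M n\<^esub> a = \<zero>\<^bsub>FO M n\<^esub>"
  using klinear_zero[OF obj_module obj_module act_klinear] by blast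

lemma act_zero_alg: "\<lbrakk>M \<in> Ob CC; v \<in> el M n\<rbrakk> \<Longrightarrow> act M n v (\<o> n) = \<zero>\<^bsub>FO M n\<^esub>"
  using klinear_zero[OF alg_module obj_module act_klinear_alg] by blast

definition mk_obj :: "(nat \<Rightarrow> ('k, 'u) space) \<Rightarrow> (nat \<Rightarrow> ('k, 'u) univ \<Rightarrow> 'x \<Rightarrow> ('k, 'u) univ) \<Rightarrow>
    ('k, 'u, 'x) mobj" where
  "mk_obj V \<rho> = \<lparr>FO = V, FA = (\<lambda>(m, n, b)\<in>arrows bar.
    lmap_of (V n) (V m) (\<lambda>x. if m = n then \<rho> m x b else \<zero>\<^bsub>V m\<^esub>))\<rparr>"

text \<open>The module axioms give functoriality within one degree, and everything between different
  degrees is zero. Representable modules, Day convolutions and extended modules are recognised as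
  objects in this way.\<close>

lemma mk_obj:
  assumes V: "\<And>n. module K (V n)"
    and l: "\<And>n b. b \<in> \<A> n \<Longrightarrow> klinear K (V n) (V n) (\<lambda>x. \<rho> n x b)"
    and r: "\<And>n x. x \<in> carrier (V n) \<Longrightarrow> klinear K (Alg A n) (V n) (\<rho> n x)"
    and one: "\<And>n x. x \<in> carrier (V n) \<Longrightarrow> \<rho> n x (\<e> n) = x"
    and mult: "\<And>n x a b. \<lbrakk>x \<in> carrier (V n); a \<in> \<A> n; b \<in> \<A> n\<rbrakk> \<Longrightarrow>
     \<rho> n (\<rho> n x a) b = \<rho> n x (a \<otimes>\<^bsub>Alg A n\<^esub> b)"
  shows "mk_obj V \<rho> \<in> Ob CC"
proof -
  interpret V: module K "V n" for n by (rule V)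
  have z: "klinear K (V n) (V m) (\<lambda>x. \<zero>\<^bsub>V m\<^esub>)" for m n by (rule klinearI) simp_all
  have rz: "\<rho> n x (\<o> n) = \<zero>\<^bsub>V n\<^esub>" if "x \<in> carrier (V n)" for n x
    using klinear_zero[OF alg_module V r[OF that]] .
  have zr: "\<rho> n \<zero>\<^bsub>V n\<^esub> a = \<zero>\<^bsub>V n\<^esub>" if "a \<in> \<A> n" for n a
    using klinear_zero[OF V V l[OF that]] .
  have FA: "FA (mk_obj V \<rho>) (m, n, b) = lmap_of (V n) (V m) (\<lambda>x. if m = n then \<rho> m x b else \<zero>\<^bsub>V m\<^esub>)"
    if "(m, n, b) \<in> arrows bar" for m n b using that by (simp add: mk_obj_def)
  have FO: "FO (mk_obj V \<rho>) = V" by (simp add: mk_obj_def)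
  show ?thesis unfolding CC_simps(1) mem_Collect_eq
  proof (rule linear_functor.intro, goal_cases)
    case 1 show ?case by (simp add: FO V op_cat_simps bar_simps vect_simps PiE_def extensional_def)
  next
    case 2 show ?case by (simp add: mk_obj_def op_cat_simps)
  next
    case (3 n m f)
    then obtain b where f: "f = (m, n, b)" "(m, n, b) \<in> arrows bar"
     by (auto simp: op_cat_simps bar_simps bar_arrows)
    show ?case unfolding f(1) FA[OF f(2)] FO
     by (rule lmap_of_mor[OF V], cases "m = n") (use l[of b m] f(2) z[of n m] in \<open>auto simp: bar_arrows\<close>)
  next
    case (4 n)
    have "(n, n, (\<e> n)) \<in> arrows bar" by (simp add: bar_arrows)
    from FA[OF this] show ?case by (simp add: op_cat_simps bar_simps FO vect_simps one cong: lmap_of_cong)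
  next
    case (5 n m l f g)
    then obtain a b where f: "f = (m, n, a)" "(m, n, a) \<in> arrows bar" and g: "g = (l, m, b)" "(l, m, b) \<in> arrows bar"
     by (auto simp: op_cat_simps bar_simps bar_arrows)
    have ab: "a \<in> \<A> m" "b \<in> \<A> l" using f(2) g(2) by (simp_all add: bar_arrows)
    let ?c = "if l = m \<and> m = n then a \<otimes>\<^bsub>Alg A l\<^esub> b else (\<o> l)"
    have c: "(l, n, ?c) \<in> arrows bar" using ab by (auto simp: bar_arrows)
    show ?case
     unfolding f(1) g(1) op_cat_simps bar_simps FA[OF c] FA[OF f(2)] FA[OF g(2)] vect_simps(7) lmap_of_simps
     by (rule lmap_of_cong) (use ab in \<open>auto simp: mult rz zr l[THEN klinearD(1)] intro!: zr\<close>)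
  next
    case (6 n m f g)
    then obtain a b where f: "f = (m, n, a)" "(m, n, a) \<in> arrows bar" and g: "g = (m, n, b)" "(m, n, b) \<in> arrows bar"
     by (auto simp: op_cat_simps bar_simps bar_arrows)
    have c: "(m, n, a \<oplus>\<^bsub>Alg A m\<^esub> b) \<in> arrows bar" using f(2) g(2) by (auto simp: bar_arrows)
    show ?case unfolding f(1) g(1) op_cat_simps bar_simps FA[OF c] FA[OF f(2)] FA[OF g(2)] FO vect_simps
     by (rule lmap_of_cong, cases "m = n") (use f(2) g(2) in \<open>simp_all add: bar_arrows r[THEN klinearD(2)]\<close>)
  next
    case (7 n m f t)
    then obtain a where f: "f = (m, n, a)" "(m, n, a) \<in> arrows bar"
     by (auto simp: op_cat_simps bar_simps bar_arrows)
    have c: "(m, n, t \<odot>\<^bsub>Alg A m\<^esub> a) \<in> arrows bar" using f(2) 7(4) by (auto simp: bar_arrows)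
    show ?case unfolding f(1) op_cat_simps bar_simps FA[OF c] FA[OF f(2)] FO vect_simps
     by (rule lmap_of_cong, cases "m = n") (use f(2) 7(4) in \<open>simp_all add: bar_arrows r[THEN klinearD(3)]\<close>)
  qed
qed

lemma mk_obj_act: "b \<in> \<A> n \<Longrightarrow> x \<in> carrier (V n) \<Longrightarrow> act (mk_obj V \<rho>) n x b = \<rho> n x b"
  by (simp add: mk_obj_def bar_arrows)

definition mk_arr :: "('k, 'u, 'x) mobj \<Rightarrow> ('k, 'u, 'x) mobj \<Rightarrow> (nat \<Rightarrow> ('k, 'u) univ \<Rightarrow> ('k, 'u) univ) \<Rightarrow>
    ('k, 'u, 'x) marr" where
  "mk_arr M N f = \<lparr>Src = M, Tgt = N, At = (\<lambda>n. lmap_of (FO M n) (FO N n) (f n))\<rparr>"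

lemma mk_arr_apply [simp]: "v \<in> el M n \<Longrightarrow> ap (mk_arr M N f) n v = f n v"
  by (simp add: mk_arr_def)

lemma mk_arr:
  assumes o: "M \<in> Ob CC" "N \<in> Ob CC"
    and l: "\<And>n. klinear K (FO M n) (FO N n) (f n)"
    and eq: "\<And>n v a. \<lbrakk>v \<in> el M n; a \<in> \<A> n\<rbrakk> \<Longrightarrow> f n (act M n v a) = act N n (f n v) a"
  shows "mk_arr M N f \<in> mor CC M N"
proof -
  have "natural (op_cat bar) (vect K) M N (\<lambda>n. lmap_of (FO M n) (FO N n) (f n))"
  proof (rule naturalI, goal_cases)
    case (1 n) show ?case by (rule lmap_of_mor[OF obj_module[OF o(1)] l])
  next
    case 2 show ?case by (simp add: op_cat_simps bar_simps extensional_def)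
  next
    case (3 n m g)
    then obtain b where g: "g = (m, n, b)" "(m, n, b) \<in> arrows bar"
     by (auto simp: op_cat_simps bar_simps bar_arrows)
    show ?case
    proof (cases "m = n")
     case True
     then have b: "b \<in> \<A> n" using g by (simp add: bar_arrows)
     have "lcod (FA N (n, n, b)) = FO N n" "ldom (FA M (n, n, b)) = FO M n"
      using FA_mor[OF o(2) g(2)] FA_mor[OF o(1) g(2)] True by (auto simp: vect_simps)
     then show ?thesis unfolding g(1) True vect_simps lmap_of_simps
      using b by (auto intro!: lmap_of_cong simp: act_closed[OF o(1)] eq klinearD(1)[OF l])
    next
     case False
     then have b: "b = (\<o> m)" using g by (simp add: bar_arrows)
     show ?thesis unfolding g(1) b FA_off_diag[OF o(1) False] FA_off_diag[OF o(2) False] vect_simps lmap_of_simps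
      using klinear_zero[OF obj_module[OF o(1)] obj_module[OF o(2)] l, of m]
       abelian_group.axioms(1)[OF module.axioms(2)[OF obj_module[OF o(1)]]]
      by (auto intro!: lmap_of_cong simp: abelian_monoid.zero_closed klinearD(1)[OF l])
    qed
  qed
  then show ?thesis by (simp add: mk_arr_def CC_simps(2))
qed

lemma morD:
  assumes "M \<in> Ob CC" "\<alpha> \<in> mor CC M N"
  shows mor_Src: "Src \<alpha> = M" and mor_Tgt: "Tgt \<alpha> = N"
    and mor_klinear: "klinear K (FO M n) (FO N n) (ap \<alpha> n)"
    and mor_dom: "ldom (At \<alpha> n) = FO M n" and mor_cod: "lcod (At \<alpha> n) = FO N n"
    and mor_ext: "ap \<alpha> n \<in> extensional (el M n)"
  using assms(2) naturalD(1)[of "op_cat bar" "vect K" M N "At \<alpha>" n] obj_module[OF assms(1)]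
  by (auto simp: CC_simps(2) op_cat_simps bar_simps vect_mor_iff)

lemma mor_act:
  assumes o: "M \<in> Ob CC" "N \<in> Ob CC" and \<alpha>: "\<alpha> \<in> mor CC M N" and v: "v \<in> el M n" and a: "a \<in> \<A> n"
  shows "ap \<alpha> n (act M n v a) = act N n (ap \<alpha> n v) a"
proof -
  have "(n, n, a) \<in> arrows bar" using a by (simp add: bar_arrows)
  note F = FA_mor[OF o(1) this] FA_mor[OF o(2) this]
  have "At \<alpha> n \<bullet>\<^bsub>vect K\<^esub> FA M (n, n, a) = FA N (n, n, a) \<bullet>\<^bsub>vect K\<^esub> At \<alpha> n"
    using \<alpha> a naturalD(3)[of "op_cat bar" "vect K" M N "At \<alpha>" n n "(n, n, a)"]
    by (auto simp: CC_simps(2) op_cat_simps bar_simps)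
  from this[THEN arg_cong[where f = "\<lambda>f. lapp f v"]] show ?thesis
    using v F obj_module o by (simp add: vect_simps(7) vect_mor_iff mor_dom[OF o(1) \<alpha>])
qed

lemma mor_eqI:
  assumes o: "M \<in> Ob CC" and \<alpha>: "\<alpha> \<in> mor CC M N" and \<beta>: "\<beta> \<in> mor CC M N"
    and eq: "\<And>n v. v \<in> el M n \<Longrightarrow> ap \<alpha> n v = ap \<beta> n v"
  shows "\<alpha> = \<beta>"
proof -
  have "At \<alpha> n = At \<beta> n" for n
    by (rule lmap_eqI[of _ "FO M n"]) (simp_all add: morD[OF o \<alpha>] morD[OF o \<beta>] eq)
  then show ?thesis using morD(1,2)[OF o \<alpha>] morD(1,2)[OF o \<beta>] by (intro trans.equality) auto
qed

lemma comp_apply: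
  assumes "M \<in> Ob CC" "\<alpha> \<in> mor CC M N" "v \<in> el M n"
  shows "ap (\<beta> \<bullet>\<^bsub>CC\<^esub> \<alpha>) n v = ap \<beta> n (ap \<alpha> n v)"
  using assms by (simp add: CC_simps(7) mor_dom[OF assms(1,2)])

lemma id_apply: "v \<in> el M n \<Longrightarrow> ap (Id CC M) n v = v"
  by (simp add: CC_simps)

lemma hom_apply:
  assumes "v \<in> el M n"
  shows "ap \<zero>\<^bsub>Hom CC M N\<^esub> n v = \<zero>\<^bsub>FO N n\<^esub>"
    "ap (\<alpha> \<oplus>\<^bsub>Hom CC M N\<^esub> \<beta>) n v = ap \<alpha> n v \<oplus>\<^bsub>FO N n\<^esub> ap \<beta> n v"
    "ap (r \<odot>\<^bsub>Hom CC M N\<^esub> \<alpha>) n v = r \<odot>\<^bsub>FO N n\<^esub> ap \<alpha> n v"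
  using assms by (simp_all add: CC_simps)

subsection \<open>Representable modules\<close>

lemma FO_rep:
  "el (rep n) m = {Emb A a |a. a \<in> \<A> m \<and> (m = n \<or> a = (\<o> m))}"
  "\<zero>\<^bsub>FO (rep n) m\<^esub> = Emb A (\<o> m)"
  "x \<oplus>\<^bsub>FO (rep n) m\<^esub> y = Emb A (Unemb A x \<oplus>\<^bsub>Alg A m\<^esub> Unemb A y)"
  "r \<odot>\<^bsub>FO (rep n) m\<^esub> x = Emb A (r \<odot>\<^bsub>Alg A m\<^esub> Unemb A x)"
  by (auto simp: rep_obj_def Let_def bar_simps)

lemma rep_module: "module K (FO (rep n) m)"
  unfolding rep_obj_def Let_def funct.select_convs
proof (rule module_linear_space[OF field_K], goal_cases)
  case 5 then show ?case by (auto simp: bar_simps alg.a_comm)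
next
  case 9 then show ?case by (auto simp: bar_simps algm.smult_l_distr)
next
  case 10 then show ?case by (auto simp: bar_simps algm.smult_r_distr)
next
  case 11 then show ?case by (auto simp: bar_simps algm.smult_assoc1)
qed (auto simp: bar_simps alg.a_assoc)

lemma rep_obj_eq: "rep n = mk_obj (FO (rep n)) (\<lambda>m x b. Emb A (Unemb A x \<otimes>\<^bsub>Alg A m\<^esub> b))"
proof -
  have "FA (rep n) = FA (mk_obj (FO (rep n)) (\<lambda>m x b. Emb A (Unemb A x \<otimes>\<^bsub>Alg A m\<^esub> b)))"
    unfolding mk_obj_def funct.select_convs
    by (subst rep_obj_def, unfold Let_def funct.select_convs, rule restrict_ext)
     (auto simp: rep_obj_def Let_def bar_simps bar_arrows intro!: lmap_of_cong)
  then show ?thesis by (intro funct.equality) (simp_all add: mk_obj_def)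
qed

lemma rep_obj: "rep n \<in> Ob CC"
  by (subst rep_obj_eq, rule mk_obj[OF rep_module])
    (auto simp: FO_rep klinear_def alg.l_distr alg.r_distr smult_mult_l smult_mult_r alg.m_assoc)

lemma rep_act: "\<lbrakk>x \<in> el (rep n) m; b \<in> \<A> m\<rbrakk> \<Longrightarrow>
    act (rep n) m x b = Emb A (Unemb A x \<otimes>\<^bsub>Alg A m\<^esub> b)"
  by (subst rep_obj_eq) (simp add: mk_obj_act)

lemma Emb_rep: "Emb A a \<in> el (rep n) m \<longleftrightarrow>
    a \<in> \<A> m \<and> (m = n \<or> a = (\<o> m))"
  using inj_Emb by (auto simp: FO_rep dest: injD)

lemma rep_act_Emb: "\<lbrakk>a \<in> \<A> m; m = n \<or> a = (\<o> m); b \<in> \<A> m\<rbrakk> \<Longrightarrow>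
    act (rep n) m (Emb A a) b = Emb A (a \<otimes>\<^bsub>Alg A m\<^esub> b)"
  using rep_act[of "Emb A a" n m b] by (simp add: Emb_rep)

text \<open>The arrow that the Yoneda lemma assigns to the element \<open>v\<close> of degree
  \<open>n\<close>.\<close>

definition yon :: "('k, 'u, 'x) mobj \<Rightarrow> nat \<Rightarrow> ('k, 'u) univ \<Rightarrow> ('k, 'u, 'x) marr" where
  "yon M n v = mk_arr (rep n) M (\<lambda>m x. if m = n then act M n v (Unemb A x) else \<zero>\<^bsub>FO M m\<^esub>)"

lemma yon:
  assumes M: "M \<in> Ob CC" and v: "v \<in> el M n"
  shows "yon M n v \<in> mor CC (rep n) M"
proof -
  interpret M: module K "FO M m" for m by (rule obj_module[OF M])
  show ?thesis unfolding yon_def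
    by (rule mk_arr[OF rep_obj M])
     (auto simp: klinear_def FO_rep rep_act_Emb act_closed[OF M] act_add_alg[OF M] act_smult_alg[OF M]
      act_mult[OF M] act_zero[OF M] v)
qed

lemma yon_apply: "a \<in> \<A> n \<Longrightarrow> ap (yon M n v) n (Emb A a) = act M n v a"
  unfolding yon_def by (subst mk_arr_apply) (simp_all add: Emb_rep)

text \<open>Uniqueness in the Yoneda lemma: in degree \<open>n\<close> the representable module is
  generated by the unit of the algebra, and in all other degrees it is zero.\<close>

lemma rep_hom_eqI:
  assumes M: "M \<in> Ob CC" and \<alpha>: "\<alpha> \<in> mor CC (rep n) M" and \<beta>: "\<beta> \<in> mor CC (rep n) M"
    and eq: "ap \<alpha> n (Emb A (\<e> n)) = ap \<beta> n (Emb A (\<e> n))"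
  shows "\<alpha> = \<beta>"
proof (rule mor_eqI[OF rep_obj \<alpha> \<beta>])
  fix m v assume v: "v \<in> el (rep n) m"
  show "ap \<alpha> m v = ap \<beta> m v"
  proof (cases "m = n")
    case True
    then obtain a where a: "v = Emb A a" "a \<in> \<A> n" using v by (auto simp: FO_rep)
    have 1: "Emb A (\<e> n) \<in> el (rep n) n" by (auto simp: FO_rep)
    have "v = act (rep n) n (Emb A (\<e> n)) a" using a rep_act[OF 1 a(2)] by simp
    then show ?thesis using mor_act[OF rep_obj M \<alpha> 1 a(2)] mor_act[OF rep_obj M \<beta> 1 a(2)] eq True by simp
  next
    case False
    then have "v = \<zero>\<^bsub>FO (rep n) m\<^esub>" using v by (auto simp: FO_rep)
    then show ?thesis
     using klinear_zero[OF rep_module obj_module[OF M] mor_klinear[OF rep_obj \<alpha>]]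
      klinear_zero[OF rep_module obj_module[OF M] mor_klinear[OF rep_obj \<beta>]] by simp
  qed
qed

lemma rep_arr_eq: "a \<in> \<A> n \<Longrightarrow> rep_arr A n a = yon (rep n) n (Emb A a)"
  unfolding rep_arr_def yon_def mk_arr_def
  by (auto simp: fun_eq_iff FO_rep bar_simps rep_act_Emb intro!: lmap_of_cong)

lemma rep_arr: "a \<in> \<A> n \<Longrightarrow> rep_arr A n a \<in> mor CC (rep n) (rep n)"
  by (simp add: rep_arr_eq) (rule yon[OF rep_obj], auto simp: FO_rep)

lemma rep_arr_apply: "\<lbrakk>a \<in> \<A> n; b \<in> \<A> n\<rbrakk> \<Longrightarrow>
    ap (rep_arr A n a) n (Emb A b) = Emb A (a \<otimes>\<^bsub>Alg A n\<^esub> b)"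
  by (simp add: rep_arr_eq yon_apply rep_act_Emb)

lemma one_rep: "Emb A (\<e> n) \<in> el (rep n) n"
  by (auto simp: FO_rep)

lemma rep_arr_add: "\<lbrakk>a \<in> \<A> n; b \<in> \<A> n\<rbrakk> \<Longrightarrow>
    rep_arr A n (a \<oplus>\<^bsub>Alg A n\<^esub> b) = rep_arr A n a \<oplus>\<^bsub>Hom CC (rep n) (rep n)\<^esub> rep_arr A n b"
  by (rule rep_hom_eqI[OF rep_obj])
    (auto intro!: rep_arr C.hom_add rep_obj simp: hom_apply[OF one_rep] rep_arr_apply FO_rep)

lemma rep_arr_smult: "\<lbrakk>a \<in> \<A> n; r \<in> carrier K\<rbrakk> \<Longrightarrow>
    rep_arr A n (r \<odot>\<^bsub>Alg A n\<^esub> a) = r \<odot>\<^bsub>Hom CC (rep n) (rep n)\<^esub> rep_arr A n a"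
  by (rule rep_hom_eqI[OF rep_obj])
    (auto intro!: rep_arr C.hom_smult rep_obj simp: hom_apply[OF one_rep] rep_arr_apply FO_rep)

lemma rep_arr_mult: "\<lbrakk>a \<in> \<A> n; b \<in> \<A> n\<rbrakk> \<Longrightarrow>
    rep_arr A n (a \<otimes>\<^bsub>Alg A n\<^esub> b) = rep_arr A n a \<bullet>\<^bsub>CC\<^esub> rep_arr A n b"
  by (rule rep_hom_eqI[OF rep_obj])
    (auto intro!: rep_arr C.comp_mor[OF _ _ _ rep_arr rep_arr] rep_obj simp: comp_apply[OF rep_obj rep_arr one_rep] rep_arr_apply)

lemma rep_arr_one: "rep_arr A n (\<e> n) = Id CC (rep n)"
  by (rule rep_hom_eqI[OF rep_obj]) (auto intro!: rep_arr C.id_mor rep_obj simp: id_apply[OF one_rep] rep_arr_apply)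

text \<open>The arrow of an element of the form \<open>v a\<close> factors through left
  multiplication by \<open>a\<close>. Hence a functor that kills these multiplications for
  \<open>a\<close> in an ideal also kills the arrows of all such elements.\<close>

lemma yon_rep_arr:
  assumes "M \<in> Ob CC" "v \<in> el M n" "a \<in> \<A> n"
  shows "yon M n v \<bullet>\<^bsub>CC\<^esub> rep_arr A n a = yon M n (act M n v a)"
  using assms by (intro rep_hom_eqI[OF assms(1), of _ n] yon C.comp_mor[OF _ _ _ rep_arr yon] rep_obj)
    (auto simp: comp_apply[OF rep_obj rep_arr one_rep] rep_arr_apply yon_apply act_one act_closed)

end

section \<open>Day convolution\<close>

context algebra_sequence
begin

definition pure :: "('k, 'u, 'x) mobj \<Rightarrow> ('k, 'u, 'x) mobj \<Rightarrow> nat \<Rightarrow> nat \<Rightarrow> ('k, 'u) univ \<Rightarrow> nat \<Rightarrow>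
    ('k, 'u) univ \<Rightarrow> 'x \<Rightarrow> ('k, 'u) univ" where
  "pure M N p i v j w a = day_elt K A M N p [(i, v, j, w, Emb A a)]"

lemma day_gens_iff: "(i, v, j, w, Emb A a) \<in> day_gens A M N p \<longleftrightarrow>
    i + j = p \<and> v \<in> el M i \<and> w \<in> el N j \<and> a \<in> \<A> p"
  using inj_Emb by (auto simp: day_gens_def dest: injD)

lemma day_presentation:
  assumes M: "M \<in> Ob CC" and N: "N \<in> Ob CC"
  shows "sum_presentation K DayTerms day_terms (day_gens A M N p) (day_rel K A M N p)
    (\<lambda>r (i, v, j, w, a). (i, r \<odot>\<^bsub>FO M i\<^esub> v, j, w, a))"
proof -
  interpret M: module K "FO M i" for i by (rule obj_module[OF M])
  interpret N: module K "FO N i" for i by (rule obj_module[OF N])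
  let ?s = "\<lambda>r (i, v, j, w, a). (i, r \<odot>\<^bsub>FO M i\<^esub> v, j, w, a)"
  show ?thesis
  proof (rule sum_presentation.intro, goal_cases)
    case 1 show ?case by (rule field_K)
  next
    case 2 show ?case by simp
  next
    case (3 P Q)
    then show ?case
     by (cases rule: day_rel.cases)
      (auto simp: day_gens_iff act_closed[OF M] act_closed[OF N] mu_closed)
  next
    case (4 r g) then show ?case by (auto simp: day_gens_def)
  next
    case (5 r P Q)
    from 5(2) show ?case
    proof (cases rule: day_rel.cases)
     case (add_left i j v v' w a)
     then show ?thesis using 5(1) by (auto simp: M.smult_r_distr intro!: sum_eq.rel day_rel.add_left)
    next
     case (add_right i j v w w' a)
     then show ?thesis using 5(1) by (auto intro!: sum_eq.rel day_rel.add_right)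
    next
     case (add_alg i j v w a a')
     then show ?thesis using 5(1) by (auto intro!: sum_eq.rel day_rel.add_alg)
    next
     case (zero i j w a)
     then show ?thesis using 5(1) by (auto intro!: sum_eq.rel day_rel.zero)
    next
     case (scalar i j v w a t)
     \<comment> \<open>Commutativity of the field makes the relation \<open>scalar\<close> stable
       under multiplication by \<open>r\<close>.\<close>
     have "r \<odot>\<^bsub>FO M i\<^esub> (t \<odot>\<^bsub>FO M i\<^esub> v) = t \<odot>\<^bsub>FO M i\<^esub> (r \<odot>\<^bsub>FO M i\<^esub> v)"
      using scalar 5(1) by (simp add: M.smult_assoc1[symmetric] K.m_comm)
     then show ?thesis using scalar 5(1) by (auto intro!: sum_eq.rel day_rel.scalar)
    next
     case (balanced i j v w a b b')
     then show ?thesis using 5(1) by (auto intro!: sum_eq.rel day_rel.balanced simp: act_smult[OF M, symmetric])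
    qed
  next
    case (6 r t g)
    then show ?case by (auto simp: day_gens_def M.smult_l_distr intro!: sum_eq.rel day_rel.add_left)
  next
    case (7 r t g)
    then show ?case by (auto simp: day_gens_def M.smult_assoc1 intro!: sum_eq.refl)
  next
    case (8 g)
    then show ?case by (auto simp: day_gens_def intro!: sum_eq.refl)
  next
    case (9 g)
    then show ?case by (auto simp: day_gens_def intro!: sum_eq.rel day_rel.zero)
  qed
qed

lemma day_space_eq: "FO (day M N) p = sum_space DayTerms day_terms (day_gens A M N p) (day_rel K A M N p)
     (\<lambda>r (i, v, j, w, a). (i, r \<odot>\<^bsub>FO M i\<^esub> v, j, w, a))"
  by (simp add: day_obj_def day_space_def)

lemma day_elt_cls: "\<lbrakk>M \<in> Ob CC; N \<in> Ob CC\<rbrakk> \<Longrightarrow>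
    sum_presentation.cls DayTerms (day_rel K A M N p) P = day_elt K A M N p P"
  by (simp add: sum_presentation.cls_def[OF day_presentation] day_elt_def)

text \<open>The maps on generators that correspond to linear maps out of degree \<open>p\<close> of
  a Day convolution: linear over the field in each of the three slots and balanced over the two
  algebras, for every splitting of \<open>p\<close>. Compatibility with the right action of the
  algebra in degree \<open>p\<close> is a separate condition, imposed in the lemma
  \<open>day_hom\<close>.\<close>

definition day_bilin :: "('k, 'u, 'x) mobj \<Rightarrow> ('k, 'u, 'x) mobj \<Rightarrow> nat \<Rightarrow> ('k, 'w) module \<Rightarrow>
    (nat \<Rightarrow> ('k, 'u) univ \<Rightarrow> nat \<Rightarrow> ('k, 'u) univ \<Rightarrow> 'x \<Rightarrow> 'w) \<Rightarrow> bool" where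
  "day_bilin M N p W \<phi> \<longleftrightarrow> module K W \<and> (\<forall>i j. i + j = p \<longrightarrow>
    (\<forall>w\<in>el N j. \<forall>a\<in>\<A> p. klinear K (FO M i) W (\<lambda>v. \<phi> i v j w a)) \<and>
    (\<forall>v\<in>el M i. \<forall>a\<in>\<A> p. klinear K (FO N j) W (\<lambda>w. \<phi> i v j w a)) \<and>
    (\<forall>v\<in>el M i. \<forall>w\<in>el N j. klinear K (Alg A p) W (\<phi> i v j w)) \<and>
    (\<forall>v\<in>el M i. \<forall>w\<in>el N j. \<forall>a\<in>\<A> p.
     \<forall>b\<in>\<A> i. \<forall>b'\<in>\<A> j.
     \<phi> i (act M i v b) j (act N j w b') a = \<phi> i v j w (Mu A i j b b' \<otimes>\<^bsub>Alg A p\<^esub> a)))"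

definition day_map :: "('k, 'w) module \<Rightarrow> (nat \<Rightarrow> ('k, 'u) univ \<Rightarrow> nat \<Rightarrow> ('k, 'u) univ \<Rightarrow> 'x \<Rightarrow> 'w) \<Rightarrow>
    ('k, 'u) univ \<Rightarrow> 'w" where
  "day_map W \<phi> x = term_sum W (\<lambda>(i, v, j, w, a). \<phi> i v j w (Unemb A a)) (day_terms x)"

definition day_hom :: "('k, 'u, 'x) mobj \<Rightarrow> ('k, 'u, 'x) mobj \<Rightarrow> ('k, 'u, 'x) mobj \<Rightarrow> (nat \<Rightarrow> nat \<Rightarrow> ('k, 'u) univ \<Rightarrow> nat \<Rightarrow> ('k, 'u) univ \<Rightarrow> 'x \<Rightarrow> ('k, 'u) univ) \<Rightarrow>
    ('k, 'u, 'x) marr" where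
  "day_hom M N P \<phi> = mk_arr (day M N) P (\<lambda>p. day_map (FO P p) (\<phi> p))"

context
  fixes M N assumes M: "M \<in> Ob CC" and N: "N \<in> Ob CC"
begin

interpretation M: module K "FO M i" for i by (rule obj_module[OF M])
interpretation N: module K "FO N i" for i by (rule obj_module[OF N])
interpretation D: sum_presentation K DayTerms day_terms "day_gens A M N p" "day_rel K A M N p"
    "\<lambda>r (i, v, j, w, a). (i, r \<odot>\<^bsub>FO M i\<^esub> v, j, w, a)" for p by (rule day_presentation[OF M N])

lemma day_module: "module K (FO (day M N) p)"
  unfolding day_space_eq by (rule D.sum_space_module)

interpretation DM: module K "FO (day M N) p" for p by (rule day_module)

lemma cls_pure: "D.cls p [(i, v, j, w, Emb A a)] = pure M N p i v j w a"
  by (simp add: pure_def day_elt_cls[OF M N])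

lemma day_gensE:
  assumes "g \<in> day_gens A M N p"
  obtains i v j w a where "g = (i, v, j, w, Emb A a)" "i + j = p" "v \<in> el M i"
    "w \<in> el N j" "a \<in> \<A> p"
  using assms by (auto simp: day_gens_def)

lemma day_gensI:
  "\<lbrakk>i + j = p; v \<in> el M i; w \<in> el N j; a \<in> \<A> p\<rbrakk> \<Longrightarrow>
    (i, v, j, w, Emb A a) \<in> day_gens A M N p"
  by (simp add: day_gens_iff)

lemma pure_closed:
  "\<lbrakk>i + j = p; v \<in> el M i; w \<in> el N j; a \<in> \<A> p\<rbrakk> \<Longrightarrow>
    pure M N p i v j w a \<in> el (day M N) p"
  unfolding cls_pure[symmetric] day_space_eq by (rule D.cls_closed) (simp add: day_gensI)

lemma pure_rel:
  assumes "i + j = p" "v \<in> el M i" "w \<in> el N j" "a \<in> \<A> p"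
  shows pure_add_left: "v' \<in> el M i \<Longrightarrow> pure M N p i (v \<oplus>\<^bsub>FO M i\<^esub> v') j w a =
     pure M N p i v j w a \<oplus>\<^bsub>FO (day M N) p\<^esub> pure M N p i v' j w a"
    and pure_add_right: "w' \<in> el N j \<Longrightarrow> pure M N p i v j (w \<oplus>\<^bsub>FO N j\<^esub> w') a =
     pure M N p i v j w a \<oplus>\<^bsub>FO (day M N) p\<^esub> pure M N p i v j w' a"
    and pure_add_alg: "a' \<in> \<A> p \<Longrightarrow> pure M N p i v j w (a \<oplus>\<^bsub>Alg A p\<^esub> a') =
     pure M N p i v j w a \<oplus>\<^bsub>FO (day M N) p\<^esub> pure M N p i v j w a'"
    and pure_smult_left: "r \<in> carrier K \<Longrightarrow> pure M N p i (r \<odot>\<^bsub>FO M i\<^esub> v) j w a =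
     r \<odot>\<^bsub>FO (day M N) p\<^esub> pure M N p i v j w a"
    and pure_smult_right: "r \<in> carrier K \<Longrightarrow> pure M N p i v j (r \<odot>\<^bsub>FO N j\<^esub> w) a =
     r \<odot>\<^bsub>FO (day M N) p\<^esub> pure M N p i v j w a"
    and pure_balanced: "\<lbrakk>b \<in> \<A> i; b' \<in> \<A> j\<rbrakk> \<Longrightarrow>
     pure M N p i (act M i v b) j (act N j w b') a = pure M N p i v j w (Mu A i j b b' \<otimes>\<^bsub>Alg A p\<^esub> a)"
    and pure_smult_alg: "r \<in> carrier K \<Longrightarrow> pure M N p i v j w (r \<odot>\<^bsub>Alg A p\<^esub> a) =
     r \<odot>\<^bsub>FO (day M N) p\<^esub> pure M N p i v j w a"
proof -
  note g = assms
  have ad: "pure M N p i v j w a \<oplus>\<^bsub>FO (day M N) p\<^esub> pure M N p i' v' j' w' a' =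
    D.cls p [(i, v, j, w, Emb A a), (i', v', j', w', Emb A a')]" for i v j w a i' v' j' w' a'
    unfolding cls_pure[symmetric] day_space_eq by (simp add: D.cls_add)
  show "pure M N p i (v \<oplus>\<^bsub>FO M i\<^esub> v') j w a =
     pure M N p i v j w a \<oplus>\<^bsub>FO (day M N) p\<^esub> pure M N p i v' j w a" if "v' \<in> el M i"
    unfolding ad unfolding cls_pure[symmetric] D.cls_eq_iff using g that
    by (intro sum_eq.rel day_rel.add_left)
  show "pure M N p i v j (w \<oplus>\<^bsub>FO N j\<^esub> w') a =
     pure M N p i v j w a \<oplus>\<^bsub>FO (day M N) p\<^esub> pure M N p i v j w' a" if "w' \<in> el N j"
    unfolding ad unfolding cls_pure[symmetric] D.cls_eq_iff using g that
    by (intro sum_eq.rel day_rel.add_right)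
  show "pure M N p i v j w (a \<oplus>\<^bsub>Alg A p\<^esub> a') =
     pure M N p i v j w a \<oplus>\<^bsub>FO (day M N) p\<^esub> pure M N p i v j w a'" if "a' \<in> \<A> p"
    unfolding ad unfolding cls_pure[symmetric] D.cls_eq_iff using g that
    by (intro sum_eq.rel day_rel.add_alg)
  have sl: "pure M N p i (r \<odot>\<^bsub>FO M i\<^esub> v) j w a = r \<odot>\<^bsub>FO (day M N) p\<^esub> pure M N p i v j w a"
    if "r \<in> carrier K" for r a
    unfolding cls_pure[symmetric] day_space_eq D.cls_smult[OF that] by simp
  then show "r \<in> carrier K \<Longrightarrow> pure M N p i (r \<odot>\<^bsub>FO M i\<^esub> v) j w a = r \<odot>\<^bsub>FO (day M N) p\<^esub> pure M N p i v j w a" .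
  have "pure M N p i (r \<odot>\<^bsub>FO M i\<^esub> v) j w a = pure M N p i v j (r \<odot>\<^bsub>FO N j\<^esub> w) a" if "r \<in> carrier K"
    unfolding cls_pure[symmetric] D.cls_eq_iff using g that by (intro sum_eq.rel day_rel.scalar)
  then show "r \<in> carrier K \<Longrightarrow> pure M N p i v j (r \<odot>\<^bsub>FO N j\<^esub> w) a = r \<odot>\<^bsub>FO (day M N) p\<^esub> pure M N p i v j w a"
    using sl by simp
  have bal: "pure M N p i (act M i v b) j (act N j w b') a = pure M N p i v j w (Mu A i j b b' \<otimes>\<^bsub>Alg A p\<^esub> a)"
    if "b \<in> \<A> i" "b' \<in> \<A> j" for b b'
    unfolding cls_pure[symmetric] D.cls_eq_iff using g that by (intro sum_eq.rel day_rel.balanced)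
  then show "\<lbrakk>b \<in> \<A> i; b' \<in> \<A> j\<rbrakk> \<Longrightarrow>
     pure M N p i (act M i v b) j (act N j w b') a = pure M N p i v j w (Mu A i j b b' \<otimes>\<^bsub>Alg A p\<^esub> a)" .
  \<comment> \<open>No relation mentions scalars in the algebra slot. They are obtained by balancing
    with \<open>r\<close> times the unit of the left algebra and the unit of the right one.\<close>
  show "pure M N p i v j w (r \<odot>\<^bsub>Alg A p\<^esub> a) = r \<odot>\<^bsub>FO (day M N) p\<^esub> pure M N p i v j w a"
    if "r \<in> carrier K"
    using sl[OF that] bal[of "r \<odot>\<^bsub>Alg A i\<^esub> (\<e> i)" "(\<e> j)"] g that
     mu_smult_l[OF that, of "(\<e> i)" i "(\<e> j)" j] smult_mult_l[OF that, of "(\<e> p)" p a]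
    by (simp add: act_smult_alg M act_one N mu_one)
qed

lemma pure_zero:
  assumes "i + j = p" "w \<in> el N j" "a \<in> \<A> p"
  shows "pure M N p i \<zero>\<^bsub>FO M i\<^esub> j w a = \<zero>\<^bsub>FO (day M N) p\<^esub>"
  unfolding cls_pure[symmetric] day_space_eq D.cls_Nil D.cls_eq_iff using assms
  by (intro sum_eq.rel day_rel.zero)

lemma day_ext:
  assumes W: "module K W" and h: "klinear K (FO (day M N) p) W h" "klinear K (FO (day M N) p) W h'"
    and eq: "\<And>i v j w a. \<lbrakk>i + j = p; v \<in> el M i; w \<in> el N j; a \<in> \<A> p\<rbrakk> \<Longrightarrow>
     h (pure M N p i v j w a) = h' (pure M N p i v j w a)"
    and x: "x \<in> el (day M N) p"
  shows "h x = h' x"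
  using D.klinear_ext[OF W h[unfolded day_space_eq] _ x[unfolded day_space_eq]] eq
  by (metis (full_types) cls_pure day_gensE)

lemma day_map:
  assumes b: "day_bilin M N p W \<phi>"
  shows "klinear K (FO (day M N) p) W (day_map W \<phi>)"
    and "\<lbrakk>i + j = p; v \<in> el M i; w \<in> el N j; a \<in> \<A> p\<rbrakk> \<Longrightarrow>
     day_map W \<phi> (pure M N p i v j w a) = \<phi> i v j w a"
proof -
  let ?f = "\<lambda>(i, v, j, w, a). \<phi> i v j w (Unemb A a)"
  have W: "module K W" using b by (simp add: day_bilin_def)
  interpret W: module K W by fact
  have 1: "klinear K (FO M i) W (\<lambda>v. \<phi> i v j w a)"
    if "i + j = p" "w \<in> el N j" "a \<in> \<A> p" for i j w a
    using b that by (simp add: day_bilin_def)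
  have 2: "klinear K (FO N j) W (\<lambda>w. \<phi> i v j w a)"
    if "i + j = p" "v \<in> el M i" "a \<in> \<A> p" for i j v a
    using b that by (simp add: day_bilin_def)
  have 3: "klinear K (Alg A p) W (\<phi> i v j w)"
    if "i + j = p" "v \<in> el M i" "w \<in> el N j" for i j v w
    using b that by (simp add: day_bilin_def)
  have 4: "\<phi> i (act M i v b) j (act N j w b') a = \<phi> i v j w (Mu A i j b b' \<otimes>\<^bsub>Alg A p\<^esub> a)"
    if "i + j = p" "v \<in> el M i" "w \<in> el N j" "a \<in> \<A> p"
     "b \<in> \<A> i" "b' \<in> \<A> j" for i j v w a b b'
    using b that by (simp add: day_bilin_def)
  have f: "?f g \<in> carrier W" if "g \<in> day_gens A M N p" for g
    using that by (elim day_gensE) (auto intro: klinearD(1)[OF 1])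
  have rel: "term_sum W ?f P = term_sum W ?f Q" if "day_rel K A M N p P Q" for P Q
    using that
  proof (cases rule: day_rel.cases)
    case (add_left i j v v' w a)
    then show ?thesis by (simp add: klinearD[OF 1])
  next
    case (add_right i j v w w' a)
    then show ?thesis by (simp add: klinearD[OF 2])
  next
    case (add_alg i j v w a a')
    then show ?thesis by (simp add: klinearD[OF 3])
  next
    case (zero i j w a)
    then show ?thesis using klinear_zero[OF obj_module[OF M] W 1] by simp
  next
    case (scalar i j v w a r)
    then show ?thesis by (simp add: klinearD[OF 1] klinearD[OF 2])
  next
    case (balanced i j v w a b b')
    then show ?thesis by (simp add: 4)
  qed
  have fs: "?f ((\<lambda>(i, v, j, w, a). (i, r \<odot>\<^bsub>FO M i\<^esub> v, j, w, a)) g) = r \<odot>\<^bsub>W\<^esub> ?f g"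
    if "r \<in> carrier K" "g \<in> day_gens A M N p" for r g
    using that by (elim day_gensE) (auto simp: klinearD(3)[OF 1])
  show "klinear K (FO (day M N) p) W (day_map W \<phi>)"
    using D.lift(1)[OF W f rel fs] unfolding day_space_eq day_map_def .
  show "\<lbrakk>i + j = p; v \<in> el M i; w \<in> el N j; a \<in> \<A> p\<rbrakk> \<Longrightarrow>
     day_map W \<phi> (pure M N p i v j w a) = \<phi> i v j w a"
    using D.lift(2)[OF W f rel fs day_gensI[of i j p v w a]] by (simp add: day_map_def cls_pure)
qed

text \<open>Linearity in a parameter is inherited from pure tensors: for fixed parameters both sides
  of each law are linear in \<open>x\<close>, hence agree by \<open>day_ext\<close>. This gives
  linearity of the actions in the algebra element and the remaining linearities for iterated
  convolutions.\<close>

lemma day_map_param: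
  assumes U: "\<And>t. t \<in> carrier U \<Longrightarrow> day_bilin M N p W (\<psi> t)" and UM: "module K U" and W: "module K W"
    and l: "\<And>i v j w a. \<lbrakk>i + j = p; v \<in> el M i; w \<in> el N j; a \<in> \<A> p\<rbrakk> \<Longrightarrow>
     klinear K U W (\<lambda>t. \<psi> t i v j w a)"
    and x: "x \<in> el (day M N) p"
  shows "klinear K U W (\<lambda>t. day_map W (\<psi> t) x)"
proof -
  interpret W: module K W by (rule W)
  interpret U: module K U by (rule UM)
  let ?D = "FO (day M N) p"
  show ?thesis
  proof (rule klinearI)
    fix b c assume b: "b \<in> carrier U" "c \<in> carrier U"
    have "klinear K ?D W (\<lambda>x. day_map W (\<psi> b) x \<oplus>\<^bsub>W\<^esub> day_map W (\<psi> c) x)"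
     by (rule klinearI) (simp_all add: klinearD[OF day_map(1)[OF U[OF b(1)]]]
      klinearD[OF day_map(1)[OF U[OF b(2)]]] W.smult_r_distr W.a_ac)
    from day_ext[OF W day_map(1)[OF U[OF U.a_closed[OF b]]] this _ x]
    show "day_map W (\<psi> (b \<oplus>\<^bsub>U\<^esub> c)) x = day_map W (\<psi> b) x \<oplus>\<^bsub>W\<^esub> day_map W (\<psi> c) x"
     using b by (simp add: day_map(2)[OF U] klinearD(2)[OF l])
  next
    fix r b assume b: "r \<in> carrier K" "b \<in> carrier U"
    have "klinear K ?D W (\<lambda>x. r \<odot>\<^bsub>W\<^esub> day_map W (\<psi> b) x)"
     by (rule klinearI) (simp_all add: klinearD[OF day_map(1)[OF U[OF b(2)]]] b(1)
      W.smult_r_distr W.smult_assoc1[symmetric] K.m_comm)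
    from day_ext[OF W day_map(1)[OF U[OF U.smult_closed[OF b]]] this _ x]
    show "day_map W (\<psi> (r \<odot>\<^bsub>U\<^esub> b)) x = r \<odot>\<^bsub>W\<^esub> day_map W (\<psi> b) x"
     using b by (simp add: day_map(2)[OF U] klinearD(3)[OF l])
  qed (rule klinearD(1)[OF day_map(1)[OF U] x])
qed

lemma day_terms_gens: "x \<in> el (day M N) p \<Longrightarrow> set (day_terms x) \<subseteq> day_gens A M N p"
  using D.cls_d unfolding day_space_eq by blast

lemma day_map_cong:
  assumes "x \<in> el (day M N) p"
    and "\<And>i v j w a. \<lbrakk>i + j = p; v \<in> el M i; w \<in> el N j; a \<in> \<A> p\<rbrakk> \<Longrightarrow>
     f (i, v, j, w, Emb A a) = \<phi> i v j w a"
  shows "term_sum W f (day_terms x) = day_map W \<phi> x"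
  unfolding day_map_def
proof (rule term_sum_cong)
  fix g assume "g \<in> set (day_terms x)"
  then have "g \<in> day_gens A M N p" using day_terms_gens[OF assms(1)] by blast
  then show "f g = (case g of (i, v, j, w, a) \<Rightarrow> \<phi> i v j w (Unemb A a))"
    by (elim day_gensE) (simp add: assms(2))
qed

lemma day_elt_concat:
  assumes "\<And>g. g \<in> set P \<Longrightarrow> set (F g) \<subseteq> day_gens A M N p"
  shows "day_elt K A M N p (concat (map F P)) = term_sum (FO (day M N) p) (\<lambda>g. day_elt K A M N p (F g)) P"
  using D.cls_concat[of P F p] assms unfolding day_space_eq by (simp add: day_elt_cls[OF M N])

lemma day_elt_map:
  assumes "\<And>g. g \<in> set P \<Longrightarrow> F g \<in> day_gens A M N p"
  shows "day_elt K A M N p (map F P) = term_sum (FO (day M N) p) (\<lambda>g. day_elt K A M N p [F g]) P"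
  using D.cls_map[of P F p] assms unfolding day_space_eq by (simp add: day_elt_cls[OF M N])

lemma pure_klinear:
  assumes "i + j = p"
  shows "\<lbrakk>w \<in> el N j; a \<in> \<A> p\<rbrakk> \<Longrightarrow> klinear K (FO M i) (FO (day M N) p) (\<lambda>v. pure M N p i v j w a)"
    and "\<lbrakk>v \<in> el M i; a \<in> \<A> p\<rbrakk> \<Longrightarrow> klinear K (FO N j) (FO (day M N) p) (\<lambda>w. pure M N p i v j w a)"
    and "\<lbrakk>v \<in> el M i; w \<in> el N j\<rbrakk> \<Longrightarrow> klinear K (Alg A p) (FO (day M N) p) (pure M N p i v j w)"
  using assms by (auto intro!: klinearI pure_closed pure_rel)

lemma day_act_bilin:
  assumes b: "b \<in> \<A> p"
  shows "day_bilin M N p (FO (day M N) p) (\<lambda>i v j w a. pure M N p i v j w (a \<otimes>\<^bsub>Alg A p\<^esub> b))"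
  unfolding day_bilin_def
proof (intro conjI allI impI ballI day_module, goal_cases)
  case 1 then show ?case using b by (auto intro!: pure_klinear)
next
  case 2 then show ?case using b by (auto intro!: pure_klinear)
next
  case (3 i j v w)
  have "klinear K (Alg A p) (Alg A p) (\<lambda>a. a \<otimes>\<^bsub>Alg A p\<^esub> b)"
    using b by (auto intro!: klinearI simp: alg.l_distr smult_mult_l)
  from klinear_comp[OF this pure_klinear(3)[OF 3]] show ?case .
next
  case (4 i j v w a c c')
  then show ?case using b mu_closed[of c i c' j] by (simp add: pure_balanced alg.m_assoc)
qed

text \<open>The action is defined on stored terms; here it is identified with the map induced by
  right multiplication in the algebra slot, for which linearity and the module laws can be checked
  on pure tensors.\<close>

lemma day_obj_eq: "day M N = mk_obj (FO (day M N))
    (\<lambda>p x b. day_map (FO (day M N) p) (\<lambda>i v j w a. pure M N p i v j w (a \<otimes>\<^bsub>Alg A p\<^esub> b)) x)"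
proof -
  have "day_elt K A M N p (map (\<lambda>(i, v, j, w, a). (i, v, j, w, Emb A (Unemb A a \<otimes>\<^bsub>Alg A p\<^esub> b))) (day_terms x)) =
    day_map (FO (day M N) p) (\<lambda>i v j w a. pure M N p i v j w (a \<otimes>\<^bsub>Alg A p\<^esub> b)) x"
    if x: "x \<in> el (day M N) p" and b: "b \<in> \<A> p" for p x b
  proof -
    let ?F = "\<lambda>(i, v, j, w, a). (i, v, j, w, Emb A (Unemb A a \<otimes>\<^bsub>Alg A p\<^esub> b))"
    have "?F g \<in> day_gens A M N p" if "g \<in> set (day_terms x)" for g
     using day_terms_gens[OF x] that b by (auto elim!: day_gensE dest!: subsetD simp: day_gens_iff)
    then have "day_elt K A M N p (map ?F (day_terms x)) =
      term_sum (FO (day M N) p) (\<lambda>g. day_elt K A M N p [?F g]) (day_terms x)"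
     by (rule day_elt_map)
    also have "\<dots> = day_map (FO (day M N) p) (\<lambda>i v j w a. pure M N p i v j w (a \<otimes>\<^bsub>Alg A p\<^esub> b)) x"
     by (rule day_map_cong[OF x]) (simp add: pure_def)
    finally show ?thesis .
  qed
  then have "FA (day M N) = FA (mk_obj (FO (day M N))
    (\<lambda>p x b. day_map (FO (day M N) p) (\<lambda>i v j w a. pure M N p i v j w (a \<otimes>\<^bsub>Alg A p\<^esub> b)) x))"
    unfolding mk_obj_def funct.select_convs
    by (subst day_obj_def, unfold funct.select_convs, intro restrict_ext)
     (auto simp: day_obj_def bar_arrows intro!: lmap_of_cong)
  then show ?thesis by (intro funct.equality) (simp_all add: mk_obj_def)
qed

lemma day_obj: "day M N \<in> Ob CC"
proof (subst day_obj_eq, rule mk_obj[OF day_module], goal_cases)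
  case (1 p b) show ?case by (rule day_map(1)[OF day_act_bilin[OF 1]])
next
  case (2 p x)
  show ?case
  proof (rule day_map_param[OF day_act_bilin alg_module day_module _ 2])
    fix i v j w a assume g: "i + j = p" "v \<in> el M i" "w \<in> el N j" "a \<in> \<A> p"
    have "klinear K (Alg A p) (Alg A p) (\<lambda>b. a \<otimes>\<^bsub>Alg A p\<^esub> b)"
     using g by (auto intro!: klinearI simp: alg.r_distr smult_mult_r)
    from klinear_comp[OF this pure_klinear(3)[OF g(1-3)]]
    show "klinear K (Alg A p) (FO (day M N) p) (\<lambda>b. pure M N p i v j w (a \<otimes>\<^bsub>Alg A p\<^esub> b))" .
  qed
next
  case (3 p x)
  have "klinear K (FO (day M N) p) (FO (day M N) p) (\<lambda>x. x)" by (rule klinearI) simp_all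
  from day_ext[OF day_module day_map(1)[OF day_act_bilin] this _ 3] show ?case
    by (simp add: day_map(2)[OF day_act_bilin])
next
  case (4 p x a b)
  from day_ext[OF day_module klinear_comp[OF day_map(1)[OF day_act_bilin[OF 4(2)]] day_map(1)[OF day_act_bilin[OF 4(3)]]]
    day_map(1)[OF day_act_bilin[OF alg.m_closed[OF 4(2,3)]]] _ 4(1)] show ?case
    using 4 by (simp add: day_map(2)[OF day_act_bilin] alg.m_assoc)
qed

lemma day_act:
  assumes "i + j = p" "v \<in> el M i" "w \<in> el N j" "a \<in> \<A> p" "b \<in> \<A> p"
  shows "act (day M N) p (pure M N p i v j w a) b = pure M N p i v j w (a \<otimes>\<^bsub>Alg A p\<^esub> b)"
  by (subst day_obj_eq, subst mk_obj_act)
    (use assms in \<open>simp_all add: pure_closed day_map(2)[OF day_act_bilin]\<close>)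

text \<open>Linearity comes from \<open>day_map\<close>; compatibility with the actions is an
  identity between linear maps and is therefore tested on pure tensors.\<close>

lemma day_hom:
  assumes P: "P \<in> Ob CC" and b: "\<And>p. day_bilin M N p (FO P p) (\<phi> p)"
    and eq: "\<And>p i v j w a b. \<lbrakk>i + j = p; v \<in> el M i; w \<in> el N j; a \<in> \<A> p;
     b \<in> \<A> p\<rbrakk> \<Longrightarrow> \<phi> p i v j w (a \<otimes>\<^bsub>Alg A p\<^esub> b) = act P p (\<phi> p i v j w a) b"
  shows "day_hom M N P \<phi> \<in> mor CC (day M N) P"
    and "\<lbrakk>i + j = p; v \<in> el M i; w \<in> el N j; a \<in> \<A> p\<rbrakk> \<Longrightarrow>
     ap (day_hom M N P \<phi>) p (pure M N p i v j w a) = \<phi> p i v j w a"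
proof -
  show "day_hom M N P \<phi> \<in> mor CC (day M N) P"
    unfolding day_hom_def
  proof (rule mk_arr[OF day_obj P day_map(1)[OF b]])
    fix p x c assume x: "x \<in> el (day M N) p" and c: "c \<in> \<A> p"
    show "day_map (FO P p) (\<phi> p) (act (day M N) p x c) = act P p (day_map (FO P p) (\<phi> p) x) c"
     by (rule day_ext[OF obj_module[OF P] klinear_comp[OF act_klinear[OF day_obj c] day_map(1)[OF b]]
        klinear_comp[OF day_map(1)[OF b] act_klinear[OF P c]] _ x])
      (use c in \<open>simp add: day_act day_map(2)[OF b] eq\<close>)
  qed
  show "\<lbrakk>i + j = p; v \<in> el M i; w \<in> el N j; a \<in> \<A> p\<rbrakk> \<Longrightarrow>
     ap (day_hom M N P \<phi>) p (pure M N p i v j w a) = \<phi> p i v j w a"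
    unfolding day_hom_def by (simp add: pure_closed day_map(2)[OF b])
qed

lemma day_hom_eqI:
  assumes P: "P \<in> Ob CC" and h: "h \<in> mor CC (day M N) P" "h' \<in> mor CC (day M N) P"
    and eq: "\<And>p i v j w a. \<lbrakk>i + j = p; v \<in> el M i; w \<in> el N j; a \<in> \<A> p\<rbrakk> \<Longrightarrow>
     ap h p (pure M N p i v j w a) = ap h' p (pure M N p i v j w a)"
  shows "h = h'"
  by (rule mor_eqI[OF day_obj h]) (rule day_ext[OF obj_module[OF P] mor_klinear[OF day_obj h(1)] mor_klinear[OF day_obj h(2)] eq])

end

end

section \<open>Day convolution of arrows\<close>

context algebra_sequence
begin

lemma klinear_const_zero: "module K W \<Longrightarrow> klinear K V W (\<lambda>_. \<zero>\<^bsub>W\<^esub>)"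
proof -
  assume "module K W"
  then interpret module K W .
  show ?thesis by (rule klinearI) simp_all
qed

lemma day_bilinI:
  assumes "module K W"
    and "\<And>i j w a. \<lbrakk>i + j = p; w \<in> el N j; a \<in> \<A> p\<rbrakk> \<Longrightarrow> klinear K (FO M i) W (\<lambda>v. \<phi> i v j w a)"
    and "\<And>i j v a. \<lbrakk>i + j = p; v \<in> el M i; a \<in> \<A> p\<rbrakk> \<Longrightarrow> klinear K (FO N j) W (\<lambda>w. \<phi> i v j w a)"
    and "\<And>i j v w. \<lbrakk>i + j = p; v \<in> el M i; w \<in> el N j\<rbrakk> \<Longrightarrow> klinear K (Alg A p) W (\<phi> i v j w)"
    and "\<And>i j v w a b b'. \<lbrakk>i + j = p; v \<in> el M i; w \<in> el N j; a \<in> \<A> p;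
      b \<in> \<A> i; b' \<in> \<A> j\<rbrakk> \<Longrightarrow>
     \<phi> i (act M i v b) j (act N j w b') a = \<phi> i v j w (Mu A i j b b' \<otimes>\<^bsub>Alg A p\<^esub> a)"
  shows "day_bilin M N p W \<phi>"
  using assms by (simp add: day_bilin_def)

lemma mult_klinear:
  assumes "b \<in> \<A> p"
  shows "klinear K (Alg A p) (Alg A p) (\<lambda>a. a \<otimes>\<^bsub>Alg A p\<^esub> b)" "klinear K (Alg A p) (Alg A p) (\<lambda>a. b \<otimes>\<^bsub>Alg A p\<^esub> a)"
  using assms by (auto intro!: klinearI simp: alg.l_distr alg.r_distr smult_mult_l smult_mult_r)

lemma mu_klinear:
  assumes "i + j = p"
  shows "b \<in> \<A> j \<Longrightarrow> klinear K (Alg A i) (Alg A p) (\<lambda>a. Mu A i j a b)"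
    and "a \<in> \<A> i \<Longrightarrow> klinear K (Alg A j) (Alg A p) (Mu A i j a)"
  using assms by (auto intro!: klinearI simp: mu_closed mu_add_l mu_add_r mu_smult_l mu_smult_r)

lemma mu_closed': "\<lbrakk>i + j = p; a \<in> \<A> i; b \<in> \<A> j\<rbrakk> \<Longrightarrow> Mu A i j a b \<in> \<A> p"
  using mu_closed by auto

lemma day_arr_bilin:
  assumes o: "M \<in> Ob CC" "N \<in> Ob CC" "M' \<in> Ob CC" "N' \<in> Ob CC"
    and \<alpha>: "\<alpha> \<in> mor CC M M'" and \<beta>: "\<beta> \<in> mor CC N N'"
  shows "day_bilin M N p (FO (day M' N') p)
    (\<lambda>i v j w a. pure M' N' p i (ap \<alpha> i v) j (ap \<beta> j w) a)"
proof (rule day_bilinI[OF day_module[OF o(3,4)]], goal_cases)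
  case 1
  then show ?case
    by (intro klinear_comp[OF mor_klinear[OF o(1) \<alpha>] pure_klinear(1)[OF o(3,4)]] klinearD(1)[OF mor_klinear[OF o(2) \<beta>]])
next
  case 2
  then show ?case
    by (intro klinear_comp[OF mor_klinear[OF o(2) \<beta>] pure_klinear(2)[OF o(3,4)]] klinearD(1)[OF mor_klinear[OF o(1) \<alpha>]])
next
  case 3
  then show ?case
    by (intro pure_klinear(3)[OF o(3,4)] klinearD(1)[OF mor_klinear[OF o(1) \<alpha>]] klinearD(1)[OF mor_klinear[OF o(2) \<beta>]])
next
  case (4 i j v w a b b')
  then show ?case
    using mor_act[OF o(1,3) \<alpha> 4(2,5)] mor_act[OF o(2,4) \<beta> 4(3,6)]
    by (simp add: pure_balanced[OF o(3,4)] klinearD(1)[OF mor_klinear[OF o(1) \<alpha>]] klinearD(1)[OF mor_klinear[OF o(2) \<beta>]])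
qed

lemma
  assumes o: "M \<in> Ob CC" "N \<in> Ob CC" "M' \<in> Ob CC" "N' \<in> Ob CC"
    and \<alpha>: "\<alpha> \<in> mor CC M M'" and \<beta>: "\<beta> \<in> mor CC N N'"
  shows day_arr: "day_arr K A \<alpha> \<beta> \<in> mor CC (day M N) (day M' N')"
    and day_arr_apply: "\<lbrakk>i + j = p; v \<in> el M i; w \<in> el N j; a \<in> \<A> p\<rbrakk> \<Longrightarrow>
     ap (day_arr K A \<alpha> \<beta>) p (pure M N p i v j w a) = pure M' N' p i (ap \<alpha> i v) j (ap \<beta> j w) a"
proof -
  let ?\<phi> = "\<lambda>p i v j w a. pure M' N' p i (ap \<alpha> i v) j (ap \<beta> j w) a"
  have eq: "day_arr K A \<alpha> \<beta> = day_hom M N (day M' N') ?\<phi>"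
  proof -
    have "day_elt K A M' N' p (map (\<lambda>(i, v, j, w, a). (i, ap \<alpha> i v, j, ap \<beta> j w, a)) (day_terms x)) =
     day_map (FO (day M' N') p) (?\<phi> p) x" if x: "x \<in> el (day M N) p" for p x
    proof -
     let ?F = "\<lambda>(i, v, j, w, a). (i, ap \<alpha> i v, j, ap \<beta> j w, a)"
     have "?F g \<in> day_gens A M' N' p" if "g \<in> set (day_terms x)" for g
      using subsetD[OF day_terms_gens[OF o(1,2) x] that]
      by (elim day_gensE[OF o(1,2)])
       (simp add: day_gens_iff klinearD(1)[OF mor_klinear[OF o(1) \<alpha>]] klinearD(1)[OF mor_klinear[OF o(2) \<beta>]])
     from day_elt_map[OF o(3,4) this]
     have "day_elt K A M' N' p (map ?F (day_terms x)) =
      term_sum (FO (day M' N') p) (\<lambda>g. day_elt K A M' N' p [?F g]) (day_terms x)" .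
     also have "\<dots> = day_map (FO (day M' N') p) (?\<phi> p) x"
      by (rule day_map_cong[OF o(1,2) x]) (simp add: pure_def)
     finally show ?thesis .
    qed
    then show ?thesis
     unfolding day_arr_def day_hom_def mk_arr_def mor_Src[OF o(1) \<alpha>] mor_Tgt[OF o(1) \<alpha>]
      mor_Src[OF o(2) \<beta>] mor_Tgt[OF o(2) \<beta>]
     by (auto simp: day_obj_def fun_eq_iff intro!: lmap_of_cong)
  qed
  note h = day_hom[OF o(1,2) day_obj[OF o(3,4)] day_arr_bilin[OF o \<alpha> \<beta>]]
  have act: "?\<phi> p i v j w (a \<otimes>\<^bsub>Alg A p\<^esub> b) = act (day M' N') p (?\<phi> p i v j w a) b"
    if "i + j = p" "v \<in> el M i" "w \<in> el N j" "a \<in> \<A> p" "b \<in> \<A> p"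
    for p i v j w a b
    using that by (simp add: day_act[OF o(3,4)] klinearD(1)[OF mor_klinear[OF o(1) \<alpha>]] klinearD(1)[OF mor_klinear[OF o(2) \<beta>]])
  show "day_arr K A \<alpha> \<beta> \<in> mor CC (day M N) (day M' N')"
    unfolding eq by (rule h(1)[OF act])
  show "\<lbrakk>i + j = p; v \<in> el M i; w \<in> el N j; a \<in> \<A> p\<rbrakk> \<Longrightarrow>
     ap (day_arr K A \<alpha> \<beta>) p (pure M N p i v j w a) = pure M' N' p i (ap \<alpha> i v) j (ap \<beta> j w) a"
    unfolding eq by (rule h(2)[OF act])
qed

section \<open>The associativity constraint\<close>

context
  fixes M N P assumes M: "M \<in> Ob CC" and N: "N \<in> Ob CC" and P: "P \<in> Ob CC"
begin

abbreviation (input) "MN \<equiv> day M N"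
abbreviation (input) "NP \<equiv> day N P"
abbreviation (input) "M_NP \<equiv> day M NP"

lemma MN: "MN \<in> Ob CC" and NP: "NP \<in> Ob CC" and M_NP: "M_NP \<in> Ob CC"
  using M N P by (auto intro: day_obj)

text \<open>The associator is built in two stages that mirror the nested lists of
  \<open>day_assoc\<close>. Here the outer data \<open>w\<close> and \<open>b\<close> are fixed and
  the inner tensor is pure; in \<open>assoc_out\<close> the inner tensor is an arbitrary element
  \<open>y\<close>.\<close>

definition assoc_in :: "nat \<Rightarrow> nat \<Rightarrow> nat \<Rightarrow> ('k, 'u) univ \<Rightarrow> 'x \<Rightarrow>
    nat \<Rightarrow> ('k, 'u) univ \<Rightarrow> nat \<Rightarrow> ('k, 'u) univ \<Rightarrow> 'x \<Rightarrow> ('k, 'u) univ" where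
  "assoc_in p l k w b i u j v a = pure M NP p i u (j + k) (pure N P (j + k) j v k w (\<e> (j + k)))
    (Mu A l k a (\<e> k) \<otimes>\<^bsub>Alg A p\<^esub> b)"

definition assoc_out :: "nat \<Rightarrow> nat \<Rightarrow> ('k, 'u) univ \<Rightarrow> nat \<Rightarrow> ('k, 'u) univ \<Rightarrow> 'x \<Rightarrow> ('k, 'u) univ" where
  "assoc_out p l y k w b = day_map (FO M_NP p) (assoc_in p l k w b) y"

text \<open>Rewrites a balancing step in the inner convolution as a right action on its element,
  which the outer convolution can then balance.\<close>

lemma pure_act:
  assumes "v \<in> el N j" "w \<in> el P k" "c \<in> \<A> j" "c' \<in> \<A> k"
  shows "pure N P (j + k) j (act N j v c) k (act P k w c') (\<e> (j + k)) =
    act NP (j + k) (pure N P (j + k) j v k w (\<e> (j + k))) (Mu A j k c c')"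
  using assms by (simp add: pure_balanced[OF N P] day_act[OF N P] mu_closed)

lemma assoc_in_klinear:
  assumes lk: "l + k = p" and ij: "i + j = l" and u: "u \<in> el M i" and v: "v \<in> el N j"
    and a: "a \<in> \<A> l" and w: "w \<in> el P k" and b: "b \<in> \<A> p"
  shows "klinear K (FO M i) (FO M_NP p) (\<lambda>u. assoc_in p l k w b i u j v a)"
    and "klinear K (FO N j) (FO M_NP p) (\<lambda>v. assoc_in p l k w b i u j v a)"
    and "klinear K (Alg A l) (FO M_NP p) (assoc_in p l k w b i u j v)"
    and "klinear K (FO P k) (FO M_NP p) (\<lambda>w. assoc_in p l k w b i u j v a)"
    and "klinear K (Alg A p) (FO M_NP p) (\<lambda>b. assoc_in p l k w b i u j v a)"
proof -
  have ijk: "i + (j + k) = p" using lk ij by simp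
  note c = pure_closed[OF N P HOL.refl v w alg.one_closed] mu_closed'[OF lk a alg.one_closed]
  have X: "Mu A l k a (\<e> k) \<otimes>\<^bsub>Alg A p\<^esub> b \<in> \<A> p" using c b by simp
  show "klinear K (FO M i) (FO M_NP p) (\<lambda>u. assoc_in p l k w b i u j v a)"
    unfolding assoc_in_def by (rule pure_klinear(1)[OF M NP ijk c(1) X])
  show "klinear K (FO N j) (FO M_NP p) (\<lambda>v. assoc_in p l k w b i u j v a)"
    unfolding assoc_in_def
    by (rule klinear_comp[OF pure_klinear(1)[OF N P HOL.refl w alg.one_closed] pure_klinear(2)[OF M NP ijk u X]])
  show "klinear K (FO P k) (FO M_NP p) (\<lambda>w. assoc_in p l k w b i u j v a)"
    unfolding assoc_in_def
    by (rule klinear_comp[OF pure_klinear(2)[OF N P HOL.refl v alg.one_closed] pure_klinear(2)[OF M NP ijk u X]])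
  show "klinear K (Alg A l) (FO M_NP p) (assoc_in p l k w b i u j v)"
    unfolding assoc_in_def
    by (rule klinear_comp[OF klinear_comp[OF mu_klinear(1)[OF lk alg.one_closed] mult_klinear(1)[OF b]]
     pure_klinear(3)[OF M NP ijk u c(1)]])
  show "klinear K (Alg A p) (FO M_NP p) (\<lambda>b. assoc_in p l k w b i u j v a)"
    unfolding assoc_in_def
    by (rule klinear_comp[OF mult_klinear(2)[OF c(2)] pure_klinear(3)[OF M NP ijk u c(1)]])
qed

lemma assoc_in_bilin:
  assumes lk: "l + k = p" and w: "w \<in> el P k" and b: "b \<in> \<A> p"
  shows "day_bilin M N l (FO M_NP p) (assoc_in p l k w b)"
proof (rule day_bilinI[OF obj_module[OF M_NP]], goal_cases)
  case (1 i j v a)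
  show ?case
    by (rule assoc_in_klinear(1)[OF lk 1(1) abelian_monoid.zero_closed[OF abelian_group.axioms(1)[OF module.axioms(2)[OF obj_module[OF M]]]] 1(2,3) w b])
next
  case (2 i j u a)
  show ?case
    by (rule assoc_in_klinear(2)[OF lk 2(1,2) abelian_monoid.zero_closed[OF abelian_group.axioms(1)[OF module.axioms(2)[OF obj_module[OF N]]]] 2(3) w b])
next
  case (3 i j u v)
  show ?case by (rule assoc_in_klinear(3)[OF lk 3 alg.zero_closed w b])
next
  case (4 i j u v a c c')
  have ijk: "i + (j + k) = p" using lk 4(1) by simp
  let ?X = "Mu A l k a (\<e> k) \<otimes>\<^bsub>Alg A p\<^esub> b"
  have X: "?X \<in> \<A> p" using b mu_closed'[OF lk 4(4) alg.one_closed] by simp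
  \<comment> \<open>Associativity of \<open>Mu\<close> regroups the nested product, and its
    multiplicativity absorbs the factor into \<open>a\<close>.\<close>
  have m: "Mu A i (j + k) c (Mu A j k c' (\<e> k)) \<otimes>\<^bsub>Alg A p\<^esub> ?X =
    Mu A l k (Mu A i j c c' \<otimes>\<^bsub>Alg A l\<^esub> a) (\<e> k) \<otimes>\<^bsub>Alg A p\<^esub> b"
    using 4 b lk mu_assoc[OF 4(5,6) alg.one_closed[of k]]
     mu_mult[OF mu_closed'[OF 4(1,5,6)] 4(4) alg.one_closed[of k] alg.one_closed[of k]]
     mu_closed'[OF 4(1,5,6)] mu_closed'[OF lk 4(4) alg.one_closed]
     mu_closed'[OF lk mu_closed'[OF 4(1,5,6)] alg.one_closed]
    by (simp add: alg.m_assoc[symmetric])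
  have "assoc_in p l k w b i (act M i u c) j (act N j v c') a =
    pure M NP p i (act M i u c) (j + k) (act NP (j + k) (pure N P (j + k) j v k w (\<e> (j + k))) (Mu A j k c' (\<e> k))) ?X"
    using pure_act[OF 4(3) w 4(6) alg.one_closed] by (simp add: assoc_in_def act_one[OF P w])
  also have "\<dots> = pure M NP p i u (j + k) (pure N P (j + k) j v k w (\<e> (j + k)))
     (Mu A i (j + k) c (Mu A j k c' (\<e> k)) \<otimes>\<^bsub>Alg A p\<^esub> ?X)"
    by (rule pure_balanced[OF M NP ijk 4(2) pure_closed[OF N P HOL.refl 4(3) w alg.one_closed] X 4(5) mu_closed[OF 4(6) alg.one_closed]])
  finally show ?case unfolding m assoc_in_def .
qed

lemma assoc_out_pure:
  assumes lk: "l + k = p" and ij: "i + j = l" and u: "u \<in> el M i" and v: "v \<in> el N j"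
    and a: "a \<in> \<A> l" and w: "w \<in> el P k" and b: "b \<in> \<A> p"
  shows "assoc_out p l (pure M N l i u j v a) k w b = assoc_in p l k w b i u j v a"
  unfolding assoc_out_def by (rule day_map(2)[OF M N assoc_in_bilin[OF lk w b] ij u v a])

lemma assoc_out_bilin: "day_bilin MN P p (FO M_NP p) (assoc_out p)"
proof (rule day_bilinI[OF obj_module[OF M_NP]], goal_cases)
  case (1 l k w b)
  show ?case unfolding assoc_out_def by (rule day_map(1)[OF M N assoc_in_bilin[OF 1]])
next
  case (2 l k y b)
  show ?case unfolding assoc_out_def
  proof (rule day_map_param[OF M N assoc_in_bilin obj_module[OF P] obj_module[OF M_NP] _ 2(2)], goal_cases)
    case (4 i u j v a)
    show ?case
     by (rule assoc_in_klinear(4)[OF 2(1) 4 abelian_monoid.zero_closed[OF abelian_group.axioms(1)[OF module.axioms(2)[OF obj_module[OF P]]]] 2(3)])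
  qed (use 2 in auto)
next
  case (3 l k y w)
  show ?case unfolding assoc_out_def
  proof (rule day_map_param[OF M N assoc_in_bilin alg_module obj_module[OF M_NP] _ 3(2)], goal_cases)
    case (4 i u j v a)
    show ?case by (rule assoc_in_klinear(5)[OF \<open>l + k = p\<close> 4 \<open>w \<in> _\<close> alg.zero_closed])
  qed (use 3 in auto)
next
  case (4 l k y w b c c')
  let ?m = "Mu A l k c c' \<otimes>\<^bsub>Alg A p\<^esub> b"
  have w': "act P k w c' \<in> el P k" using 4 by (simp add: act_closed[OF P])
  have m: "Mu A l k c c' \<in> \<A> p" by (rule mu_closed'[OF 4(1,5,6)])
  have mb: "?m \<in> \<A> p" using m 4 by simp
  note k1 = klinear_comp[OF act_klinear[OF MN 4(5)] day_map(1)[OF M N assoc_in_bilin[OF 4(1) w' 4(4)]]]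
  note k2 = day_map(1)[OF M N assoc_in_bilin[OF 4(1,3) mb]]
  show ?case unfolding assoc_out_def
  proof (rule day_ext[OF M N obj_module[OF M_NP] k1 k2 _ 4(2)])
    fix i u j v a assume g: "i + j = l" "u \<in> el M i" "v \<in> el N j" "a \<in> \<A> l"
    have ijk: "i + (j + k) = p" using 4(1) g(1) by simp
    have ac: "a \<otimes>\<^bsub>Alg A l\<^esub> c \<in> \<A> l" using g 4 by simp
    note cl = mu_closed'[OF 4(1) g(4) alg.one_closed] mu_closed'[OF 4(1) ac alg.one_closed]
     mu_closed'[OF 4(1) ac 4(6)] mu_closed'[OF 4(1) alg.one_closed 4(6)]
    let ?X = "Mu A l k (a \<otimes>\<^bsub>Alg A l\<^esub> c) (\<e> k) \<otimes>\<^bsub>Alg A p\<^esub> b"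
    have X: "?X \<in> \<A> p" using cl 4(4) by simp
    \<comment> \<open>Moving \<open>c'\<close> to the algebra slot takes two balancing steps, one in
      each convolution, and \<open>e1\<close> combines them. By \<open>e2\<close> and
      \<open>e3\<close> both sides then end in \<open>Mu\<close> of the product of \<open>a\<close>
      and \<open>c\<close> with \<open>c'\<close>, multiplied by \<open>b\<close>.\<close>
    have e1: "Mu A i (j + k) (\<e> i) (Mu A j k (\<e> j) c') = Mu A l k (\<e> l) c'"
     using mu_assoc[OF alg.one_closed[of i] alg.one_closed[of j] 4(6)] g(1) by (simp add: mu_one)
    have e2: "Mu A l k (\<e> l) c' \<otimes>\<^bsub>Alg A p\<^esub> ?X = Mu A l k (a \<otimes>\<^bsub>Alg A l\<^esub> c) c' \<otimes>\<^bsub>Alg A p\<^esub> b"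
     using mu_mult[OF alg.one_closed[of l] ac 4(6) alg.one_closed[of k]] 4(1,4,6) ac cl
     by (simp add: alg.m_assoc[symmetric])
    have e3: "Mu A l k a (\<e> k) \<otimes>\<^bsub>Alg A p\<^esub> ?m = Mu A l k (a \<otimes>\<^bsub>Alg A l\<^esub> c) c' \<otimes>\<^bsub>Alg A p\<^esub> b"
     using mu_mult[OF g(4) 4(5) alg.one_closed[of k] 4(6)] 4(1,4,6) m cl
     by (simp add: alg.m_assoc[symmetric])
    have "assoc_in p l k (act P k w c') b i u j v (a \<otimes>\<^bsub>Alg A l\<^esub> c) =
     pure M NP p i (act M i u (\<e> i)) (j + k) (act NP (j + k) (pure N P (j + k) j v k w (\<e> (j + k))) (Mu A j k (\<e> j) c')) ?X"
     using pure_act[OF g(3) 4(3) alg.one_closed 4(6)] by (simp add: assoc_in_def act_one[OF N g(3)] act_one[OF M g(2)])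
    also have "\<dots> = pure M NP p i u (j + k) (pure N P (j + k) j v k w (\<e> (j + k)))
     (Mu A i (j + k) (\<e> i) (Mu A j k (\<e> j) c') \<otimes>\<^bsub>Alg A p\<^esub> ?X)"
     by (rule pure_balanced[OF M NP ijk g(2) pure_closed[OF N P HOL.refl g(3) 4(3) alg.one_closed] X alg.one_closed mu_closed[OF alg.one_closed 4(6)]])
    also have "\<dots> = assoc_in p l k w ?m i u j v a"
     unfolding e1 e2 assoc_in_def e3 ..
    finally show "day_map (FO M_NP p) (assoc_in p l k (act P k w c') b) (act MN l (pure M N l i u j v a) c) =
     day_map (FO M_NP p) (assoc_in p l k w ?m) (pure M N l i u j v a)"
     unfolding day_act[OF M N g 4(5)] day_map(2)[OF M N assoc_in_bilin[OF 4(1) w' 4(4)] g(1-3) ac]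
      day_map(2)[OF M N assoc_in_bilin[OF 4(1,3) mb] g] .
  qed
qed

lemma assoc_out_act:
  assumes g: "l + k = p" "y \<in> el MN l" "w \<in> el P k" "b \<in> \<A> p" "c \<in> \<A> p"
  shows "assoc_out p l y k w (b \<otimes>\<^bsub>Alg A p\<^esub> c) = act M_NP p (assoc_out p l y k w b) c"
  unfolding assoc_out_def
proof (rule day_ext[OF M N obj_module[OF M_NP] day_map(1)[OF M N assoc_in_bilin]
    klinear_comp[OF day_map(1)[OF M N assoc_in_bilin] act_klinear[OF M_NP g(5)]] _ g(2)])
  fix i u j v a assume h: "i + j = l" "u \<in> el M i" "v \<in> el N j" "a \<in> \<A> l"
  have ijk: "i + (j + k) = p" using g(1) h(1) by simp
  have "assoc_in p l k w (b \<otimes>\<^bsub>Alg A p\<^esub> c) i u j v a = act M_NP p (assoc_in p l k w b i u j v a) c"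
    unfolding assoc_in_def
    by (subst day_act[OF M NP ijk h(2) pure_closed[OF N P HOL.refl h(3) g(3) alg.one_closed]])
     (use g mu_closed'[OF g(1) h(4) alg.one_closed] in \<open>simp_all add: alg.m_assoc\<close>)
  then show "day_map (FO M_NP p) (assoc_in p l k w (b \<otimes>\<^bsub>Alg A p\<^esub> c)) (pure M N l i u j v a) =
     act M_NP p (day_map (FO M_NP p) (assoc_in p l k w b) (pure M N l i u j v a)) c"
    using g h by (simp add: day_map(2)[OF M N assoc_in_bilin])
qed (use g in auto)

text \<open>Shows that the nested lists of the definition compute the two-stage construction, so
  that being an arrow of modules follows from \<open>day_hom\<close>.\<close>

lemma day_assoc_eq: "day_assoc K A M N P = day_hom MN P M_NP assoc_out"
proof -
  let ?G = "\<lambda>p l k w b. \<lambda>(i, u, j, v, a).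
        (i, u, j + k, day_elt K A N P (j + k) [(j, v, k, w, Emb A (\<e> (j + k)))],
        Emb A (Mu A l k (Unemb A a) (\<e> k) \<otimes>\<^bsub>Alg A p\<^esub> Unemb A b))"
  let ?F = "\<lambda>p. \<lambda>(l, y, k, w, b). map (?G p l k w b) (day_terms y)"
  have G: "?G p l k w (Emb A b) g \<in> day_gens A M NP p"
    if "l + k = p" "w \<in> el P k" "b \<in> \<A> p" "y \<in> el MN l" "g \<in> set (day_terms y)"
    for p l k w b y g
    using subsetD[OF day_terms_gens[OF M N that(4)] that(5)] that(1-3)
     pure_closed[OF N P HOL.refl _ that(2) alg.one_closed, unfolded pure_def] mu_closed'[OF that(1) _ alg.one_closed]
    by (elim day_gensE[OF M N]) (auto simp: day_gens_iff)
  have "day_elt K A M NP p (concat (map (?F p) (day_terms x))) = day_map (FO M_NP p) (assoc_out p) x"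
    if x: "x \<in> el (day MN P) p" for p x
  proof -
    have "set (?F p g) \<subseteq> day_gens A M NP p" if "g \<in> set (day_terms x)" for g
     using subsetD[OF day_terms_gens[OF MN P x] that] G
     by (elim day_gensE[OF MN P]) (simp add: image_subset_iff)
    then have "day_elt K A M NP p (concat (map (?F p) (day_terms x))) =
     term_sum (FO M_NP p) (\<lambda>g. day_elt K A M NP p (?F p g)) (day_terms x)"
     by (rule day_elt_concat[OF M NP])
    also have "\<dots> = day_map (FO M_NP p) (assoc_out p) x"
    proof (rule day_map_cong[OF MN P x])
     fix l y k w b
     assume g: "l + k = p" "y \<in> el MN l" "w \<in> el P k" "b \<in> \<A> p"
     have "day_elt K A M NP p (map (?G p l k w (Emb A b)) (day_terms y)) =
      term_sum (FO M_NP p) (\<lambda>g. day_elt K A M NP p [?G p l k w (Emb A b) g]) (day_terms y)"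
      by (rule day_elt_map[OF M NP G[OF g(1,3,4,2)]])
     also have "\<dots> = day_map (FO M_NP p) (assoc_in p l k w b) y"
      by (rule day_map_cong[OF M N g(2)]) (simp add: assoc_in_def pure_def)
     finally show "day_elt K A M NP p (?F p (l, y, k, w, Emb A b)) = assoc_out p l y k w b"
      by (simp add: assoc_out_def)
    qed
    finally show ?thesis .
  qed
  then show ?thesis
    unfolding day_assoc_def Let_def day_hom_def mk_arr_def
    by (auto simp: fun_eq_iff intro!: lmap_of_cong)
qed

lemma day_assoc: "day_assoc K A M N P \<in> mor CC (day MN P) M_NP"
  unfolding day_assoc_eq by (rule day_hom(1)[OF MN P M_NP assoc_out_bilin assoc_out_act])

lemma day_assoc_apply:
  assumes "l + k = p" "i + j = l" "u \<in> el M i" "v \<in> el N j" "a \<in> \<A> l"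
    "w \<in> el P k" "b \<in> \<A> p"
  shows "ap (day_assoc K A M N P) p (pure MN P p l (pure M N l i u j v a) k w b) =
    pure M NP p i u (j + k) (pure N P (j + k) j v k w (\<e> (j + k))) (Mu A l k a (\<e> k) \<otimes>\<^bsub>Alg A p\<^esub> b)"
  unfolding day_assoc_eq
  by (subst day_hom(2)[OF MN P M_NP assoc_out_bilin assoc_out_act assms(1) pure_closed[OF M N assms(2-5)] assms(6,7)])
    (auto simp: assoc_out_pure[OF assms] assoc_in_def)

end

end

section \<open>The unit constraints\<close>

context algebra_sequence
begin

lemma rep_klinear: "klinear K (FO (rep n) n) (Alg A n) (Unemb A)"
  by (rule klinearI) (auto simp: FO_rep)

context
  fixes M assumes M: "M \<in> Ob CC"
begin

definition lun_map :: "nat \<Rightarrow> nat \<Rightarrow> ('k, 'u) univ \<Rightarrow> nat \<Rightarrow> ('k, 'u) univ \<Rightarrow> 'x \<Rightarrow> ('k, 'u) univ" where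
  "lun_map p i a j v b = (if i = 0
       then act M p v (Mu A 0 p (Unemb A a) (\<e> p) \<otimes>\<^bsub>Alg A p\<^esub> b) else \<zero>\<^bsub>FO M p\<^esub>)"

definition run_map :: "nat \<Rightarrow> nat \<Rightarrow> ('k, 'u) univ \<Rightarrow> nat \<Rightarrow> ('k, 'u) univ \<Rightarrow> 'x \<Rightarrow> ('k, 'u) univ" where
  "run_map p i v j a b = (if j = 0
       then act M p v (Mu A p 0 (\<e> p) (Unemb A a) \<otimes>\<^bsub>Alg A p\<^esub> b) else \<zero>\<^bsub>FO M p\<^esub>)"

text \<open>An Eckmann--Hilton argument: by multiplicativity of \<open>Mu\<close>, factors coming
  from degree 0 commute with those coming from degree \<open>p\<close>. The identities are the
  balancing conditions of the two unit constraints.\<close>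

lemma unit_mult:
  assumes "x \<in> \<A> 0" "c \<in> \<A> 0" "c' \<in> \<A> p" "b \<in> \<A> p"
  shows "c' \<otimes>\<^bsub>Alg A p\<^esub> (Mu A 0 p (x \<otimes>\<^bsub>Alg A 0\<^esub> c) (\<e> p) \<otimes>\<^bsub>Alg A p\<^esub> b) =
     Mu A 0 p x (\<e> p) \<otimes>\<^bsub>Alg A p\<^esub> (Mu A 0 p c c' \<otimes>\<^bsub>Alg A p\<^esub> b)"
    and "c' \<otimes>\<^bsub>Alg A p\<^esub> (Mu A p 0 (\<e> p) (x \<otimes>\<^bsub>Alg A 0\<^esub> c) \<otimes>\<^bsub>Alg A p\<^esub> b) =
     Mu A p 0 (\<e> p) x \<otimes>\<^bsub>Alg A p\<^esub> (Mu A p 0 c' c \<otimes>\<^bsub>Alg A p\<^esub> b)"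
proof -
  note cl = mu_closed[of _ 0 _ p, simplified] mu_closed[of _ p _ 0, simplified]
  have "Mu A 0 p (\<e> 0) c' \<otimes>\<^bsub>Alg A p\<^esub> Mu A 0 p (x \<otimes>\<^bsub>Alg A 0\<^esub> c) (\<e> p) = Mu A 0 p x (\<e> p) \<otimes>\<^bsub>Alg A p\<^esub> Mu A 0 p c c'"
    using mu_mult[of "(\<e> 0)" 0 "x \<otimes>\<^bsub>Alg A 0\<^esub> c" c' p "(\<e> p)"] mu_mult[of x 0 c "(\<e> p)" p c'] assms by simp
  then show "c' \<otimes>\<^bsub>Alg A p\<^esub> (Mu A 0 p (x \<otimes>\<^bsub>Alg A 0\<^esub> c) (\<e> p) \<otimes>\<^bsub>Alg A p\<^esub> b) =
     Mu A 0 p x (\<e> p) \<otimes>\<^bsub>Alg A p\<^esub> (Mu A 0 p c c' \<otimes>\<^bsub>Alg A p\<^esub> b)"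
    using assms by (simp add: mu_unit_l alg.m_assoc[symmetric] cl)
  have "Mu A p 0 c' (\<e> 0) \<otimes>\<^bsub>Alg A p\<^esub> Mu A p 0 (\<e> p) (x \<otimes>\<^bsub>Alg A 0\<^esub> c) = Mu A p 0 (\<e> p) x \<otimes>\<^bsub>Alg A p\<^esub> Mu A p 0 c' c"
    using mu_mult[of c' p "(\<e> p)" "(\<e> 0)" 0 "x \<otimes>\<^bsub>Alg A 0\<^esub> c"] mu_mult[of "(\<e> p)" p c' x 0 c] assms by simp
  then show "c' \<otimes>\<^bsub>Alg A p\<^esub> (Mu A p 0 (\<e> p) (x \<otimes>\<^bsub>Alg A 0\<^esub> c) \<otimes>\<^bsub>Alg A p\<^esub> b) =
     Mu A p 0 (\<e> p) x \<otimes>\<^bsub>Alg A p\<^esub> (Mu A p 0 c' c \<otimes>\<^bsub>Alg A p\<^esub> b)"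
    using assms by (simp add: mu_unit_r alg.m_assoc[symmetric] cl)
qed

lemma lun_bilin: "day_bilin (rep 0) M p (FO M p) (lun_map p)"
proof (rule day_bilinI[OF obj_module[OF M]], goal_cases)
  case (1 i j v b)
  show ?case
  proof (cases "i = 0")
    case True
    then have v: "v \<in> el M p" using 1 by simp
    have "klinear K (FO (rep 0) 0) (FO M p) (\<lambda>a. act M p v (Mu A 0 p (Unemb A a) (\<e> p) \<otimes>\<^bsub>Alg A p\<^esub> b))"
     by (rule klinear_comp[OF klinear_comp[OF klinear_comp[OF rep_klinear mu_klinear(1)[OF add_0 alg.one_closed]] mult_klinear(1)[OF 1(3)]] act_klinear_alg[OF M v]])
    then show ?thesis using True by (simp add: lun_map_def)
  qed (simp add: lun_map_def klinear_const_zero[OF obj_module[OF M]])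
next
  case (2 i j a b)
  show ?case
  proof (cases "i = 0")
    case True
    then have j: "j = p" using 2 by simp
    have "Mu A 0 p (Unemb A a) (\<e> p) \<otimes>\<^bsub>Alg A p\<^esub> b \<in> \<A> p"
     using 2 True by (intro alg.m_closed mu_closed'[OF add_0]) (auto simp: FO_rep)
    from act_klinear[OF M this] show ?thesis using True j by (simp add: lun_map_def)
  qed (simp add: lun_map_def klinear_const_zero[OF obj_module[OF M]])
next
  case (3 i j a v)
  show ?case
  proof (cases "i = 0")
    case True
    then have v: "v \<in> el M p" using 3 by simp
    have "Mu A 0 p (Unemb A a) (\<e> p) \<in> \<A> p"
     using 3 True by (intro mu_closed'[OF add_0]) (auto simp: FO_rep)
    from klinear_comp[OF mult_klinear(2)[OF this] act_klinear_alg[OF M v]] show ?thesis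
     using True by (simp add: lun_map_def[abs_def])
  qed (simp add: lun_map_def[abs_def] klinear_const_zero[OF obj_module[OF M]])
next
  case (4 i j a v b c c')
  show ?case
  proof (cases "i = 0")
    case True
    then have [simp]: "j = p" "i = 0" using 4(1) by simp_all
    obtain x where x: "a = Emb A x" "x \<in> \<A> 0" using 4(2) by (auto simp: FO_rep)
    have "Mu A 0 p (x \<otimes>\<^bsub>Alg A 0\<^esub> c) (\<e> p) \<otimes>\<^bsub>Alg A p\<^esub> b \<in> \<A> p"
     using 4 x by (intro alg.m_closed mu_closed'[OF add_0]) auto
    then show ?thesis
     using 4 x by (simp add: lun_map_def rep_act_Emb act_mult[OF M] unit_mult)
  qed (simp add: lun_map_def)
qed

lemma run_bilin: "day_bilin M (rep 0) p (FO M p) (run_map p)"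
proof (rule day_bilinI[OF obj_module[OF M]], goal_cases)
  case (2 i j v b)
  show ?case
  proof (cases "j = 0")
    case True
    then have v: "v \<in> el M p" using 2 by simp
    have "klinear K (FO (rep 0) 0) (FO M p) (\<lambda>a. act M p v (Mu A p 0 (\<e> p) (Unemb A a) \<otimes>\<^bsub>Alg A p\<^esub> b))"
     by (rule klinear_comp[OF klinear_comp[OF klinear_comp[OF rep_klinear mu_klinear(2)[OF add_0_right alg.one_closed]] mult_klinear(1)[OF 2(3)]] act_klinear_alg[OF M v]])
    then show ?thesis using True by (simp add: run_map_def)
  qed (simp add: run_map_def klinear_const_zero[OF obj_module[OF M]])
next
  case (1 i j a b)
  show ?case
  proof (cases "j = 0")
    case True
    then have j: "i = p" using 1 by simp
    have "Mu A p 0 (\<e> p) (Unemb A a) \<otimes>\<^bsub>Alg A p\<^esub> b \<in> \<A> p"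
     using 1 True by (intro alg.m_closed mu_closed'[OF add_0_right]) (auto simp: FO_rep)
    from act_klinear[OF M this] show ?thesis using True j by (simp add: run_map_def)
  qed (simp add: run_map_def klinear_const_zero[OF obj_module[OF M]])
next
  case (3 i j v a)
  show ?case
  proof (cases "j = 0")
    case True
    then have v: "v \<in> el M p" using 3 by simp
    have "Mu A p 0 (\<e> p) (Unemb A a) \<in> \<A> p"
     using 3 True by (intro mu_closed'[OF add_0_right]) (auto simp: FO_rep)
    from klinear_comp[OF mult_klinear(2)[OF this] act_klinear_alg[OF M v]] show ?thesis
     using True by (simp add: run_map_def[abs_def])
  qed (simp add: run_map_def[abs_def] klinear_const_zero[OF obj_module[OF M]])
next
  case (4 i j v a b c' c)
  show ?case
  proof (cases "j = 0")
    case True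
    then have [simp]: "i = p" "j = 0" using 4(1) by simp_all
    obtain x where x: "a = Emb A x" "x \<in> \<A> 0" using 4(3) by (auto simp: FO_rep)
    have "Mu A p 0 (\<e> p) (x \<otimes>\<^bsub>Alg A 0\<^esub> c) \<otimes>\<^bsub>Alg A p\<^esub> b \<in> \<A> p"
     using 4 x by (intro alg.m_closed mu_closed'[OF add_0_right]) auto
    then show ?thesis
     using 4 x by (simp add: run_map_def rep_act_Emb act_mult[OF M] unit_mult)
  qed (simp add: run_map_def)
qed

lemma lun_act:
  assumes "i + j = p" "a \<in> el (rep 0) i" "v \<in> el M j" "b \<in> \<A> p" "c \<in> \<A> p"
  shows "lun_map p i a j v (b \<otimes>\<^bsub>Alg A p\<^esub> c) = act M p (lun_map p i a j v b) c"
proof (cases "i = 0")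
  case True
  have "Mu A 0 p (Unemb A a) (\<e> p) \<in> \<A> p"
    using assms True by (intro mu_closed'[OF add_0]) (auto simp: FO_rep)
  then show ?thesis using assms True by (simp add: lun_map_def act_mult[OF M] alg.m_assoc)
qed (use assms in \<open>simp add: lun_map_def act_zero[OF M]\<close>)

lemma run_act:
  assumes "i + j = p" "v \<in> el M i" "a \<in> el (rep 0) j" "b \<in> \<A> p" "c \<in> \<A> p"
  shows "run_map p i v j a (b \<otimes>\<^bsub>Alg A p\<^esub> c) = act M p (run_map p i v j a b) c"
proof (cases "j = 0")
  case True
  have "Mu A p 0 (\<e> p) (Unemb A a) \<in> \<A> p"
    using assms True by (intro mu_closed'[OF add_0_right]) (auto simp: FO_rep)
  then show ?thesis using assms True by (simp add: run_map_def act_mult[OF M] alg.m_assoc)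
qed (use assms in \<open>simp add: run_map_def act_zero[OF M]\<close>)

lemma day_lun_eq: "day_lun K A M = day_hom (rep 0) M M lun_map"
  unfolding day_lun_def Let_def day_hom_def mk_arr_def
  by (auto simp: fun_eq_iff lun_map_def intro!: lmap_of_cong day_map_cong[OF rep_obj M])

lemma day_run_eq: "day_run K A M = day_hom M (rep 0) M run_map"
  unfolding day_run_def Let_def day_hom_def mk_arr_def
  by (auto simp: fun_eq_iff run_map_def intro!: lmap_of_cong day_map_cong[OF M rep_obj])

lemma day_lun: "day_lun K A M \<in> mor CC (day (rep 0) M) M"
  unfolding day_lun_eq by (rule day_hom(1)[OF rep_obj M M lun_bilin lun_act])

lemma day_run: "day_run K A M \<in> mor CC (day M (rep 0)) M"
  unfolding day_run_eq by (rule day_hom(1)[OF M rep_obj M run_bilin run_act])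

lemma day_lun_apply:
  "\<lbrakk>i + j = p; a \<in> el (rep 0) i; v \<in> el M j; b \<in> \<A> p\<rbrakk> \<Longrightarrow>
    ap (day_lun K A M) p (pure (rep 0) M p i a j v b) = (if i = 0
       then act M p v (Mu A 0 p (Unemb A a) (\<e> p) \<otimes>\<^bsub>Alg A p\<^esub> b) else \<zero>\<^bsub>FO M p\<^esub>)"
  unfolding day_lun_eq using day_hom(2)[OF rep_obj M M lun_bilin lun_act, of i j p a v b]
  by (simp add: lun_map_def[of p i a j v b])

lemma day_run_apply:
  "\<lbrakk>i + j = p; v \<in> el M i; a \<in> el (rep 0) j; b \<in> \<A> p\<rbrakk> \<Longrightarrow>
    ap (day_run K A M) p (pure M (rep 0) p i v j a b) = (if j = 0
       then act M p v (Mu A p 0 (\<e> p) (Unemb A a) \<otimes>\<^bsub>Alg A p\<^esub> b) else \<zero>\<^bsub>FO M p\<^esub>)"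
  unfolding day_run_eq using day_hom(2)[OF M rep_obj M run_bilin run_act, of i j p v a b]
  by (simp add: run_map_def[of p i v j a b])

end

lemma CC_tensor_category: "tensor_category K CC"
  by (intro tensor_category.intro tensor_category_axioms.intro CC_linear)
    (auto simp: CC_simps(8-13) intro: day_obj day_arr day_assoc day_lun day_run rep_obj)

sublocale C: tensor_category K CC by (rule CC_tensor_category)

text \<open>A pure outer tensor is linear in its inner element, so the inner element may be taken
  pure as well. This is the form in which associativity equations are tested.\<close>

lemma day_hom_eqI2:
  assumes M: "M \<in> Ob CC" and N: "N \<in> Ob CC" and P: "P \<in> Ob CC" and Q: "Q \<in> Ob CC"
    and h: "h \<in> mor CC (day (day M N) P) Q" "h' \<in> mor CC (day (day M N) P) Q"
    and eq: "\<And>p l i u j v a k w b. \<lbrakk>l + k = p; i + j = l; u \<in> el M i; v \<in> el N j; a \<in> \<A> l;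
     w \<in> el P k; b \<in> \<A> p\<rbrakk> \<Longrightarrow>
     ap h p (pure (day M N) P p l (pure M N l i u j v a) k w b) =
     ap h' p (pure (day M N) P p l (pure M N l i u j v a) k w b)"
  shows "h = h'"
proof (rule day_hom_eqI[OF day_obj[OF M N] P Q h])
  fix p l k y w b
  assume g: "l + k = p" "y \<in> el (day M N) l" "w \<in> el P k" "b \<in> \<A> p"
  note D = day_obj[OF M N] day_obj[OF day_obj[OF M N] P]
  note l = pure_klinear(1)[OF D(1) P g(1,3,4)]
  show "ap h p (pure (day M N) P p l y k w b) = ap h' p (pure (day M N) P p l y k w b)"
    by (rule day_ext[OF M N obj_module[OF Q] klinear_comp[OF l mor_klinear[OF D(2) h(1)]]
     klinear_comp[OF l mor_klinear[OF D(2) h(2)]] eq[OF g(1) _ _ _ _ g(3,4)] g(2)])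
qed

end

section \<open>Arrows inverted by a cocontinuous functor\<close>

text \<open>The kernel condition is applied to the difference of \<open>x\<close> and
  \<open>y\<close>.\<close>

lemma klinear_kernel_le:
  assumes V: "module K V" and W: "module K W" and U: "module K U" and f: "klinear K V W f" and g: "klinear K V U g"
    and le: "\<And>x. \<lbrakk>x \<in> carrier V; f x = \<zero>\<^bsub>W\<^esub>\<rbrakk> \<Longrightarrow> g x = \<zero>\<^bsub>U\<^esub>"
    and x: "x \<in> carrier V" "y \<in> carrier V" and eq: "f x = f y"
  shows "g x = g y"
proof -
  interpret V: module K V by (rule V)
  interpret W: module K W by (rule W)
  interpret U: module K U by (rule U)
  let ?m = "\<ominus>\<^bsub>K\<^esub> \<one>\<^bsub>K\<^esub>"
  let ?d = "x \<oplus>\<^bsub>V\<^esub> ?m \<odot>\<^bsub>V\<^esub> y"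
  have d: "?d \<in> carrier V" using x by simp
  have "f ?d = \<zero>\<^bsub>W\<^esub>"
    using x eq klinearD(1)[OF f] by (simp add: klinearD[OF f] W.smult_l_minus W.r_neg)
  from le[OF d this] have "g x \<oplus>\<^bsub>U\<^esub> \<ominus>\<^bsub>U\<^esub> g y = \<zero>\<^bsub>U\<^esub>"
    using x klinearD(1)[OF g] by (simp add: klinearD[OF g] U.smult_l_minus)
  then show ?thesis using x klinearD(1)[OF g] by (metis U.M.minus_equality U.a_inv_closed U.minus_minus)
qed

context algebra_sequence
begin

definition kills :: "(nat \<Rightarrow> 'x set) \<Rightarrow> ('k, 'u, 'x) mobj \<Rightarrow> ('k, 'u, 'x) mobj \<Rightarrow> ('k, 'u, 'x) marr \<Rightarrow> bool" where
  "kills J M N f \<longleftrightarrow> (\<forall>n. \<forall>x\<in>el M n. \<forall>b\<in>J n. ap f n (act M n x b) = \<zero>\<^bsub>FO N n\<^esub>)"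

text \<open>Expresses that \<open>f\<close> is the quotient of \<open>M\<close> by the submodule
  generated by all \<open>x b\<close> with \<open>b\<close> in \<open>J\<close>, without
  constructing this submodule: the kernel of \<open>f\<close> is the smallest one among the arrows
  that kill \<open>J\<close>.\<close>

definition quotient_arr :: "(nat \<Rightarrow> 'x set) \<Rightarrow> ('k, 'u, 'x) mobj \<Rightarrow> ('k, 'u, 'x) mobj \<Rightarrow> ('k, 'u, 'x) marr \<Rightarrow> bool" where
  "quotient_arr J M N f \<longleftrightarrow> M \<in> Ob CC \<and> N \<in> Ob CC \<and> f \<in> mor CC M N \<and> kills J M N f \<and>
    (\<forall>n. \<forall>y\<in>el N n. \<exists>x\<in>el M n. ap f n x = y) \<and>
    (\<forall>P\<in>Ob CC. \<forall>g\<in>mor CC M P. kills J M P g \<longrightarrow>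
     (\<forall>n. \<forall>x\<in>el M n. ap f n x = \<zero>\<^bsub>FO N n\<^esub> \<longrightarrow> ap g n x = \<zero>\<^bsub>FO P n\<^esub>))"

text \<open>The factorization takes any preimage under the surjection \<open>f\<close>. By the
  kernel condition the value of \<open>g\<close> does not depend on the preimage, which yields
  linearity and compatibility with the actions; uniqueness is surjectivity of
  \<open>f\<close>.\<close>

lemma quotient_arr_factors:
  assumes q: "quotient_arr J M N f" and P: "P \<in> Ob CC" and g: "g \<in> mor CC M P" and k: "kills J M P g"
  shows "\<exists>!h. h \<in> mor CC N P \<and> h \<bullet>\<^bsub>CC\<^esub> f = g"
proof -
  have M: "M \<in> Ob CC" and N: "N \<in> Ob CC" and f: "f \<in> mor CC M N"
    and surj: "\<And>n y. y \<in> el N n \<Longrightarrow> \<exists>x\<in>el M n. ap f n x = y"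
    and ker: "\<And>n x. \<lbrakk>x \<in> el M n; ap f n x = \<zero>\<^bsub>FO N n\<^esub>\<rbrakk> \<Longrightarrow> ap g n x = \<zero>\<^bsub>FO P n\<^esub>"
    using q P g k unfolding quotient_arr_def by blast+
  define s where "s n y = (SOME x. x \<in> el M n \<and> ap f n x = y)" for n y
  have s: "s n y \<in> el M n" "ap f n (s n y) = y" if "y \<in> el N n" for n y
    using someI_ex[of "\<lambda>x. x \<in> el M n \<and> ap f n x = y"] surj[OF that] unfolding s_def by blast+
  interpret M: module K "FO M n" for n by (rule obj_module[OF M])
  interpret N: module K "FO N n" for n by (rule obj_module[OF N])
  interpret P: module K "FO P n" for n by (rule obj_module[OF P])
  note lf = mor_klinear[OF M f] and lg = mor_klinear[OF M g]
  have gs: "ap g n x = ap g n (s n y)" if "x \<in> el M n" "ap f n x = y" for n x y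
  proof -
    have y: "y \<in> el N n" using that klinearD(1)[OF lf] by auto
    show ?thesis
     by (rule klinear_kernel_le[OF obj_module[OF M] obj_module[OF N] obj_module[OF P] lf lg ker that(1) s(1)[OF y]])
      (simp_all add: s[OF y] that)
  qed
  let ?h = "mk_arr N P (\<lambda>n y. ap g n (s n y))"
  have h: "?h \<in> mor CC N P"
  proof (rule mk_arr[OF N P])
    fix n
    show "klinear K (FO N n) (FO P n) (\<lambda>y. ap g n (s n y))"
    proof (rule klinearI)
     fix v w assume vw: "v \<in> el N n" "w \<in> el N n"
     have "ap g n (s n v \<oplus>\<^bsub>FO M n\<^esub> s n w) = ap g n (s n (v \<oplus>\<^bsub>FO N n\<^esub> w))"
      using vw by (intro gs) (simp_all add: s klinearD(2)[OF lf])
     then show "ap g n (s n (v \<oplus>\<^bsub>FO N n\<^esub> w)) = ap g n (s n v) \<oplus>\<^bsub>FO P n\<^esub> ap g n (s n w)"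
      using vw by (simp add: klinearD(2)[OF lg] s)
    next
     fix r v assume rv: "r \<in> carrier K" "v \<in> el N n"
     have "ap g n (r \<odot>\<^bsub>FO M n\<^esub> s n v) = ap g n (s n (r \<odot>\<^bsub>FO N n\<^esub> v))"
      using rv by (intro gs) (simp_all add: s klinearD(3)[OF lf])
     then show "ap g n (s n (r \<odot>\<^bsub>FO N n\<^esub> v)) = r \<odot>\<^bsub>FO P n\<^esub> ap g n (s n v)"
      using rv by (simp add: klinearD(3)[OF lg] s)
    qed (simp add: klinearD(1)[OF lg] s)
  next
    fix n v a assume v: "v \<in> el N n" "a \<in> \<A> n"
    have "ap g n (act M n (s n v) a) = ap g n (s n (act N n v a))"
     using v by (intro gs) (simp_all add: s act_closed[OF M] mor_act[OF M N f])
    then show "ap g n (s n (act N n v a)) = act P n (ap g n (s n v)) a"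
     using v by (simp add: mor_act[OF M P g] s)
  qed
  show ?thesis
  proof (rule ex1I[of _ ?h], intro conjI h)
    show "?h \<bullet>\<^bsub>CC\<^esub> f = g"
    proof (rule mor_eqI[OF M C.comp_mor[OF M N P f h] g])
     fix n v assume v: "v \<in> el M n"
     show "ap (?h \<bullet>\<^bsub>CC\<^esub> f) n v = ap g n v"
      using v gs[OF v HOL.refl] by (simp add: comp_apply[OF M f] klinearD(1)[OF lf])
    qed
  next
    fix h' assume h': "h' \<in> mor CC N P \<and> h' \<bullet>\<^bsub>CC\<^esub> f = g"
    show "h' = ?h"
    proof (rule mor_eqI[OF N _ h])
     fix n y assume y: "y \<in> el N n"
     have "ap (h' \<bullet>\<^bsub>CC\<^esub> f) n (s n y) = ap h' n y" using s[OF y] by (simp add: comp_apply[OF M f])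
     then show "ap h' n y = ap ?h n y" using h' y by simp
    qed (use h' in simp)
  qed
qed

text \<open>A quotient arrow out of \<open>M\<close> is the colimit of the diagram with vertices \<open>M\<close> and all
  \<open>rep_obj n\<close>, and with arrows from \<open>rep_obj n\<close> to \<open>M\<close> the zero arrow and those given by
  \<open>x b\<close> for \<open>x\<close> in \<open>M\<^sub>n\<close> and \<open>b\<close> in \<open>J n\<close>. The functor makes all these arrows vanish.\<close>

lemma quotient_arr_inverted:
  fixes F :: "(('k, 'u, 'x) mobj, ('k, 'u, 'x) marr, 'p, 'b, 'w) funct_scheme"
  assumes q: "quotient_arr J M N f" and E: "linear_category K E" and F: "linear_functor K CC E F"
    and coc: "cocontinuous TYPE(('k, 'u) univ) CC E F"
    and J: "\<And>n b. b \<in> J n \<Longrightarrow> b \<in> \<A> n"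
    and kill: "\<And>n b. b \<in> J n \<Longrightarrow>
     FA F (rep_arr A n b) = \<zero>\<^bsub>Hom E (FO F (rep n)) (FO F (rep n))\<^esub>"
  shows "iso_arr E (FO F M) (FO F N) (FA F f)"
proof -
  interpret E: linear_category K E by (rule E)
  interpret F: linear_functor K CC E F by (rule F)
  have M: "M \<in> Ob CC" and N: "N \<in> Ob CC" and f: "f \<in> mor CC M N" and kf: "kills J M N f"
    using q unfolding quotient_arr_def by blast+
  \<comment> \<open>Codes for the quiver inside \<open>univ\<close>. The empty list is the vertex of
    \<open>M\<close>; otherwise the first entry is the degree. Each \<open>vn n\<close> is both the
    vertex of \<open>rep n\<close> and the name of the edge with the zero arrow; the third entry, 0
    or 1, distinguishes it from the edges \<open>ed\<close>.\<close>
  let ?z = "DayTerms [] :: ('k, 'u) univ"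
  define vn where "vn n = (DayTerms [(n, ?z, 0, ?z, ?z)] :: ('k, 'u) univ)" for n
  define ed where "ed n x b = (DayTerms [(n, x, 1, Emb A b, ?z)] :: ('k, 'u) univ)" for n x b
  define ix where "ix e = fst (hd (day_terms e))" for e :: "('k, 'u) univ"
  have ix: "ix (vn n) = n" "ix (ed n x b) = n" for n x b by (simp_all add: ix_def vn_def ed_def)
  define D :: "(('k, 'u) univ, ('k, 'u, 'x) mobj, ('k, 'u, 'x) marr) diagram" where
    "D = \<lparr>Verts = insert ?z (range vn),
     Edges = range vn \<union> {ed n x b |n x b. x \<in> el M n \<and> b \<in> J n},
     Tail = (\<lambda>e. vn (ix e)), Head = (\<lambda>e. ?z),
     DO = (\<lambda>i. if i = ?z then M else rep (ix i)),
     DA = (\<lambda>e. case hd (day_terms e) of (n, x, t, b, _) \<Rightarrow>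
      if t = 0 then \<zero>\<^bsub>Hom CC (rep n) M\<^esub> else yon M n x \<bullet>\<^bsub>CC\<^esub> rep_arr A n (Unemb A b))\<rparr>"
  have vz: "vn n \<noteq> ?z" for n by (simp add: vn_def)
  have D: "Verts D = insert ?z (range vn)"
    "Edges D = range vn \<union> {ed n x b |n x b. x \<in> el M n \<and> b \<in> J n}"
    "Tail D e = vn (ix e)" "Head D e = ?z" "DO D ?z = M" "DO D (vn n) = rep n"
    "DA D (vn n) = \<zero>\<^bsub>Hom CC (rep n) M\<^esub>" "DA D (ed n x b) = yon M n x \<bullet>\<^bsub>CC\<^esub> rep_arr A n b" for e n x b
    using vz by (simp_all add: D_def ix) (simp_all add: vn_def ed_def)
  have edge: "yon M n x \<bullet>\<^bsub>CC\<^esub> rep_arr A n b \<in> mor CC (rep n) M"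
    if "x \<in> el M n" "b \<in> J n" for n x b
    using that M J by (intro C.comp_mor[OF _ _ _ rep_arr yon]) (auto simp: rep_obj)
  have zero: "\<zero>\<^bsub>Hom CC (rep n) P\<^esub> \<in> mor CC (rep n) P" if "P \<in> Ob CC" for n P
    using that by (intro C.hom_zero rep_obj)
  have diag: "is_diagram CC D"
    unfolding is_diagram_def by (auto simp: D ix M rep_obj edge zero)
  define l where "l i = (if i = ?z then f else \<zero>\<^bsub>Hom CC (rep (ix i)) N\<^esub>)" for i
  have l: "l ?z = f" "l (vn n) = \<zero>\<^bsub>Hom CC (rep n) N\<^esub>" for n using vz by (simp_all add: l_def ix)
  \<comment> \<open>By Yoneda an arrow kills the edge of \<open>x\<close> and \<open>b\<close> iff
    it kills the element \<open>x b\<close>, so cocones correspond to arrows out of \<open>M\<close>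
    that kill \<open>J\<close>.\<close>
  have comp_edge: "g \<bullet>\<^bsub>CC\<^esub> (yon M n x \<bullet>\<^bsub>CC\<^esub> rep_arr A n b) = \<zero>\<^bsub>Hom CC (rep n) P\<^esub> \<longleftrightarrow>
     ap g n (act M n x b) = \<zero>\<^bsub>FO P n\<^esub>"
    if P: "P \<in> Ob CC" and g: "g \<in> mor CC M P" and x: "x \<in> el M n" and b: "b \<in> J n" for P g n x b
  proof -
    have v: "ap (g \<bullet>\<^bsub>CC\<^esub> (yon M n x \<bullet>\<^bsub>CC\<^esub> rep_arr A n b)) n (Emb A (\<e> n)) = ap g n (act M n x b)"
     unfolding yon_rep_arr[OF M x J[OF b]] comp_apply[OF rep_obj yon[OF M act_closed[OF M J[OF b] x]] one_rep]
     using J[OF b] x by (simp add: yon_apply act_one[OF M] act_closed[OF M])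
    have z: "ap \<zero>\<^bsub>Hom CC (rep n) P\<^esub> n (Emb A (\<e> n)) = \<zero>\<^bsub>FO P n\<^esub>"
     by (rule hom_apply(1)[OF one_rep])
    show ?thesis
     using v z rep_hom_eqI[OF P C.comp_mor[OF rep_obj M P edge[OF x b] g] zero[OF P]] by auto
  qed
  have coc_f: "is_cocone CC D N l"
    unfolding is_cocone_def
  proof (intro conjI ballI N)
    fix i assume "i \<in> Verts D"
    then show "l i \<in> mor CC (DO D i) N" by (auto simp: D l f zero[OF N])
  next
    fix e assume "e \<in> Edges D"
    then consider n where "e = vn n" | n x b where "e = ed n x b" "x \<in> el M n" "b \<in> J n"
     by (auto simp: D)
    then show "l (Head D e) \<bullet>\<^bsub>CC\<^esub> DA D e = l (Tail D e)"
    proof cases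
     case (1 n)
     then show ?thesis using C.comp_zero_right[OF rep_obj M N f] by (simp add: D l ix)
    next
     case (2 n x b)
     then show ?thesis using comp_edge[OF N f 2(2,3)] kf by (simp add: D l ix kills_def)
    qed
  qed
  have colim: "is_colimit CC D N l"
    unfolding is_colimit_def
  proof (intro conjI allI impI coc_f)
    fix P l' assume c: "is_cocone CC D P l'"
    have P: "P \<in> Ob CC" and g: "l' ?z \<in> mor CC M P"
     using c unfolding is_cocone_def by (auto simp: D)
    have e: "l' (Head D e) \<bullet>\<^bsub>CC\<^esub> DA D e = l' (Tail D e)" if "e \<in> Edges D" for e
     using c that unfolding is_cocone_def by blast
    \<comment> \<open>This is the purpose of the zero edges: they force the legs of a cocone at the
      representable vertices to vanish.\<close>
    have lz: "l' (vn n) = \<zero>\<^bsub>Hom CC (rep n) P\<^esub>" for n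
     using e[of "vn n"] C.comp_zero_right[OF rep_obj M P g] by (simp add: D ix)
    have k: "kills J M P (l' ?z)"
     unfolding kills_def
    proof (intro allI ballI)
     fix n x b assume x: "x \<in> el M n" "b \<in> J n"
     then have "ed n x b \<in> Edges D" by (auto simp: D)
     from e[OF this] show "ap (l' ?z) n (act M n x b) = \<zero>\<^bsub>FO P n\<^esub>"
      using comp_edge[OF P g x] by (simp add: D ix lz)
    qed
    have u: "\<exists>!h. h \<in> mor CC N P \<and> h \<bullet>\<^bsub>CC\<^esub> f = l' ?z" by (rule quotient_arr_factors[OF q P g k])
    have "(h \<in> mor CC N P \<and> (\<forall>i\<in>Verts D. h \<bullet>\<^bsub>CC\<^esub> l i = l' i)) \<longleftrightarrow> (h \<in> mor CC N P \<and> h \<bullet>\<^bsub>CC\<^esub> f = l' ?z)" for h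
     using C.comp_zero_right[OF rep_obj N P, of h] by (auto simp: D l lz)
    then show "\<exists>!h. h \<in> mor CC N P \<and> (\<forall>i\<in>Verts D. h \<bullet>\<^bsub>CC\<^esub> l i = l' i)" using u by simp
  qed
  define FD where "FD = map_diagram F D"
  define Fl where "Fl i = FA F (l i)" for i
  have FD: "Verts FD = insert ?z (range vn)" "Edges FD = Edges D" "Tail FD = Tail D" "Head FD = Head D"
    "DO FD i = FO F (DO D i)" "DA FD e = FA F (DA D e)" for i e
    by (simp_all add: FD_def map_diagram_def D)
  have cl: "is_colimit E FD (FO F N) Fl"
    using coc diag colim unfolding cocontinuous_def FD_def Fl_def by blast
  have oM: "FO F M \<in> Ob E" and oN: "FO F N \<in> Ob E" and oR: "FO F (rep n) \<in> Ob E" for n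
    using M N rep_obj by (auto intro: F.obj_closed)
  have Ff: "FA F f \<in> mor E (FO F M) (FO F N)" by (rule F.arr[OF M N f])
  have Fz: "FA F \<zero>\<^bsub>Hom CC (rep n) P\<^esub> = \<zero>\<^bsub>Hom E (FO F (rep n)) (FO F P)\<^esub>" if "P \<in> Ob CC" for n P
    using linear_functor_zero[OF CC_linear E F rep_obj that] .
  have Fe: "FA F (yon M n x \<bullet>\<^bsub>CC\<^esub> rep_arr A n b) = \<zero>\<^bsub>Hom E (FO F (rep n)) (FO F M)\<^esub>"
    if x: "x \<in> el M n" and b: "b \<in> J n" for n x b
    using F.comp[OF rep_obj rep_obj M rep_arr[OF J[OF b]] yon[OF M x]] kill[OF b]
     E.comp_zero_right[OF oR oR oM F.arr[OF rep_obj M yon[OF M x]]] by simp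
  \<comment> \<open>All edges become zero under \<open>F\<close>, so the identity of
    \<open>FO F M\<close> together with zero legs is a cocone. The arrow that it induces is the
    inverse of the image of \<open>f\<close>.\<close>
  let ?k = "\<lambda>i. if i = ?z then Id E (FO F M) else \<zero>\<^bsub>Hom E (FO F (rep (ix i))) (FO F M)\<^esub>"
  have "is_cocone E FD (FO F M) ?k"
    unfolding is_cocone_def
  proof (intro conjI ballI oM)
    fix i assume "i \<in> Verts FD"
    then show "?k i \<in> mor E (DO FD i) (FO F M)"
     using vz by (auto simp: FD D ix intro: E.id_mor[OF oM] E.hom_zero[OF oR oM])
  next
    fix e assume "e \<in> Edges FD"
    then consider n where "e = vn n" | n x b where "e = ed n x b" "x \<in> el M n" "b \<in> J n"
     by (auto simp: FD D)
    then show "?k (Head FD e) \<bullet>\<^bsub>E\<^esub> DA FD e = ?k (Tail FD e)"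
     by cases (use vz in \<open>simp_all add: FD D ix Fz[OF M] Fe E.comp_zero_right[OF oR oM oM E.id_mor[OF oM]]\<close>)
  qed
  with cl obtain h where h: "h \<in> mor E (FO F N) (FO F M)" "\<forall>i\<in>Verts FD. h \<bullet>\<^bsub>E\<^esub> Fl i = ?k i"
    unfolding is_colimit_def by blast
  have hf: "h \<bullet>\<^bsub>E\<^esub> FA F f = Id E (FO F M)" using h(2) by (simp add: FD Fl_def l)
  have "is_cocone E FD (FO F N) Fl" using cl unfolding is_colimit_def by blast
  then have ex1: "\<exists>!g. g \<in> mor E (FO F N) (FO F N) \<and> (\<forall>i\<in>Verts FD. g \<bullet>\<^bsub>E\<^esub> Fl i = Fl i)"
    using cl unfolding is_colimit_def by blast
  have fh: "FA F f \<bullet>\<^bsub>E\<^esub> h \<in> mor E (FO F N) (FO F N)" by (rule E.comp_mor[OF oN oM oN h(1) Ff])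
  \<comment> \<open>Uniqueness for the colimit: this composite and the identity are both compatible
    with the colimit cocone.\<close>
  have "(FA F f \<bullet>\<^bsub>E\<^esub> h) \<bullet>\<^bsub>E\<^esub> FA F f = FA F f"
    using E.comp_assoc[OF oM oN oM oN Ff h(1) Ff] hf E.id_right[OF oM oN Ff] by simp
  then have "\<forall>i\<in>Verts FD. (FA F f \<bullet>\<^bsub>E\<^esub> h) \<bullet>\<^bsub>E\<^esub> Fl i = Fl i"
    by (auto simp: FD Fl_def l Fz[OF N] E.comp_zero_right[OF oR oN oN fh])
  moreover have "\<forall>i\<in>Verts FD. Id E (FO F N) \<bullet>\<^bsub>E\<^esub> Fl i = Fl i"
    by (auto simp: FD Fl_def l Fz[OF N] E.id_left[OF oM oN Ff] E.comp_zero_right[OF oR oN oN E.id_mor[OF oN]])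
  ultimately have "FA F f \<bullet>\<^bsub>E\<^esub> h = Id E (FO F N)"
    using ex1 fh E.id_mor[OF oN] by blast
  then show ?thesis unfolding iso_arr_def using Ff h(1) hf by blast
qed

end

section \<open>Restriction along a surjective homomorphism\<close>

context sum_presentation
begin

lemma klinear_surj:
  assumes U: "module K U" and f: "klinear K U V f"
    and gen: "\<And>g. g \<in> S \<Longrightarrow> \<exists>u\<in>carrier U. f u = cls [g]" and x: "x \<in> carrier V"
  shows "\<exists>u\<in>carrier U. f u = x"
proof -
  interpret U: module K U by (rule U)
  have "\<exists>u\<in>carrier U. f u = cls P" if "set P \<subseteq> S" for P
    using that
  proof (induction P)
    case Nil
    show ?case using klinear_zero[OF U sum_space_module f] U.zero_closed by (auto simp: cls_Nil)
  next
    case (Cons g P)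
    then obtain u v where uv: "u \<in> carrier U" "v \<in> carrier U" "f u = cls [g]" "f v = cls P"
     using gen[of g] by auto
    then have "f (u \<oplus>\<^bsub>U\<^esub> v) = cls (g # P)" using cls_add[of "[g]" P] by (simp add: klinearD(2)[OF f])
    then show ?case using uv by blast
  qed
  then show ?thesis using cls_d[OF x] by metis
qed

end

context algebra_sequence
begin

lemma day_surj:
  assumes M: "M \<in> Ob CC" and N: "N \<in> Ob CC" and U: "module K U" and f: "klinear K U (FO (day M N) p) f"
    and gen: "\<And>i v j w a. \<lbrakk>i + j = p; v \<in> el M i; w \<in> el N j; a \<in> \<A> p\<rbrakk> \<Longrightarrow>
     \<exists>u\<in>carrier U. f u = pure M N p i v j w a"
    and x: "x \<in> el (day M N) p"
  shows "\<exists>u\<in>carrier U. f u = x"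
proof (rule sum_presentation.klinear_surj[OF day_presentation[OF M N] U f[unfolded day_space_eq] _ x[unfolded day_space_eq]])
  fix g assume "g \<in> day_gens A M N p"
  then show "\<exists>u\<in>carrier U. f u = sum_presentation.cls DayTerms (day_rel K A M N p) [g]"
    by (elim day_gensE[OF M N]) (simp add: day_elt_cls[OF M N] pure_def[symmetric] gen)
qed

end

text \<open>In the application \<pi> is the projection to the affine Hecke algebras. By surjectivity
  every element over \<open>B\<close> lifts, so that balancing over \<open>B\<close> reduces to
  balancing over \<open>A\<close>.\<close>

locale algebra_sequence_hom = A: algebra_sequence K A + B: algebra_sequence K B
  for K :: "'k ring" and A :: "('k, 'u, 'x) algseq" and B :: "('k, 'u, 'y) algseq" +
  fixes \<pi> :: "nat \<Rightarrow> 'x \<Rightarrow> 'y"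
  assumes pi_closed: "\<And>n a. a \<in> carrier (Alg A n) \<Longrightarrow> \<pi> n a \<in> carrier (Alg B n)"
    and pi_surj: "\<And>n b. b \<in> carrier (Alg B n) \<Longrightarrow> \<exists>a\<in>carrier (Alg A n). \<pi> n a = b"
    and pi_add: "\<And>n a b. \<lbrakk>a \<in> carrier (Alg A n); b \<in> carrier (Alg A n)\<rbrakk> \<Longrightarrow>
     \<pi> n (a \<oplus>\<^bsub>Alg A n\<^esub> b) = \<pi> n a \<oplus>\<^bsub>Alg B n\<^esub> \<pi> n b"
    and pi_smult: "\<And>n r a. \<lbrakk>r \<in> carrier K; a \<in> carrier (Alg A n)\<rbrakk> \<Longrightarrow>
     \<pi> n (r \<odot>\<^bsub>Alg A n\<^esub> a) = r \<odot>\<^bsub>Alg B n\<^esub> \<pi> n a"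
    and pi_mult: "\<And>n a b. \<lbrakk>a \<in> carrier (Alg A n); b \<in> carrier (Alg A n)\<rbrakk> \<Longrightarrow>
     \<pi> n (a \<otimes>\<^bsub>Alg A n\<^esub> b) = \<pi> n a \<otimes>\<^bsub>Alg B n\<^esub> \<pi> n b"
    and pi_one: "\<And>n. \<pi> n \<one>\<^bsub>Alg A n\<^esub> = \<one>\<^bsub>Alg B n\<^esub>"
    and pi_mu: "\<And>m n a b. \<lbrakk>a \<in> carrier (Alg A m); b \<in> carrier (Alg A n)\<rbrakk> \<Longrightarrow>
     \<pi> (m + n) (Mu A m n a b) = Mu B m n (\<pi> m a) (\<pi> n b)"
begin

lemma pi_klinear: "klinear K (Alg A n) (Alg B n) (\<pi> n)"
  by (rule klinearI) (simp_all add: pi_closed pi_add pi_smult)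

lemma pi_zero: "\<pi> n \<zero>\<^bsub>Alg A n\<^esub> = \<zero>\<^bsub>Alg B n\<^esub>"
  by (rule klinear_zero[OF A.alg_module B.alg_module pi_klinear])

definition bar_functor :: "(nat, 'x bar_arr, nat, 'y bar_arr) funct" where
  "bar_functor = \<lparr>FO = (\<lambda>n. n), FA = (\<lambda>(m, n, a)\<in>arrows A.bar. (m, n, \<pi> m a))\<rparr>"

lemma bar_functor: "linear_functor K (op_cat A.bar) (op_cat B.bar) bar_functor"
proof (rule linear_functor.intro, goal_cases)
  case 1 show ?case by (simp add: bar_functor_def op_cat_simps A.bar_simps B.bar_simps PiE_def extensional_def)
next
  case 2 show ?case by (simp add: bar_functor_def op_cat_simps)
next
  case (3 a b f) then show ?case
    by (auto simp: bar_functor_def op_cat_simps A.bar_simps B.bar_simps A.bar_arrows pi_closed pi_zero)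
next
  case (4 a) then show ?case
    by (auto simp: bar_functor_def op_cat_simps A.bar_simps B.bar_simps A.bar_arrows pi_one)
next
  case (5 a b c f g)
  then obtain x y where f: "f = (b, a, x)" "x \<in> carrier (Alg A b)" "b = a \<or> x = \<zero>\<^bsub>Alg A b\<^esub>"
    and g: "g = (c, b, y)" "y \<in> carrier (Alg A c)" "c = b \<or> y = \<zero>\<^bsub>Alg A c\<^esub>"
    by (auto simp: op_cat_simps A.bar_simps)
  show ?case unfolding f(1) g(1)
    by (cases "c = b"; cases "b = a"; use f g in \<open>simp add: bar_functor_def op_cat_simps A.bar_simps
     B.bar_simps A.bar_arrows pi_mult pi_zero\<close>)
next
  case (6 a b f g)
  then obtain x y where f: "f = (b, a, x)" "x \<in> carrier (Alg A b)" "b = a \<or> x = \<zero>\<^bsub>Alg A b\<^esub>"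
    and g: "g = (b, a, y)" "y \<in> carrier (Alg A b)" "b = a \<or> y = \<zero>\<^bsub>Alg A b\<^esub>"
    by (auto simp: op_cat_simps A.bar_simps)
  show ?case unfolding f(1) g(1)
    by (cases "b = a"; use f g in \<open>simp add: bar_functor_def op_cat_simps A.bar_simps
     B.bar_simps A.bar_arrows pi_add pi_zero\<close>)
next
  case (7 a b f r)
  then obtain x where f: "f = (b, a, x)" "x \<in> carrier (Alg A b)" "b = a \<or> x = \<zero>\<^bsub>Alg A b\<^esub>"
    by (auto simp: op_cat_simps A.bar_simps)
  show ?case unfolding f(1)
    by (cases "b = a"; use f 7(4) in \<open>simp add: bar_functor_def op_cat_simps A.bar_simps
     B.bar_simps A.bar_arrows pi_smult pi_zero\<close>)
qed

text \<open>Restriction is precomposition with \<open>bar_functor\<close>; it is written out so that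
  the underlying spaces are literally those of \<open>N\<close>.\<close>

definition res_obj :: "('k, 'u, 'y) mobj \<Rightarrow> ('k, 'u, 'x) mobj" where
  "res_obj N = \<lparr>FO = FO N, FA = (\<lambda>(m, n, a)\<in>arrows A.bar. FA N (m, n, \<pi> m a))\<rparr>"

lemma FO_res [simp]: "FO (res_obj N) = FO N"
  by (simp add: res_obj_def)

lemma act_res: "a \<in> carrier (Alg A n) \<Longrightarrow> act (res_obj N) n v a = act N n v (\<pi> n a)"
  by (simp add: res_obj_def A.bar_arrows)

lemma res_obj: "N \<in> Ob B.CC \<Longrightarrow> res_obj N \<in> Ob A.CC"
proof -
  assume N: "N \<in> Ob B.CC"
  have "res_obj N = comp_functor (op_cat A.bar) N bar_functor"
    by (rule funct.equality)
     (auto simp: res_obj_def comp_functor_def bar_functor_def op_cat_simps A.bar_simps restrict_def fun_eq_iff)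
  then show ?thesis
    using linear_functor_comp[OF A.op_bar_linear bar_functor N[unfolded B.CC_simps mem_Collect_eq]]
    by (simp add: A.CC_simps)
qed

section \<open>Restriction of scalars as a lax monoidal functor\<close>

definition res_arr :: "('k, 'u, 'y) marr \<Rightarrow> ('k, 'u, 'x) marr" where
  "res_arr \<alpha> = \<lparr>Src = res_obj (Src \<alpha>), Tgt = res_obj (Tgt \<alpha>), At = At \<alpha>\<rparr>"

lemma At_res [simp]: "At (res_arr \<alpha>) = At \<alpha>"
  by (simp add: res_arr_def)

lemma res_arr: "\<lbrakk>M \<in> Ob B.CC; N \<in> Ob B.CC; \<alpha> \<in> mor B.CC M N\<rbrakk> \<Longrightarrow> res_arr \<alpha> \<in> mor A.CC (res_obj M) (res_obj N)"
proof -
  assume o: "M \<in> Ob B.CC" "N \<in> Ob B.CC" and \<alpha>: "\<alpha> \<in> mor B.CC M N"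
  have "res_arr \<alpha> = A.mk_arr (res_obj M) (res_obj N) (\<lambda>n. ap \<alpha> n)"
    using B.morD[OF o(1) \<alpha>] by (simp add: res_arr_def A.mk_arr_def fun_eq_iff)
     (auto intro!: lmap_eqI[of _ "FO M _"])
  also have "\<dots> \<in> mor A.CC (res_obj M) (res_obj N)"
    using B.mor_klinear[OF o(1) \<alpha>] B.mor_act[OF o \<alpha>]
    by (intro A.mk_arr res_obj o) (simp_all add: act_res pi_closed)
  finally show ?thesis .
qed

text \<open>The comparison of the two Day convolutions of one pair of modules, over \<open>A\<close>
  and over \<open>B\<close>: the module slots are kept and the algebra slot is mapped by
  \<pi>.\<close>

definition res_mul :: "('k, 'u, 'y) mobj \<Rightarrow> ('k, 'u, 'y) mobj \<Rightarrow> ('k, 'u, 'x) marr" where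
  "res_mul M N = A.day_hom (res_obj M) (res_obj N) (res_obj (B.day M N))
    (\<lambda>p i v j w a. B.pure M N p i v j w (\<pi> p a))"

definition res_eps :: "('k, 'u, 'x) marr" where
  "res_eps = A.mk_arr (rep_obj A 0) (res_obj (rep_obj B 0)) (\<lambda>m x. Emb B (\<pi> m (Unemb A x)))"

definition res :: "(('k, 'u, 'y) mobj, ('k, 'u, 'y) marr, ('k, 'u, 'x) mobj, ('k, 'u, 'x) marr) monfun" where
  "res = \<lparr>FO = (\<lambda>N\<in>Ob B.CC. res_obj N), FA = (\<lambda>\<alpha>\<in>arrows B.CC. res_arr \<alpha>), Mul = res_mul, Eps = res_eps\<rparr>"

lemma res_mul_bilin:
  assumes o: "M \<in> Ob B.CC" "N \<in> Ob B.CC"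
  shows "A.day_bilin (res_obj M) (res_obj N) p (FO (res_obj (B.day M N)) p)
    (\<lambda>i v j w a. B.pure M N p i v j w (\<pi> p a))"
proof (rule A.day_bilinI, goal_cases)
  case 1 show ?case using B.day_module[OF o] by simp
next
  case (2 i j w a) then show ?case using B.pure_klinear(1)[OF o 2(1)] by (simp add: pi_closed)
next
  case (3 i j v a) then show ?case using B.pure_klinear(2)[OF o 3(1)] by (simp add: pi_closed)
next
  case (4 i j v w)
  then show ?case using klinear_comp[OF pi_klinear B.pure_klinear(3)[OF o 4(1)]] by simp
next
  case (5 i j v w a b b')
  then show ?case
    using pi_mu[OF 5(5,6)] A.mu_closed[OF 5(5,6)]
    by (simp add: act_res B.pure_balanced[OF o] pi_closed pi_mult)
qed

lemma res_mul_act: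
  assumes o: "M \<in> Ob B.CC" "N \<in> Ob B.CC" and "i + j = p" "v \<in> el (res_obj M) i"
    "w \<in> el (res_obj N) j" "a \<in> carrier (Alg A p)" "b \<in> carrier (Alg A p)"
  shows "B.pure M N p i v j w (\<pi> p (a \<otimes>\<^bsub>Alg A p\<^esub> b)) =
    act (res_obj (B.day M N)) p (B.pure M N p i v j w (\<pi> p a)) b"
  using assms by (simp add: act_res pi_mult B.day_act pi_closed)

lemma
  assumes o: "M \<in> Ob B.CC" "N \<in> Ob B.CC"
  shows res_mul: "res_mul M N \<in> mor A.CC (A.day (res_obj M) (res_obj N)) (res_obj (B.day M N))"
    and res_mul_apply: "\<lbrakk>i + j = p; v \<in> el M i; w \<in> el N j; a \<in> carrier (Alg A p)\<rbrakk> \<Longrightarrow>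
     ap (res_mul M N) p (A.pure (res_obj M) (res_obj N) p i v j w a) = B.pure M N p i v j w (\<pi> p a)"
proof -
  note h = A.day_hom[OF res_obj[OF o(1)] res_obj[OF o(2)] res_obj[OF B.day_obj[OF o]] res_mul_bilin[OF o]]
  show "res_mul M N \<in> mor A.CC (A.day (res_obj M) (res_obj N)) (res_obj (B.day M N))"
    unfolding res_mul_def by (rule h(1)[OF res_mul_act[OF o]])
  show "\<lbrakk>i + j = p; v \<in> el M i; w \<in> el N j; a \<in> carrier (Alg A p)\<rbrakk> \<Longrightarrow>
     ap (res_mul M N) p (A.pure (res_obj M) (res_obj N) p i v j w a) = B.pure M N p i v j w (\<pi> p a)"
    unfolding res_mul_def by (rule h(2)[OF res_mul_act[OF o]], assumption+, simp_all)
qed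

lemma res_eps: "res_eps \<in> mor A.CC (rep_obj A 0) (res_obj (rep_obj B 0))"
  unfolding res_eps_def
proof (rule A.mk_arr[OF A.rep_obj res_obj[OF B.rep_obj]])
  fix n show "klinear K (FO (rep_obj A 0) n) (FO (res_obj (rep_obj B 0)) n) (\<lambda>x. Emb B (\<pi> n (Unemb A x)))"
    by (rule klinearI) (auto simp: A.FO_rep B.FO_rep B.Emb_rep pi_closed pi_zero pi_add pi_smult)
next
  fix n v a assume "v \<in> el (rep_obj A 0) n" "a \<in> carrier (Alg A n)"
  then show "Emb B (\<pi> n (Unemb A (act (rep_obj A 0) n v a))) = act (res_obj (rep_obj B 0)) n (Emb B (\<pi> n (Unemb A v))) a"
    by (auto simp: A.FO_rep A.rep_act_Emb act_res B.rep_act_Emb pi_closed pi_mult pi_zero)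
qed

lemma res_eps_apply: "a \<in> carrier (Alg A m) \<Longrightarrow> m = 0 \<or> a = \<zero>\<^bsub>Alg A m\<^esub> \<Longrightarrow>
    ap res_eps m (Emb A a) = Emb B (\<pi> m a)"
  unfolding res_eps_def by (subst A.mk_arr_apply) (auto simp: A.Emb_rep)

lemma res_simps:
  "N \<in> Ob B.CC \<Longrightarrow> FO res N = res_obj N"
  "\<lbrakk>M \<in> Ob B.CC; N \<in> Ob B.CC; \<alpha> \<in> mor B.CC M N\<rbrakk> \<Longrightarrow> FA res \<alpha> = res_arr \<alpha>"
  "Mul res = res_mul" "Eps res = res_eps"
  by (auto simp: res_def arrowsI)

lemma res_functor: "linear_functor K B.CC A.CC res"
proof (rule linear_functor.intro, goal_cases)
  case 1 show ?case by (auto simp: res_def res_obj)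
next
  case 2 show ?case by (simp add: res_def)
next
  case 3 then show ?case by (simp add: res_simps res_arr)
next
  case (4 M)
  then show ?case
    by (simp add: res_simps(1) res_simps(2)[OF _ _ B.C.id_mor] res_arr_def)
     (simp add: A.CC_simps B.CC_simps)
next
  case (5 M N P f g)
  then show ?case
    by (simp add: res_simps(2)[OF 5(1,2,4)] res_simps(2)[OF 5(2,3,5)] res_simps(2)[OF 5(1,3) B.C.comp_mor[OF 5]])
     (simp add: res_arr_def A.CC_simps(7) B.CC_simps(7))
next
  case (6 M N f g)
  then show ?case
    by (simp add: res_simps(1) res_simps(2)[OF 6(1,2,3)] res_simps(2)[OF 6(1,2,4)] res_simps(2)[OF 6(1,2) B.C.hom_add[OF 6]])
     (simp add: res_arr_def A.CC_simps(4) B.CC_simps(4))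
next
  case (7 M N f r)
  then show ?case
    by (simp add: res_simps(1) res_simps(2)[OF 7(1,2,3)] res_simps(2)[OF 7(1,2) B.C.hom_smult[OF 7(1,2,4,3)]])
     (simp add: res_arr_def A.CC_simps(5) B.CC_simps(5))
qed

lemma comp_app2:
  assumes "M \<in> Ob A.CC" "N \<in> Ob A.CC" "P \<in> Ob A.CC" "f \<in> mor A.CC M N" "g \<in> mor A.CC N P" "v \<in> el M n"
  shows "ap (h \<bullet>\<^bsub>A.CC\<^esub> g \<bullet>\<^bsub>A.CC\<^esub> f) n v = ap h n (ap g n (ap f n v))"
  using assms by (simp add: A.comp_apply[OF assms(1) A.C.comp_mor[OF assms(1-5)]] A.comp_apply[OF assms(1,4)])

text \<open>Each equation is compared on pure tensors, where it says that \<pi> preserves units,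
  products and \<open>Mu\<close>.\<close>

lemma res_lax: "lax_monoidal_functor K B.CC A.CC res"
proof (intro lax_monoidal_functor.intro res_functor lax_monoidal_functor_axioms.intro, goal_cases)
  case (1 M N) then show ?case by (simp add: res_simps B.CC_simps(8) A.CC_simps(8) B.day_obj res_mul)
next
  case (2 M N M' N' f g)
  note o = 2(1-4) and rs = res_obj[OF 2(1)] res_obj[OF 2(2)] res_obj[OF 2(3)] res_obj[OF 2(4)]
  note rf = res_arr[OF o(1,3) 2(5)] and rg = res_arr[OF o(2,4) 2(6)]
  note fg = B.day_arr[OF o 2(5,6)]
  note rfg = A.day_arr[OF rs rf rg]
  note D = A.day_obj[OF rs(1,2)] A.day_obj[OF rs(3,4)] B.day_obj[OF o(1,2)] B.day_obj[OF o(3,4)]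
  have "res_mul M' N' \<bullet>\<^bsub>A.CC\<^esub> day_arr K A (res_arr f) (res_arr g) = res_arr (day_arr K B f g) \<bullet>\<^bsub>A.CC\<^esub> res_mul M N"
  proof (rule A.day_hom_eqI[OF rs(1,2) res_obj[OF D(4)]])
    show "res_mul M' N' \<bullet>\<^bsub>A.CC\<^esub> day_arr K A (res_arr f) (res_arr g) \<in> mor A.CC (A.day (res_obj M) (res_obj N)) (res_obj (B.day M' N'))"
     by (rule A.C.comp_mor[OF D(1,2) res_obj[OF D(4)] rfg res_mul[OF o(3,4)]])
    show "res_arr (day_arr K B f g) \<bullet>\<^bsub>A.CC\<^esub> res_mul M N \<in> mor A.CC (A.day (res_obj M) (res_obj N)) (res_obj (B.day M' N'))"
     by (rule A.C.comp_mor[OF D(1) res_obj[OF D(3)] res_obj[OF D(4)] res_mul[OF o(1,2)] res_arr[OF D(3,4) fg]])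
  next
    fix p i v j w a
    assume g: "i + j = p" "v \<in> el (res_obj M) i" "w \<in> el (res_obj N) j" "a \<in> carrier (Alg A p)"
    have cl: "ap f i v \<in> el M' i" "ap g j w \<in> el N' j"
     using g B.mor_klinear[OF o(1) 2(5)] B.mor_klinear[OF o(2) 2(6)] by (auto intro: klinearD(1))
    note pc = A.pure_closed[OF rs(1,2) g]
    show "ap (res_mul M' N' \<bullet>\<^bsub>A.CC\<^esub> day_arr K A (res_arr f) (res_arr g)) p (A.pure (res_obj M) (res_obj N) p i v j w a) =
     ap (res_arr (day_arr K B f g) \<bullet>\<^bsub>A.CC\<^esub> res_mul M N) p (A.pure (res_obj M) (res_obj N) p i v j w a)"
     unfolding A.comp_apply[OF D(1) rfg pc] A.comp_apply[OF D(1) res_mul[OF o(1,2)] pc] A.day_arr_apply[OF rs rf rg g]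
     using g cl by (simp add: res_mul_apply[OF o(1,2)] res_mul_apply[OF o(3,4)] B.day_arr_apply[OF o 2(5,6)] pi_closed)
  qed
  then show ?case using o 2(5,6) fg D
    by (simp add: res_simps(3) res_simps(2)[OF o(1,3) 2(5)] res_simps(2)[OF o(2,4) 2(6)] res_simps(2)[OF D(3,4) fg] A.CC_simps(8,9) B.CC_simps(8,9))
next
  case 3 show ?case by (simp add: res_simps A.CC_simps(10) B.CC_simps(10) B.rep_obj res_eps)
next
  case (4 M N P)
  note rs = 4[THEN res_obj]
  note DB = B.day_obj[OF 4(1,2)] B.day_obj[OF 4(2,3)]
  note DB' = B.day_obj[OF DB(1) 4(3)] B.day_obj[OF 4(1) DB(2)]
  note DA = A.day_obj[OF rs(1,2)] A.day_obj[OF rs(2,3)]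
  note DA' = A.day_obj[OF DA(1) rs(3)] A.day_obj[OF rs(1) DA(2)]
  note rD = DB[THEN res_obj] and rD' = DB'[THEN res_obj]
  note DR = A.day_obj[OF rD(1) rs(3)] A.day_obj[OF rs(1) rD(2)]
  note m1 = A.day_arr[OF DA(1) rs(3) rD(1) rs(3) res_mul[OF 4(1,2)] A.C.id_mor[OF rs(3)]]
  note m2 = res_mul[OF DB(1) 4(3)]
  note m3 = res_arr[OF DB' B.day_assoc[OF 4]]
  note n1 = A.day_assoc[OF rs]
  note n2 = A.day_arr[OF rs(1) DA(2) rs(1) rD(2) A.C.id_mor[OF rs(1)] res_mul[OF 4(2,3)]]
  note n3 = res_mul[OF 4(1) DB(2)]
  let ?l = "res_arr (day_assoc K B M N P) \<bullet>\<^bsub>A.CC\<^esub> res_mul (B.day M N) P \<bullet>\<^bsub>A.CC\<^esub> day_arr K A (res_mul M N) (Id A.CC (res_obj P))"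
  let ?r = "res_mul M (B.day N P) \<bullet>\<^bsub>A.CC\<^esub> day_arr K A (Id A.CC (res_obj M)) (res_mul N P) \<bullet>\<^bsub>A.CC\<^esub> day_assoc K A (res_obj M) (res_obj N) (res_obj P)"
  have "?l = ?r"
  proof (rule A.day_hom_eqI2[OF rs rD'(2)])
    show "?l \<in> mor A.CC (A.day (A.day (res_obj M) (res_obj N)) (res_obj P)) (res_obj (B.day M (B.day N P)))"
     by (rule A.C.comp_mor[OF DA'(1) rD'(1,2) A.C.comp_mor[OF DA'(1) DR(1) rD'(1) m1 m2] m3])
    show "?r \<in> mor A.CC (A.day (A.day (res_obj M) (res_obj N)) (res_obj P)) (res_obj (B.day M (B.day N P)))"
     by (rule A.C.comp_mor[OF DA'(1) DR(2) rD'(2) A.C.comp_mor[OF DA'(1,2) DR(2) n1 n2] n3])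
  next
    fix p l i u j v a k w b
    assume "l + k = p" "i + j = l" "u \<in> el (res_obj M) i" "v \<in> el (res_obj N) j" "a \<in> carrier (Alg A l)"
     "w \<in> el (res_obj P) k" "b \<in> carrier (Alg A p)"
    note g = this
    have ijk: "i + (j + k) = p" using g(1,2) by simp
    have g': "u \<in> el M i" "v \<in> el N j" "w \<in> el P k" using g by simp_all
    have X: "Mu A l k a \<one>\<^bsub>Alg A k\<^esub> \<in> carrier (Alg A p)" by (rule A.mu_closed'[OF g(1,5) A.alg.one_closed])
    have piX: "\<pi> p (Mu A l k a \<one>\<^bsub>Alg A k\<^esub>) = Mu B l k (\<pi> l a) \<one>\<^bsub>Alg B k\<^esub>"
     using pi_mu[OF g(5) A.alg.one_closed[of k]] g(1) by (simp add: pi_one)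
    note pA = A.pure_closed[OF rs(1,2) g(2-5)]
    note pB = B.pure_closed[OF 4(1,2) g(2) g'(1,2) pi_closed[OF g(5)]]
    note qA = A.pure_closed[OF rs(2,3) HOL.refl g(4,6) A.alg.one_closed]
    note qB = B.pure_closed[OF 4(2,3) HOL.refl g'(2,3) B.alg.one_closed]
    note ppA = A.pure_closed[OF DA(1) rs(3) g(1) pA g(6,7)]
    have e1: "ap ?l p (A.pure (A.day (res_obj M) (res_obj N)) (res_obj P) p l (A.pure (res_obj M) (res_obj N) l i u j v a) k w b) =
     B.pure M (B.day N P) p i u (j + k) (B.pure N P (j + k) j v k w \<one>\<^bsub>Alg B (j + k)\<^esub>) (Mu B l k (\<pi> l a) \<one>\<^bsub>Alg B k\<^esub> \<otimes>\<^bsub>Alg B p\<^esub> \<pi> p b)"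
     unfolding comp_app2[OF DA'(1) DR(1) rD'(1) m1 m2 ppA]
      A.day_arr_apply[OF DA(1) rs(3) rD(1) rs(3) res_mul[OF 4(1,2)] A.C.id_mor[OF rs(3)] g(1) pA g(6,7)]
      A.id_apply[OF g(6)] res_mul_apply[OF 4(1,2) g(2) g'(1,2) g(5)] At_res
      res_mul_apply[OF DB(1) 4(3) g(1) pB g'(3) g(7)]
      B.day_assoc_apply[OF 4 g(1,2) g'(1,2) pi_closed[OF g(5)] g'(3) pi_closed[OF g(7)]] ..
    have e2: "ap ?r p (A.pure (A.day (res_obj M) (res_obj N)) (res_obj P) p l (A.pure (res_obj M) (res_obj N) l i u j v a) k w b) =
     B.pure M (B.day N P) p i u (j + k) (B.pure N P (j + k) j v k w (\<pi> (j + k) \<one>\<^bsub>Alg A (j + k)\<^esub>)) (\<pi> p (Mu A l k a \<one>\<^bsub>Alg A k\<^esub> \<otimes>\<^bsub>Alg A p\<^esub> b))"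
     unfolding comp_app2[OF DA'(1,2) DR(2) n1 n2 ppA] A.day_assoc_apply[OF rs g]
      A.day_arr_apply[OF rs(1) DA(2) rs(1) rD(2) A.C.id_mor[OF rs(1)] res_mul[OF 4(2,3)] ijk g(3) qA A.alg.m_closed[OF X g(7)]]
      A.id_apply[OF g(3)] res_mul_apply[OF 4(2,3) HOL.refl g'(2,3) A.alg.one_closed]
     by (rule res_mul_apply[OF 4(1) DB(2) ijk g'(1) _ A.alg.m_closed[OF X g(7)]]) (simp add: pi_one qB)
    show "ap ?l p (A.pure (A.day (res_obj M) (res_obj N)) (res_obj P) p l (A.pure (res_obj M) (res_obj N) l i u j v a) k w b) =
     ap ?r p (A.pure (A.day (res_obj M) (res_obj N)) (res_obj P) p l (A.pure (res_obj M) (res_obj N) l i u j v a) k w b)"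
     unfolding e1 e2 using X g(7) by (simp add: pi_one pi_mult piX)
  qed
  then show ?case
    by (simp add: res_simps(3) res_simps(1)[OF 4(1)] res_simps(1)[OF 4(2)] res_simps(1)[OF 4(3)] A.CC_simps(8,9,11) B.CC_simps(8,9,11)
     res_simps(2)[OF DB' B.day_assoc[OF 4]])
next
  case (5 M)
  note r = res_obj[OF 5] and rI = res_obj[OF B.rep_obj[of 0]]
  note m1 = A.day_arr[OF A.rep_obj r rI r res_eps A.C.id_mor[OF r]]
  note m2 = res_mul[OF B.rep_obj 5, of 0]
  note DB = B.day_obj[OF B.rep_obj 5, of 0]
  note m3 = res_arr[OF DB 5 B.day_lun[OF 5]]
  note DA = A.day_obj[OF A.rep_obj r, of 0] A.day_obj[OF rI r]
  have "res_arr (day_lun K B M) \<bullet>\<^bsub>A.CC\<^esub> res_mul (rep_obj B 0) M \<bullet>\<^bsub>A.CC\<^esub> day_arr K A res_eps (Id A.CC (res_obj M)) = day_lun K A (res_obj M)" (is "?l = _")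
  proof (rule A.day_hom_eqI[OF A.rep_obj r r _ A.day_lun[OF r]])
    show "?l \<in> mor A.CC (A.day (rep_obj A 0) (res_obj M)) (res_obj M)"
     by (rule A.C.comp_mor[OF DA(1) res_obj[OF DB] r A.C.comp_mor[OF DA(1,2) res_obj[OF DB] m1 m2] m3])
  next
    fix p i a j v b
    assume g: "i + j = p" "a \<in> el (rep_obj A 0) i" "v \<in> el (res_obj M) j" "b \<in> carrier (Alg A p)"
    then obtain x where x: "a = Emb A x" "x \<in> carrier (Alg A i)" "i = 0 \<or> x = \<zero>\<^bsub>Alg A i\<^esub>" by (auto simp: A.FO_rep)
    have v: "v \<in> el M j" using g by simp
    have a: "Emb B (\<pi> i x) \<in> el (rep_obj B 0) i" using x by (auto simp: B.Emb_rep pi_closed pi_zero)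
    have e: "ap res_eps i a = Emb B (\<pi> i x)" using res_eps_apply[OF x(2,3)] x(1) by simp
    have "ap ?l p (A.pure (rep_obj A 0) (res_obj M) p i a j v b) =
     (if i = 0 then act M p v (Mu B 0 p (\<pi> i x) \<one>\<^bsub>Alg B p\<^esub> \<otimes>\<^bsub>Alg B p\<^esub> \<pi> p b) else \<zero>\<^bsub>FO M p\<^esub>)"
     unfolding comp_app2[OF DA res_obj[OF DB] m1 m2 A.pure_closed[OF A.rep_obj r g]]
      A.day_arr_apply[OF A.rep_obj r rI r res_eps A.C.id_mor[OF r] g] A.id_apply[OF g(3)] e
      res_mul_apply[OF B.rep_obj 5 g(1) a v g(4)] At_res B.day_lun_apply[OF 5 g(1) a v pi_closed[OF g(4)]] B.Unemb_Emb ..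
    also have "\<dots> = ap (day_lun K A (res_obj M)) p (A.pure (rep_obj A 0) (res_obj M) p i a j v b)"
    proof (cases "i = 0")
     case True
     have "Mu A 0 p x \<one>\<^bsub>Alg A p\<^esub> \<in> carrier (Alg A p)" using A.mu_closed'[OF add_0 _ A.alg.one_closed] x True by simp
     moreover have "\<pi> p (Mu A 0 p x \<one>\<^bsub>Alg A p\<^esub>) = Mu B 0 p (\<pi> 0 x) \<one>\<^bsub>Alg B p\<^esub>"
      using pi_mu[of x 0 "\<one>\<^bsub>Alg A p\<^esub>" p] x True by (simp add: pi_one)
     ultimately show ?thesis unfolding A.day_lun_apply[OF r g] using x True g by (simp add: act_res pi_mult)
    qed (simp add: A.day_lun_apply[OF r g])
    finally show "ap ?l p (A.pure (rep_obj A 0) (res_obj M) p i a j v b) =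
     ap (day_lun K A (res_obj M)) p (A.pure (rep_obj A 0) (res_obj M) p i a j v b)" .
  qed
  then show ?case
    by (simp add: res_simps(3,4) res_simps(1)[OF 5] res_simps(1)[OF B.rep_obj] res_simps(2)[OF DB 5 B.day_lun[OF 5]]
     A.CC_simps(8-12) B.CC_simps(8-12))
next
  case (6 M)
  note r = res_obj[OF 6] and rI = res_obj[OF B.rep_obj[of 0]]
  note m1 = A.day_arr[OF r A.rep_obj r rI A.C.id_mor[OF r] res_eps]
  note m2 = res_mul[OF 6 B.rep_obj, of 0]
  note DB = B.day_obj[OF 6 B.rep_obj, of 0]
  note m3 = res_arr[OF DB 6 B.day_run[OF 6]]
  note DA = A.day_obj[OF r A.rep_obj, of 0] A.day_obj[OF r rI]
  have "res_arr (day_run K B M) \<bullet>\<^bsub>A.CC\<^esub> res_mul M (rep_obj B 0) \<bullet>\<^bsub>A.CC\<^esub> day_arr K A (Id A.CC (res_obj M)) res_eps = day_run K A (res_obj M)" (is "?l = _")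
  proof (rule A.day_hom_eqI[OF r A.rep_obj r _ A.day_run[OF r]])
    show "?l \<in> mor A.CC (A.day (res_obj M) (rep_obj A 0)) (res_obj M)"
     by (rule A.C.comp_mor[OF DA(1) res_obj[OF DB] r A.C.comp_mor[OF DA(1,2) res_obj[OF DB] m1 m2] m3])
  next
    fix p i v j a b
    assume g: "i + j = p" "v \<in> el (res_obj M) i" "a \<in> el (rep_obj A 0) j" "b \<in> carrier (Alg A p)"
    then obtain x where x: "a = Emb A x" "x \<in> carrier (Alg A j)" "j = 0 \<or> x = \<zero>\<^bsub>Alg A j\<^esub>" by (auto simp: A.FO_rep)
    have v: "v \<in> el M i" using g by simp
    have a: "Emb B (\<pi> j x) \<in> el (rep_obj B 0) j" using x by (auto simp: B.Emb_rep pi_closed pi_zero)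
    have e: "ap res_eps j a = Emb B (\<pi> j x)" using res_eps_apply[OF x(2,3)] x(1) by simp
    have "ap ?l p (A.pure (res_obj M) (rep_obj A 0) p i v j a b) =
     (if j = 0 then act M p v (Mu B p 0 \<one>\<^bsub>Alg B p\<^esub> (\<pi> j x) \<otimes>\<^bsub>Alg B p\<^esub> \<pi> p b) else \<zero>\<^bsub>FO M p\<^esub>)"
     unfolding comp_app2[OF DA res_obj[OF DB] m1 m2 A.pure_closed[OF r A.rep_obj g]]
      A.day_arr_apply[OF r A.rep_obj r rI A.C.id_mor[OF r] res_eps g] A.id_apply[OF g(2)] e
      res_mul_apply[OF 6 B.rep_obj g(1) v a g(4)] At_res B.day_run_apply[OF 6 g(1) v a pi_closed[OF g(4)]] B.Unemb_Emb ..
    also have "\<dots> = ap (day_run K A (res_obj M)) p (A.pure (res_obj M) (rep_obj A 0) p i v j a b)"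
    proof (cases "j = 0")
     case True
     have "Mu A p 0 \<one>\<^bsub>Alg A p\<^esub> x \<in> carrier (Alg A p)" using A.mu_closed'[OF add_0_right A.alg.one_closed] x True by simp
     moreover have "\<pi> p (Mu A p 0 \<one>\<^bsub>Alg A p\<^esub> x) = Mu B p 0 \<one>\<^bsub>Alg B p\<^esub> (\<pi> 0 x)"
      using pi_mu[of "\<one>\<^bsub>Alg A p\<^esub>" p x 0] x True by (simp add: pi_one)
     ultimately show ?thesis unfolding A.day_run_apply[OF r g] using x True g by (simp add: act_res pi_mult)
    qed (simp add: A.day_run_apply[OF r g])
    finally show "ap ?l p (A.pure (res_obj M) (rep_obj A 0) p i v j a b) =
     ap (day_run K A (res_obj M)) p (A.pure (res_obj M) (rep_obj A 0) p i v j a b)" .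
  qed
  then show ?case
    by (simp add: res_simps(3,4) res_simps(1)[OF 6] res_simps(1)[OF B.rep_obj] res_simps(2)[OF DB 6 B.day_run[OF 6]]
     A.CC_simps(8-13) B.CC_simps(8-13))
qed

section \<open>Structure maps of the restriction as quotients by the kernel\<close>

definition ker :: "nat \<Rightarrow> 'x set" where
  "ker n = {a \<in> carrier (Alg A n). \<pi> n a = \<zero>\<^bsub>Alg B n\<^esub>}"

text \<open>The kernel of \<pi> acts by zero on a restricted module.\<close>

lemma kills_res:
  assumes N: "N \<in> Ob B.CC" and M: "M \<in> Ob A.CC" and f: "f \<in> mor A.CC M (res_obj N)"
  shows "A.kills ker M (res_obj N) f"
  unfolding A.kills_def
proof (intro allI ballI)
  fix n x b assume x: "x \<in> el M n" and b: "b \<in> ker n"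
  have "ap f n x \<in> el N n" using klinearD(1)[OF A.mor_klinear[OF M f] x] by simp
  then show "ap f n (act M n x b) = \<zero>\<^bsub>FO (res_obj N) n\<^esub>"
    using A.mor_act[OF M res_obj[OF N] f x] b by (simp add: ker_def act_res B.act_zero_alg[OF N])
qed

text \<open>The image of \<open>x a\<close> under \<open>g\<close> is linear in \<open>a\<close> and
  vanishes on \<open>ker\<close>, so \<open>klinear_kernel_le\<close> applies. This makes the choice
  of lifts along \<pi> immaterial below.\<close>

lemma kills_eq:
  assumes M: "M \<in> Ob A.CC" and P: "P \<in> Ob A.CC" and g: "g \<in> mor A.CC M P" and k: "A.kills ker M P g"
    and x: "x \<in> el M n" and a: "a \<in> carrier (Alg A n)" "a' \<in> carrier (Alg A n)" and eq: "\<pi> n a = \<pi> n a'"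
  shows "ap g n (act M n x a) = ap g n (act M n x a')"
proof -
  have l: "klinear K (Alg A n) (FO P n) (\<lambda>a. ap g n (act M n x a))"
    by (rule klinear_comp[OF A.act_klinear_alg[OF M x] A.mor_klinear[OF M g]])
  show ?thesis
    by (rule klinear_kernel_le[OF A.alg_module B.alg_module A.obj_module[OF P] pi_klinear l _ a eq])
     (use k x in \<open>auto simp: A.kills_def ker_def\<close>)
qed

text \<open>An arrow \<open>g\<close> that kills the kernel factors, as a linear map, through the
  convolution over \<open>B\<close>: on pure tensors the algebra element is lifted along \<pi>. So
  \<open>g\<close> vanishes wherever \<open>res_mul\<close> does.\<close>

lemma res_mul_quotient:
  assumes o: "M \<in> Ob B.CC" "N \<in> Ob B.CC"
  shows "A.quotient_arr ker (A.day (res_obj M) (res_obj N)) (res_obj (B.day M N)) (res_mul M N)"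
  unfolding A.quotient_arr_def
proof (intro conjI ballI allI impI)
  let ?D = "A.day (res_obj M) (res_obj N)"
  note r = res_obj[OF o(1)] res_obj[OF o(2)]
  note D = A.day_obj[OF r] and DB = B.day_obj[OF o]
  show "?D \<in> Ob A.CC" by (rule D)
  show "res_obj (B.day M N) \<in> Ob A.CC" by (rule res_obj[OF DB])
  show m: "res_mul M N \<in> mor A.CC ?D (res_obj (B.day M N))" by (rule res_mul[OF o])
  show "A.kills ker ?D (res_obj (B.day M N)) (res_mul M N)" by (rule kills_res[OF DB D m])
  have l: "klinear K (FO ?D n) (FO (B.day M N) n) (ap (res_mul M N) n)" for n
    using A.mor_klinear[OF D m] by simp
  {
    fix n y assume y: "y \<in> el (res_obj (B.day M N)) n"
    show "\<exists>x\<in>el ?D n. ap (res_mul M N) n x = y"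
    proof (rule B.day_surj[OF o A.obj_module[OF D] l _ y[unfolded FO_res]])
     fix i v j w b assume g: "i + j = n" "v \<in> el M i" "w \<in> el N j" "b \<in> carrier (Alg B n)"
     obtain a where a: "a \<in> carrier (Alg A n)" "\<pi> n a = b" using pi_surj[OF g(4)] by blast
     show "\<exists>x\<in>el ?D n. ap (res_mul M N) n x = B.pure M N n i v j w b"
      using res_mul_apply[OF o g(1-3) a(1)] a(2) A.pure_closed[OF r g(1) _ _ a(1)] g by auto
    qed
  }
  fix P g n x
  assume P: "P \<in> Ob A.CC" and g: "g \<in> mor A.CC ?D P" and k: "A.kills ker ?D P g"
    and x: "x \<in> el ?D n" and fx: "ap (res_mul M N) n x = \<zero>\<^bsub>FO (res_obj (B.day M N)) n\<^esub>"
  \<comment> \<open>A set-theoretic section of \<pi>, chosen without linearity. By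
    \<open>dep\<close> the values of \<open>g\<close> do not see which lift is taken, and this
    restores linearity.\<close>
  define s where "s b = (SOME a. a \<in> carrier (Alg A n) \<and> \<pi> n a = b)" for b
  have s: "s b \<in> carrier (Alg A n)" "\<pi> n (s b) = b" if "b \<in> carrier (Alg B n)" for b
    using someI_ex[of "\<lambda>a. a \<in> carrier (Alg A n) \<and> \<pi> n a = b"] pi_surj[OF that] unfolding s_def by blast+
  let ?g = "\<lambda>i v j w a. ap g n (A.pure (res_obj M) (res_obj N) n i v j w a)"
  have dep: "?g i v j w a = ?g i v j w a'"
    if "i + j = n" "v \<in> el M i" "w \<in> el N j" "a \<in> carrier (Alg A n)" "a' \<in> carrier (Alg A n)" "\<pi> n a = \<pi> n a'"
    for i v j w a a'
    using kills_eq[OF D P g k A.pure_closed[OF r that(1) _ _ A.alg.one_closed] that(4,5,6)] that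
    by (simp add: A.day_act[OF r])
  have lg: "klinear K (FO ?D n) (FO P n) (ap g n)" by (rule A.mor_klinear[OF D g])
  have bil: "B.day_bilin M N n (FO P n) (\<lambda>i v j w b. ?g i v j w (s b))"
  proof (rule B.day_bilinI[OF A.obj_module[OF P]], goal_cases)
    case (1 i j w b)
    then show ?case using klinear_comp[OF A.pure_klinear(1)[OF r 1(1)] lg] s by simp
  next
    case (2 i j v b)
    then show ?case using klinear_comp[OF A.pure_klinear(2)[OF r 2(1)] lg] s by simp
  next
    case (3 i j v w)
    have l3: "klinear K (Alg A n) (FO P n) (?g i v j w)"
     using klinear_comp[OF A.pure_klinear(3)[OF r 3(1)] lg] 3 by simp
    show ?case
    proof (rule klinearI)
     fix b c assume b: "b \<in> carrier (Alg B n)" "c \<in> carrier (Alg B n)"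
     have "?g i v j w (s (b \<oplus>\<^bsub>Alg B n\<^esub> c)) = ?g i v j w (s b \<oplus>\<^bsub>Alg A n\<^esub> s c)"
      using b 3 by (intro dep) (simp_all add: s pi_add)
     then show "?g i v j w (s (b \<oplus>\<^bsub>Alg B n\<^esub> c)) = ?g i v j w (s b) \<oplus>\<^bsub>FO P n\<^esub> ?g i v j w (s c)"
      using b by (simp add: klinearD(2)[OF l3] s)
    next
     fix t b assume b: "t \<in> carrier K" "b \<in> carrier (Alg B n)"
     have "?g i v j w (s (t \<odot>\<^bsub>Alg B n\<^esub> b)) = ?g i v j w (t \<odot>\<^bsub>Alg A n\<^esub> s b)"
      using b 3 by (intro dep) (simp_all add: s pi_smult)
     then show "?g i v j w (s (t \<odot>\<^bsub>Alg B n\<^esub> b)) = t \<odot>\<^bsub>FO P n\<^esub> ?g i v j w (s b)"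
      using b by (simp add: klinearD(3)[OF l3] s)
    qed (simp add: klinearD(1)[OF l3] s)
  next
    case (4 i j v w b c c')
    \<comment> \<open>Balancing over \<open>B\<close> is reduced to \<open>A\<close> by lifting
      \<open>c\<close> and \<open>c'\<close>; the lift of the product and the product of the lifts
      are identified by \<open>dep\<close>.\<close>
    obtain d d' where d: "d \<in> carrier (Alg A i)" "\<pi> i d = c" "d' \<in> carrier (Alg A j)" "\<pi> j d' = c'"
     using pi_surj[OF 4(5)] pi_surj[OF 4(6)] by blast
    have m: "Mu A i j d d' \<in> carrier (Alg A n)" "\<pi> n (Mu A i j d d') = Mu B i j c c'" "Mu B i j c c' \<in> carrier (Alg B n)"
     using A.mu_closed'[OF 4(1) d(1,3)] B.mu_closed'[OF 4(1,5,6)] pi_mu[OF d(1,3)] 4(1) d by auto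
    have "?g i (act M i v c) j (act N j w c') (s b) = ?g i (act (res_obj M) i v d) j (act (res_obj N) j w d') (s b)"
     using d by (simp add: act_res)
    also have "\<dots> = ?g i v j w (Mu A i j d d' \<otimes>\<^bsub>Alg A n\<^esub> s b)"
     using 4 d by (subst A.pure_balanced[OF r 4(1)]) (simp_all add: s)
    also have "\<dots> = ?g i v j w (s (Mu B i j c c' \<otimes>\<^bsub>Alg B n\<^esub> b))"
     using 4 m by (intro dep) (simp_all add: s pi_mult)
    finally show ?case .
  qed
  let ?h = "B.day_map (FO P n) (\<lambda>i v j w b. ?g i v j w (s b))"
  have "?h (ap (res_mul M N) n x) = ap g n x"
  proof (rule A.day_ext[OF r A.obj_module[OF P] klinear_comp[OF l B.day_map(1)[OF o bil]] lg _ x])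
    fix i v j w a assume h: "i + j = n" "v \<in> el (res_obj M) i" "w \<in> el (res_obj N) j" "a \<in> carrier (Alg A n)"
    then show "?h (ap (res_mul M N) n (A.pure (res_obj M) (res_obj N) n i v j w a)) = ?g i v j w a"
     using dep[OF h(1) _ _ s(1) h(4) s(2)] by (simp add: res_mul_apply[OF o] B.day_map(2)[OF o bil] pi_closed)
  qed
  then show "ap g n x = \<zero>\<^bsub>FO P n\<^esub>"
    using klinear_zero[OF B.day_module[OF o] A.obj_module[OF P] B.day_map(1)[OF o bil]] fx by simp
qed

text \<open>In degree 0 an element that \<open>res_eps\<close> sends to zero is the unit acted on by
  an element of \<open>ker 0\<close>; in the other degrees the representable module is zero.\<close>

lemma res_eps_quotient: "A.quotient_arr ker (rep_obj A 0) (res_obj (rep_obj B 0)) res_eps"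
  unfolding A.quotient_arr_def
proof (intro conjI ballI allI impI A.rep_obj res_obj B.rep_obj res_eps)
  show "A.kills ker (rep_obj A 0) (res_obj (rep_obj B 0)) res_eps"
    by (rule kills_res[OF B.rep_obj A.rep_obj res_eps])
next
  fix n y assume "y \<in> el (res_obj (rep_obj B 0)) n"
  then obtain b where b: "y = Emb B b" "b \<in> carrier (Alg B n)" "n = 0 \<or> b = \<zero>\<^bsub>Alg B n\<^esub>"
    by (auto simp: B.FO_rep)
  have "\<exists>a\<in>carrier (Alg A n). \<pi> n a = b \<and> (n = 0 \<or> a = \<zero>\<^bsub>Alg A n\<^esub>)"
    using pi_surj[OF b(2)] b(3) pi_zero[of n] by (cases "n = 0") auto
  then show "\<exists>x\<in>el (rep_obj A 0) n. ap res_eps n x = y"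
    using b res_eps_apply A.Emb_rep by metis
next
  fix P g n x
  assume P: "P \<in> Ob A.CC" and g: "g \<in> mor A.CC (rep_obj A 0) P" and k: "A.kills ker (rep_obj A 0) P g"
    and x: "x \<in> el (rep_obj A 0) n" and fx: "ap res_eps n x = \<zero>\<^bsub>FO (res_obj (rep_obj B 0)) n\<^esub>"
  from x obtain a where a: "x = Emb A a" "a \<in> carrier (Alg A n)" "n = 0 \<or> a = \<zero>\<^bsub>Alg A n\<^esub>" by (auto simp: A.FO_rep)
  show "ap g n x = \<zero>\<^bsub>FO P n\<^esub>"
  proof (cases "n = 0")
    case True
    have "Emb B (\<pi> n a) = Emb B \<zero>\<^bsub>Alg B n\<^esub>" using fx a res_eps_apply[OF a(2,3)] by (simp add: B.FO_rep)
    then have "a \<in> ker n" using a by (metis (mono_tags) B.Unemb_Emb ker_def mem_Collect_eq)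
    moreover have "x = act (rep_obj A 0) n (Emb A \<one>\<^bsub>Alg A n\<^esub>) a" using a True by (simp add: A.rep_act_Emb)
    moreover have "Emb A \<one>\<^bsub>Alg A n\<^esub> \<in> el (rep_obj A 0) n" using True by (simp add: A.Emb_rep)
    ultimately show ?thesis using k by (auto simp: A.kills_def)
  next
    case False
    then have "x = \<zero>\<^bsub>FO (rep_obj A 0) n\<^esub>" using a by (simp add: A.FO_rep)
    then show ?thesis using klinear_zero[OF A.rep_module A.obj_module[OF P] A.mor_klinear[OF A.rep_obj g]] by simp
  qed
qed

end

section \<open>Group algebras\<close>

lemma module_cong:
  fixes M N :: "('k, 'v) module"
  assumes "module K M" "carrier N = carrier M" "add N = add M" "zero N = zero M" "smult N = smult M"
  shows "module K N"
  using assms unfolding module_def abelian_group_def abelian_monoid_def abelian_group_axioms_def module_axioms_def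
  by simp

definition fin_fun :: "'k ring \<Rightarrow> 'g set \<Rightarrow> ('g \<Rightarrow> 'k) set" where
  "fin_fun K S = {f. range f \<subseteq> carrier K \<and> finite {x. f x \<noteq> \<zero>\<^bsub>K\<^esub>} \<and> {x. f x \<noteq> \<zero>\<^bsub>K\<^esub>} \<subseteq> S}"

definition fin_space :: "'k ring \<Rightarrow> 'g set \<Rightarrow> ('k, 'g \<Rightarrow> 'k) module" where
  "fin_space K S = linear_space (fin_fun K S) (\<lambda>x. \<zero>\<^bsub>K\<^esub>) (\<lambda>f g x. f x \<oplus>\<^bsub>K\<^esub> g x) (\<lambda>r f x. r \<otimes>\<^bsub>K\<^esub> f x)"

text \<open>Bilinear extension of an operation on basis elements, where the three index sets may
  differ. It is the product of a group algebra for the group multiplication, and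
  \<open>braid_mu\<close> for \<open>group_mu\<close>.\<close>

definition conv :: "'k ring \<Rightarrow> ('g \<Rightarrow> 'h \<Rightarrow> 'i) \<Rightarrow> ('g \<Rightarrow> 'k) \<Rightarrow> ('h \<Rightarrow> 'k) \<Rightarrow> 'i \<Rightarrow> 'k" where
  "conv K op f g = (\<lambda>z. finsum K (\<lambda>(x, y). f x \<otimes>\<^bsub>K\<^esub> g y)
    {(x, y). f x \<noteq> \<zero>\<^bsub>K\<^esub> \<and> g y \<noteq> \<zero>\<^bsub>K\<^esub> \<and> op x y = z})"

definition delta :: "'k ring \<Rightarrow> 'g \<Rightarrow> 'g \<Rightarrow> 'k" where
  "delta K x = (\<lambda>y. if y = x then \<one>\<^bsub>K\<^esub> else \<zero>\<^bsub>K\<^esub>)"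

locale convolution = field K for K :: "'k ring"
begin

abbreviation "supp f \<equiv> {x. f x \<noteq> \<zero>\<^bsub>K\<^esub>}"

lemma fin_space_simps [simp]:
  "carrier (fin_space K S) = fin_fun K S"
  "\<zero>\<^bsub>fin_space K S\<^esub> = (\<lambda>x. \<zero>\<^bsub>K\<^esub>)"
  "f \<oplus>\<^bsub>fin_space K S\<^esub> g = (\<lambda>x. f x \<oplus>\<^bsub>K\<^esub> g x)"
  "r \<odot>\<^bsub>fin_space K S\<^esub> f = (\<lambda>x. r \<otimes>\<^bsub>K\<^esub> f x)"
  by (simp_all add: fin_space_def)

lemma fin_funI:
  assumes "\<And>x. f x \<in> carrier K" "finite F" "\<And>x. f x \<noteq> \<zero>\<^bsub>K\<^esub> \<Longrightarrow> x \<in> F" "\<And>x. f x \<noteq> \<zero>\<^bsub>K\<^esub> \<Longrightarrow> x \<in> S"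
  shows "f \<in> fin_fun K S"
  using assms by (auto simp: fin_fun_def intro: finite_subset)

lemma fin_funD:
  assumes "f \<in> fin_fun K S"
  shows "f x \<in> carrier K" "finite (supp f)" "f x \<noteq> \<zero>\<^bsub>K\<^esub> \<Longrightarrow> x \<in> S"
  using assms by (auto simp: fin_fun_def)

lemma fin_space_module: "module K (fin_space K S)"
  unfolding fin_space_def
proof (rule module_linear_space[OF field_axioms], goal_cases)
  case 1 show ?case by (rule fin_funI[of _ "{}"]) auto
next
  case (2 f g)
  have nz: "f x \<noteq> \<zero>\<^bsub>K\<^esub> \<or> g x \<noteq> \<zero>\<^bsub>K\<^esub>" if "f x \<oplus>\<^bsub>K\<^esub> g x \<noteq> \<zero>\<^bsub>K\<^esub>" for x
    using that by auto
  show ?case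
    by (rule fin_funI[of _ "supp f \<union> supp g"])
     (use 2[THEN fin_funD(1)] 2[THEN fin_funD(2)] 2[THEN fin_funD(3)] nz in \<open>auto, blast\<close>)
next
  case (3 r f)
  have nz: "f x \<noteq> \<zero>\<^bsub>K\<^esub>" if "r \<otimes>\<^bsub>K\<^esub> f x \<noteq> \<zero>\<^bsub>K\<^esub>" for x
    using that 3(1) by auto
  show ?case
    by (rule fin_funI[of _ "supp f"])
     (use 3(1) 3(2)[THEN fin_funD(1)] 3(2)[THEN fin_funD(2)] 3(2)[THEN fin_funD(3)] nz in auto)
next
  case (4 f g h) then show ?case using fin_funD(1) by (simp add: fun_eq_iff a_assoc[OF fin_funD(1) fin_funD(1) fin_funD(1)])
next
  case (5 f g) then show ?case by (simp add: fun_eq_iff a_comm[OF fin_funD(1) fin_funD(1)])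
next
  case (6 f) then show ?case by (simp add: fun_eq_iff fin_funD(1))
next
  case (7 f) then show ?case by (simp add: fun_eq_iff fin_funD(1))
next
  case (8 f) then show ?case by (simp add: fun_eq_iff fin_funD(1))
next
  case (9 r t f) then show ?case by (simp add: fun_eq_iff fin_funD(1) l_distr)
next
  case (10 r f g) then show ?case by (simp add: fun_eq_iff fin_funD(1) r_distr)
next
  case (11 r t f) then show ?case by (simp add: fun_eq_iff fin_funD(1) m_assoc)
qed

lemma delta_fin_fun: "x \<in> S \<Longrightarrow> delta K x \<in> fin_fun K S"
  by (rule fin_funI[of _ "{x}"]) (auto simp: delta_def split: if_splits)

lemma delta_apply [simp]: "delta K x x = \<one>\<^bsub>K\<^esub>" "y \<noteq> x \<Longrightarrow> delta K x y = \<zero>\<^bsub>K\<^esub>"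
  by (simp_all add: delta_def)

text \<open>The functions \<open>delta K x\<close> span: induction on a finite set containing the
  support, removing one point at a time.\<close>

lemma fin_space_ext:
  assumes W: "module K W" and h: "klinear K (fin_space K S) W h" "klinear K (fin_space K S) W h'"
    and eq: "\<And>x. x \<in> S \<Longrightarrow> h (delta K x) = h' (delta K x)" and f: "f \<in> fin_fun K S"
  shows "h f = h' f"
proof -
  have "h f = h' f" if "finite F" "f \<in> fin_fun K S" "supp f \<subseteq> F" for F f
    using that
  proof (induction F arbitrary: f rule: finite_induct)
    case empty
    then have "f = (\<lambda>x. \<zero>\<^bsub>K\<^esub>)" by auto
    then show ?case using klinear_zero[OF fin_space_module W h(1)] klinear_zero[OF fin_space_module W h(2)] by simp
  next
    case (insert x F)
    note fc = fin_funD(1)[OF insert.prems(1)]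
    show ?case
    proof (cases "x \<in> S")
     case True
     let ?g = "\<lambda>y. if y = x then \<zero>\<^bsub>K\<^esub> else f y"
     have g: "?g \<in> fin_fun K S"
      by (rule fin_funI[of _ "supp f"])
       (use fin_funD[OF insert.prems(1)] in \<open>auto split: if_splits\<close>)
     have "{y. ?g y \<noteq> \<zero>\<^bsub>K\<^esub>} \<subseteq> F" using insert.prems(2) by auto
     then have IH: "h ?g = h' ?g" using insert.IH g by blast
     have fg: "f = ?g \<oplus>\<^bsub>fin_space K S\<^esub> f x \<odot>\<^bsub>fin_space K S\<^esub> delta K x"
      using fc by (auto simp: fun_eq_iff delta_def)
     have d: "delta K x \<in> carrier (fin_space K S)" using delta_fin_fun[OF True] by simp
     have d': "f x \<odot>\<^bsub>fin_space K S\<^esub> delta K x \<in> carrier (fin_space K S)"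
      by (rule module.smult_closed[OF fin_space_module fc d])
     have g': "?g \<in> carrier (fin_space K S)" using g by simp
     show ?thesis
      by (subst fg, subst (2) fg)
       (simp only: klinearD(2)[OF h(1) g' d'] klinearD(2)[OF h(2) g' d'] klinearD(3)[OF h(1) fc d]
        klinearD(3)[OF h(2) fc d] IH eq[OF True])
    next
     case False
     then have "f x = \<zero>\<^bsub>K\<^esub>" using fin_funD(3)[OF insert.prems(1)] by blast
     then show ?thesis using insert.IH[OF insert.prems(1)] insert.prems(2) by auto
    qed
  qed
  then show ?thesis using fin_funD(2)[OF f] f by blast
qed

text \<open>In the definition the index set depends on the supports of \<open>f\<close> and
  \<open>g\<close>. Enlarging it to fixed finite sets lets sums for different functions be added
  termwise.\<close>

lemma conv_eq:
  assumes f: "f \<in> fin_fun K S" and g: "g \<in> fin_fun K U" and XY: "finite X" "finite Z"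
    and sX: "supp f \<subseteq> X" and sZ: "supp g \<subseteq> Z"
  shows "conv K op f g z = finsum K (\<lambda>(x, y). f x \<otimes>\<^bsub>K\<^esub> g y) {(x, y). x \<in> X \<and> y \<in> Z \<and> op x y = z}"
  unfolding conv_def
proof (rule add.finprod_mono_neutral_cong_left)
  show "finite {(x, y). x \<in> X \<and> y \<in> Z \<and> op x y = z}"
    by (rule finite_subset[of _ "X \<times> Z"]) (use XY in auto)
  show "{(x, y). f x \<noteq> \<zero>\<^bsub>K\<^esub> \<and> g y \<noteq> \<zero>\<^bsub>K\<^esub> \<and> op x y = z} \<subseteq> {(x, y). x \<in> X \<and> y \<in> Z \<and> op x y = z}"
    using sX sZ by auto
qed (use fin_funD(1)[OF f] fin_funD(1)[OF g] in auto)

lemma conv_fin_fun: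
  assumes f: "f \<in> fin_fun K S" and g: "g \<in> fin_fun K U" and op: "\<And>x y. \<lbrakk>x \<in> S; y \<in> U\<rbrakk> \<Longrightarrow> op x y \<in> V"
  shows "conv K op f g \<in> fin_fun K V"
proof (rule fin_funI[of _ "case_prod op ` (supp f \<times> supp g)"])
  fix z
  show "conv K op f g z \<in> carrier K"
    unfolding conv_def by (rule finsum_closed) (use fin_funD(1)[OF f] fin_funD(1)[OF g] in auto)
  {
    assume "conv K op f g z \<noteq> \<zero>\<^bsub>K\<^esub>"
    then have "{(x, y). f x \<noteq> \<zero>\<^bsub>K\<^esub> \<and> g y \<noteq> \<zero>\<^bsub>K\<^esub> \<and> op x y = z} \<noteq> {}"
     unfolding conv_def using finsum_empty by metis
    then obtain x y where "f x \<noteq> \<zero>\<^bsub>K\<^esub>" "g y \<noteq> \<zero>\<^bsub>K\<^esub>" "op x y = z" by auto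
    then show "z \<in> case_prod op ` (supp f \<times> supp g)" "z \<in> V"
     using fin_funD(3)[OF f] fin_funD(3)[OF g] op by auto
  }
qed (use fin_funD(2)[OF f] fin_funD(2)[OF g] in auto)

lemma conv_klinear_left:
  assumes op: "\<And>x y. \<lbrakk>x \<in> S; y \<in> U\<rbrakk> \<Longrightarrow> op x y \<in> V" and g: "g \<in> fin_fun K U"
  shows "klinear K (fin_space K S) (fin_space K V) (\<lambda>f. conv K op f g)"
proof -
  have ad: "(\<lambda>x. f x \<oplus>\<^bsub>K\<^esub> f' x) \<in> fin_fun K W" "(\<lambda>x. r \<otimes>\<^bsub>K\<^esub> f x) \<in> fin_fun K W"
    if "f \<in> fin_fun K W" "f' \<in> fin_fun K W" "r \<in> carrier K" for f f' r and W :: "'z set"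
    using that module.smult_closed[OF fin_space_module, of r f W]
     abelian_monoid.a_closed[OF abelian_group.axioms(1)[OF module.axioms(2)[OF fin_space_module]], of f W f'] by simp_all
  have add_c: "finsum K (\<lambda>p. c p \<oplus>\<^bsub>K\<^esub> c' p) P = finsum K c P \<oplus>\<^bsub>K\<^esub> finsum K c' P"
    if "\<And>p. c p \<in> carrier K" "\<And>p. c' p \<in> carrier K" for c c' and P :: "('x \<times> 'y) set"
    using that by (intro finsum_addf) auto
  have sm_c: "finsum K (\<lambda>p. r \<otimes>\<^bsub>K\<^esub> c p) P = r \<otimes>\<^bsub>K\<^esub> finsum K c P"
    if "finite P" "r \<in> carrier K" "\<And>p. c p \<in> carrier K" for r c and P :: "('x \<times> 'y) set"
    using that by (intro finsum_rdistr[symmetric]) auto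
  let ?Z = "supp g"
  note gc = fin_funD(1)[OF g]
  show "klinear K (fin_space K S) (fin_space K V) (\<lambda>f. conv K op f g)"
  proof (rule klinearI)
    fix f f' assume "f \<in> carrier (fin_space K S)" "f' \<in> carrier (fin_space K S)"
    then have f: "f \<in> fin_fun K S" "f' \<in> fin_fun K S" by simp_all
    let ?X = "supp f \<union> supp f'"
    have X: "finite ?X" "finite ?Z" using f g by (auto dest: fin_funD(2))
    note fc = fin_funD(1)[OF f(1)] fin_funD(1)[OF f(2)]
    have "conv K op (\<lambda>x. f x \<oplus>\<^bsub>K\<^esub> f' x) g z = conv K op f g z \<oplus>\<^bsub>K\<^esub> conv K op f' g z" for z
    proof -
     have s: "{x. f x \<oplus>\<^bsub>K\<^esub> f' x \<noteq> \<zero>\<^bsub>K\<^esub>} \<subseteq> ?X" by auto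
     show ?thesis
      unfolding conv_eq[OF ad(1)[OF f zero_closed] g X s order_refl] conv_eq[OF f(1) g X Un_upper1 order_refl]
       conv_eq[OF f(2) g X Un_upper2 order_refl]
      by (subst add_c[symmetric]) (auto simp: fc gc l_distr case_prod_unfold)
    qed
    then show "conv K op (f \<oplus>\<^bsub>fin_space K S\<^esub> f') g = conv K op f g \<oplus>\<^bsub>fin_space K V\<^esub> conv K op f' g" by auto
  next
    fix r f assume r: "r \<in> carrier K" and "f \<in> carrier (fin_space K S)"
    then have f: "f \<in> fin_fun K S" by simp
    let ?X = "supp f"
    have X: "finite ?X" "finite ?Z" using f g by (auto dest: fin_funD(2))
    note fc = fin_funD(1)[OF f]
    have "conv K op (\<lambda>x. r \<otimes>\<^bsub>K\<^esub> f x) g z = r \<otimes>\<^bsub>K\<^esub> conv K op f g z" for z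
    proof -
     have s: "{x. r \<otimes>\<^bsub>K\<^esub> f x \<noteq> \<zero>\<^bsub>K\<^esub>} \<subseteq> ?X" using r by auto
     have fP: "finite {(x, y). x \<in> ?X \<and> y \<in> ?Z \<and> op x y = z}"
      by (rule finite_subset[of _ "?X \<times> ?Z"]) (use X in auto)
     show ?thesis
      unfolding conv_eq[OF ad(2)[OF f f r] g X s order_refl] conv_eq[OF f g X order_refl order_refl]
      by (subst sm_c[OF fP r, symmetric]) (auto simp: fc gc r m_assoc case_prod_unfold)
    qed
    then show "conv K op (r \<odot>\<^bsub>fin_space K S\<^esub> f) g = r \<odot>\<^bsub>fin_space K V\<^esub> conv K op f g" by auto
  qed (use conv_fin_fun[OF _ g op] in auto)
qed

text \<open>Reduces linearity in the second variable to linearity in the first; commutativity of the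
  field enters here.\<close>

lemma conv_commute:
  assumes "f \<in> fin_fun K S" "g \<in> fin_fun K U"
  shows "conv K op f g = conv K (\<lambda>y x. op x y) g f"
proof
  fix z
  let ?A = "{(y, x). g y \<noteq> \<zero>\<^bsub>K\<^esub> \<and> f x \<noteq> \<zero>\<^bsub>K\<^esub> \<and> op x y = z}"
  have "{(x, y). f x \<noteq> \<zero>\<^bsub>K\<^esub> \<and> g y \<noteq> \<zero>\<^bsub>K\<^esub> \<and> op x y = z} = prod.swap ` ?A" by force
  then show "conv K op f g z = conv K (\<lambda>y x. op x y) g f z"
    unfolding conv_def using assms[THEN fin_funD(1)]
    by (simp add: finsum_reindex Pi_def case_prod_unfold) (auto intro!: finsum_cong' simp: m_comm)
qed

lemma conv_klinear:
  assumes op: "\<And>x y. \<lbrakk>x \<in> S; y \<in> U\<rbrakk> \<Longrightarrow> op x y \<in> V"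
  shows "g \<in> fin_fun K U \<Longrightarrow> klinear K (fin_space K S) (fin_space K V) (\<lambda>f. conv K op f g)"
    and "f \<in> fin_fun K S \<Longrightarrow> klinear K (fin_space K U) (fin_space K V) (conv K op f)"
proof -
  show "g \<in> fin_fun K U \<Longrightarrow> klinear K (fin_space K S) (fin_space K V) (\<lambda>f. conv K op f g)"
    by (rule conv_klinear_left[OF op])
  show "klinear K (fin_space K U) (fin_space K V) (conv K op f)" if f: "f \<in> fin_fun K S"
  proof -
    have l: "klinear K (fin_space K U) (fin_space K V) (\<lambda>g. conv K (\<lambda>y x. op x y) g f)"
     by (rule conv_klinear_left[OF op f])
    have eq: "conv K op f g = conv K (\<lambda>y x. op x y) g f" if "g \<in> carrier (fin_space K U)" for g
     by (rule conv_commute[OF f]) (use that in simp)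
    show ?thesis by (rule klinear_cong[OF fin_space_module eq, THEN iffD2, OF _ l])
  qed
qed

text \<open>Together with \<open>fin_space_ext\<close> and bilinearity this reduces identities
  between convolutions to identities between operations on basis elements.\<close>

lemma conv_delta: "conv K op (delta K x) (delta K y) = delta K (op x y)"
proof
  fix z
  have "conv K op (delta K x) (delta K y) z = finsum K (\<lambda>(x', y'). delta K x x' \<otimes>\<^bsub>K\<^esub> delta K y y')
     {(x', y'). x' \<in> {x} \<and> y' \<in> {y} \<and> op x' y' = z}"
    by (rule conv_eq[OF delta_fin_fun[OF UNIV_I] delta_fin_fun[OF UNIV_I]]) (auto simp: delta_def split: if_splits)
  also have "{(x', y'). x' \<in> {x} \<and> y' \<in> {y} \<and> op x' y' = z} = (if z = op x y then {(x, y)} else {})" by auto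
  finally show "conv K op (delta K x) (delta K y) z = delta K (op x y) z"
    using finsum_insert[of "{}" "(x, y)" "\<lambda>(x', y'). delta K x x' \<otimes>\<^bsub>K\<^esub> delta K y y'"] by (simp add: delta_def)
qed

text \<open>The functions are replaced by basis elements one variable at a time. Four operations are
  allowed because the statement has to cover associativity both of the group algebra product and of
  \<open>braid_mu\<close>.\<close>

lemma conv_assoc:
  assumes op: "\<And>x y. \<lbrakk>x \<in> S; y \<in> U\<rbrakk> \<Longrightarrow> op2 x y \<in> A" "\<And>x y. \<lbrakk>x \<in> A; y \<in> V\<rbrakk> \<Longrightarrow> op1 x y \<in> D"
    "\<And>x y. \<lbrakk>x \<in> U; y \<in> V\<rbrakk> \<Longrightarrow> op4 x y \<in> B" "\<And>x y. \<lbrakk>x \<in> S; y \<in> B\<rbrakk> \<Longrightarrow> op3 x y \<in> D"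
    and eq: "\<And>x y z. \<lbrakk>x \<in> S; y \<in> U; z \<in> V\<rbrakk> \<Longrightarrow> op1 (op2 x y) z = op3 x (op4 y z)"
    and f: "f \<in> fin_fun K S" and g: "g \<in> fin_fun K U" and h: "h \<in> fin_fun K V"
  shows "conv K op1 (conv K op2 f g) h = conv K op3 f (conv K op4 g h)"
proof (rule fin_space_ext[OF fin_space_module klinear_comp[OF conv_klinear(1)[OF op(1) g] conv_klinear(1)[OF op(2) h]]
    conv_klinear(1)[OF op(4) conv_fin_fun[OF g h op(3)]] _ f])
  fix x assume x: "x \<in> S"
  note dx = delta_fin_fun[OF x]
  show "conv K op1 (conv K op2 (delta K x) g) h = conv K op3 (delta K x) (conv K op4 g h)"
  proof (rule fin_space_ext[OF fin_space_module klinear_comp[OF conv_klinear(2)[OF op(1) dx] conv_klinear(1)[OF op(2) h]]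
     klinear_comp[OF conv_klinear(1)[OF op(3) h] conv_klinear(2)[OF op(4) dx]] _ g])
    fix y assume y: "y \<in> U"
    note dy = delta_fin_fun[OF y]
    show "conv K op1 (conv K op2 (delta K x) (delta K y)) h = conv K op3 (delta K x) (conv K op4 (delta K y) h)"
     by (rule fin_space_ext[OF fin_space_module conv_klinear(2)[OF op(2) conv_fin_fun[OF dx dy op(1)]]
      klinear_comp[OF conv_klinear(2)[OF op(3) dy] conv_klinear(2)[OF op(4) dx]] _ h])
     (simp_all add: conv_delta eq x y)
  qed
qed

text \<open>Same method as for \<open>conv_assoc\<close>, with four variables. It yields the
  multiplicativity of \<open>braid_mu\<close> from that of \<open>group_mu\<close>.\<close>

lemma conv_interchange:
  assumes op: "\<And>x y. \<lbrakk>x \<in> S; y \<in> S\<rbrakk> \<Longrightarrow> p x y \<in> S" "\<And>x y. \<lbrakk>x \<in> U; y \<in> U\<rbrakk> \<Longrightarrow> q x y \<in> U"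
    "\<And>x y. \<lbrakk>x \<in> V; y \<in> V\<rbrakk> \<Longrightarrow> r x y \<in> V" "\<And>x y. \<lbrakk>x \<in> S; y \<in> U\<rbrakk> \<Longrightarrow> m x y \<in> V"
    and eq: "\<And>x x' y y'. \<lbrakk>x \<in> S; x' \<in> S; y \<in> U; y' \<in> U\<rbrakk> \<Longrightarrow> m (p x x') (q y y') = r (m x y) (m x' y')"
    and f: "f \<in> fin_fun K S" "f' \<in> fin_fun K S" and g: "g \<in> fin_fun K U" "g' \<in> fin_fun K U"
  shows "conv K m (conv K p f f') (conv K q g g') = conv K r (conv K m f g) (conv K m f' g')"
proof (rule fin_space_ext[OF fin_space_module klinear_comp[OF conv_klinear(1)[OF op(1) f(2)] conv_klinear(1)[OF op(4) conv_fin_fun[OF g op(2)]]]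
    klinear_comp[OF conv_klinear(1)[OF op(4) g(1)] conv_klinear(1)[OF op(3) conv_fin_fun[OF f(2) g(2) op(4)]]] _ f(1)])
  fix x assume x: "x \<in> S"
  note dx = delta_fin_fun[OF x]
  show "conv K m (conv K p (delta K x) f') (conv K q g g') = conv K r (conv K m (delta K x) g) (conv K m f' g')"
  proof (rule fin_space_ext[OF fin_space_module klinear_comp[OF conv_klinear(2)[OF op(1) dx] conv_klinear(1)[OF op(4) conv_fin_fun[OF g op(2)]]]
     klinear_comp[OF conv_klinear(1)[OF op(4) g(2)] conv_klinear(2)[OF op(3) conv_fin_fun[OF dx g(1) op(4)]]] _ f(2)])
    fix x' assume x': "x' \<in> S"
    note dx' = delta_fin_fun[OF x']
    show "conv K m (conv K p (delta K x) (delta K x')) (conv K q g g') = conv K r (conv K m (delta K x) g) (conv K m (delta K x') g')"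
    proof (rule fin_space_ext[OF fin_space_module klinear_comp[OF conv_klinear(1)[OF op(2) g(2)] conv_klinear(2)[OF op(4) conv_fin_fun[OF dx dx' op(1)]]]
      klinear_comp[OF conv_klinear(2)[OF op(4) dx] conv_klinear(1)[OF op(3) conv_fin_fun[OF dx' g(2) op(4)]]] _ g(1)])
     fix y assume y: "y \<in> U"
     note dy = delta_fin_fun[OF y]
     show "conv K m (conv K p (delta K x) (delta K x')) (conv K q (delta K y) g') = conv K r (conv K m (delta K x) (delta K y)) (conv K m (delta K x') g')"
      by (rule fin_space_ext[OF fin_space_module klinear_comp[OF conv_klinear(2)[OF op(2) dy] conv_klinear(2)[OF op(4) conv_fin_fun[OF dx dx' op(1)]]]
       klinear_comp[OF conv_klinear(2)[OF op(4) dx'] conv_klinear(2)[OF op(3) conv_fin_fun[OF dx dy op(4)]]] _ g(2)])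
      (simp_all add: conv_delta eq x x' y)
    qed
  qed
qed

lemma group_algebra_eq:
  "carrier (group_algebra K G) = carrier (fin_space K (carrier G))"
  "add (group_algebra K G) = add (fin_space K (carrier G))"
  "zero (group_algebra K G) = zero (fin_space K (carrier G))"
  "smult (group_algebra K G) = smult (fin_space K (carrier G))"
  "f \<otimes>\<^bsub>group_algebra K G\<^esub> g = conv K (mult G) f g"
  "\<one>\<^bsub>group_algebra K G\<^esub> = delta K \<one>\<^bsub>G\<^esub>"
  by (simp_all add: group_algebra_def fin_space_def fin_fun_def conv_def delta_def)

lemma group_algebra_module: "module K (group_algebra K G)"
  by (rule module_cong[OF fin_space_module[of "carrier G"] group_algebra_eq(1-4)])

lemma group_algebra_ring:
  assumes "Group.monoid G"
  shows "ring (group_algebra K G)"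
proof -
  interpret G: Group.monoid G by fact
  interpret M: module K "group_algebra K G" by (rule group_algebra_module)
  have kl: "g \<in> fin_fun K (carrier G) \<Longrightarrow> klinear K (fin_space K (carrier G)) (fin_space K (carrier G)) (\<lambda>f. conv K (mult G) f g)"
    "g \<in> fin_fun K (carrier G) \<Longrightarrow> klinear K (fin_space K (carrier G)) (fin_space K (carrier G)) (conv K (mult G) g)" for g
    by (rule conv_klinear; simp)+
  have one: "delta K \<one>\<^bsub>G\<^esub> \<in> fin_fun K (carrier G)" by (rule delta_fin_fun[OF G.one_closed])
  have id: "klinear K (fin_space K (carrier G)) (fin_space K (carrier G)) (\<lambda>f. f)" by (rule klinearI) simp_all
  show ?thesis
  proof (rule ringI[OF M.abelian_group_axioms Group.monoidI], unfold group_algebra_eq(1,5,6) fin_space_simps(1), goal_cases)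
    case (1 f g) then show ?case by (rule conv_fin_fun[OF _ _ G.m_closed])
  next
    case 2 show ?case by (rule one)
  next
    case (3 f g h)
    then show ?case by (intro conv_assoc[of "carrier G" "carrier G" _ "carrier G" "carrier G" _ "carrier G" _ "carrier G"]) (auto simp: G.m_assoc)
  next
    case (4 f)
    show ?case by (rule fin_space_ext[OF fin_space_module kl(2)[OF one] id _ 4]) (simp add: conv_delta)
  next
    case (5 f)
    show ?case by (rule fin_space_ext[OF fin_space_module kl(1)[OF one] id _ 5]) (simp add: conv_delta)
  next
    case (6 f g h)
    then show ?case using klinearD(2)[OF kl(1)[OF 6(3)]] by (simp add: group_algebra_eq)
  next
    case (7 f g h)
    then show ?case using klinearD(2)[OF kl(2)[OF 7(3)]] by (simp add: group_algebra_eq)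
  qed
qed

end

section \<open>Affine braid groups\<close>

lemma word_class_eq_iff: "Collect (word_eq S R u) = Collect (word_eq S R v) \<longleftrightarrow> word_eq S R u v"
  by (auto intro: word_eq.intros)

abbreviation "beq n \<equiv> word_eq (bgens n) (brels n)"

lemma braid_class_eq_iff: "braid_class n u = braid_class n v \<longleftrightarrow> beq n u v"
  by (simp add: braid_class_def word_class_eq_iff)

lemma braid_group_simps:
  "carrier (affine_braid_group n) = {braid_class n w |w. snd ` set w \<subseteq> bgens n}"
  "\<one>\<^bsub>affine_braid_group n\<^esub> = braid_class n []"
  by (simp_all add: affine_braid_group_def presented_group_def braid_class_def)

lemma braid_class_mult: "braid_class n u \<otimes>\<^bsub>affine_braid_group n\<^esub> braid_class n v = braid_class n (u @ v)"
  by (auto simp: affine_braid_group_def presented_group_def braid_class_def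
     intro: word_eq.intros dest: word_eq.append[THEN word_eq.trans])

lemma braid_class_carrier: "snd ` set w \<subseteq> bgens n \<Longrightarrow> braid_class n w \<in> carrier (affine_braid_group n)"
  by (auto simp: braid_group_simps)

lemma braid_group_monoid: "Group.monoid (affine_braid_group n)"
proof (rule monoidI, goal_cases)
  case (1 x y)
  then obtain u v where "x = braid_class n u" "y = braid_class n v" "snd ` set u \<subseteq> bgens n" "snd ` set v \<subseteq> bgens n"
    by (auto simp: braid_group_simps)
  then show ?case by (simp add: braid_class_mult braid_class_carrier image_Un)
next
  case 2 show ?case by (simp add: braid_group_simps(2) braid_class_carrier)
qed (auto simp: braid_group_simps(1) braid_class_mult braid_group_simps(2))

text \<open>Induced maps between presented groups, on the level of words. It is applied to the
  inclusion into more strands, where \<open>h\<close> is the identity, and to the shift of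
  indices.\<close>

lemma word_eq_map:
  assumes rel: "\<And>u v. (u, v) \<in> R \<Longrightarrow> word_eq S' R' (map (map_prod id h) u) (map (map_prod id h) v)"
    and gen: "\<And>g. g \<in> S \<Longrightarrow> h g \<in> S'" and uv: "word_eq S R u v"
  shows "word_eq S' R' (map (map_prod id h) u) (map (map_prod id h) v)"
  using uv
proof (induction rule: word_eq.induct)
  case (rel u v) then show ?case by (rule assms(1))
next
  case (cancel g b) then show ?case using word_eq.cancel[OF gen] by simp
next
  case (append u u' v v') then show ?case using word_eq.append by (simp only: map_append)
qed (rule word_eq.refl, erule word_eq.sym, erule (1) word_eq.trans)

lemma shift_word_eq_map: "shift_word m w = map (map_prod id (shift_gen m)) w"
  by (simp add: shift_word_def map_prod_def)

lemma bgens_mono: "bgens m \<subseteq> bgens (m + n)"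
  by (auto simp: bgens_def)

lemma brels_mono: "brels m \<subseteq> brels (m + n)"
  unfolding brels_def by (intro Un_mono) force+

lemma word_eq_mono: "beq m u v \<Longrightarrow> beq (m + n) u v"
  using word_eq_map[of "brels m" "bgens (m + n)" "brels (m + n)" id "bgens m" u v] brels_mono[of m n] bgens_mono[of m n]
  by (auto simp: prod.map_id0 intro: word_eq.rel)

lemma shift_gen_bgens: "g \<in> bgens n \<Longrightarrow> shift_gen m g \<in> bgens (m + n)"
  by (auto simp: bgens_def)

lemma brels_shift: "(u, v) \<in> brels n \<Longrightarrow> (shift_word m u, shift_word m v) \<in> brels (m + n)"
  unfolding brels_def shift_word_def by (elim UnE) force+

lemma word_eq_shift: "beq n u v \<Longrightarrow>
    beq (m + n) (shift_word m u) (shift_word m v)"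
  unfolding shift_word_eq_map
  by (rule word_eq_map) (auto simp: shift_gen_bgens shift_word_eq_map[symmetric] intro!: word_eq.rel brels_shift)

lemma shift_word_append: "shift_word m (u @ v) = shift_word m u @ shift_word m v"
  by (simp add: shift_word_def)

lemma shift_word_shift: "shift_word l (shift_word m w) = shift_word (l + m) w"
proof -
  have "shift_gen l (shift_gen m g) = shift_gen (l + m) g" for g by (cases g) auto
  then show ?thesis by (simp add: shift_word_def case_prod_unfold)
qed

lemma shift_word_0: "shift_word 0 w = w"
proof -
  have "shift_gen 0 g = g" for g by (cases g) auto
  then show ?thesis by (simp add: shift_word_def case_prod_unfold)
qed

lemma shift_word_gens: "snd ` set w \<subseteq> bgens n \<Longrightarrow> snd ` set (shift_word m w) \<subseteq> bgens (m + n)"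
  using shift_gen_bgens by (force simp: shift_word_def)

text \<open>Insert a cancelling pair in front of the word, move \<open>w\<close> past the letter,
  and cancel at the end.\<close>

lemma word_eq_comm_inverse:
  assumes c: "word_eq S R (w @ [(b, g)]) ([(b, g)] @ w)" and g: "g \<in> S"
  shows "word_eq S R (w @ [(\<not> b, g)]) ([(\<not> b, g)] @ w)"
proof -
  note [trans] = word_eq.trans
  let ?a = "[(b, g)]" and ?i = "[(\<not> b, g)]"
  have ai: "word_eq S R (?a @ ?i) []" "word_eq S R (?i @ ?a) []"
    using word_eq.cancel[OF g, of R b] word_eq.cancel[OF g, of R "\<not> b"] by simp_all
  have "word_eq S R (w @ ?i) ((?i @ ?a) @ (w @ ?i))"
    using word_eq.append[OF word_eq.sym[OF ai(2)] word_eq.refl[of _ _ "w @ ?i"]] by simp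
  also have "word_eq S R ((?i @ ?a) @ (w @ ?i)) (?i @ (w @ ?a) @ ?i)"
    using word_eq.append[OF word_eq.refl[of _ _ ?i] word_eq.append[OF word_eq.sym[OF c] word_eq.refl[of _ _ ?i]]] by simp
  also have "word_eq S R (?i @ (w @ ?a) @ ?i) (?i @ w)"
    using word_eq.append[OF word_eq.refl[of _ _ "?i @ w"] ai(1)] by simp
  finally show ?thesis .
qed

text \<open>The generator \<open>T m\<close> belongs to neither block, so indices from the two
  blocks are far enough apart for the commutation relations. These concern positive letters; the
  cases with inverses follow from \<open>word_eq_comm_inverse\<close>.\<close>

lemma word_eq_comm_letter:
  assumes g: "g \<in> bgens m" and h: "h \<in> bgens n"
  shows "beq (m + n) [(b, g), (b', shift_gen m h)] [(b', shift_gen m h), (b, g)]"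
proof -
  let ?h = "shift_gen m h" and ?eq = "beq (m + n)"
  have gS: "g \<in> bgens (m + n)" and hS: "?h \<in> bgens (m + n)"
    using bgens_mono[of m n] g shift_gen_bgens[OF h] by auto
  \<comment> \<open>Commutation of a \<open>T\<close> with a \<open>Y\<close> is listed with the
    \<open>T\<close> in front, so the relation may have to be read from right to left.\<close>
  have "([(False, g), (False, ?h)], [(False, ?h), (False, g)]) \<in> brels (m + n) \<or>
    ([(False, ?h), (False, g)], [(False, g), (False, ?h)]) \<in> brels (m + n)"
    using g h by (cases g; cases h) (force simp: bgens_def brels_def)+
  then have 0: "?eq [(False, g), (False, ?h)] [(False, ?h), (False, g)]"
    by (auto intro: word_eq.intros)
  have 1: "?eq [(False, g), (b', ?h)] [(b', ?h), (False, g)]"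
    using 0 word_eq_comm_inverse[of _ _ "[(False, g)]" False ?h] hS by (cases b') auto
  show ?thesis
    using 1 word_eq_comm_inverse[of _ _ "[(b', ?h)]" False g] gS by (cases b) (auto intro: word_eq.sym)
qed

lemma word_eq_comm_words:
  assumes l: "\<And>x y. \<lbrakk>x \<in> set u; y \<in> set v\<rbrakk> \<Longrightarrow> word_eq S R [x, y] [y, x]"
  shows "word_eq S R (u @ v) (v @ u)"
proof -
  note [trans] = word_eq.trans
  have 1: "word_eq S R (x # v) (v @ [x])" if "\<And>y. y \<in> set v \<Longrightarrow> word_eq S R [x, y] [y, x]" for x v
    using that
  proof (induction v)
    case (Cons y v)
    have "word_eq S R (x # y # v) ([y] @ (x # v))"
     using word_eq.append[OF Cons.prems[of y] word_eq.refl[of _ _ v]] by simp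
    also have "word_eq S R ([y] @ (x # v)) ([y] @ (v @ [x]))"
     using Cons by (intro word_eq.append[OF word_eq.refl]) auto
    finally show ?case by simp
  qed (simp add: word_eq.refl)
  show ?thesis using l
  proof (induction u)
    case (Cons x u)
    have "word_eq S R (u @ v) (v @ u)" using Cons by auto
    then have "word_eq S R ([x] @ (u @ v)) ([x] @ (v @ u))"
     by (rule word_eq.append[OF word_eq.refl])
    also have "word_eq S R ([x] @ (v @ u)) ((v @ [x]) @ u)"
     using word_eq.append[OF 1[of v x] word_eq.refl[of _ _ u]] Cons.prems by simp
    finally show ?case by simp
  qed (simp add: word_eq.refl)
qed

lemma word_eq_comm_shift:
  assumes "snd ` set u \<subseteq> bgens m" "snd ` set v \<subseteq> bgens n"
  shows "beq (m + n) (u @ shift_word m v) (shift_word m v @ u)"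
  by (rule word_eq_comm_words) (use assms in \<open>force simp: shift_word_def intro: word_eq_comm_letter\<close>)

lemma group_mu_class: "group_mu m n (braid_class m u) (braid_class n v) = braid_class (m + n) (u @ shift_word m v)"
proof -
  have "beq (m + n) (u @ shift_word m v) (u' @ shift_word m v')"
    if "beq m u u'" "beq n v v'" for u' v'
    using word_eq.append[OF word_eq_mono[OF that(1), of n] word_eq_shift[OF that(2), of m]] .
  then show ?thesis
    by (auto simp: group_mu_def braid_class_def intro: word_eq.trans word_eq.refl)
qed

lemma braid_groupE:
  assumes "x \<in> carrier (affine_braid_group n)"
  obtains w where "x = braid_class n w" "snd ` set w \<subseteq> bgens n"
  using assms by (auto simp: braid_group_simps)

lemma group_mu_closed: "\<lbrakk>x \<in> carrier (affine_braid_group m); y \<in> carrier (affine_braid_group n)\<rbrakk> \<Longrightarrow>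
    group_mu m n x y \<in> carrier (affine_braid_group (m + n))"
  using bgens_mono[of m n] shift_word_gens[of _ n m]
  by (elim braid_groupE) (simp add: group_mu_class braid_class_carrier image_Un subset_trans)

text \<open>Multiplicativity is the commutation of \<open>u'\<close>, on the first \<open>m\<close>
  strands, with the shifted word \<open>v\<close>.\<close>

lemma group_mu_mult:
  assumes "x \<in> carrier (affine_braid_group m)" "x' \<in> carrier (affine_braid_group m)"
    "y \<in> carrier (affine_braid_group n)" "y' \<in> carrier (affine_braid_group n)"
  shows "group_mu m n (x \<otimes>\<^bsub>affine_braid_group m\<^esub> x') (y \<otimes>\<^bsub>affine_braid_group n\<^esub> y') =
    group_mu m n x y \<otimes>\<^bsub>affine_braid_group (m + n)\<^esub> group_mu m n x' y'"
proof -
  obtain u u' v v' where w: "x = braid_class m u" "x' = braid_class m u'" "y = braid_class n v" "y' = braid_class n v'"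
    and g: "snd ` set u' \<subseteq> bgens m" "snd ` set v \<subseteq> bgens n"
    using assms by (elim braid_groupE) auto
  have "beq (m + n) (u @ (u' @ shift_word m v) @ shift_word m v') (u @ (shift_word m v @ u') @ shift_word m v')"
    by (intro word_eq.append word_eq.refl word_eq_comm_shift g)
  then show ?thesis
    by (simp add: w braid_class_mult group_mu_class braid_class_eq_iff shift_word_append)
qed

context convolution
begin

lemma braid_seq_simps:
  "Alg (braid_seq K) n = group_algebra K (affine_braid_group n)" "Mu (braid_seq K) m n = conv K (group_mu m n)"
  "Emb (braid_seq K) = InB"
  by (simp_all add: braid_seq_def braid_algebra_def braid_mu_def conv_def fun_eq_iff)

lemma braid_algebra_eq:
  "carrier (Alg (braid_seq K) n) = carrier (fin_space K (carrier (affine_braid_group n)))"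
  "add (Alg (braid_seq K) n) = add (fin_space K (carrier (affine_braid_group n)))"
  "zero (Alg (braid_seq K) n) = zero (fin_space K (carrier (affine_braid_group n)))"
  "smult (Alg (braid_seq K) n) = smult (fin_space K (carrier (affine_braid_group n)))"
  "f \<otimes>\<^bsub>Alg (braid_seq K) n\<^esub> g = conv K (mult (affine_braid_group n)) f g"
  "\<one>\<^bsub>Alg (braid_seq K) n\<^esub> = delta K (braid_class n [])"
  by (simp_all only: braid_seq_simps group_algebra_eq braid_group_simps)

text \<open>The linear laws come from \<open>conv_klinear\<close>, and the other identities are
  reduced to words, where \<open>group_mu\<close> is concatenation with a shift.\<close>

theorem braid_seq_algebra_sequence: "algebra_sequence K (braid_seq K :: ('k, 'u, 'k braid_elt) algseq)"
proof -
  let ?G = affine_braid_group and ?B = "\<lambda>n. fin_space K (carrier (affine_braid_group n))"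
  interpret G: Group.monoid "?G n" for n by (rule braid_group_monoid)
  have mul: "g \<in> fin_fun K (carrier (?G n)) \<Longrightarrow> klinear K (?B n) (?B n) (\<lambda>f. conv K (mult (?G n)) f g)"
    "g \<in> fin_fun K (carrier (?G n)) \<Longrightarrow> klinear K (?B n) (?B n) (conv K (mult (?G n)) g)" for n g
    by (rule conv_klinear; simp)+
  have mu: "g \<in> fin_fun K (carrier (?G n)) \<Longrightarrow> klinear K (?B m) (?B (m + n)) (\<lambda>f. conv K (group_mu m n) f g)"
    "f \<in> fin_fun K (carrier (?G m)) \<Longrightarrow> klinear K (?B n) (?B (m + n)) (conv K (group_mu m n) f)" for m n f g
    by (rule conv_klinear; simp add: group_mu_closed)+
  have one: "delta K (braid_class n []) \<in> fin_fun K (carrier (?G n))" for n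
    by (rule delta_fin_fun) (simp add: braid_class_carrier)
  have id: "klinear K (?B n) (?B n) (\<lambda>f. f)" for n by (rule klinearI) simp_all
  show ?thesis
  proof (rule algebra_sequence.intro, goal_cases)
    case 1 show ?case by (rule field_axioms)
  next
    case 2 show ?case unfolding braid_seq_simps by (rule group_algebra_ring[OF braid_group_monoid])
  next
    case 3 show ?case unfolding braid_seq_simps by (rule group_algebra_module)
  next
    case (4 n r a b)
    then show ?case unfolding braid_algebra_eq fin_space_simps(1) using klinearD(3)[OF mul(1)] by simp
  next
    case (5 n r a b)
    then show ?case unfolding braid_algebra_eq fin_space_simps(1) using klinearD(3)[OF mul(2)] by simp
  next
    case (6 m n a b)
    then show ?case unfolding braid_algebra_eq braid_seq_simps(2) fin_space_simps(1)
     by (intro conv_fin_fun group_mu_closed)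
  next
    case (7 m n a a' b)
    then show ?case unfolding braid_algebra_eq braid_seq_simps(2) fin_space_simps(1) using klinearD(2)[OF mu(1)] by simp
  next
    case (8 m n a b b')
    then show ?case unfolding braid_algebra_eq braid_seq_simps(2) fin_space_simps(1) using klinearD(2)[OF mu(2)] by simp
  next
    case (9 m n r a b)
    then show ?case unfolding braid_algebra_eq braid_seq_simps(2) fin_space_simps(1) using klinearD(3)[OF mu(1)] by simp
  next
    case (10 m n r a b)
    then show ?case unfolding braid_algebra_eq braid_seq_simps(2) fin_space_simps(1) using klinearD(3)[OF mu(2)] by simp
  next
    case (11 m n a a' b b')
    then show ?case unfolding braid_algebra_eq braid_seq_simps(2) fin_space_simps(1)
     by (intro conv_interchange[where S = "carrier (?G m)" and U = "carrier (?G n)" and V = "carrier (?G (m + n))"])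
      (simp_all add: group_mu_closed group_mu_mult)
  next
    case (12 m n)
    show ?case unfolding braid_algebra_eq braid_seq_simps(2)
     by (simp add: conv_delta group_mu_class shift_word_def)
  next
    case (13 l m n a b c)
    \<comment> \<open>Both sides are the concatenation of three words, the second shifted by
      \<open>l\<close> and the third by \<open>l + m\<close>.\<close>
    have "group_mu (l + m) n (group_mu l m x y) z = group_mu l (m + n) x (group_mu m n y z)"
     if "x \<in> carrier (?G l)" "y \<in> carrier (?G m)" "z \<in> carrier (?G n)" for x y z
     using that by (elim braid_groupE) (simp add: group_mu_class shift_word_append shift_word_shift add.assoc)
    then show ?case using 13 unfolding braid_algebra_eq braid_seq_simps(2) fin_space_simps(1)
     using group_mu_closed[of _ l _ "m + n"]
     by (intro conv_assoc[where S = "carrier (?G l)" and U = "carrier (?G m)" and V = "carrier (?G n)"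
      and A = "carrier (?G (l + m))" and B = "carrier (?G (m + n))" and D = "carrier (?G (l + m + n))"])
      (auto simp: add.assoc group_mu_closed intro: group_mu_closed[of _ "l + m", unfolded add.assoc])
  next
    case (14 n b)
    have "klinear K (?B n) (?B (0 + n)) (conv K (group_mu 0 n) (delta K (braid_class 0 [])))" by (rule mu(2)[OF one])
    then have mu0: "klinear K (?B n) (?B n) (conv K (group_mu 0 n) (delta K (braid_class 0 [])))" by simp
    show ?case unfolding braid_algebra_eq braid_seq_simps(2)
    proof (rule fin_space_ext[OF fin_space_module mu0 id _ 14[unfolded braid_algebra_eq fin_space_simps(1)]])
     fix x assume "x \<in> carrier (?G n)"
     then show "conv K (group_mu 0 n) (delta K (braid_class 0 [])) (delta K x) = delta K x"
      by (elim braid_groupE) (simp add: conv_delta group_mu_class shift_word_0)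
    qed
  next
    case (15 n b)
    have "klinear K (?B n) (?B (n + 0)) (\<lambda>f. conv K (group_mu n 0) f (delta K (braid_class 0 [])))" by (rule mu(1)[OF one])
    then have mu0: "klinear K (?B n) (?B n) (\<lambda>f. conv K (group_mu n 0) f (delta K (braid_class 0 [])))" by simp
    show ?case unfolding braid_algebra_eq braid_seq_simps(2)
    proof (rule fin_space_ext[OF fin_space_module mu0 id _ 15[unfolded braid_algebra_eq fin_space_simps(1)]])
     fix x assume "x \<in> carrier (?G n)"
     then show "conv K (group_mu n 0) (delta K x) (delta K (braid_class 0 [])) = delta K x"
      by (elim braid_groupE) (simp add: conv_delta group_mu_class shift_word_def)
    qed
  next
    case 16 show ?case by (simp add: braid_seq_simps inj_def)
  qed
qed

end

section \<open>Affine Hecke algebras\<close>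

lemma klinear_minus:
  assumes V: "module K V" and W: "module K W" and f: "klinear K V W f" and x: "x \<in> carrier V" "y \<in> carrier V"
  shows "f (x \<ominus>\<^bsub>V\<^esub> y) = f x \<ominus>\<^bsub>W\<^esub> f y"
proof -
  interpret V: module K V by fact
  interpret W: module K W by fact
  have "\<ominus>\<^bsub>V\<^esub> y = (\<ominus>\<^bsub>K\<^esub> \<one>\<^bsub>K\<^esub>) \<odot>\<^bsub>V\<^esub> y" "\<ominus>\<^bsub>W\<^esub> f y = (\<ominus>\<^bsub>K\<^esub> \<one>\<^bsub>K\<^esub>) \<odot>\<^bsub>W\<^esub> f y"
    using x klinearD(1)[OF f] by (simp_all add: V.smult_l_minus W.smult_l_minus)
  then show ?thesis using x by (simp add: a_minus_def klinearD(2,3)[OF f])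
qed

locale hecke_parameter = convolution K for K :: "'k ring" +
  fixes q :: 'k
  assumes q_closed: "q \<in> carrier K" and q_nonzero: "q \<noteq> \<zero>\<^bsub>K\<^esub>"
begin

abbreviation "BA \<equiv> braid_algebra K"
abbreviation "HA \<equiv> affine_hecke_algebra K q"
abbreviation "I \<equiv> hecke_ideal K q"
abbreviation "proj \<equiv> hecke_proj K q"
abbreviation "\<B> n \<equiv> carrier (braid_algebra K n)"
abbreviation "\<H> n \<equiv> carrier (affine_hecke_algebra K q n)"

text \<open>The atoms are set to \<open>unit\<close> so that the facts about the algebras drawn from
  here do not carry the type of atoms.\<close>

lemma braid_sequence: "algebra_sequence K (braid_seq K :: ('k, unit, 'k braid_elt) algseq)"
  by (rule braid_seq_algebra_sequence)

lemma braid_seq_sel: "Alg (braid_seq K) = BA" "Mu (braid_seq K) = braid_mu K"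
  by (simp_all add: braid_seq_def)

lemmas BA_ring = algebra_sequence.alg_ring[OF braid_sequence, unfolded braid_seq_sel]
lemmas BA_module = algebra_sequence.alg_module[OF braid_sequence, unfolded braid_seq_sel]
lemmas BA_smult = algebra_sequence.smult_mult_l[OF braid_sequence, unfolded braid_seq_sel]
  algebra_sequence.smult_mult_r[OF braid_sequence, unfolded braid_seq_sel]
lemmas mu_closed = algebra_sequence.mu_closed[OF braid_sequence, unfolded braid_seq_sel]
lemmas mu_add = algebra_sequence.mu_add_l[OF braid_sequence, unfolded braid_seq_sel]
  algebra_sequence.mu_add_r[OF braid_sequence, unfolded braid_seq_sel]
lemmas mu_smult = algebra_sequence.mu_smult_l[OF braid_sequence, unfolded braid_seq_sel]
  algebra_sequence.mu_smult_r[OF braid_sequence, unfolded braid_seq_sel]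
lemmas mu_mult = algebra_sequence.mu_mult[OF braid_sequence, unfolded braid_seq_sel]
lemmas mu_one = algebra_sequence.mu_one[OF braid_sequence, unfolded braid_seq_sel]
lemmas mu_assoc = algebra_sequence.mu_assoc[OF braid_sequence, unfolded braid_seq_sel]
lemmas mu_unit_l = algebra_sequence.mu_unit_l[OF braid_sequence, unfolded braid_seq_sel]
lemmas mu_unit_r = algebra_sequence.mu_unit_r[OF braid_sequence, unfolded braid_seq_sel]

sublocale B: ring "BA n" for n by (rule BA_ring)
sublocale BM: module K "BA n" for n by (rule BA_module)

lemma inv_q: "inv\<^bsub>K\<^esub> q \<in> carrier K"
  using field_Units q_closed q_nonzero by auto

definition hecke_poly :: "nat \<Rightarrow> 'k braid_elt \<Rightarrow> 'k braid_elt" where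
  "hecke_poly n t = (t \<ominus>\<^bsub>BA n\<^esub> q \<odot>\<^bsub>BA n\<^esub> \<one>\<^bsub>BA n\<^esub>) \<otimes>\<^bsub>BA n\<^esub> (t \<oplus>\<^bsub>BA n\<^esub> inv\<^bsub>K\<^esub> q \<odot>\<^bsub>BA n\<^esub> \<one>\<^bsub>BA n\<^esub>)"

definition gen :: "nat \<Rightarrow> nat \<Rightarrow> 'k braid_elt" where
  "gen n i = braid_elt K n (t_word i)"

lemma gen_eq: "gen n i = delta K (braid_class n (t_word i))"
  by (simp add: gen_def braid_elt_def delta_def)

lemma gen_closed: "\<lbrakk>1 \<le> i; i < n\<rbrakk> \<Longrightarrow> gen n i \<in> \<B> n"
  unfolding gen_eq braid_algebra_def group_algebra_eq fin_space_simps
  by (rule delta_fin_fun[OF braid_class_carrier]) (auto simp: bgens_def)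

lemma hecke_poly_closed: "t \<in> \<B> n \<Longrightarrow> hecke_poly n t \<in> \<B> n"
  by (simp add: hecke_poly_def q_closed inv_q)

lemma hecke_ideal_eq: "I n = Idl\<^bsub>BA n\<^esub> {hecke_poly n (gen n i) |i. 1 \<le> i \<and> i < n}"
  by (simp add: hecke_ideal_def Let_def hecke_poly_def gen_def)

lemma hecke_gens_subset: "{hecke_poly n (gen n i) |i. 1 \<le> i \<and> i < n} \<subseteq> \<B> n"
  using hecke_poly_closed gen_closed by auto

lemma hecke_ideal: "ideal (I n) (BA n)"
  unfolding hecke_ideal_eq by (rule B.genideal_ideal[OF hecke_gens_subset])

sublocale HI: ideal "I n" "BA n" for n by (rule hecke_ideal)

lemma hecke_gen_mem: "\<lbrakk>1 \<le> i; i < n\<rbrakk> \<Longrightarrow> hecke_poly n (gen n i) \<in> I n"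
  unfolding hecke_ideal_eq using B.genideal_self[OF hecke_gens_subset] by blast

text \<open>Minimality of the generated ideal. It is applied to preimages under the maps
  \<open>braid_mu\<close> and to the set of elements killed by a functor.\<close>

lemma hecke_ideal_le:
  assumes "ideal J (BA n)" "\<And>i. \<lbrakk>1 \<le> i; i < n\<rbrakk> \<Longrightarrow> hecke_poly n (gen n i) \<in> J"
  shows "I n \<subseteq> J"
  unfolding hecke_ideal_eq by (rule B.genideal_minimal[OF assms(1)]) (use assms(2) in auto)

lemma proj_eq_iff:
  assumes "a \<in> \<B> n" "b \<in> \<B> n"
  shows "proj n a = proj n b \<longleftrightarrow> a \<ominus>\<^bsub>BA n\<^esub> b \<in> I n"
proof -
  have "proj n a = proj n b \<longleftrightarrow> a \<in> I n +>\<^bsub>BA n\<^esub> b"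
    unfolding hecke_proj_def using HI.a_repr_independence' HI.a_rcos_self assms by metis
  then show ?thesis using HI.a_rcos_module_minus[OF BA_ring assms(2,1)] by simp
qed

lemma HA_simps:
  "\<H> n = proj n ` \<B> n"
  "\<one>\<^bsub>HA n\<^esub> = proj n \<one>\<^bsub>BA n\<^esub>"
  "\<zero>\<^bsub>HA n\<^esub> = proj n \<zero>\<^bsub>BA n\<^esub>"
  "\<lbrakk>a \<in> \<B> n; b \<in> \<B> n\<rbrakk> \<Longrightarrow> proj n a \<otimes>\<^bsub>HA n\<^esub> proj n b = proj n (a \<otimes>\<^bsub>BA n\<^esub> b)"
  "\<lbrakk>a \<in> \<B> n; b \<in> \<B> n\<rbrakk> \<Longrightarrow> proj n a \<oplus>\<^bsub>HA n\<^esub> proj n b = proj n (a \<oplus>\<^bsub>BA n\<^esub> b)"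
proof -
  show "\<H> n = proj n ` \<B> n"
    by (auto simp: affine_hecke_algebra_def ring.defs FactRing_def A_RCOSETS_def' hecke_proj_def a_r_coset_def')
  show "\<one>\<^bsub>HA n\<^esub> = proj n \<one>\<^bsub>BA n\<^esub>"
    by (simp add: affine_hecke_algebra_def ring.defs FactRing_def hecke_proj_def)
  show "\<zero>\<^bsub>HA n\<^esub> = proj n \<zero>\<^bsub>BA n\<^esub>"
    by (simp add: affine_hecke_algebra_def ring.defs FactRing_def hecke_proj_def HI.a_rcos_const)
  show "proj n a \<otimes>\<^bsub>HA n\<^esub> proj n b = proj n (a \<otimes>\<^bsub>BA n\<^esub> b)" if "a \<in> \<B> n" "b \<in> \<B> n"
    using that by (simp add: affine_hecke_algebra_def ring.defs FactRing_def hecke_proj_def HI.rcoset_mult_add)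
  show "proj n a \<oplus>\<^bsub>HA n\<^esub> proj n b = proj n (a \<oplus>\<^bsub>BA n\<^esub> b)" if "a \<in> \<B> n" "b \<in> \<B> n"
    using that by (simp add: affine_hecke_algebra_def ring.defs FactRing_def hecke_proj_def HI.a_rcos_sum)
qed

lemma proj_mem:
  assumes "a \<in> \<B> n" "a' \<in> proj n a"
  shows "a' \<in> \<B> n \<and> proj n a' = proj n a"
  using HI.a_repr_independence'[OF assms(2)[unfolded hecke_proj_def] assms(1)]
    HI.a_elemrcos_carrier[OF assms(1) assms(2)[unfolded hecke_proj_def]]
  by (simp add: hecke_proj_def)

lemma proj_memD:
  assumes "a \<in> \<B> n" "a' \<in> proj n a"
  shows "a' \<in> \<B> n" "a' \<ominus>\<^bsub>BA n\<^esub> a \<in> I n"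
proof -
  show a': "a' \<in> \<B> n" using proj_mem[OF assms] by blast
  show "a' \<ominus>\<^bsub>BA n\<^esub> a \<in> I n" using proj_mem[OF assms] proj_eq_iff[OF a' assms(1)] by blast
qed

lemma proj_self: "a \<in> \<B> n \<Longrightarrow> a \<in> proj n a"
  unfolding hecke_proj_def by (rule HI.a_rcos_self)

text \<open>A scalar multiple is the product with a multiple of the unit, so ideals are
  subspaces.\<close>

lemma I_smult:
  assumes r: "r \<in> carrier K" and a: "a \<in> I n"
  shows "r \<odot>\<^bsub>BA n\<^esub> a \<in> I n"
proof -
  have "(r \<odot>\<^bsub>BA n\<^esub> \<one>\<^bsub>BA n\<^esub>) \<otimes>\<^bsub>BA n\<^esub> a = r \<odot>\<^bsub>BA n\<^esub> a"
    unfolding BA_smult(1)[OF r B.one_closed HI.a_Hcarr[OF a]] B.l_one[OF HI.a_Hcarr[OF a]] ..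
  then show ?thesis using HI.I_l_closed[OF a BM.smult_closed[OF r B.one_closed]] by metis
qed

text \<open>The definition takes a union over all representatives of the coset; by
  \<open>I_smult\<close> all of them contribute the same coset.\<close>

lemma HA_smult:
  assumes r: "r \<in> carrier K" and a: "a \<in> \<B> n"
  shows "r \<odot>\<^bsub>HA n\<^esub> proj n a = proj n (r \<odot>\<^bsub>BA n\<^esub> a)"
proof -
  have "proj n (r \<odot>\<^bsub>BA n\<^esub> a') = proj n (r \<odot>\<^bsub>BA n\<^esub> a)" if "a' \<in> proj n a" for a'
  proof -
    note a' = proj_memD[OF a that]
    have "klinear K (BA n) (BA n) (\<lambda>x. r \<odot>\<^bsub>BA n\<^esub> x)"
     by (rule klinearI) (simp_all add: r BM.smult_r_distr BM.smult_assoc1[symmetric] m_comm)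
    from klinear_minus[OF BA_module BA_module this a'(1) a]
    show ?thesis using I_smult[OF r a'(2)] proj_eq_iff[OF BM.smult_closed[OF r a'(1)] BM.smult_closed[OF r a]] by metis
  qed
  moreover have "proj n a \<noteq> {}" using proj_self[OF a] by blast
  ultimately have "(\<Union>a'\<in>proj n a. proj n (r \<odot>\<^bsub>BA n\<^esub> a')) = proj n (r \<odot>\<^bsub>BA n\<^esub> a)"
    by (intro SUP_eq_const)
  then show ?thesis by (simp add: affine_hecke_algebra_def ring.defs)
qed

lemma gen_mu:
  assumes "1 \<le> i" "i < m"
  shows "braid_mu K m n (gen m i) \<one>\<^bsub>BA n\<^esub> = gen (m + n) i"
    and "braid_mu K n m \<one>\<^bsub>BA n\<^esub> (gen m i) = gen (n + m) (i + n)"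
proof -
  have one: "\<one>\<^bsub>BA n\<^esub> = delta K (braid_class n [])"
    by (simp add: braid_algebra_def group_algebra_eq braid_group_simps)
  have mu: "braid_mu K m n = conv K (group_mu m n)" for m n by (simp add: fun_eq_iff braid_mu_def conv_def)
  show "braid_mu K m n (gen m i) \<one>\<^bsub>BA n\<^esub> = gen (m + n) i"
    and "braid_mu K n m \<one>\<^bsub>BA n\<^esub> (gen m i) = gen (n + m) (i + n)"
    unfolding one mu gen_eq conv_delta group_mu_class by (simp_all add: shift_word_def)
qed

lemma mu_ring_hom:
  "ring_hom_ring (BA m) (BA (m + n)) (\<lambda>a. braid_mu K m n a \<one>\<^bsub>BA n\<^esub>)"
  "ring_hom_ring (BA n) (BA (m + n)) (\<lambda>b. braid_mu K m n \<one>\<^bsub>BA m\<^esub> b)"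
  using mu_mult[of _ m _ "\<one>\<^bsub>BA n\<^esub>" n "\<one>\<^bsub>BA n\<^esub>"] mu_mult[of "\<one>\<^bsub>BA m\<^esub>" m "\<one>\<^bsub>BA m\<^esub>" _ n]
  by (auto intro!: ring_hom_ringI2[OF BA_ring BA_ring] ring_hom_memI simp: mu_closed mu_add mu_one)

lemma hecke_poly_mu:
  assumes t: "t \<in> \<B> m"
  shows "braid_mu K m n (hecke_poly m t) \<one>\<^bsub>BA n\<^esub> = hecke_poly (m + n) (braid_mu K m n t \<one>\<^bsub>BA n\<^esub>)"
    and "braid_mu K n m \<one>\<^bsub>BA n\<^esub> (hecke_poly m t) = hecke_poly (n + m) (braid_mu K n m \<one>\<^bsub>BA n\<^esub> t)"
proof -
  interpret h: ring_hom_ring "BA m" "BA (m + n)" "\<lambda>a. braid_mu K m n a \<one>\<^bsub>BA n\<^esub>" by (rule mu_ring_hom)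
  show "braid_mu K m n (hecke_poly m t) \<one>\<^bsub>BA n\<^esub> = hecke_poly (m + n) (braid_mu K m n t \<one>\<^bsub>BA n\<^esub>)"
    using t by (simp add: hecke_poly_def q_closed inv_q a_minus_def h.hom_a_inv mu_smult mu_one del: h.hom_one)
  interpret h': ring_hom_ring "BA m" "BA (n + m)" "\<lambda>b. braid_mu K n m \<one>\<^bsub>BA n\<^esub> b" by (rule mu_ring_hom)
  show "braid_mu K n m \<one>\<^bsub>BA n\<^esub> (hecke_poly m t) = hecke_poly (n + m) (braid_mu K n m \<one>\<^bsub>BA n\<^esub> t)"
    using t by (simp add: hecke_poly_def q_closed inv_q a_minus_def h'.hom_a_inv mu_smult mu_one del: h'.hom_one)
qed

text \<open>The preimage of \<open>I (m + n)\<close> under \<open>braid_mu\<close> with a unit in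
  the other argument is an ideal containing the Hecke relations, hence it contains
  \<open>I m\<close>. A general element \<open>b\<close> in place of the unit is split off by
  multiplicativity.\<close>

lemma mu_ideal:
  assumes b: "b \<in> \<B> n"
  shows "a \<in> I m \<Longrightarrow> braid_mu K m n a b \<in> I (m + n)" and "a \<in> I m \<Longrightarrow> braid_mu K n m b a \<in> I (n + m)"
proof -
  note carr = HI.a_Hcarr[of a m]
  {
    assume a: "a \<in> I m"
    interpret h: ring_hom_ring "BA m" "BA (m + n)" "\<lambda>a. braid_mu K m n a \<one>\<^bsub>BA n\<^esub>" by (rule mu_ring_hom)
    have "I m \<subseteq> {a \<in> \<B> m. braid_mu K m n a \<one>\<^bsub>BA n\<^esub> \<in> I (m + n)}"
     by (rule hecke_ideal_le[OF h.ideal_vimage[OF hecke_ideal]])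
      (simp add: hecke_poly_closed gen_closed hecke_poly_mu gen_mu hecke_gen_mem)
    then have "braid_mu K m n a \<one>\<^bsub>BA n\<^esub> \<otimes>\<^bsub>BA (m + n)\<^esub> braid_mu K m n \<one>\<^bsub>BA m\<^esub> b \<in> I (m + n)"
     using a b by (intro HI.I_r_closed mu_closed) auto
    then show "braid_mu K m n a b \<in> I (m + n)"
     using mu_mult[of a m "\<one>\<^bsub>BA m\<^esub>" "\<one>\<^bsub>BA n\<^esub>" n b] carr a b by simp
  }
  {
    assume a: "a \<in> I m"
    interpret h: ring_hom_ring "BA m" "BA (n + m)" "\<lambda>a. braid_mu K n m \<one>\<^bsub>BA n\<^esub> a" by (rule mu_ring_hom)
    have "I m \<subseteq> {a \<in> \<B> m. braid_mu K n m \<one>\<^bsub>BA n\<^esub> a \<in> I (n + m)}"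
     by (rule hecke_ideal_le[OF h.ideal_vimage[OF hecke_ideal]])
      (simp add: hecke_poly_closed gen_closed hecke_poly_mu gen_mu hecke_gen_mem)
    then have "braid_mu K n m b \<one>\<^bsub>BA m\<^esub> \<otimes>\<^bsub>BA (n + m)\<^esub> braid_mu K n m \<one>\<^bsub>BA n\<^esub> a \<in> I (n + m)"
     using a b by (intro HI.I_l_closed mu_closed) auto
    then show "braid_mu K n m b a \<in> I (n + m)"
     using mu_mult[of b n "\<one>\<^bsub>BA n\<^esub>" "\<one>\<^bsub>BA m\<^esub>" m a] carr a b by simp
  }
qed

lemma mu_zero:
  "b \<in> \<B> n \<Longrightarrow> klinear K (BA m) (BA (m + n)) (\<lambda>a. braid_mu K m n a b)"
  "a \<in> \<B> m \<Longrightarrow> klinear K (BA n) (BA (m + n)) (braid_mu K m n a)"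
  by (auto intro!: klinearI simp: mu_closed mu_add mu_smult)

text \<open>The definition is a union over representatives; replacing one representative at a time
  changes the product by an element of the ideal, by \<open>mu_ideal\<close>.\<close>

lemma hecke_mu_proj:
  assumes a: "a \<in> \<B> m" and b: "b \<in> \<B> n"
  shows "hecke_mu K q m n (proj m a) (proj n b) = proj (m + n) (braid_mu K m n a b)"
proof -
  have "proj (m + n) (braid_mu K m n a' b') = proj (m + n) (braid_mu K m n a b)"
    if "a' \<in> proj m a" "b' \<in> proj n b" for a' b'
  proof -
    note a' = proj_memD[OF a that(1)] and b' = proj_memD[OF b that(2)]
    have "proj (m + n) (braid_mu K m n a' b') = proj (m + n) (braid_mu K m n a b')"
     using mu_ideal(1)[OF b'(1) a'(2)] klinear_minus[OF BA_module BA_module mu_zero(1)[OF b'(1)] a'(1) a]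
      proj_eq_iff[OF mu_closed[OF a'(1) b'(1)] mu_closed[OF a b'(1)]] by metis
    also have "\<dots> = proj (m + n) (braid_mu K m n a b)"
     using mu_ideal(2)[OF a b'(2)] klinear_minus[OF BA_module BA_module mu_zero(2)[OF a] b'(1) b]
      proj_eq_iff[OF mu_closed[OF a b'(1)] mu_closed[OF a b]] by metis
    finally show ?thesis .
  qed
  moreover have "proj m a \<noteq> {}" "proj n b \<noteq> {}" using proj_self[OF a] proj_self[OF b] by blast+
  ultimately show ?thesis unfolding hecke_mu_def by (intro SUP_eq_const)
qed

lemma HA_E:
  assumes "x \<in> \<H> n" obtains a where "x = proj n a" "a \<in> \<B> n"
  using assms by (auto simp: HA_simps)

lemma HA_closed: "a \<in> \<B> n \<Longrightarrow> proj n a \<in> \<H> n"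
  by (simp add: HA_simps)

lemma HA_module: "module K (HA n)"
proof (rule module_cong[OF module_linear_space[OF field_axioms, of "\<zero>\<^bsub>HA n\<^esub>" "\<H> n" "add (HA n)" "smult (HA n)"]], goal_cases)
  case 1 show ?case by (simp add: HA_simps)
next
  case (2 x y) then show ?case by (elim HA_E) (simp add: HA_simps)
next
  case (3 r x) then show ?case by (elim HA_E) (simp add: HA_smult HA_closed)
next
  case (4 x y z) then show ?case by (elim HA_E) (simp add: HA_simps B.a_assoc)
next
  case (5 x y) then show ?case by (elim HA_E) (simp add: HA_simps B.a_comm)
next
  case (6 x) then show ?case by (elim HA_E) (simp add: HA_simps)
next
  case (7 x) then show ?case by (elim HA_E) (simp add: HA_smult HA_simps)
next
  case (8 x) then show ?case by (elim HA_E) (simp add: HA_smult)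
next
  case (9 r t x) then show ?case by (elim HA_E) (simp add: HA_smult HA_simps BM.smult_l_distr)
next
  case (10 r x y) then show ?case by (elim HA_E) (simp add: HA_smult HA_simps BM.smult_r_distr)
next
  case (11 r t x) then show ?case by (elim HA_E) (simp add: HA_smult BM.smult_assoc1)
qed simp_all

lemma HA_ring: "ring (HA n)"
proof -
  interpret M: module K "HA n" by (rule HA_module)
  show ?thesis
  proof (rule ringI[OF M.abelian_group_axioms Group.monoidI], goal_cases)
    case (1 x y) then show ?case by (elim HA_E) (simp add: HA_simps)
  next
    case 2 show ?case by (simp add: HA_simps)
  next
    case (3 x y z) then show ?case by (elim HA_E) (simp add: HA_simps B.m_assoc)
  next
    case (4 x) then show ?case by (elim HA_E) (simp add: HA_simps)
  next
    case (5 x) then show ?case by (elim HA_E) (simp add: HA_simps)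
  next
    case (6 x y z) then show ?case by (elim HA_E) (simp add: HA_simps B.l_distr)
  next
    case (7 x y z) then show ?case by (elim HA_E) (simp add: HA_simps B.r_distr)
  qed
qed

lemma hecke_seq_simps: "Alg (hecke_seq K q) = HA" "Mu (hecke_seq K q) = hecke_mu K q" "Emb (hecke_seq K q) = InH"
  by (simp_all add: hecke_seq_def)

theorem hecke_seq_algebra_sequence: "algebra_sequence K (hecke_seq K q :: ('k, 'u, 'k hecke_elt) algseq)"
proof (rule algebra_sequence.intro, unfold hecke_seq_simps, goal_cases)
  case 1 show ?case by (rule field_axioms)
next
  case 2 show ?case by (rule HA_ring)
next
  case 3 show ?case by (rule HA_module)
next
  case (4 n r a b) then show ?case by (elim HA_E) (simp add: HA_simps HA_smult BA_smult)
next
  case (5 n r a b) then show ?case by (elim HA_E) (simp add: HA_simps HA_smult BA_smult)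
next
  case (6 m n a b) then show ?case by (elim HA_E) (simp add: hecke_mu_proj HA_closed mu_closed)
next
  case (7 m n a a' b) then show ?case by (elim HA_E) (simp add: HA_simps hecke_mu_proj mu_closed mu_add)
next
  case (8 m n a b b') then show ?case by (elim HA_E) (simp add: HA_simps hecke_mu_proj mu_closed mu_add)
next
  case (9 m n r a b) then show ?case by (elim HA_E) (simp add: HA_smult hecke_mu_proj mu_closed mu_smult)
next
  case (10 m n r a b) then show ?case by (elim HA_E) (simp add: HA_smult hecke_mu_proj mu_closed mu_smult)
next
  case (11 m n a a' b b') then show ?case by (elim HA_E) (simp add: HA_simps hecke_mu_proj mu_closed mu_mult)
next
  case (12 m n) show ?case by (simp add: HA_simps hecke_mu_proj mu_one)
next
  case (13 l m n a b c)
  then show ?case using mu_closed[of _ l _ m] mu_closed[of _ m _ n] by (elim HA_E) (simp add: hecke_mu_proj mu_assoc add.assoc)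
next
  case (14 n b) then show ?case using hecke_mu_proj[of _ 0 _ n] by (elim HA_E) (simp add: HA_simps mu_unit_l)
next
  case (15 n b) then show ?case using hecke_mu_proj[of _ n _ 0] by (elim HA_E) (simp add: HA_simps mu_unit_r)
next
  case 16 show ?case by (simp add: inj_def)
qed

theorem hecke_proj_hom:
  "algebra_sequence_hom K (braid_seq K :: ('k, 'u, 'k braid_elt) algseq) (hecke_seq K q) proj"
  by (intro algebra_sequence_hom.intro braid_seq_algebra_sequence hecke_seq_algebra_sequence algebra_sequence_hom_axioms.intro,
     unfold hecke_seq_simps braid_seq_sel)
    (auto simp: HA_simps HA_smult hecke_mu_proj)

lemma ker_hecke: "{a \<in> \<B> n. proj n a = \<zero>\<^bsub>HA n\<^esub>} = I n"
proof -
  have "proj n a = \<zero>\<^bsub>HA n\<^esub> \<longleftrightarrow> a \<in> I n" if "a \<in> \<B> n" for a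
    using proj_eq_iff[OF that, of "\<zero>\<^bsub>BA n\<^esub>"] that by (simp add: HA_simps a_minus_def)
  then show ?thesis using HI.a_Hcarr by blast
qed

end

section \<open>Extension of scalars to the affine Hecke algebras\<close>

text \<open>The parameter \<open>universe\<close> carries the type of atoms, so that both module
  categories have a fixed type within the locale.\<close>

locale hecke_extension = hecke_parameter K q for K :: "'k ring" and q :: 'k +
  fixes universe :: "'u itself"
begin

abbreviation "BS \<equiv> braid_seq K :: ('k, 'u, 'k braid_elt) algseq"
abbreviation "HS \<equiv> hecke_seq K q :: ('k, 'u, 'k hecke_elt) algseq"

sublocale X: algebra_sequence_hom K BS HS proj by (rule hecke_proj_hom)

abbreviation "BC \<equiv> module_category K BS"
abbreviation "HC \<equiv> module_category K HS"
abbreviation "ext \<equiv> ext_obj K q"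

lemma seq_sel [simp]: "Alg BS = BA" "Alg HS = HA" "Mu BS = braid_mu K" "Mu HS = hecke_mu K q" "Emb BS = InB" "Emb HS = InH"
  by (simp_all add: braid_seq_def hecke_seq_def)

lemma inv_InH [simp]: "Hilbert_Choice.inv InH (InH h) = h"
  by (rule inv_f_f) (simp add: inj_def)

lemma ext_gens_iff: "(v, InH h) \<in> ext_gens K q M n \<longleftrightarrow> v \<in> el M n \<and> h \<in> \<H> n"
  by (auto simp: ext_gens_def)

lemma ext_gensE:
  assumes "g \<in> ext_gens K q M n"
  obtains v h where "g = (v, InH h)" "v \<in> el M n" "h \<in> \<H> n"
  using assms by (auto simp: ext_gens_def)

sublocale H: ring "HA n" for n by (rule HA_ring)
sublocale HM: module K "HA n" for n by (rule HA_module)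

lemma HA_mult_klinear:
  assumes "b \<in> \<H> n"
  shows "klinear K (HA n) (HA n) (\<lambda>a. a \<otimes>\<^bsub>HA n\<^esub> b)" "klinear K (HA n) (HA n) (\<lambda>a. b \<otimes>\<^bsub>HA n\<^esub> a)"
  using X.B.mult_klinear[of b n] assms by simp_all

lemma ext_presentation:
  assumes M: "M \<in> Ob BC"
  shows "sum_presentation K ExtTerms ext_terms (ext_gens K q M n) (ext_rel K q M n) (\<lambda>r (v, h). (r \<odot>\<^bsub>FO M n\<^esub> v, h))"
proof -
  interpret M: module K "FO M i" for i by (rule X.A.obj_module[OF M])
  have act: "\<lbrakk>v \<in> el M n; b \<in> \<B> n\<rbrakk> \<Longrightarrow> act M n v b \<in> el M n" for v b
    using X.A.act_closed[OF M] by simp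
  show ?thesis
  proof (rule sum_presentation.intro, goal_cases)
    case 1 show ?case by (rule field_axioms)
  next
    case 2 show ?case by simp
  next
    case (3 P Q)
    then show ?case by (cases rule: ext_rel.cases) (simp_all add: ext_gens_iff act HA_closed)
  next
    case (4 r g) then show ?case by (auto simp: ext_gens_def)
  next
    case (5 r P Q)
    from 5(2) show ?case
    proof (cases rule: ext_rel.cases)
     case (add_left v v' h)
     then show ?thesis using 5(1) by (auto simp: M.smult_r_distr intro!: sum_eq.rel ext_rel.add_left)
    next
     case (add_right v h h')
     then show ?thesis using 5(1) by (auto intro!: sum_eq.rel ext_rel.add_right)
    next
     case (zero h)
     then show ?thesis using 5(1) by (auto intro!: sum_eq.rel ext_rel.zero)
    next
     case (balanced v b h)
     then have "r \<odot>\<^bsub>FO M n\<^esub> act M n v b = act M n (r \<odot>\<^bsub>FO M n\<^esub> v) b"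
      using X.A.act_smult[OF M _ 5(1)] by simp
     then show ?thesis using 5(1) balanced by (auto intro!: sum_eq.rel ext_rel.balanced)
    qed
  next
    case (6 r t g)
    then show ?case by (auto simp: ext_gens_def M.smult_l_distr intro!: sum_eq.rel ext_rel.add_left)
  next
    case (7 r t g)
    then show ?case by (auto simp: ext_gens_def M.smult_assoc1 intro!: sum_eq.refl)
  next
    case (8 g)
    then show ?case by (auto simp: ext_gens_def intro!: sum_eq.refl)
  next
    case (9 g)
    then show ?case by (auto simp: ext_gens_def intro!: sum_eq.rel ext_rel.zero)
  qed
qed

definition ext_pure :: "('k, 'u) braid_mobj \<Rightarrow> nat \<Rightarrow> ('k, 'u) univ \<Rightarrow> 'k hecke_elt \<Rightarrow> ('k, 'u) univ" where
  "ext_pure M n v h = ext_elt K q M n [(v, InH h)]"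

text \<open>Counterpart of \<open>day_bilin\<close> for one tensor product over the group algebra;
  the lemmas below run parallel to those for Day convolutions.\<close>

definition ext_bilin :: "('k, 'u) braid_mobj \<Rightarrow> nat \<Rightarrow> ('k, 'w) module \<Rightarrow> (('k, 'u) univ \<Rightarrow> 'k hecke_elt \<Rightarrow> 'w) \<Rightarrow> bool" where
  "ext_bilin M n W \<phi> \<longleftrightarrow> module K W \<and>
    (\<forall>h\<in>\<H> n. klinear K (FO M n) W (\<lambda>v. \<phi> v h)) \<and>
    (\<forall>v\<in>el M n. klinear K (HA n) W (\<phi> v)) \<and>
    (\<forall>v\<in>el M n. \<forall>b\<in>\<B> n. \<forall>h\<in>\<H> n.
     \<phi> (act M n v b) h = \<phi> v (proj n b \<otimes>\<^bsub>HA n\<^esub> h))"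

definition ext_map :: "('k, 'w) module \<Rightarrow> (('k, 'u) univ \<Rightarrow> 'k hecke_elt \<Rightarrow> 'w) \<Rightarrow> ('k, 'u) univ \<Rightarrow> 'w" where
  "ext_map W \<phi> x = term_sum W (\<lambda>(v, h). \<phi> v (Hilbert_Choice.inv InH h)) (ext_terms x)"

lemma FO_ext: "FO (ext M) n = sum_space ExtTerms ext_terms (ext_gens K q M n) (ext_rel K q M n) (\<lambda>r (v, h). (r \<odot>\<^bsub>FO M n\<^esub> v, h))"
  by (simp add: ext_obj_def ext_space_def)

lemma ext_space_FO: "ext_space K q M = FO (ext M)"
  by (simp add: ext_obj_def)

lemma ext_elt_cls: "M \<in> Ob BC \<Longrightarrow> sum_presentation.cls ExtTerms (ext_rel K q M n) P = ext_elt K q M n P"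
  by (simp add: sum_presentation.cls_def[OF ext_presentation] ext_elt_def)

context
  fixes M assumes M: "M \<in> Ob BC"
begin

interpretation M: module K "FO M n" for n by (rule X.A.obj_module[OF M])
interpretation E: sum_presentation K ExtTerms ext_terms "ext_gens K q M n" "ext_rel K q M n"
    "\<lambda>r (v, h). (r \<odot>\<^bsub>FO M n\<^esub> v, h)" for n by (rule ext_presentation[OF M])

lemma ext_module: "module K (FO (ext M) n)"
  unfolding FO_ext by (rule E.sum_space_module)

interpretation EM: module K "FO (ext M) n" for n by (rule ext_module)

lemma cls_ext_pure: "E.cls n [(v, InH h)] = ext_pure M n v h"
  by (simp add: ext_pure_def ext_elt_cls[OF M])

lemma ext_pure_closed: "\<lbrakk>v \<in> el M n; h \<in> \<H> n\<rbrakk> \<Longrightarrow> ext_pure M n v h \<in> el (ext M) n"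
  unfolding cls_ext_pure[symmetric] FO_ext by (rule E.cls_closed) (simp add: ext_gens_iff)

lemma ext_pure_balanced: "\<lbrakk>v \<in> el M n; b \<in> \<B> n; h \<in> \<H> n\<rbrakk> \<Longrightarrow>
    ext_pure M n (act M n v b) h = ext_pure M n v (proj n b \<otimes>\<^bsub>HA n\<^esub> h)"
  unfolding cls_ext_pure[symmetric] E.cls_eq_iff by (intro sum_eq.rel ext_rel.balanced)

lemma ext_pure_klinear:
  "h \<in> \<H> n \<Longrightarrow> klinear K (FO M n) (FO (ext M) n) (\<lambda>v. ext_pure M n v h)"
  "v \<in> el M n \<Longrightarrow> klinear K (HA n) (FO (ext M) n) (ext_pure M n v)"
proof -
  have ad: "ext_pure M n v h \<oplus>\<^bsub>FO (ext M) n\<^esub> ext_pure M n v' h' = E.cls n [(v, InH h), (v', InH h')]" for v h v' h'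
    unfolding cls_ext_pure[symmetric] FO_ext by (simp add: E.cls_add)
  have sm: "r \<odot>\<^bsub>FO (ext M) n\<^esub> ext_pure M n v h = ext_pure M n (r \<odot>\<^bsub>FO M n\<^esub> v) h" if "r \<in> carrier K" for r v h
    unfolding cls_ext_pure[symmetric] FO_ext using E.cls_smult[OF that] by simp
  show "klinear K (FO M n) (FO (ext M) n) (\<lambda>v. ext_pure M n v h)" if h: "h \<in> \<H> n"
  proof (rule klinearI)
    fix v w assume "v \<in> el M n" "w \<in> el M n"
    then show "ext_pure M n (v \<oplus>\<^bsub>FO M n\<^esub> w) h = ext_pure M n v h \<oplus>\<^bsub>FO (ext M) n\<^esub> ext_pure M n w h"
     unfolding ad unfolding cls_ext_pure[symmetric] E.cls_eq_iff using h by (intro sum_eq.rel ext_rel.add_left)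
  qed (simp_all add: ext_pure_closed h sm)
  show "klinear K (HA n) (FO (ext M) n) (ext_pure M n v)" if v: "v \<in> el M n"
  proof (rule klinearI)
    fix g h assume "g \<in> \<H> n" "h \<in> \<H> n"
    then show "ext_pure M n v (g \<oplus>\<^bsub>HA n\<^esub> h) = ext_pure M n v g \<oplus>\<^bsub>FO (ext M) n\<^esub> ext_pure M n v h"
     unfolding ad unfolding cls_ext_pure[symmetric] E.cls_eq_iff using v by (intro sum_eq.rel ext_rel.add_right)
  next
    fix r h assume r: "r \<in> carrier K" and h: "h \<in> \<H> n"
    \<comment> \<open>Scalars reach the Hecke slot by balancing with \<open>r\<close> times the unit
      of the group algebra, as no relation mentions them there.\<close>
    have 1: "act M n v (r \<odot>\<^bsub>BA n\<^esub> \<one>\<^bsub>BA n\<^esub>) = r \<odot>\<^bsub>FO M n\<^esub> v"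
     using X.A.act_smult_alg[OF M v _ r, of "\<one>\<^bsub>BA n\<^esub>"] X.A.act_one[OF M v] by simp
    have "proj n (r \<odot>\<^bsub>BA n\<^esub> \<one>\<^bsub>BA n\<^esub>) \<otimes>\<^bsub>HA n\<^esub> h = (r \<odot>\<^bsub>HA n\<^esub> \<one>\<^bsub>HA n\<^esub>) \<otimes>\<^bsub>HA n\<^esub> h"
     using r by (simp add: HA_simps HA_smult)
    also have "\<dots> = r \<odot>\<^bsub>HA n\<^esub> h" using X.B.smult_mult_l[OF r, of "\<one>\<^bsub>HA n\<^esub>" n h] h by simp
    finally show "ext_pure M n v (r \<odot>\<^bsub>HA n\<^esub> h) = r \<odot>\<^bsub>FO (ext M) n\<^esub> ext_pure M n v h"
     using ext_pure_balanced[OF v _ h, of "r \<odot>\<^bsub>BA n\<^esub> \<one>\<^bsub>BA n\<^esub>"] r by (simp add: 1 sm)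
  qed (simp add: ext_pure_closed v)
qed

lemma ext_ext:
  assumes W: "module K W" and h: "klinear K (FO (ext M) n) W f" "klinear K (FO (ext M) n) W f'"
    and eq: "\<And>v h. \<lbrakk>v \<in> el M n; h \<in> \<H> n\<rbrakk> \<Longrightarrow> f (ext_pure M n v h) = f' (ext_pure M n v h)"
    and x: "x \<in> el (ext M) n"
  shows "f x = f' x"
  using E.klinear_ext[OF W h[unfolded FO_ext] _ x[unfolded FO_ext]] eq
  by (metis (full_types) cls_ext_pure ext_gensE)

lemma ext_surj:
  assumes U: "module K U" and f: "klinear K U (FO (ext M) n) f"
    and gen: "\<And>v h. \<lbrakk>v \<in> el M n; h \<in> \<H> n\<rbrakk> \<Longrightarrow> \<exists>u\<in>carrier U. f u = ext_pure M n v h"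
    and x: "x \<in> el (ext M) n"
  shows "\<exists>u\<in>carrier U. f u = x"
proof (rule E.klinear_surj[OF U f[unfolded FO_ext] _ x[unfolded FO_ext]])
  fix g assume "g \<in> ext_gens K q M n"
  then show "\<exists>u\<in>carrier U. f u = E.cls n [g]" by (elim ext_gensE) (simp add: cls_ext_pure gen)
qed

lemma ext_bilinI:
  assumes "module K W" "\<And>h. h \<in> \<H> n \<Longrightarrow> klinear K (FO M n) W (\<lambda>v. \<phi> v h)"
    "\<And>v. v \<in> el M n \<Longrightarrow> klinear K (HA n) W (\<phi> v)"
    "\<And>v b h. \<lbrakk>v \<in> el M n; b \<in> \<B> n; h \<in> \<H> n\<rbrakk> \<Longrightarrow>
     \<phi> (act M n v b) h = \<phi> v (proj n b \<otimes>\<^bsub>HA n\<^esub> h)"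
  shows "ext_bilin M n W \<phi>"
  using assms by (simp add: ext_bilin_def)

lemma ext_map:
  assumes b: "ext_bilin M n W \<phi>"
  shows "klinear K (FO (ext M) n) W (ext_map W \<phi>)"
    and "\<lbrakk>v \<in> el M n; h \<in> \<H> n\<rbrakk> \<Longrightarrow> ext_map W \<phi> (ext_pure M n v h) = \<phi> v h"
proof -
  let ?f = "\<lambda>(v, h). \<phi> v (Hilbert_Choice.inv InH h)"
  have W: "module K W" and 1: "\<And>h. h \<in> \<H> n \<Longrightarrow> klinear K (FO M n) W (\<lambda>v. \<phi> v h)"
    and 2: "\<And>v. v \<in> el M n \<Longrightarrow> klinear K (HA n) W (\<phi> v)"
    and 3: "\<And>v b h. \<lbrakk>v \<in> el M n; b \<in> \<B> n; h \<in> \<H> n\<rbrakk> \<Longrightarrow>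
     \<phi> (act M n v b) h = \<phi> v (proj n b \<otimes>\<^bsub>HA n\<^esub> h)"
    using b by (simp_all add: ext_bilin_def)
  interpret W: module K W by fact
  have f: "?f g \<in> carrier W" if "g \<in> ext_gens K q M n" for g
    using that by (elim ext_gensE) (auto intro: klinearD(1)[OF 1])
  have rel: "term_sum W ?f P = term_sum W ?f Q" if "ext_rel K q M n P Q" for P Q
    using that
  proof (cases rule: ext_rel.cases)
    case (add_left v v' h) then show ?thesis by (simp add: klinearD[OF 1])
  next
    case (add_right v h h') then show ?thesis by (simp add: klinearD[OF 2])
  next
    case (zero h) then show ?thesis using klinear_zero[OF X.A.obj_module[OF M] W 1] by simp
  next
    case (balanced v b h) then show ?thesis by (simp add: 3)
  qed
  have fs: "?f ((\<lambda>(v, h). (r \<odot>\<^bsub>FO M n\<^esub> v, h)) g) = r \<odot>\<^bsub>W\<^esub> ?f g"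
    if "r \<in> carrier K" "g \<in> ext_gens K q M n" for r g
    using that by (elim ext_gensE) (auto simp: klinearD(3)[OF 1])
  show "klinear K (FO (ext M) n) W (ext_map W \<phi>)"
    using E.lift(1)[OF W f rel fs] unfolding FO_ext ext_map_def .
  show "\<lbrakk>v \<in> el M n; h \<in> \<H> n\<rbrakk> \<Longrightarrow> ext_map W \<phi> (ext_pure M n v h) = \<phi> v h"
    using E.lift(2)[OF W f rel fs, of "(v, InH h)"] by (simp add: ext_map_def cls_ext_pure ext_gens_iff)
qed

lemma ext_map_param:
  assumes U: "\<And>t. t \<in> carrier U \<Longrightarrow> ext_bilin M n W (\<psi> t)" and UM: "module K U" and W: "module K W"
    and l: "\<And>v h. \<lbrakk>v \<in> el M n; h \<in> \<H> n\<rbrakk> \<Longrightarrow> klinear K U W (\<lambda>t. \<psi> t v h)"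
    and x: "x \<in> el (ext M) n"
  shows "klinear K U W (\<lambda>t. ext_map W (\<psi> t) x)"
proof -
  interpret W: module K W by (rule W)
  interpret U: module K U by (rule UM)
  let ?D = "FO (ext M) n"
  show ?thesis
  proof (rule klinearI)
    fix b c assume b: "b \<in> carrier U" "c \<in> carrier U"
    have "klinear K ?D W (\<lambda>x. ext_map W (\<psi> b) x \<oplus>\<^bsub>W\<^esub> ext_map W (\<psi> c) x)"
     by (rule klinearI) (simp_all add: klinearD[OF ext_map(1)[OF U[OF b(1)]]]
      klinearD[OF ext_map(1)[OF U[OF b(2)]]] W.smult_r_distr W.a_ac)
    from ext_ext[OF W ext_map(1)[OF U[OF U.a_closed[OF b]]] this _ x]
    show "ext_map W (\<psi> (b \<oplus>\<^bsub>U\<^esub> c)) x = ext_map W (\<psi> b) x \<oplus>\<^bsub>W\<^esub> ext_map W (\<psi> c) x"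
     using b by (simp add: ext_map(2)[OF U] klinearD(2)[OF l])
  next
    fix r b assume b: "r \<in> carrier K" "b \<in> carrier U"
    have "klinear K ?D W (\<lambda>x. r \<odot>\<^bsub>W\<^esub> ext_map W (\<psi> b) x)"
     by (rule klinearI) (simp_all add: klinearD[OF ext_map(1)[OF U[OF b(2)]]] b(1)
      W.smult_r_distr W.smult_assoc1[symmetric] m_comm)
    from ext_ext[OF W ext_map(1)[OF U[OF U.smult_closed[OF b]]] this _ x]
    show "ext_map W (\<psi> (r \<odot>\<^bsub>U\<^esub> b)) x = r \<odot>\<^bsub>W\<^esub> ext_map W (\<psi> b) x"
     using b by (simp add: ext_map(2)[OF U] klinearD(3)[OF l])
  qed (rule klinearD(1)[OF ext_map(1)[OF U] x])
qed

lemma ext_terms_gens: "x \<in> el (ext M) n \<Longrightarrow> set (ext_terms x) \<subseteq> ext_gens K q M n"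
  using E.cls_d unfolding FO_ext by blast

lemma ext_map_cong:
  assumes "x \<in> el (ext M) n"
    and "\<And>v h. \<lbrakk>v \<in> el M n; h \<in> \<H> n\<rbrakk> \<Longrightarrow> f (v, InH h) = \<phi> v h"
  shows "term_sum W f (ext_terms x) = ext_map W \<phi> x"
  unfolding ext_map_def
proof (rule term_sum_cong)
  fix g assume "g \<in> set (ext_terms x)"
  then have "g \<in> ext_gens K q M n" using ext_terms_gens[OF assms(1)] by blast
  then show "f g = (case g of (v, h) \<Rightarrow> \<phi> v (Hilbert_Choice.inv InH h))"
    by (elim ext_gensE) (simp add: assms(2))
qed

lemma ext_elt_concat:
  assumes "\<And>g. g \<in> set P \<Longrightarrow> set (F g) \<subseteq> ext_gens K q M n"
  shows "ext_elt K q M n (concat (map F P)) = term_sum (FO (ext M) n) (\<lambda>g. ext_elt K q M n (F g)) P"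
  using E.cls_concat[of P F n] assms unfolding FO_ext by (simp add: ext_elt_cls[OF M])

lemma ext_elt_map:
  assumes "\<And>g. g \<in> set P \<Longrightarrow> F g \<in> ext_gens K q M n"
  shows "ext_elt K q M n (map F P) = term_sum (FO (ext M) n) (\<lambda>g. ext_elt K q M n [F g]) P"
  using E.cls_map[of P F n] assms unfolding FO_ext by (simp add: ext_elt_cls[OF M])

lemma ext_act_bilin:
  assumes b: "b \<in> \<H> n"
  shows "ext_bilin M n (FO (ext M) n) (\<lambda>v h. ext_pure M n v (h \<otimes>\<^bsub>HA n\<^esub> b))"
proof (rule ext_bilinI[OF ext_module], goal_cases)
  case 1 then show ?case using b by (intro ext_pure_klinear) simp
next
  case (2 v) show ?case by (rule klinear_comp[OF HA_mult_klinear(1)[OF b] ext_pure_klinear(2)[OF 2]])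
next
  case (3 v c h) then show ?case using b by (simp add: ext_pure_balanced H.m_assoc HA_closed)
qed

lemma ext_obj_eq: "ext M = X.B.mk_obj (FO (ext M))
    (\<lambda>n x b. ext_map (FO (ext M) n) (\<lambda>v h. ext_pure M n v (h \<otimes>\<^bsub>HA n\<^esub> b)) x)"
proof -
  have "ext_elt K q M n (map (\<lambda>(v, h). (v, InH (Hilbert_Choice.inv InH h \<otimes>\<^bsub>HA n\<^esub> b))) (ext_terms x)) =
    ext_map (FO (ext M) n) (\<lambda>v h. ext_pure M n v (h \<otimes>\<^bsub>HA n\<^esub> b)) x"
    if x: "x \<in> el (ext M) n" and b: "b \<in> \<H> n" for n x b
  proof -
    let ?F = "\<lambda>(v, h). (v, InH (Hilbert_Choice.inv InH h \<otimes>\<^bsub>HA n\<^esub> b))"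
    have "?F g \<in> ext_gens K q M n" if "g \<in> set (ext_terms x)" for g
     using subsetD[OF ext_terms_gens[OF x] that] b by (elim ext_gensE) (simp add: ext_gens_iff)
    then have "ext_elt K q M n (map ?F (ext_terms x)) =
      term_sum (FO (ext M) n) (\<lambda>g. ext_elt K q M n [?F g]) (ext_terms x)"
     by (rule ext_elt_map)
    also have "\<dots> = ext_map (FO (ext M) n) (\<lambda>v h. ext_pure M n v (h \<otimes>\<^bsub>HA n\<^esub> b)) x"
     by (rule ext_map_cong[OF x]) (simp add: ext_pure_def)
    finally show ?thesis .
  qed
  then have "FA (ext M) = FA (X.B.mk_obj (FO (ext M))
    (\<lambda>n x b. ext_map (FO (ext M) n) (\<lambda>v h. ext_pure M n v (h \<otimes>\<^bsub>HA n\<^esub> b)) x))"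
    unfolding X.B.mk_obj_def funct.select_convs
    by (subst ext_obj_def, unfold funct.select_convs ext_space_FO, intro restrict_ext)
     (auto simp: X.B.bar_arrows intro!: X.B.lmap_of_cong)
  then show ?thesis by (intro funct.equality) (simp_all add: X.B.mk_obj_def)
qed

lemma ext_obj: "ext M \<in> Ob HC"
proof (subst ext_obj_eq, rule X.B.mk_obj[OF ext_module], unfold seq_sel, goal_cases)
  case (1 n b) show ?case by (rule ext_map(1)[OF ext_act_bilin[OF 1]])
next
  case (2 n x)
  show ?case
  proof (rule ext_map_param[OF ext_act_bilin HA_module ext_module _ 2])
    fix v h assume g: "v \<in> el M n" "h \<in> \<H> n"
    show "klinear K (HA n) (FO (ext M) n) (\<lambda>b. ext_pure M n v (h \<otimes>\<^bsub>HA n\<^esub> b))"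
     by (rule klinear_comp[OF HA_mult_klinear(2)[OF g(2)] ext_pure_klinear(2)[OF g(1)]])
  qed
next
  case (3 n x)
  have "klinear K (FO (ext M) n) (FO (ext M) n) (\<lambda>x. x)" by (rule klinearI) simp_all
  from ext_ext[OF ext_module ext_map(1)[OF ext_act_bilin[OF H.one_closed]] this _ 3] show ?case
    by (simp add: ext_map(2)[OF ext_act_bilin])
next
  case (4 n x a b)
  from ext_ext[OF ext_module klinear_comp[OF ext_map(1)[OF ext_act_bilin[OF 4(2)]] ext_map(1)[OF ext_act_bilin[OF 4(3)]]]
    ext_map(1)[OF ext_act_bilin[OF H.m_closed[OF 4(2,3)]]] _ 4(1)] show ?case
    using 4 by (simp add: ext_map(2)[OF ext_act_bilin] H.m_assoc)
qed

lemma ext_act: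
  "\<lbrakk>v \<in> el M n; h \<in> \<H> n; b \<in> \<H> n\<rbrakk> \<Longrightarrow>
    act (ext M) n (ext_pure M n v h) b = ext_pure M n v (h \<otimes>\<^bsub>HA n\<^esub> b)"
  by (subst ext_obj_eq, subst X.B.mk_obj_act) (simp_all add: ext_pure_closed ext_map(2)[OF ext_act_bilin])

lemma ext_hom:
  assumes P: "P \<in> Ob HC" and b: "\<And>n. ext_bilin M n (FO P n) (\<phi> n)"
    and eq: "\<And>n v h c. \<lbrakk>v \<in> el M n; h \<in> \<H> n; c \<in> \<H> n\<rbrakk> \<Longrightarrow>
     \<phi> n v (h \<otimes>\<^bsub>HA n\<^esub> c) = act P n (\<phi> n v h) c"
  shows "X.B.mk_arr (ext M) P (\<lambda>n. ext_map (FO P n) (\<phi> n)) \<in> mor HC (ext M) P"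
proof (rule X.B.mk_arr[OF ext_obj P ext_map(1)[OF b]])
  fix n x c assume x: "x \<in> el (ext M) n" and "c \<in> carrier (Alg HS n)"
  then have c: "c \<in> \<H> n" by simp
  note kc = X.B.act_klinear[OF _ \<open>c \<in> carrier (Alg HS n)\<close>]
  show "ext_map (FO P n) (\<phi> n) (act (ext M) n x c) = act P n (ext_map (FO P n) (\<phi> n) x) c"
    by (rule ext_ext[OF X.B.obj_module[OF P] klinear_comp[OF kc[OF ext_obj] ext_map(1)[OF b]]
       klinear_comp[OF ext_map(1)[OF b] kc[OF P]] _ x])
     (use c in \<open>simp add: ext_act ext_map(2)[OF b] eq\<close>)
qed

text \<open>The unit of the adjunction between extension and restriction of scalars.\<close>

definition ext_unit :: "('k, 'u) braid_marr" where
  "ext_unit = X.A.mk_arr M (X.res_obj (ext M)) (\<lambda>n v. ext_pure M n v \<one>\<^bsub>HA n\<^esub>)"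

lemma ext_unit: "ext_unit \<in> mor BC M (X.res_obj (ext M))"
  unfolding ext_unit_def
proof (rule X.A.mk_arr[OF M X.res_obj[OF ext_obj]])
  fix n show "klinear K (FO M n) (FO (X.res_obj (ext M)) n) (\<lambda>v. ext_pure M n v \<one>\<^bsub>HA n\<^esub>)"
    using ext_pure_klinear(1)[OF H.one_closed] by simp
next
  fix n v a assume "v \<in> el M n" "a \<in> carrier (Alg BS n)"
  then show "ext_pure M n (act M n v a) \<one>\<^bsub>HA n\<^esub> = act (X.res_obj (ext M)) n (ext_pure M n v \<one>\<^bsub>HA n\<^esub>) a"
    by (simp add: X.act_res ext_pure_balanced ext_act HA_closed)
qed

lemma ext_unit_apply: "v \<in> el M n \<Longrightarrow> ap ext_unit n v = ext_pure M n v \<one>\<^bsub>HA n\<^esub>"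
  by (simp add: ext_unit_def)

text \<open>Tensoring with a quotient algebra is the quotient by the image of the ideal.
  Surjectivity holds because \<open>v\<close> tensor the class of \<open>b\<close> equals
  \<open>v b\<close> tensor the unit; an arrow that kills the kernel extends linearly to
  \<open>ext M\<close> by lifting the Hecke element along \<open>proj\<close>.\<close>

lemma ext_unit_quotient: "X.A.quotient_arr X.ker M (X.res_obj (ext M)) ext_unit"
  unfolding X.A.quotient_arr_def
proof (intro conjI ballI allI impI M X.res_obj ext_obj ext_unit X.kills_res[OF ext_obj M ext_unit])
  fix n y assume y: "y \<in> el (X.res_obj (ext M)) n"
  have l: "klinear K (FO M n) (FO (ext M) n) (ap ext_unit n)"
    using X.A.mor_klinear[OF M ext_unit] by simp
  show "\<exists>x\<in>el M n. ap ext_unit n x = y"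
  proof (rule ext_surj[OF X.A.obj_module[OF M] l _ y[unfolded X.FO_res]])
    fix v h assume v: "v \<in> el M n" and h: "h \<in> \<H> n"
    obtain b where b: "h = proj n b" "b \<in> \<B> n" using h by (rule HA_E)
    have "act M n v b \<in> el M n" using X.A.act_closed[OF M _ v] b by simp
    moreover from this have "ap ext_unit n (act M n v b) = ext_pure M n v h"
     using v b by (simp add: ext_unit_apply ext_pure_balanced HA_closed)
    ultimately show "\<exists>x\<in>el M n. ap ext_unit n x = ext_pure M n v h" by blast
  qed
next
  fix P g n x
  assume P: "P \<in> Ob BC" and g: "g \<in> mor BC M P" and k: "X.A.kills X.ker M P g"
    and x: "x \<in> el M n" and fx: "ap ext_unit n x = \<zero>\<^bsub>FO (X.res_obj (ext M)) n\<^esub>"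
  define s where "s h = (SOME a. a \<in> \<B> n \<and> proj n a = h)" for h
  have s: "s h \<in> \<B> n" "proj n (s h) = h" if "h \<in> \<H> n" for h
    using someI_ex[of "\<lambda>a. a \<in> \<B> n \<and> proj n a = h"] HA_E[OF that] unfolding s_def by blast+
  have dep: "ap g n (act M n v a) = ap g n (act M n v a')"
    if "v \<in> el M n" "a \<in> \<B> n" "a' \<in> \<B> n" "proj n a = proj n a'" for v a a'
    using X.kills_eq[OF M P g k that(1) _ _ that(4)] that by simp
  have lg: "klinear K (FO M n) (FO P n) (ap g n)" by (rule X.A.mor_klinear[OF M g])
  have la: "klinear K (BA n) (FO P n) (\<lambda>a. ap g n (act M n v a))" if "v \<in> el M n" for v
    using klinear_comp[OF X.A.act_klinear_alg[OF M that] lg] by simp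
  have bil: "ext_bilin M n (FO P n) (\<lambda>v h. ap g n (act M n v (s h)))"
  proof (rule ext_bilinI[OF X.A.obj_module[OF P]], goal_cases)
    case (1 h)
    then show ?case using klinear_comp[OF X.A.act_klinear[OF M, of "s h" n] lg] s by simp
  next
    case (2 v)
    show ?case
    proof (rule klinearI)
     fix b c assume b: "b \<in> \<H> n" "c \<in> \<H> n"
     have "ap g n (act M n v (s (b \<oplus>\<^bsub>HA n\<^esub> c))) = ap g n (act M n v (s b \<oplus>\<^bsub>BA n\<^esub> s c))"
      using b 2 HA_simps(5)[of "s b" n "s c"] by (intro dep) (simp_all add: s HA_closed)
     then show "ap g n (act M n v (s (b \<oplus>\<^bsub>HA n\<^esub> c))) = ap g n (act M n v (s b)) \<oplus>\<^bsub>FO P n\<^esub> ap g n (act M n v (s c))"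
      using b by (simp add: klinearD(2)[OF la[OF 2]] s)
    next
     fix t b assume b: "t \<in> carrier K" "b \<in> \<H> n"
     have "ap g n (act M n v (s (t \<odot>\<^bsub>HA n\<^esub> b))) = ap g n (act M n v (t \<odot>\<^bsub>BA n\<^esub> s b))"
      using b 2 HA_smult[OF b(1), of "s b" n] by (intro dep) (simp_all add: s HA_closed)
     then show "ap g n (act M n v (s (t \<odot>\<^bsub>HA n\<^esub> b))) = t \<odot>\<^bsub>FO P n\<^esub> ap g n (act M n v (s b))"
      using b by (simp add: klinearD(3)[OF la[OF 2]] s)
    qed (simp add: klinearD(1)[OF la[OF 2]] s)
  next
    case (3 v b h)
    have "ap g n (act M n (act M n v b) (s h)) = ap g n (act M n v (b \<otimes>\<^bsub>BA n\<^esub> s h))"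
     using X.A.act_mult[OF M 3(1), of b "s h"] 3 s by simp
    also have "\<dots> = ap g n (act M n v (s (proj n b \<otimes>\<^bsub>HA n\<^esub> h)))"
     using 3 HA_simps(4)[of b n "s h"] by (intro dep) (simp_all add: s HA_closed)
    finally show ?case .
  qed
  let ?h = "ext_map (FO P n) (\<lambda>v h. ap g n (act M n v (s h)))"
  have "?h (ap ext_unit n x) = ap g n (act M n x (s \<one>\<^bsub>HA n\<^esub>))"
    using x by (simp add: ext_unit_apply ext_map(2)[OF bil])
  also have "\<dots> = ap g n (act M n x \<one>\<^bsub>BA n\<^esub>)"
    using x HA_simps(2)[of n] by (intro dep) (simp_all add: s HA_closed)
  also have "\<dots> = ap g n x" using X.A.act_one[OF M x] by simp
  finally show "ap g n x = \<zero>\<^bsub>FO P n\<^esub>"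
    using klinear_zero[OF ext_module X.A.obj_module[OF P] ext_map(1)[OF bil]] fx by simp
qed

end

lemma
  assumes o: "M \<in> Ob BC" "N \<in> Ob BC" and \<alpha>: "\<alpha> \<in> mor BC M N"
  shows ext_arr: "ext_arr K q \<alpha> \<in> mor HC (ext M) (ext N)"
    and ext_arr_apply: "\<lbrakk>v \<in> el M n; h \<in> \<H> n\<rbrakk> \<Longrightarrow>
     ap (ext_arr K q \<alpha>) n (ext_pure M n v h) = ext_pure N n (ap \<alpha> n v) h"
proof -
  note cl = klinearD(1)[OF X.A.mor_klinear[OF o(1) \<alpha>]]
  let ?\<phi> = "\<lambda>n v h. ext_pure N n (ap \<alpha> n v) h"
  have bil: "ext_bilin M n (FO (ext N) n) (?\<phi> n)" for n
  proof (rule ext_bilinI[OF o(1) ext_module[OF o(2)]], goal_cases)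
    case (1 h) show ?case by (rule klinear_comp[OF X.A.mor_klinear[OF o(1) \<alpha>] ext_pure_klinear(1)[OF o(2) 1]])
  next
    case (2 v) show ?case by (rule ext_pure_klinear(2)[OF o(2) cl[OF 2]])
  next
    case (3 v b h)
    then show ?case using X.A.mor_act[OF o \<alpha> 3(1), of b] by (simp add: ext_pure_balanced[OF o(2)] cl)
  qed
  have eq: "ext_arr K q \<alpha> = X.B.mk_arr (ext M) (ext N) (\<lambda>n. ext_map (FO (ext N) n) (?\<phi> n))"
  proof -
    have "ext_elt K q N n (map (\<lambda>(v, h). (ap \<alpha> n v, h)) (ext_terms x)) = ext_map (FO (ext N) n) (?\<phi> n) x"
     if x: "x \<in> el (ext M) n" for n x
    proof -
     let ?F = "\<lambda>(v, h). (ap \<alpha> n v, h)"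
     have "?F g \<in> ext_gens K q N n" if "g \<in> set (ext_terms x)" for g
      using subsetD[OF ext_terms_gens[OF o(1) x] that] by (elim ext_gensE) (simp add: ext_gens_iff cl)
     then have "ext_elt K q N n (map ?F (ext_terms x)) =
       term_sum (FO (ext N) n) (\<lambda>g. ext_elt K q N n [?F g]) (ext_terms x)"
      by (rule ext_elt_map[OF o(2)])
     also have "\<dots> = ext_map (FO (ext N) n) (?\<phi> n) x"
      by (rule ext_map_cong[OF o(1) x]) (simp add: ext_pure_def)
     finally show ?thesis .
    qed
    then show ?thesis
     unfolding ext_arr_def X.B.mk_arr_def X.A.mor_Src[OF o(1) \<alpha>] X.A.mor_Tgt[OF o(1) \<alpha>] ext_space_FO
     by (auto simp: fun_eq_iff intro!: X.B.lmap_of_cong)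
  qed
  show "ext_arr K q \<alpha> \<in> mor HC (ext M) (ext N)"
    unfolding eq by (rule ext_hom[OF o(1) ext_obj[OF o(2)] bil]) (simp add: ext_act[OF o(2)] cl)
  show "\<lbrakk>v \<in> el M n; h \<in> \<H> n\<rbrakk> \<Longrightarrow>
     ap (ext_arr K q \<alpha>) n (ext_pure M n v h) = ext_pure N n (ap \<alpha> n v) h"
    unfolding eq by (simp add: ext_pure_closed[OF o(1)] ext_map(2)[OF o(1) bil])
qed

end

section \<open>The monoidal structure of extension of scalars\<close>

context hecke_extension
begin

lemmas HA_mu_klinear = X.B.mu_klinear[unfolded seq_sel]
lemmas HA_mu_closed = X.B.mu_closed'[unfolded seq_sel]
lemmas HA_mu_mult = X.B.mu_mult[unfolded seq_sel]

context
  fixes M N assumes M: "M \<in> Ob BC" and N: "N \<in> Ob BC"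
begin

abbreviation (input) "MN \<equiv> day_obj K BS M N"
abbreviation (input) "EMN \<equiv> ext MN"

lemma MN: "MN \<in> Ob BC" by (rule X.A.day_obj[OF M N])

lemmas em = ext_module[OF MN] and eo = ext_obj[OF M] ext_obj[OF N] ext_obj[OF MN]

text \<open>The map is built in three stages that mirror the nested lists of \<open>ext_mul\<close>:
  all tensors pure, then an arbitrary element \<open>z\<close> of the second extension, then an
  arbitrary element \<open>y\<close> of the first.\<close>

definition ext_mul_pure where
  "ext_mul_pure p i v h j w h' g =
    ext_pure MN p (X.A.pure M N p i v j w \<one>\<^bsub>BA p\<^esub>) (hecke_mu K q i j h h' \<otimes>\<^bsub>HA p\<^esub> g)"

definition ext_mul_in where
  "ext_mul_in p i v h j z g = ext_map (FO EMN p) (\<lambda>w h'. ext_mul_pure p i v h j w h' g) z"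

definition ext_mul_out where
  "ext_mul_out p i y j z g = ext_map (FO EMN p) (\<lambda>v h. ext_mul_in p i v h j z g) y"

context
  fixes p i j :: nat assumes ij: "i + j = p"
begin

abbreviation (input) "e \<equiv> \<lambda>v h. ext_mul_pure p i v h j"
abbreviation (input) "V \<equiv> el M i"
abbreviation (input) "W \<equiv> el N j"

lemma mul_pure_closed: "\<lbrakk>v \<in> V; w \<in> W; a \<in> \<B> p\<rbrakk> \<Longrightarrow> X.A.pure M N p i v j w a \<in> el MN p"
  using X.A.pure_closed[OF M N ij] by simp

lemma mul_pure_klinear:
  "\<lbrakk>h \<in> \<H> i; w \<in> W; h' \<in> \<H> j; g \<in> \<H> p\<rbrakk> \<Longrightarrow> klinear K (FO M i) (FO EMN p) (\<lambda>v. e v h w h' g)"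
  "\<lbrakk>v \<in> V; w \<in> W; h' \<in> \<H> j; g \<in> \<H> p\<rbrakk> \<Longrightarrow> klinear K (HA i) (FO EMN p) (\<lambda>h. e v h w h' g)"
  "\<lbrakk>v \<in> V; h \<in> \<H> i; h' \<in> \<H> j; g \<in> \<H> p\<rbrakk> \<Longrightarrow> klinear K (FO N j) (FO EMN p) (\<lambda>w. e v h w h' g)"
  "\<lbrakk>v \<in> V; h \<in> \<H> i; w \<in> W; g \<in> \<H> p\<rbrakk> \<Longrightarrow> klinear K (HA j) (FO EMN p) (\<lambda>h'. e v h w h' g)"
  "\<lbrakk>v \<in> V; h \<in> \<H> i; w \<in> W; h' \<in> \<H> j\<rbrakk> \<Longrightarrow> klinear K (HA p) (FO EMN p) (\<lambda>g. e v h w h' g)"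
  unfolding ext_mul_pure_def
proof goal_cases
  case 1 then show ?case
    by (intro klinear_comp[OF X.A.pure_klinear(1)[OF M N ij] ext_pure_klinear(1)[OF MN]]) (simp_all add: HA_mu_closed[OF ij])
next
  case 2 show ?case
    by (rule klinear_comp[OF klinear_comp[OF HA_mu_klinear(1)[OF ij 2(3)] HA_mult_klinear(1)[OF 2(4)]]
     ext_pure_klinear(2)[OF MN]]) (simp add: mul_pure_closed 2)
next
  case 3 then show ?case
    by (intro klinear_comp[OF X.A.pure_klinear(2)[OF M N ij] ext_pure_klinear(1)[OF MN]]) (simp_all add: HA_mu_closed[OF ij])
next
  case 4 show ?case
    by (rule klinear_comp[OF klinear_comp[OF HA_mu_klinear(2)[OF ij 4(2)] HA_mult_klinear(1)[OF 4(4)]]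
     ext_pure_klinear(2)[OF MN]]) (simp add: mul_pure_closed 4)
next
  case 5 show ?case
    by (rule klinear_comp[OF HA_mult_klinear(2)[OF HA_mu_closed[OF ij]] ext_pure_klinear(2)[OF MN]])
     (simp_all add: mul_pure_closed 5)
qed

text \<open>The elements \<open>b\<close> and \<open>b'\<close> pass from the modules to the Hecke
  side: balancing in the convolution produces \<open>braid_mu\<close> in the algebra slot, which is
  an action on the pure tensor with a unit in that slot; balancing of the extension carries it
  across, and there \<open>hecke_mu\<close> is multiplicative.\<close>

lemma mul_pure_balanced:
  assumes "v \<in> V" "h \<in> \<H> i" "w \<in> W" "h' \<in> \<H> j" "g \<in> \<H> p"
    and "b \<in> \<B> i" "b' \<in> \<B> j"
  shows "e (act M i v b) h (act N j w b') h' g = e v (proj i b \<otimes>\<^bsub>HA i\<^esub> h) w (proj j b' \<otimes>\<^bsub>HA j\<^esub> h') g"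
proof -
  let ?m = "braid_mu K i j b b'"
  have m: "?m \<in> \<B> p" using mu_closed assms(6,7) ij by blast
  have "X.A.pure M N p i (act M i v b) j (act N j w b') \<one>\<^bsub>BA p\<^esub> = X.A.pure M N p i v j w ?m"
    using X.A.pure_balanced[OF M N ij assms(1,3), of "\<one>\<^bsub>BA p\<^esub>" b b'] assms(6,7) m X.A.alg.r_one[of ?m p] by simp
  also have "\<dots> = act MN p (X.A.pure M N p i v j w \<one>\<^bsub>BA p\<^esub>) ?m"
    using X.A.day_act[OF M N ij assms(1,3), of "\<one>\<^bsub>BA p\<^esub>" ?m] m X.A.alg.l_one[of ?m p] by simp
  finally show ?thesis
    unfolding ext_mul_pure_def
    using ext_pure_balanced[OF MN mul_pure_closed[OF assms(1,3)] m, of "\<one>\<^bsub>BA p\<^esub>" "hecke_mu K q i j h h' \<otimes>\<^bsub>HA p\<^esub> g"]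
     HA_mu_mult[OF HA_closed[OF assms(6)] assms(2) HA_closed[OF assms(7)] assms(4)]
     assms(2,4,5) HA_closed[OF m] HA_mu_closed[OF ij assms(2,4)] X.A.alg.one_closed[of p]
    by (simp add: ij hecke_mu_proj[OF assms(6,7)] H.m_assoc)
qed

lemma mul_pure_act:
  assumes "v \<in> V" "h \<in> \<H> i" "w \<in> W" "h' \<in> \<H> j" "g \<in> \<H> p" "b \<in> \<H> p"
  shows "e v h w h' (g \<otimes>\<^bsub>HA p\<^esub> b) = act EMN p (e v h w h' g) b"
  unfolding ext_mul_pure_def using assms X.A.alg.one_closed[of p]
  by (simp add: ext_act[OF MN] mul_pure_closed HA_mu_closed[OF ij] H.m_assoc)

lemma mul_in_bilin:
  "\<lbrakk>v \<in> V; h \<in> \<H> i; g \<in> \<H> p\<rbrakk> \<Longrightarrow> ext_bilin N j (FO EMN p) (\<lambda>w h'. e v h w h' g)"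
proof (rule ext_bilinI[OF N em], goal_cases)
  case 1 then show ?case by (intro mul_pure_klinear(3))
next
  case 2 then show ?case by (intro mul_pure_klinear(4))
next
  case (3 w b h')
  \<comment> \<open>Balancing in the second factor alone is the two-sided statement with the unit in
    the first.\<close>
  have "act M i v \<one>\<^bsub>BA i\<^esub> = v" "proj i \<one>\<^bsub>BA i\<^esub> \<otimes>\<^bsub>HA i\<^esub> h = h"
    using X.A.act_one[OF M 3(1)] 3(2) by (simp_all add: HA_simps(2)[symmetric])
  then show ?case using mul_pure_balanced[OF 3(1,2,4,6,3) _ 3(5), of "\<one>\<^bsub>BA i\<^esub>"] X.A.alg.one_closed[of i] by simp
qed

lemma mul_in:
  "\<lbrakk>v \<in> V; h \<in> \<H> i; g \<in> \<H> p; w \<in> W; h' \<in> \<H> j\<rbrakk> \<Longrightarrow>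
    ext_mul_in p i v h j (ext_pure N j w h') g = e v h w h' g"
  unfolding ext_mul_in_def using ext_map(2)[OF N mul_in_bilin] by simp

lemma mul_in_klinear:
  "\<lbrakk>h \<in> \<H> i; z \<in> el (ext N) j; g \<in> \<H> p\<rbrakk> \<Longrightarrow>
    klinear K (FO M i) (FO EMN p) (\<lambda>v. ext_mul_in p i v h j z g)"
  "\<lbrakk>v \<in> V; z \<in> el (ext N) j; g \<in> \<H> p\<rbrakk> \<Longrightarrow>
    klinear K (HA i) (FO EMN p) (\<lambda>h. ext_mul_in p i v h j z g)"
  "\<lbrakk>v \<in> V; h \<in> \<H> i; z \<in> el (ext N) j\<rbrakk> \<Longrightarrow>
    klinear K (HA p) (FO EMN p) (\<lambda>g. ext_mul_in p i v h j z g)"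
  "\<lbrakk>v \<in> V; h \<in> \<H> i; g \<in> \<H> p\<rbrakk> \<Longrightarrow>
    klinear K (FO (ext N) j) (FO EMN p) (\<lambda>z. ext_mul_in p i v h j z g)"
  unfolding ext_mul_in_def
proof goal_cases
  case 1 show ?case
    by (rule ext_map_param[OF N mul_in_bilin X.A.obj_module[OF M] em mul_pure_klinear(1)]) (use 1 in simp_all)
next
  case 2 show ?case
    by (rule ext_map_param[OF N mul_in_bilin HA_module em mul_pure_klinear(2)]) (use 2 in simp_all)
next
  case 3 show ?case
    by (rule ext_map_param[OF N mul_in_bilin HA_module em mul_pure_klinear(5)]) (use 3 in simp_all)
next
  case 4 show ?case by (rule ext_map(1)[OF N mul_in_bilin[OF 4]])
qed

lemma mul_out_bilin:
  "\<lbrakk>z \<in> el (ext N) j; g \<in> \<H> p\<rbrakk> \<Longrightarrow> ext_bilin M i (FO EMN p) (\<lambda>v h. ext_mul_in p i v h j z g)"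
proof (rule ext_bilinI[OF M em], goal_cases)
  case (3 v b h)
  have c: "act M i v b \<in> V" "proj i b \<otimes>\<^bsub>HA i\<^esub> h \<in> \<H> i"
    using X.A.act_closed[OF M, of b i v] 3 by (simp_all add: HA_closed)
  show ?case
  proof (rule ext_ext[OF N em mul_in_klinear(4)[OF c(1) 3(5,2)] mul_in_klinear(4)[OF 3(3) c(2) 3(2)] _ 3(1)])
    fix w h' assume wh: "w \<in> W" "h' \<in> \<H> j"
    have "act N j w \<one>\<^bsub>BA j\<^esub> = w" "proj j \<one>\<^bsub>BA j\<^esub> \<otimes>\<^bsub>HA j\<^esub> h' = h'"
     using X.A.act_one[OF N wh(1)] wh(2) by (simp_all add: HA_simps(2)[symmetric])
    then show "ext_mul_in p i (act M i v b) h j (ext_pure N j w h') g =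
      ext_mul_in p i v (proj i b \<otimes>\<^bsub>HA i\<^esub> h) j (ext_pure N j w h') g"
     using mul_pure_balanced[OF 3(3,5) wh 3(2,4), of "\<one>\<^bsub>BA j\<^esub>"] X.A.alg.one_closed[of j] 3 wh
     by (simp add: mul_in c)
  qed
qed (simp_all add: mul_in_klinear)

lemma mul_out:
  "\<lbrakk>v \<in> V; h \<in> \<H> i; g \<in> \<H> p; w \<in> W; h' \<in> \<H> j\<rbrakk> \<Longrightarrow>
    ext_mul_out p i (ext_pure M i v h) j (ext_pure N j w h') g = e v h w h' g"
  unfolding ext_mul_out_def using ext_map(2)[OF M mul_out_bilin] ext_pure_closed[OF N] mul_in by simp

lemma mul_out_klinear:
  "\<lbrakk>z \<in> el (ext N) j; g \<in> \<H> p\<rbrakk> \<Longrightarrow>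
    klinear K (FO (ext M) i) (FO EMN p) (\<lambda>y. ext_mul_out p i y j z g)"
  "\<lbrakk>y \<in> el (ext M) i; g \<in> \<H> p\<rbrakk> \<Longrightarrow>
    klinear K (FO (ext N) j) (FO EMN p) (\<lambda>z. ext_mul_out p i y j z g)"
  "\<lbrakk>y \<in> el (ext M) i; z \<in> el (ext N) j\<rbrakk> \<Longrightarrow>
    klinear K (HA p) (FO EMN p) (\<lambda>g. ext_mul_out p i y j z g)"
  unfolding ext_mul_out_def
proof goal_cases
  case 1 show ?case by (rule ext_map(1)[OF M mul_out_bilin[OF 1]])
next
  case 2 show ?case
    by (rule ext_map_param[OF M mul_out_bilin ext_module[OF N] em mul_in_klinear(4)]) (use 2 in simp_all)
next
  case 3 show ?case
    by (rule ext_map_param[OF M mul_out_bilin HA_module em mul_in_klinear(3)]) (use 3 in simp_all)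
qed

text \<open>Two applications of \<open>ext_ext\<close>, one variable after the other.\<close>

lemma mul_out_ext:
  assumes f: "\<And>z. z \<in> el (ext N) j \<Longrightarrow> klinear K (FO (ext M) i) U (\<lambda>y. f y z)"
     "\<And>y. y \<in> el (ext M) i \<Longrightarrow> klinear K (FO (ext N) j) U (f y)"
    and g: "\<And>z. z \<in> el (ext N) j \<Longrightarrow> klinear K (FO (ext M) i) U (\<lambda>y. f' y z)"
     "\<And>y. y \<in> el (ext M) i \<Longrightarrow> klinear K (FO (ext N) j) U (f' y)"
    and U: "module K U"
    and eq: "\<And>v h w h'. \<lbrakk>v \<in> V; h \<in> \<H> i; w \<in> W; h' \<in> \<H> j\<rbrakk> \<Longrightarrow>
     f (ext_pure M i v h) (ext_pure N j w h') = f' (ext_pure M i v h) (ext_pure N j w h')"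
    and yz: "y \<in> el (ext M) i" "z \<in> el (ext N) j"
  shows "f y z = f' y z"
  by (rule ext_ext[OF M U f(1)[OF yz(2)] g(1)[OF yz(2)] _ yz(1)],
     rule ext_ext[OF N U f(2) g(2) _ yz(2)]) (simp_all add: eq ext_pure_closed[OF M])

lemma mul_out_balanced:
  assumes yz: "y \<in> el (ext M) i" "z \<in> el (ext N) j"
    and g: "g \<in> \<H> p" and b: "b \<in> \<H> i" "b' \<in> \<H> j"
  shows "ext_mul_out p i (act (ext M) i y b) j (act (ext N) j z b') g =
    ext_mul_out p i y j z (hecke_mu K q i j b b' \<otimes>\<^bsub>HA p\<^esub> g)"
proof -
  have m: "hecke_mu K q i j b b' \<otimes>\<^bsub>HA p\<^esub> g \<in> \<H> p" using HA_mu_closed[OF ij b] g by simp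
  note ka = X.B.act_klinear[OF eo(1), of b i] and kb = X.B.act_klinear[OF eo(2), of b' j]
  show ?thesis
  proof (rule mul_out_ext[where f = "\<lambda>y z. ext_mul_out p i (act (ext M) i y b) j (act (ext N) j z b') g"
      and f' = "\<lambda>y z. ext_mul_out p i y j z (hecke_mu K q i j b b' \<otimes>\<^bsub>HA p\<^esub> g)", OF _ _ _ _ em[of p] _ yz], goal_cases)
    case 1 show ?case by (rule klinear_comp[OF ka mul_out_klinear(1)]) (use b g 1 klinearD(1)[OF kb] in simp_all)
  next
    case 2 show ?case by (rule klinear_comp[OF kb mul_out_klinear(2)]) (use b g 2 klinearD(1)[OF ka] in simp_all)
  next
    case 3 show ?case by (rule mul_out_klinear(1)[OF 3 m])
  next
    case 4 show ?case by (rule mul_out_klinear(2)[OF 4 m])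
  next
    case (5 v h w h')
    then show ?case using b g m HA_mu_closed[OF ij b] HA_mu_closed[OF ij 5(2,4)] HA_mu_mult[OF 5(2) b(1) 5(4) b(2)]
     by (simp add: ext_act[OF M] ext_act[OF N] mul_out ext_mul_pure_def ij H.m_assoc)
  qed
qed

lemma mul_out_act:
  assumes yz: "y \<in> el (ext M) i" "z \<in> el (ext N) j"
    and g: "g \<in> \<H> p" and b: "b \<in> \<H> p"
  shows "ext_mul_out p i y j z (g \<otimes>\<^bsub>HA p\<^esub> b) = act EMN p (ext_mul_out p i y j z g) b"
proof -
  have m: "g \<otimes>\<^bsub>HA p\<^esub> b \<in> \<H> p" using g b by simp
  have ka: "klinear K (FO EMN p) (FO EMN p) (\<lambda>x. act EMN p x b)" using X.B.act_klinear[OF eo(3)] b by simp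
  show ?thesis
    by (rule mul_out_ext[where f = "\<lambda>y z. ext_mul_out p i y j z (g \<otimes>\<^bsub>HA p\<^esub> b)", OF mul_out_klinear(1)[OF _ m] mul_out_klinear(2)[OF _ m]
     klinear_comp[OF mul_out_klinear(1)[OF _ g] ka] klinear_comp[OF mul_out_klinear(2)[OF _ g] ka] em _ yz])
     (use g b m in \<open>simp_all add: mul_out mul_pure_act\<close>)
qed

end

lemma ext_mul_bilin: "X.B.day_bilin (ext M) (ext N) p (FO EMN p) (ext_mul_out p)"
  by (rule X.B.day_bilinI[OF em]; unfold seq_sel)
    (simp_all add: mul_out_klinear(1,2) mul_out_klinear(3)[simplified eta_contract_eq] mul_out_balanced)

text \<open>Identifies the nested lists of the definition with the three-stage construction, so that
  \<open>ext_mul\<close> is an arrow of modules by the universal property of Day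
  convolution.\<close>

lemma ext_mul_eq: "ext_mul K q M N = X.B.day_hom (ext M) (ext N) EMN ext_mul_out"
proof -
  let ?u = "Hilbert_Choice.inv InH :: ('k, 'u) univ \<Rightarrow> 'k hecke_elt"
  let ?T = "\<lambda>p i j g v h. \<lambda>(w, h'). (day_elt K BS M N p [(i, v, j, w, InB \<one>\<^bsub>BA p\<^esub>)],
        InH (hecke_mu K q i j (?u h) (?u h') \<otimes>\<^bsub>HA p\<^esub> ?u g))"
  let ?G = "\<lambda>p i j z g. \<lambda>(v, h). map (?T p i j g v h) (ext_terms z)"
  let ?F = "\<lambda>p. \<lambda>(i, y, j, z, g). concat (map (?G p i j z g) (ext_terms y))"
  have T: "?T p i j (InH g) v (InH h) (w, InH h') \<in> ext_gens K q MN p"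
    if "i + j = p" "v \<in> el M i" "h \<in> \<H> i" "w \<in> el N j" "h' \<in> \<H> j" "g \<in> \<H> p"
    for p i j v h w h' g
    using mul_pure_closed[OF that(1,2,4), of "\<one>\<^bsub>BA p\<^esub>"] X.A.alg.one_closed[of p] that
    by (simp add: ext_gens_iff X.A.pure_def HA_mu_closed[OF that(1,3,5)])
  have G: "set (?G p i j z (InH g) (v, InH h)) \<subseteq> ext_gens K q MN p"
    if "i + j = p" "v \<in> el M i" "h \<in> \<H> i" "z \<in> el (ext N) j" "g \<in> \<H> p"
    for p i j v h z g
  proof -
    have "?T p i j (InH g) v (InH h) t \<in> ext_gens K q MN p" if "t \<in> ext_gens K q N j" for t
     using that T[OF \<open>i + j = p\<close> \<open>v \<in> _\<close> \<open>h \<in> _\<close> _ _ \<open>g \<in> _\<close>] by (elim ext_gensE) simp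
    then show ?thesis using ext_terms_gens[OF N that(4)] by auto
  qed
  have Gs: "set (?G p i j z (InH g) t) \<subseteq> ext_gens K q MN p"
    if "i + j = p" "y \<in> el (ext M) i" "z \<in> el (ext N) j" "g \<in> \<H> p" "t \<in> set (ext_terms y)"
    for p i j y z g t
  proof -
    have "t \<in> ext_gens K q M i" using ext_terms_gens[OF M that(2)] that(5) by blast
    then show ?thesis using G[OF that(1) _ _ that(3,4)] by (elim ext_gensE) simp
  qed
  have "ext_elt K q MN p (concat (map (?F p) (day_terms x))) = X.B.day_map (FO EMN p) (ext_mul_out p) x"
    if x: "x \<in> el (day_obj K HS (ext M) (ext N)) p" for p x
  proof -
    have "set (?F p t) \<subseteq> ext_gens K q MN p" if "t \<in> set (day_terms x)" for t
     using subsetD[OF X.B.day_terms_gens[OF eo(1,2) x] that]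
    proof (elim X.B.day_gensE[OF eo(1,2)])
     fix i y j z g
     assume t: "t = (i, y, j, z, Emb HS g)" and g: "i + j = p" "y \<in> el (ext M) i"
      "z \<in> el (ext N) j" "g \<in> carrier (Alg HS p)"
     show "set (?F p t) \<subseteq> ext_gens K q MN p"
      using Gs[OF g(1-3), of g] g(4) unfolding t by (simp add: UN_subset_iff)
    qed
    then have "ext_elt K q MN p (concat (map (?F p) (day_terms x))) =
      term_sum (FO EMN p) (\<lambda>t. ext_elt K q MN p (?F p t)) (day_terms x)"
     by (rule ext_elt_concat[OF MN])
    also have "\<dots> = X.B.day_map (FO EMN p) (ext_mul_out p) x"
    proof (rule X.B.day_map_cong[OF eo(1,2) x])
     fix i y j z g
     assume g: "i + j = p" "y \<in> el (ext M) i" "z \<in> el (ext N) j" "g \<in> carrier (Alg HS p)"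
     then have g': "g \<in> \<H> p" by simp
     have "ext_elt K q MN p (concat (map (?G p i j z (InH g)) (ext_terms y))) =
       term_sum (FO EMN p) (\<lambda>t. ext_elt K q MN p (?G p i j z (InH g) t)) (ext_terms y)"
      by (rule ext_elt_concat[OF MN Gs[OF g(1-3) g']])
     also have "\<dots> = ext_mul_out p i y j z g"
      unfolding ext_mul_out_def
     proof (rule ext_map_cong[OF M g(2)])
      fix v h assume vh: "v \<in> el M i" "h \<in> \<H> i"
      have "set (map (?T p i j (InH g) v (InH h)) (ext_terms z)) \<subseteq> ext_gens K q MN p"
       using G[OF g(1) vh g(3) g'] by (simp only: prod.case)
      then have "ext_elt K q MN p (map (?T p i j (InH g) v (InH h)) (ext_terms z)) =
        term_sum (FO EMN p) (\<lambda>t. ext_elt K q MN p [?T p i j (InH g) v (InH h) t]) (ext_terms z)"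
       by (intro ext_elt_map[OF MN]) auto
      also have "\<dots> = ext_mul_in p i v h j z g"
       unfolding ext_mul_in_def
       by (rule ext_map_cong[OF N g(3)]) (simp add: ext_mul_pure_def ext_pure_def X.A.pure_def)
      finally show "ext_elt K q MN p (?G p i j z (InH g) (v, InH h)) = ext_mul_in p i v h j z g"
       by (simp only: prod.case)
     qed
     finally show "ext_elt K q MN p (?F p (i, y, j, z, Emb HS g)) = ext_mul_out p i y j z g" by simp
    qed
    finally show ?thesis .
  qed
  then show ?thesis
    unfolding ext_mul_def Let_def X.B.day_hom_def X.B.mk_arr_def
    by (auto simp: fun_eq_iff intro!: X.B.lmap_of_cong)
qed

lemma ext_mul_act:
  assumes "i + j = p" "y \<in> el (ext M) i" "z \<in> el (ext N) j"
    "g \<in> carrier (Alg HS p)" "b \<in> carrier (Alg HS p)"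
  shows "ext_mul_out p i y j z (g \<otimes>\<^bsub>Alg HS p\<^esub> b) = act EMN p (ext_mul_out p i y j z g) b"
  using mul_out_act[OF assms(1-3)] assms(4,5) by simp

lemma ext_mul: "ext_mul K q M N \<in> mor HC (day_obj K HS (ext M) (ext N)) EMN"
  unfolding ext_mul_eq by (rule X.B.day_hom(1)[OF eo(1,2,3) ext_mul_bilin ext_mul_act])

lemma ext_mul_apply:
  assumes "i + j = p" "v \<in> el M i" "h \<in> \<H> i" "w \<in> el N j" "h' \<in> \<H> j" "g \<in> \<H> p"
  shows "ap (ext_mul K q M N) p (X.B.pure (ext M) (ext N) p i (ext_pure M i v h) j (ext_pure N j w h') g) =
    ext_pure MN p (X.A.pure M N p i v j w \<one>\<^bsub>BA p\<^esub>) (hecke_mu K q i j h h' \<otimes>\<^bsub>HA p\<^esub> g)"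
  unfolding ext_mul_eq
  by (subst X.B.day_hom(2)[OF eo(1,2,3) ext_mul_bilin ext_mul_act])
    (use assms in \<open>simp_all add: ext_pure_closed[OF M] ext_pure_closed[OF N] mul_out ext_mul_pure_def\<close>)

end

end

section \<open>The unit of the adjunction as a monoidal transformation\<close>

context hecke_extension
begin

lemma BA_one: "\<one>\<^bsub>BA n\<^esub> \<in> \<B> n"
  using X.A.alg.one_closed[of n] by simp

text \<open>This is the Yoneda arrow of the unit tensor the unit, hence an arrow of modules.\<close>

lemma ext_eps_eq: "ext_eps K q = X.B.yon (ext (rep_obj BS 0)) 0 (ext_pure (rep_obj BS 0) 0 (InB \<one>\<^bsub>BA 0\<^esub>) \<one>\<^bsub>HA 0\<^esub>)"
proof -
  note r = X.A.rep_obj[of 0]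
  have 1: "InB \<one>\<^bsub>BA 0\<^esub> \<in> el (rep_obj BS 0) 0" using X.A.one_rep[of 0] by simp
  have "ext_elt K q (rep_obj BS 0) 0 [(InB \<one>\<^bsub>BA 0\<^esub>, x)] =
     act (ext (rep_obj BS 0)) 0 (ext_pure (rep_obj BS 0) 0 (InB \<one>\<^bsub>BA 0\<^esub>) \<one>\<^bsub>HA 0\<^esub>) (Hilbert_Choice.inv InH x)"
    if x: "x \<in> el (rep_obj HS 0) 0" for x
  proof -
    obtain h where "x = InH h" "h \<in> \<H> 0" using x X.B.FO_rep(1)[of 0 0] by auto
    then show ?thesis by (simp add: ext_act[OF r 1] ext_pure_def[symmetric])
  qed
  then show ?thesis
    unfolding ext_eps_def Let_def X.B.yon_def X.B.mk_arr_def
    by (auto simp: fun_eq_iff intro!: X.B.lmap_of_cong)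
qed

lemma ext_eps: "ext_eps K q \<in> mor HC (rep_obj HS 0) (ext (rep_obj BS 0))"
  unfolding ext_eps_eq
  using X.A.one_rep[of 0] by (intro X.B.yon ext_obj X.A.rep_obj ext_pure_closed) simp_all

lemma ext_unit_nat:
  assumes o: "M \<in> Ob BC" "N \<in> Ob BC" and f: "f \<in> mor BC M N"
  shows "ext_unit N \<bullet>\<^bsub>BC\<^esub> f = X.res_arr (ext_arr K q f) \<bullet>\<^bsub>BC\<^esub> ext_unit M"
proof -
  note u = ext_unit[OF o(1)] ext_unit[OF o(2)] and e = ext_obj[OF o(1)] ext_obj[OF o(2)]
  note r = X.res_arr[OF e ext_arr[OF o f]] and ro = X.res_obj[OF e(1)] X.res_obj[OF e(2)]
  show ?thesis
    by (rule X.A.mor_eqI[OF o(1) X.A.C.comp_mor[OF o ro(2) f u(2)] X.A.C.comp_mor[OF o(1) ro u(1) r]])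
     (simp add: X.A.comp_apply[OF o(1) f] X.A.comp_apply[OF o(1) u(1)] ext_unit_apply[OF o(1)] ext_unit_apply[OF o(2)]
      ext_arr_apply[OF o f] klinearD(1)[OF X.A.mor_klinear[OF o(1) f]])
qed

text \<open>On a pure tensor both sides give the tensor of \<open>v\<close>, \<open>w\<close> and
  the unit, extended by the class of \<open>a\<close>: on the left \<open>a\<close> is moved from
  the algebra slot to the Hecke side by balancing, on the right it arrives there through
  \<open>res_mul\<close>.\<close>

lemma ext_unit_mul:
  assumes o: "M \<in> Ob BC" "N \<in> Ob BC"
  shows "ext_unit (day_obj K BS M N) = X.res_arr (ext_mul K q M N) \<bullet>\<^bsub>BC\<^esub>
    (X.res_mul (ext M) (ext N) \<bullet>\<^bsub>BC\<^esub> day_arr K BS (ext_unit M) (ext_unit N))"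
proof -
  note u = ext_unit[OF o(1)] ext_unit[OF o(2)] and e = ext_obj[OF o(1)] ext_obj[OF o(2)]
  note re = X.res_obj[OF e(1)] X.res_obj[OF e(2)] and D = X.A.day_obj[OF o] and DB = X.B.day_obj[OF e]
  note d = X.A.day_arr[OF o re u] and m = X.res_mul[OF e] and x = X.res_arr[OF DB ext_obj[OF D] ext_mul[OF o]]
  note ob = X.A.day_obj[OF re] X.res_obj[OF DB] X.res_obj[OF ext_obj[OF D]]
  note md = X.A.C.comp_mor[OF D ob(1,2) d m]
  show ?thesis
  proof (rule X.A.day_hom_eqI[OF o ob(3) ext_unit[OF D] X.A.C.comp_mor[OF D ob(2,3) md x]])
    fix p i v j w a
    assume g: "i + j = p" "v \<in> el M i" "w \<in> el N j" "a \<in> carrier (Alg BS p)"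
    then have a: "a \<in> \<B> p" by simp
    note pc = X.A.pure_closed[OF o g]
    have "X.A.pure M N p i v j w a = act (day_obj K BS M N) p (X.A.pure M N p i v j w \<one>\<^bsub>BA p\<^esub>) a"
     using X.A.day_act[OF o g(1-3) _ g(4), of "\<one>\<^bsub>BA p\<^esub>"] X.A.alg.l_one[OF g(4)] BA_one by simp
    then have "ext_pure (day_obj K BS M N) p (X.A.pure M N p i v j w a) \<one>\<^bsub>HA p\<^esub> =
      ext_pure (day_obj K BS M N) p (X.A.pure M N p i v j w \<one>\<^bsub>BA p\<^esub>) (proj p a)"
     using ext_pure_balanced[OF D X.A.pure_closed[OF o g(1-3), of "\<one>\<^bsub>BA p\<^esub>"] a, of "\<one>\<^bsub>HA p\<^esub>"] BA_one HA_closed[OF a]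
     by simp
    then show "ap (ext_unit (day_obj K BS M N)) p (X.A.pure M N p i v j w a) =
     ap (X.res_arr (ext_mul K q M N) \<bullet>\<^bsub>BC\<^esub>
      (X.res_mul (ext M) (ext N) \<bullet>\<^bsub>BC\<^esub> day_arr K BS (ext_unit M) (ext_unit N))) p
     (X.A.pure M N p i v j w a)"
     using g a X.B.mu_one[of i j] HA_closed[OF a]
     by (simp add: X.A.comp_apply[OF D md pc] X.A.comp_apply[OF D d pc] ext_unit_apply[OF D pc] X.A.day_arr_apply[OF o re u]
      ext_unit_apply[OF o(1)] ext_unit_apply[OF o(2)] X.res_mul_apply[OF e] ext_pure_closed[OF o(1)] ext_pure_closed[OF o(2)]
      ext_mul_apply[OF o])
  qed
qed

lemma ext_unit_eps: "ext_unit (rep_obj BS 0) = X.res_arr (ext_eps K q) \<bullet>\<^bsub>BC\<^esub> X.res_eps"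
proof -
  note r = X.A.rep_obj[of 0] and rb = X.B.rep_obj[of 0]
  note e = X.res_arr[OF rb ext_obj[OF r] ext_eps] and ro = X.res_obj[OF rb] X.res_obj[OF ext_obj[OF r]]
  have 1: "InB \<one>\<^bsub>BA 0\<^esub> \<in> el (rep_obj BS 0) 0" using X.A.one_rep[of 0] by simp
  have "ap X.res_eps 0 (InB \<one>\<^bsub>BA 0\<^esub>) = InH \<one>\<^bsub>HA 0\<^esub>"
    using X.res_eps_apply[of "\<one>\<^bsub>BA 0\<^esub>" 0] BA_one by (simp add: HA_simps(2)[symmetric])
  moreover have "ap (ext_eps K q) 0 (InH \<one>\<^bsub>HA 0\<^esub>) = ext_pure (rep_obj BS 0) 0 (InB \<one>\<^bsub>BA 0\<^esub>) \<one>\<^bsub>HA 0\<^esub>"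
    unfolding ext_eps_eq using X.B.yon_apply[of "\<one>\<^bsub>HA 0\<^esub>" 0] ext_act[OF r 1, of "\<one>\<^bsub>HA 0\<^esub>" "\<one>\<^bsub>HA 0\<^esub>"] by simp
  ultimately show ?thesis
    using 1 by (intro X.A.rep_hom_eqI[OF ro(2) ext_unit[OF r] X.A.C.comp_mor[OF r ro X.res_eps e]])
     (simp add: X.A.comp_apply[OF r X.res_eps] ext_unit_apply[OF r])
qed

lemma hecke_quotient_simps:
  "M \<in> Ob BC \<Longrightarrow> FO (hecke_quotient K q) M = ext M"
  "\<lbrakk>M \<in> Ob BC; N \<in> Ob BC; \<alpha> \<in> mor BC M N\<rbrakk> \<Longrightarrow> FA (hecke_quotient K q) \<alpha> = ext_arr K q \<alpha>"
  "Mul (hecke_quotient K q) = ext_mul K q" "Eps (hecke_quotient K q) = ext_eps K q"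
  by (auto simp: hecke_quotient_def Let_def affine_braid_category_def arrowsI)

lemma ker_ideal: "X.ker n = I n"
  using ker_hecke[of n] by (simp add: X.ker_def)

text \<open>A strong monoidal functor that inverts the units of the adjunction between extension and
  restriction of scalars factors through the extension: compose it with the restriction, which is
  only lax monoidal, and note that it also inverts the structure maps of the latter.\<close>

theorem factors_through_hecke_quotient:
  fixes E :: "('k, 'p, 'b) moncat" and F :: "(('k, 'u) braid_mobj, ('k, 'u) braid_marr, 'p, 'b) monfun"
  assumes E: "bifunctor_category K E" and F: "strong_monoidal_functor K BC E F"
    and coc: "cocontinuous TYPE(('k, 'u) univ) BC E F"
    and kill: "\<And>n b. b \<in> I n \<Longrightarrow>
     FA F (rep_arr BS n b) = \<zero>\<^bsub>Hom E (FO F (rep_obj BS n)) (FO F (rep_obj BS n))\<^esub>"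
  shows "strong_monoidal_functor K HC E (comp_monfun HC E F X.res)"
    and "monoidal_natural_iso BC E F (comp_monfun BC E (comp_monfun HC E F X.res) (hecke_quotient K q))
     (\<lambda>M\<in>Ob BC. FA F (ext_unit M))"
proof -
  interpret E: bifunctor_category K E by (rule E)
  interpret F: strong_monoidal_functor K BC E F by (rule F)
  \<comment> \<open>The kernel of the projection is the Hecke ideal, so by \<open>kill\<close> the
    functor inverts every quotient arrow for this kernel: the structure maps of the restriction and
    the units of the adjunction.\<close>
  have inv: "iso_arr E (FO F M) (FO F N) (FA F f)" if "X.A.quotient_arr X.ker M N f" for M N f
    by (rule X.A.quotient_arr_inverted[OF that E.linear_category_axioms F.linear_functor_axioms coc])
     (simp_all add: X.ker_def, use kill ker_ideal X.ker_def in auto)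
  interpret P: inverting_pair K BC HC E X.res F
  proof (intro inverting_pair.intro inverting_pair_axioms.intro X.A.CC_tensor_category X.B.CC_tensor_category E X.res_lax F, goal_cases)
    case (1 M N)
    then show ?case using inv[OF X.res_mul_quotient[OF 1]]
     by (simp add: X.res_simps X.A.CC_simps(8) X.B.CC_simps(8) X.B.day_obj)
  next
    case 2
    then show ?case using inv[OF X.res_eps_quotient]
     by (simp add: X.res_simps X.A.CC_simps(10) X.B.CC_simps(10) X.B.rep_obj)
  qed
  show "strong_monoidal_functor K HC E (comp_monfun HC E F X.res)" by (rule P.comp_strong_monoidal)
  show "monoidal_natural_iso BC E F (comp_monfun BC E (comp_monfun HC E F X.res) (hecke_quotient K q))
     (\<lambda>M\<in>Ob BC. FA F (ext_unit M))"
  proof (rule P.comp_monoidal_natural_iso, goal_cases)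
    case 1 then show ?case by (simp add: hecke_quotient_simps ext_obj)
  next
    case 2 then show ?case by (simp add: hecke_quotient_simps ext_arr)
  next
    case (3 M N) then show ?case
     by (simp add: hecke_quotient_simps X.A.CC_simps(8) X.B.CC_simps(8) X.A.day_obj ext_mul)
  next
    case 4 show ?case using ext_eps
     by (simp add: hecke_quotient_simps X.A.CC_simps(10) X.B.CC_simps(10) X.A.rep_obj)
  next
    case 5 then show ?case by (simp add: hecke_quotient_simps X.res_simps ext_obj ext_unit)
  next
    case 6 then show ?case
     by (simp add: hecke_quotient_simps ext_unit_nat X.res_simps(2)[OF ext_obj ext_obj ext_arr])
  next
    case 7 then show ?case using inv[OF ext_unit_quotient[OF 7]] by (simp add: hecke_quotient_simps X.res_simps ext_obj)
  next
    case (8 M N)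
    note e = ext_obj[OF 8(1)] ext_obj[OF 8(2)]
    show ?case using 8
     by (simp add: hecke_quotient_simps X.A.CC_simps(8,9) X.res_simps(3)
      X.res_simps(2)[OF X.B.day_obj[OF e] ext_obj[OF X.A.day_obj[OF 8]] ext_mul[OF 8]] ext_unit_mul[OF 8])
  next
    case 9
    show ?case using ext_unit_eps
     by (simp add: hecke_quotient_simps X.A.CC_simps(10) X.res_simps(4)
      X.res_simps(2)[OF X.B.rep_obj ext_obj[OF X.A.rep_obj] ext_eps])
  qed
qed

end

section \<open>The Hecke relation\<close>

context linear_category
begin

text \<open>The Hecke polynomial when \<open>r\<close> is -q and \<open>s\<close> is the inverse of
  q. Written with sums and multiples only, it can be pushed through linear functors and tensor
  products.\<close>

definition quad :: "'o \<Rightarrow> 'k \<Rightarrow> 'k \<Rightarrow> 'a \<Rightarrow> 'a" where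
  "quad a r s f = (f \<oplus>\<^bsub>Hom C a a\<^esub> r \<odot>\<^bsub>Hom C a a\<^esub> Id C a) \<bullet>\<^bsub>C\<^esub> (f \<oplus>\<^bsub>Hom C a a\<^esub> s \<odot>\<^bsub>Hom C a a\<^esub> Id C a)"

lemma quad_minus:
  assumes "a \<in> Ob C" "r \<in> carrier K"
  shows "(f \<ominus>\<^bsub>Hom C a a\<^esub> r \<odot>\<^bsub>Hom C a a\<^esub> Id C a) \<bullet>\<^bsub>C\<^esub> (f \<oplus>\<^bsub>Hom C a a\<^esub> s \<odot>\<^bsub>Hom C a a\<^esub> Id C a) = quad a (\<ominus>\<^bsub>K\<^esub> r) s f"
proof -
  interpret M: module K "Hom C a a" using assms by (simp add: hom_space)
  show ?thesis using assms id_mor by (simp add: quad_def a_minus_def M.smult_l_minus)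
qed

lemma shift_intertwine:
  assumes o: "a \<in> Ob C" "b \<in> Ob C" and m: "f \<in> mor C a a" "g \<in> mor C b b" "h \<in> mor C a b" "r \<in> carrier K"
    and eq: "g \<bullet>\<^bsub>C\<^esub> h = h \<bullet>\<^bsub>C\<^esub> f"
  shows "(g \<oplus>\<^bsub>Hom C b b\<^esub> r \<odot>\<^bsub>Hom C b b\<^esub> Id C b) \<bullet>\<^bsub>C\<^esub> h = h \<bullet>\<^bsub>C\<^esub> (f \<oplus>\<^bsub>Hom C a a\<^esub> r \<odot>\<^bsub>Hom C a a\<^esub> Id C a)"
  using o m eq by (simp add: comp_add_left[of a b b] comp_add_right[of a a b] comp_smult_left[of a b b]
    comp_smult_right[of a a b] hom_smult id_mor id_left[of a b] id_right[of a b])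

text \<open>An isomorphism intertwining \<open>f\<close> and \<open>g\<close> also intertwines their
  shifts by scalars, hence the two polynomials, and it can be cancelled. This carries the Hecke
  relation along the associators to \<open>or_c\<close> and from there to the generator of the braid
  group algebra on two strands.\<close>

lemma quad_intertwine:
  assumes o: "a \<in> Ob C" "b \<in> Ob C" and m: "f \<in> mor C a a" "g \<in> mor C b b" "iso_arr C a b h"
    and rs: "r \<in> carrier K" "s \<in> carrier K"
    and eq: "g \<bullet>\<^bsub>C\<^esub> h = h \<bullet>\<^bsub>C\<^esub> f" and z: "quad a r s f = \<zero>\<^bsub>Hom C a a\<^esub>"
  shows "quad b r s g = \<zero>\<^bsub>Hom C b b\<^esub>"
proof -
  have h: "h \<in> mor C a b" using m(3) by (auto simp: iso_arr_def)
  let ?f = "\<lambda>r. f \<oplus>\<^bsub>Hom C a a\<^esub> r \<odot>\<^bsub>Hom C a a\<^esub> Id C a" and ?g = "\<lambda>r. g \<oplus>\<^bsub>Hom C b b\<^esub> r \<odot>\<^bsub>Hom C b b\<^esub> Id C b"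
  have f: "?f r \<in> mor C a a" and g: "?g r \<in> mor C b b" if "r \<in> carrier K" for r
    using that o m by (simp_all add: hom_add hom_smult id_mor)
  note i = shift_intertwine[OF o m(1,2) h _ eq]
  have "quad b r s g \<bullet>\<^bsub>C\<^esub> h = ?g r \<bullet>\<^bsub>C\<^esub> (h \<bullet>\<^bsub>C\<^esub> ?f s)"
    unfolding quad_def i[OF rs(2), symmetric] by (rule comp_assoc[OF o(1,2,2,2) h g[OF rs(2)] g[OF rs(1)]])
  also have "\<dots> = (?g r \<bullet>\<^bsub>C\<^esub> h) \<bullet>\<^bsub>C\<^esub> ?f s"
    by (rule comp_assoc[OF o(1,1,2,2) f[OF rs(2)] h g[OF rs(1)], symmetric])
  also have "\<dots> = h \<bullet>\<^bsub>C\<^esub> quad a r s f"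
    unfolding quad_def i[OF rs(1)] by (rule comp_assoc[OF o(1,1,1,2) f[OF rs(2)] f[OF rs(1)] h])
  also have "\<dots> = \<zero>\<^bsub>Hom C b b\<^esub> \<bullet>\<^bsub>C\<^esub> h"
    using comp_zero_right[OF o(1,1,2) h] comp_zero_left[OF o(1,2,2) h] z by simp
  finally show ?thesis
    using iso_epi[OF o(1,2,2) m(3) comp_mor[OF o(2,2,2) g[OF rs(2)] g[OF rs(1)], folded quad_def] hom_zero[OF o(2,2)]]
    by simp
qed

end

lemma linear_functor_quad:
  assumes A: "linear_category K A" and B: "linear_category K B" and F: "linear_functor K A B F"
    and a: "a \<in> Ob A" and f: "f \<in> mor A a a" and rs: "r \<in> carrier K" "s \<in> carrier K"
  shows "FA F (linear_category.quad A a r s f) = linear_category.quad B (FO F a) r s (FA F f)"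
proof -
  interpret A: linear_category K A by fact
  interpret B: linear_category K B by fact
  interpret F: linear_functor K A B F by fact
  have sh: "f \<oplus>\<^bsub>Hom A a a\<^esub> r \<odot>\<^bsub>Hom A a a\<^esub> Id A a \<in> mor A a a"
    "FA F (f \<oplus>\<^bsub>Hom A a a\<^esub> r \<odot>\<^bsub>Hom A a a\<^esub> Id A a) =
     FA F f \<oplus>\<^bsub>Hom B (FO F a) (FO F a)\<^esub> r \<odot>\<^bsub>Hom B (FO F a) (FO F a)\<^esub> Id B (FO F a)" if "r \<in> carrier K" for r
    using that a f by (simp_all add: A.hom_add A.hom_smult A.id_mor F.add F.smult F.ident)
  show ?thesis
    unfolding A.quad_def B.quad_def by (simp add: F.comp[OF a a a sh(1) sh(1)] rs sh(2))
qed

lemma (in monoidal_category) quad_tensor: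
  assumes o: "x \<in> Ob C" "a \<in> Ob C" and f: "f \<in> mor C a a" and rs: "r \<in> carrier K" "s \<in> carrier K"
  shows "quad (x \<boxtimes>\<^bsub>C\<^esub> a) r s (Id C x \<boxdot>\<^bsub>C\<^esub> f) = Id C x \<boxdot>\<^bsub>C\<^esub> quad a r s f"
proof -
  have sh: "f \<oplus>\<^bsub>Hom C a a\<^esub> r \<odot>\<^bsub>Hom C a a\<^esub> Id C a \<in> mor C a a"
    "Id C x \<boxdot>\<^bsub>C\<^esub> (f \<oplus>\<^bsub>Hom C a a\<^esub> r \<odot>\<^bsub>Hom C a a\<^esub> Id C a) =
     Id C x \<boxdot>\<^bsub>C\<^esub> f \<oplus>\<^bsub>Hom C (x \<boxtimes>\<^bsub>C\<^esub> a) (x \<boxtimes>\<^bsub>C\<^esub> a)\<^esub> r \<odot>\<^bsub>Hom C (x \<boxtimes>\<^bsub>C\<^esub> a) (x \<boxtimes>\<^bsub>C\<^esub> a)\<^esub> Id C (x \<boxtimes>\<^bsub>C\<^esub> a)"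
    if "r \<in> carrier K" for r
    using that o f by (simp_all add: hom_add hom_smult id_mor tensor_add_right[of x a x a] tensor_smult_right[of x a x a] tensor_id)
  show ?thesis
    using tensor_comp[OF o o o id_mor[OF o(1)] sh(1)[OF rs(2)] id_mor[OF o(1)] sh(1)[OF rs(1)]] o
    by (simp add: quad_def sh(2) rs id_left id_mor)
qed

section \<open>The endofunctor of a braided object\<close>

context braided_category
begin

context
  fixes X assumes X: "X \<in> Ob C"
begin

lemma or_O_simps:
  "a \<in> Ob C \<Longrightarrow> FO (or_O C X) a = a \<boxtimes>\<^bsub>C\<^esub> X"
  "\<lbrakk>a \<in> Ob C; b \<in> Ob C; f \<in> mor C a b\<rbrakk> \<Longrightarrow> FA (or_O C X) f = f \<boxdot>\<^bsub>C\<^esub> Id C X"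
  by (auto simp: or_O_def arrowsI)

lemma or_O: "linear_functor K C C (or_O C X)"
proof (rule linear_functor.intro, goal_cases)
  case 1 show ?case using X by (auto simp: or_O_def tensor_obj)
next
  case 2 show ?case by (simp add: or_O_def)
next
  case (3 a b f) then show ?case using X by (simp add: or_O_simps tensor_arr id_mor)
next
  case (4 a) then show ?case using X by (simp add: or_O_simps id_mor tensor_id)
next
  case (5 a b c f g)
  then show ?case
    using tensor_comp[OF 5(1) X 5(2) X 5(3) X 5(4) id_mor[OF X] 5(5) id_mor[OF X]] X
    by (simp add: or_O_simps(2)[of a b] or_O_simps(2)[of b c] or_O_simps(2)[of a c] comp_mor[OF 5] id_left id_mor)
next
  case (6 a b f g)
  then show ?case using X by (simp add: or_O_simps(1) or_O_simps(2)[of a b] hom_add tensor_add_left id_mor)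
next
  case (7 a b f r)
  then show ?case using X by (simp add: or_O_simps(1) or_O_simps(2)[of a b] hom_smult tensor_smult_left id_mor)
qed

abbreviation (input) "O2 \<equiv> comp_functor C (or_O C X) (or_O C X)"

lemma O2: "linear_functor K C C O2"
  by (rule linear_functor_comp[OF linear_category_axioms or_O or_O])

lemma O2_simps:
  "a \<in> Ob C \<Longrightarrow> FO O2 a = (a \<boxtimes>\<^bsub>C\<^esub> X) \<boxtimes>\<^bsub>C\<^esub> X"
  "\<lbrakk>a \<in> Ob C; b \<in> Ob C; f \<in> mor C a b\<rbrakk> \<Longrightarrow> FA O2 f = (f \<boxdot>\<^bsub>C\<^esub> Id C X) \<boxdot>\<^bsub>C\<^esub> Id C X"
  using X by (simp_all add: comp_functor_apply or_O_simps tensor_obj tensor_arr id_mor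
    or_O_simps(2)[of "a \<boxtimes>\<^bsub>C\<^esub> X" "b \<boxtimes>\<^bsub>C\<^esub> X"])

text \<open>The last equation describes the component of \<open>or_c\<close> without the inverse of
  the associator; naturality is derived from it below by cancelling the associator.\<close>

lemma or_c_at:
  assumes a: "a \<in> Ob C"
  shows "At (or_c C X) a \<in> mor C ((a \<boxtimes>\<^bsub>C\<^esub> X) \<boxtimes>\<^bsub>C\<^esub> X) ((a \<boxtimes>\<^bsub>C\<^esub> X) \<boxtimes>\<^bsub>C\<^esub> X)"
    and "Id C a \<boxdot>\<^bsub>C\<^esub> Braid C X X \<in> mor C (a \<boxtimes>\<^bsub>C\<^esub> (X \<boxtimes>\<^bsub>C\<^esub> X)) (a \<boxtimes>\<^bsub>C\<^esub> (X \<boxtimes>\<^bsub>C\<^esub> X))"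
    and "Assoc C a X X \<bullet>\<^bsub>C\<^esub> At (or_c C X) a = (Id C a \<boxdot>\<^bsub>C\<^esub> Braid C X X) \<bullet>\<^bsub>C\<^esub> Assoc C a X X"
proof -
  let ?l = "(a \<boxtimes>\<^bsub>C\<^esub> X) \<boxtimes>\<^bsub>C\<^esub> X" and ?r = "a \<boxtimes>\<^bsub>C\<^esub> (X \<boxtimes>\<^bsub>C\<^esub> X)" and ?b = "Id C a \<boxdot>\<^bsub>C\<^esub> Braid C X X"
  have o: "?l \<in> Ob C" "?r \<in> Ob C" using a X by (simp_all add: tensor_obj)
  note i = assoc_iso[OF a X X] and v = inv_arr[OF o assoc_iso[OF a X X]]
  have \<alpha>: "Assoc C a X X \<in> mor C ?l ?r" using i by (simp add: iso_arr_def)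
  show b: "?b \<in> mor C ?r ?r"
    using a X braid_iso[OF X X] by (intro tensor_arr) (simp_all add: id_mor tensor_obj iso_arr_def)
  note b\<alpha> = comp_mor[OF o(1,2,2) \<alpha> b]
  show "At (or_c C X) a \<in> mor C ?l ?l"
    using a comp_mor[OF o(1,2,1) b\<alpha> v(1)] by (simp add: or_c_def)
  show "Assoc C a X X \<bullet>\<^bsub>C\<^esub> At (or_c C X) a = ?b \<bullet>\<^bsub>C\<^esub> Assoc C a X X"
    using a comp_assoc[OF o(1,2,1,2) b\<alpha> v(1) \<alpha>] v(3) id_left[OF o b\<alpha>] by (simp add: or_c_def)
qed

lemma or_c: "or_c C X \<in> mor End O2 O2"
proof -
  have "natural C C O2 O2 (At (or_c C X))"
  proof (rule naturalI)
    show "At (or_c C X) \<in> extensional (Ob C)" by (simp add: or_c_def)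
  next
    fix a assume "a \<in> Ob C"
    then show "At (or_c C X) a \<in> mor C (FO O2 a) (FO O2 a)" by (simp add: O2_simps or_c_at)
  next
    fix a b f assume f: "a \<in> Ob C" "b \<in> Ob C" "f \<in> mor C a b"
    let ?l = "\<lambda>a. (a \<boxtimes>\<^bsub>C\<^esub> X) \<boxtimes>\<^bsub>C\<^esub> X" and ?r = "\<lambda>a. a \<boxtimes>\<^bsub>C\<^esub> (X \<boxtimes>\<^bsub>C\<^esub> X)"
    let ?F = "(f \<boxdot>\<^bsub>C\<^esub> Id C X) \<boxdot>\<^bsub>C\<^esub> Id C X" and ?G = "f \<boxdot>\<^bsub>C\<^esub> Id C (X \<boxtimes>\<^bsub>C\<^esub> X)"
    let ?c = "At (or_c C X)" and ?\<beta> = "\<lambda>a. Id C a \<boxdot>\<^bsub>C\<^esub> Braid C X X" and ?\<alpha> = "\<lambda>a. Assoc C a X X"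
    have o: "?l a \<in> Ob C" "?l b \<in> Ob C" "?r a \<in> Ob C" "?r b \<in> Ob C" and XX: "X \<boxtimes>\<^bsub>C\<^esub> X \<in> Ob C"
     using f X by (simp_all add: tensor_obj)
    have \<alpha>: "?\<alpha> a \<in> mor C (?l a) (?r a)" "?\<alpha> b \<in> mor C (?l b) (?r b)"
     using assoc_iso[OF f(1) X X] assoc_iso[OF f(2) X X] by (simp_all add: iso_arr_def)
    have F: "?F \<in> mor C (?l a) (?l b)" and G: "?G \<in> mor C (?r a) (?r b)"
     using f X by (auto intro!: tensor_arr id_mor tensor_obj)
    note c = or_c_at[OF f(1)] and d = or_c_at[OF f(2)]
    have \<beta>: "Braid C X X \<in> mor C (X \<boxtimes>\<^bsub>C\<^esub> X) (X \<boxtimes>\<^bsub>C\<^esub> X)" using braid_iso[OF X X] by (simp add: iso_arr_def)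
    have nat: "?\<alpha> b \<bullet>\<^bsub>C\<^esub> ?F = ?G \<bullet>\<^bsub>C\<^esub> ?\<alpha> a"
     using assoc_nat[OF f(1) X X f(2) X X f(3) id_mor[OF X] id_mor[OF X]] X by (simp add: tensor_id)
    \<comment> \<open>Interchange law: \<open>f\<close> acts on the first tensor factor and the
      braiding on the other.\<close>
    have G\<beta>: "?\<beta> b \<bullet>\<^bsub>C\<^esub> ?G = ?G \<bullet>\<^bsub>C\<^esub> ?\<beta> a"
     using tensor_comp[OF f(1) XX f(2) XX f(2) XX f(3) id_mor[OF XX] id_mor[OF f(2)] \<beta>]
      tensor_comp[OF f(1) XX f(1) XX f(2) XX id_mor[OF f(1)] \<beta> f(3) id_mor[OF XX]] f XX \<beta>
     by (simp add: id_left[of a b] id_right[of a b] id_left[OF XX XX] id_right[OF XX XX])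
    have "?\<alpha> b \<bullet>\<^bsub>C\<^esub> (?c b \<bullet>\<^bsub>C\<^esub> ?F) = ?\<beta> b \<bullet>\<^bsub>C\<^esub> (?\<alpha> b \<bullet>\<^bsub>C\<^esub> ?F)"
     using comp_assoc[OF o(1,2,2,4) F d(1) \<alpha>(2)] comp_assoc[OF o(1,2,4,4) F \<alpha>(2) d(2)] d(3) by simp
    also have "\<dots> = ?G \<bullet>\<^bsub>C\<^esub> (?\<beta> a \<bullet>\<^bsub>C\<^esub> ?\<alpha> a)"
     unfolding nat using comp_assoc[OF o(1,3,4,4) \<alpha>(1) G d(2)] comp_assoc[OF o(1,3,3,4) \<alpha>(1) c(2) G] G\<beta> by simp
    also have "\<dots> = ?\<alpha> b \<bullet>\<^bsub>C\<^esub> (?F \<bullet>\<^bsub>C\<^esub> ?c a)"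
     using comp_assoc[OF o(1,1,3,4) c(1) \<alpha>(1) G] comp_assoc[OF o(1,1,2,4) c(1) F \<alpha>(2)] nat c(3) by simp
    finally have e: "?\<alpha> b \<bullet>\<^bsub>C\<^esub> (?c b \<bullet>\<^bsub>C\<^esub> ?F) = ?\<alpha> b \<bullet>\<^bsub>C\<^esub> (?F \<bullet>\<^bsub>C\<^esub> ?c a)" .
    note v = inv_arr[OF o(2,4) assoc_iso[OF f(2) X X]]
    have cancel: "h = inv_arr C (?l b) (?r b) (?\<alpha> b) \<bullet>\<^bsub>C\<^esub> (?\<alpha> b \<bullet>\<^bsub>C\<^esub> h)" if "h \<in> mor C (?l a) (?l b)" for h
     using comp_assoc[OF o(1,2,4,2) that \<alpha>(2) v(1)] v(2) id_left[OF o(1,2) that] by simp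
    have "?c b \<bullet>\<^bsub>C\<^esub> ?F = ?F \<bullet>\<^bsub>C\<^esub> ?c a"
     using cancel[OF comp_mor[OF o(1,2,2) F d(1)]] cancel[OF comp_mor[OF o(1,1,2) c(1) F]] e by simp
    then show "?c b \<bullet>\<^bsub>C\<^esub> FA O2 f = FA O2 f \<bullet>\<^bsub>C\<^esub> ?c a" using f by (simp add: O2_simps(2)[OF f])
  qed
  then show ?thesis by (simp add: endofunctor_category_simps or_c_def)
qed

text \<open>The relation is checked at each object \<open>a\<close>: the component of
  \<open>or_c\<close> is conjugate, by the associator, to the identity of \<open>a\<close> tensor
  the braiding, and \<open>quad\<close> of the latter is the identity tensor zero.\<close>

lemma or_c_quad:
  assumes h: "quad (X \<boxtimes>\<^bsub>C\<^esub> X) r s (Braid C X X) = \<zero>\<^bsub>Hom C (X \<boxtimes>\<^bsub>C\<^esub> X) (X \<boxtimes>\<^bsub>C\<^esub> X)\<^esub>" and rs: "r \<in> carrier K" "s \<in> carrier K"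
  shows "linear_category.quad End O2 r s (or_c C X) = \<zero>\<^bsub>Hom End O2 O2\<^esub>"
proof -
  interpret E: linear_category K End by (rule endofunctor_category_linear)
  have o2: "O2 \<in> Ob End" using O2 by (simp add: endofunctor_category_simps)
  have sh: "or_c C X \<oplus>\<^bsub>Hom End O2 O2\<^esub> r \<odot>\<^bsub>Hom End O2 O2\<^esub> Id End O2 \<in> mor End O2 O2" if "r \<in> carrier K" for r
    using that o2 or_c by (intro E.hom_add E.hom_smult E.id_mor)
  show ?thesis
  proof (rule End_eqI[OF _ E.hom_zero[OF o2 o2]])
    show "E.quad O2 r s (or_c C X) \<in> mor End O2 O2" unfolding E.quad_def by (rule E.comp_mor[OF o2 o2 o2 sh sh]) (rule rs)+
  next
    fix a assume a: "a \<in> Ob C"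
    let ?l = "(a \<boxtimes>\<^bsub>C\<^esub> X) \<boxtimes>\<^bsub>C\<^esub> X" and ?r = "a \<boxtimes>\<^bsub>C\<^esub> (X \<boxtimes>\<^bsub>C\<^esub> X)"
    have o: "?l \<in> Ob C" "?r \<in> Ob C" and XX: "X \<boxtimes>\<^bsub>C\<^esub> X \<in> Ob C" using a X by (simp_all add: tensor_obj)
    have \<beta>: "Braid C X X \<in> mor C (X \<boxtimes>\<^bsub>C\<^esub> X) (X \<boxtimes>\<^bsub>C\<^esub> X)" using braid_iso[OF X X] by (simp add: iso_arr_def)
    note c = or_c_at[OF a] and v = inv_arr[OF o assoc_iso[OF a X X]]
    let ?i = "inv_arr C ?l ?r (Assoc C a X X)"
    have \<alpha>: "Assoc C a X X \<in> mor C ?l ?r" using assoc_iso[OF a X X] by (simp add: iso_arr_def)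
    have i: "iso_arr C ?r ?l ?i" unfolding iso_arr_def using v \<alpha> by blast
    have "?i \<bullet>\<^bsub>C\<^esub> (Id C a \<boxdot>\<^bsub>C\<^esub> Braid C X X) = (?i \<bullet>\<^bsub>C\<^esub> ((Id C a \<boxdot>\<^bsub>C\<^esub> Braid C X X) \<bullet>\<^bsub>C\<^esub> Assoc C a X X)) \<bullet>\<^bsub>C\<^esub> ?i"
     using comp_assoc[OF o(2,1,2,1) v(1) comp_mor[OF o(1,2,2) \<alpha> c(2)] v(1)] comp_assoc[OF o(2,1,2,2) v(1) \<alpha> c(2)]
      v(3) id_right[OF o(2,2) c(2)] by simp
    then have eq: "At (or_c C X) a \<bullet>\<^bsub>C\<^esub> ?i = ?i \<bullet>\<^bsub>C\<^esub> (Id C a \<boxdot>\<^bsub>C\<^esub> Braid C X X)"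
     using a by (simp add: or_c_def)
    have "quad ?r r s (Id C a \<boxdot>\<^bsub>C\<^esub> Braid C X X) = \<zero>\<^bsub>Hom C ?r ?r\<^esub>"
     using quad_tensor[OF a XX \<beta> rs] h tensor_zero_right[OF a XX a XX id_mor[OF a]] by simp
    from quad_intertwine[OF o(2,1) c(2,1) i rs eq this]
    show "At (E.quad O2 r s (or_c C X)) a = At \<zero>\<^bsub>Hom End O2 O2\<^esub> a"
     using a by (simp add: E.quad_def quad_def O2_simps(1))
  qed
qed

end

end

section \<open>Products of representable modules\<close>

context algebra_sequence
begin

context
  fixes m n :: nat
begin

abbreviation (input) "R \<equiv> rep_obj A"
abbreviation (input) "D \<equiv> day (R m) (R n)"

lemma one_one: "pure (R m) (R n) (m + n) m (Emb A (\<e> m)) n (Emb A (\<e> n)) (\<e> (m + n)) \<in> el D (m + n)"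
  by (rule pure_closed[OF rep_obj rep_obj HOL.refl one_rep one_rep]) simp

text \<open>The Yoneda embedding is strong monoidal for Day convolution. This is its structure map,
  the Yoneda arrow of the tensor product of the units; \<open>rep_split\<close> is its
  inverse.\<close>

definition rep_mul where
  "rep_mul = yon D (m + n) (pure (R m) (R n) (m + n) m (Emb A (\<e> m)) n (Emb A (\<e> n)) (\<e> (m + n)))"

lemma rep_mul: "rep_mul \<in> mor CC (R (m + n)) D"
  unfolding rep_mul_def by (rule yon[OF day_obj[OF rep_obj rep_obj] one_one])

lemma rep_mul_apply: "a \<in> \<A> (m + n) \<Longrightarrow>
    ap rep_mul (m + n) (Emb A a) = pure (R m) (R n) (m + n) m (Emb A (\<e> m)) n (Emb A (\<e> n)) a"
  unfolding rep_mul_def using day_act[OF rep_obj rep_obj HOL.refl one_rep one_rep alg.one_closed, of a m n]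
  by (simp add: yon_apply)

definition rep_split where
  "rep_split = day_hom (R m) (R n) (R (m + n)) (\<lambda>p i x j y c. Emb A (Mu A i j (Unemb A x) (Unemb A y) \<otimes>\<^bsub>Alg A p\<^esub> c))"

lemma repE: assumes "x \<in> el (R n') i"
  obtains a where "x = Emb A a" "a \<in> \<A> i" "i = n' \<or> a = (\<o> i)"
  using assms by (auto simp: FO_rep)

lemma mu_zero: "\<lbrakk>i + j = p; b \<in> \<A> j\<rbrakk> \<Longrightarrow> Mu A i j (\<o> i) b = (\<o> p)"
  "\<lbrakk>i + j = p; a \<in> \<A> i\<rbrakk> \<Longrightarrow> Mu A i j a (\<o> j) = (\<o> p)"
  using klinear_zero[OF alg_module alg_module mu_klinear(1)] klinear_zero[OF alg_module alg_module mu_klinear(2)] by simp_all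

text \<open>If \<open>p\<close> differs from \<open>m + n\<close>, then one of \<open>a\<close> and
  \<open>b\<close> lies outside its degree and is zero.\<close>

lemma rep_split_closed:
  assumes "i + j = p" "a \<in> \<A> i" "i = m \<or> a = (\<o> i)" "b \<in> \<A> j" "j = n \<or> b = (\<o> j)" "c \<in> \<A> p"
  shows "Mu A i j a b \<otimes>\<^bsub>Alg A p\<^esub> c \<in> \<A> p \<and> (p = m + n \<or> Mu A i j a b \<otimes>\<^bsub>Alg A p\<^esub> c = (\<o> p))"
  using assms mu_closed'[OF assms(1,2,4)] mu_zero[OF assms(1)] by auto

lemma rep_klinearI:
  assumes "klinear K (Alg A i) (Alg A p) f" "\<And>a. \<lbrakk>a \<in> \<A> i; i = n' \<or> a = (\<o> i)\<rbrakk> \<Longrightarrow> p = k \<or> f a = (\<o> p)"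
  shows "klinear K (FO (R n') i) (FO (R k) p) (\<lambda>x. Emb A (f (Unemb A x)))"
proof (rule klinearI)
  fix x assume "x \<in> el (R n') i"
  then show "Emb A (f (Unemb A x)) \<in> el (R k) p"
    by (elim repE) (simp add: Emb_rep assms(2) klinearD(1)[OF assms(1)])
next
  fix x y assume "x \<in> el (R n') i" "y \<in> el (R n') i"
  then show "Emb A (f (Unemb A (x \<oplus>\<^bsub>FO (R n') i\<^esub> y))) = Emb A (f (Unemb A x)) \<oplus>\<^bsub>FO (R k) p\<^esub> Emb A (f (Unemb A y))"
    by (elim repE) (simp add: FO_rep(3) klinearD(2)[OF assms(1)])
next
  fix r x assume "r \<in> carrier K" "x \<in> el (R n') i"
  then show "Emb A (f (Unemb A (r \<odot>\<^bsub>FO (R n') i\<^esub> x))) = r \<odot>\<^bsub>FO (R k) p\<^esub> Emb A (f (Unemb A x))"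
    by (elim repE) (simp add: FO_rep(4) klinearD(3)[OF assms(1)])
qed

lemma rep_split_bilin: "day_bilin (R m) (R n) p (FO (R (m + n)) p) (\<lambda>i x j y c. Emb A (Mu A i j (Unemb A x) (Unemb A y) \<otimes>\<^bsub>Alg A p\<^esub> c))"
proof (rule day_bilinI[OF rep_module], goal_cases)
  case (1 i j y c)
  then obtain b where y: "y = Emb A b" "b \<in> \<A> j" "j = n \<or> b = (\<o> j)" by (elim repE)
  show ?case unfolding y(1) Unemb_Emb
    by (rule rep_klinearI[OF klinear_comp[OF mu_klinear(1)[OF 1(1) y(2)] mult_klinear(1)[OF 1(3)]]])
     (rule rep_split_closed[OF 1(1) _ _ y(2,3) 1(3), THEN conjunct2])
next
  case (2 i j x c)
  then obtain a where x: "x = Emb A a" "a \<in> \<A> i" "i = m \<or> a = (\<o> i)" by (elim repE)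
  show ?case unfolding x(1) Unemb_Emb
    by (rule rep_klinearI[OF klinear_comp[OF mu_klinear(2)[OF 2(1) x(2)] mult_klinear(1)[OF 2(3)]]])
     (rule rep_split_closed[OF 2(1) x(2,3) _ _ 2(3), THEN conjunct2])
next
  case (3 i j x y)
  then obtain a b where x: "x = Emb A a" "a \<in> \<A> i" "i = m \<or> a = (\<o> i)"
    and y: "y = Emb A b" "b \<in> \<A> j" "j = n \<or> b = (\<o> j)" by (elim repE)
  note l = mult_klinear(2)[OF mu_closed'[OF 3(1) x(2) y(2)]]
  show ?case unfolding x(1) y(1) Unemb_Emb
  proof (rule klinearI)
    fix c assume "c \<in> \<A> p"
    then show "Emb A (Mu A i j a b \<otimes>\<^bsub>Alg A p\<^esub> c) \<in> el (R (m + n)) p"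
     unfolding Emb_rep by (rule rep_split_closed[OF 3(1) x(2,3) y(2,3)])
  qed (simp_all add: FO_rep(3,4) klinearD(2,3)[OF l])
next
  case (4 i j x y c b b')
  then obtain a a' where x: "x = Emb A a" "a \<in> \<A> i" "i = m \<or> a = (\<o> i)"
    and y: "y = Emb A a'" "a' \<in> \<A> j" "j = n \<or> a' = (\<o> j)" by (elim repE)
  then show ?case
    using alg.m_assoc[OF mu_closed'[OF 4(1) x(2) y(2)] mu_closed'[OF 4(1,5,6)] 4(4)]
    unfolding x(1) y(1) rep_act_Emb[OF x(2,3) 4(5)] rep_act_Emb[OF y(2,3) 4(6)] Unemb_Emb
     mu_mult[OF x(2) 4(5) y(2) 4(6)] \<open>i + j = p\<close> by simp
qed

lemma rep_split_act:
  assumes "i + j = p" "x \<in> el (R m) i" "y \<in> el (R n) j" "c \<in> \<A> p" "d \<in> \<A> p"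
  shows "Emb A (Mu A i j (Unemb A x) (Unemb A y) \<otimes>\<^bsub>Alg A p\<^esub> (c \<otimes>\<^bsub>Alg A p\<^esub> d)) =
    act (R (m + n)) p (Emb A (Mu A i j (Unemb A x) (Unemb A y) \<otimes>\<^bsub>Alg A p\<^esub> c)) d"
proof -
  from assms(2,3) obtain a b where x: "x = Emb A a" "a \<in> \<A> i" "i = m \<or> a = (\<o> i)"
    and y: "y = Emb A b" "b \<in> \<A> j" "j = n \<or> b = (\<o> j)" by (elim repE)
  show ?thesis
    using rep_act_Emb[OF rep_split_closed[OF assms(1) x(2,3) y(2,3) assms(4), THEN conjunct1]
      rep_split_closed[OF assms(1) x(2,3) y(2,3) assms(4), THEN conjunct2] assms(5)]
     alg.m_assoc[OF mu_closed'[OF assms(1) x(2) y(2)] assms(4,5)]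
    unfolding x(1) y(1) Unemb_Emb by simp
qed

lemma rep_split: "rep_split \<in> mor CC D (R (m + n))"
  unfolding rep_split_def by (rule day_hom(1)[OF rep_obj rep_obj rep_obj rep_split_bilin rep_split_act])

lemma rep_split_apply:
  "\<lbrakk>i + j = p; x \<in> el (R m) i; y \<in> el (R n) j; c \<in> \<A> p\<rbrakk> \<Longrightarrow>
    ap rep_split p (pure (R m) (R n) p i x j y c) = Emb A (Mu A i j (Unemb A x) (Unemb A y) \<otimes>\<^bsub>Alg A p\<^esub> c)"
  unfolding rep_split_def by (rule day_hom(2)[OF rep_obj rep_obj rep_obj rep_split_bilin rep_split_act])

lemma rep_mul_iso: "iso_arr CC (R (m + n)) D rep_mul"
  unfolding iso_arr_def
proof (intro conjI bexI rep_mul)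
  note D = day_obj[OF rep_obj[of m] rep_obj[of n]] and h = rep_split
  show "rep_split \<in> mor CC D (R (m + n))" by (rule h)
  show "rep_split \<bullet>\<^bsub>CC\<^esub> rep_mul = Id CC (R (m + n))"
    by (rule rep_hom_eqI[OF rep_obj C.comp_mor[OF rep_obj D rep_obj rep_mul h] C.id_mor[OF rep_obj]])
     (simp add: comp_apply[OF rep_obj rep_mul one_rep] id_apply[OF one_rep] rep_mul_apply rep_split_apply[OF HOL.refl one_rep one_rep] mu_one)
  show "rep_mul \<bullet>\<^bsub>CC\<^esub> rep_split = Id CC D"
  proof (rule day_hom_eqI[OF rep_obj rep_obj D C.comp_mor[OF D rep_obj D h rep_mul] C.id_mor[OF D]])
    fix p i x j y c
    assume g: "i + j = p" "x \<in> el (R m) i" "y \<in> el (R n) j" "c \<in> \<A> p"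
    note pc = pure_closed[OF rep_obj rep_obj g]
    from g(2,3) obtain a b where x: "x = Emb A a" "a \<in> \<A> i" "i = m \<or> a = (\<o> i)"
     and y: "y = Emb A b" "b \<in> \<A> j" "j = n \<or> b = (\<o> j)" by (elim repE)
    have l: "ap (rep_mul \<bullet>\<^bsub>CC\<^esub> rep_split) p (pure (R m) (R n) p i x j y c) =
      ap rep_mul p (Emb A (Mu A i j a b \<otimes>\<^bsub>Alg A p\<^esub> c))"
     unfolding comp_apply[OF D h pc] rep_split_apply[OF g] by (simp add: x(1) y(1))
    show "ap (rep_mul \<bullet>\<^bsub>CC\<^esub> rep_split) p (pure (R m) (R n) p i x j y c) = ap (Id CC D) p (pure (R m) (R n) p i x j y c)"
     unfolding l id_apply[OF pc]
    proof (cases "i = m \<and> j = n")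
     case True
     then have mn: "m + n = p" "i = m" "j = n" using g by auto
     \<comment> \<open>Balancing moves \<open>a\<close> and \<open>b\<close> from the module slots
       into the algebra slot.\<close>
     have "x = act (R m) m (Emb A (\<e> m)) a" "y = act (R n) n (Emb A (\<e> n)) b"
      using x y mn by (simp_all add: rep_act_Emb)
     then have "pure (R m) (R n) p i x j y c =
       pure (R m) (R n) p m (Emb A (\<e> m)) n (Emb A (\<e> n)) (Mu A m n a b \<otimes>\<^bsub>Alg A p\<^esub> c)"
      using pure_balanced[OF rep_obj rep_obj mn(1) one_rep one_rep g(4)] x(2) y(2) mn(2,3) by simp
     then show "ap rep_mul p (Emb A (Mu A i j a b \<otimes>\<^bsub>Alg A p\<^esub> c)) = pure (R m) (R n) p i x j y c"
      using rep_mul_apply mu_closed'[OF g(1) x(2) y(2)] g(4) mn by auto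
    next
     case False
     \<comment> \<open>Away from the degrees \<open>m\<close> and \<open>n\<close> one factor is
       zero, and so are both sides.\<close>
     then have z: "a = (\<o> i) \<or> b = (\<o> j)" using x y by auto
     then have "Mu A i j a b \<otimes>\<^bsub>Alg A p\<^esub> c = (\<o> p)" using mu_zero[OF g(1)] x(2) y(2) g(4) by auto
     moreover have "ap rep_mul p (Emb A (\<o> p)) = \<zero>\<^bsub>FO D p\<^esub>"
      using klinear_zero[OF rep_module obj_module[OF D] mor_klinear[OF rep_obj rep_mul], of p] by (simp add: FO_rep(2))
     moreover have "pure (R m) (R n) p i x j y c = \<zero>\<^bsub>FO D p\<^esub>"
      using z pure_zero[OF rep_obj rep_obj g(1,3,4)]
       klinear_zero[OF rep_module obj_module[OF D] pure_klinear(2)[OF rep_obj rep_obj g(1,2,4)]] x(1) y(1)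
      by (auto simp: FO_rep(2))
     ultimately show "ap rep_mul p (Emb A (Mu A i j a b \<otimes>\<^bsub>Alg A p\<^esub> c)) = pure (R m) (R n) p i x j y c" by simp
    qed
  qed
qed

text \<open>Tested on the unit, this is the balancing relation: \<open>a\<close> and
  \<open>b\<close> in the two module slots become \<open>Mu A m n a b\<close> in the algebra
  slot.\<close>

lemma rep_mul_nat:
  assumes a: "a \<in> \<A> m" and b: "b \<in> \<A> n"
  shows "rep_mul \<bullet>\<^bsub>CC\<^esub> rep_arr A (m + n) (Mu A m n a b) = day_arr K A (rep_arr A m a) (rep_arr A n b) \<bullet>\<^bsub>CC\<^esub> rep_mul"
proof -
  note D = day_obj[OF rep_obj[of m] rep_obj[of n]] and ab = mu_closed[OF a b] and r = rep_obj[of "m + n"]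
  note ra = rep_arr[OF a] and rb = rep_arr[OF b] and rab = rep_arr[OF mu_closed[OF a b]]
  note d = day_arr[OF rep_obj rep_obj rep_obj rep_obj ra rb]
  have 1: "Emb A a = act (R m) m (Emb A (\<e> m)) a" "Emb A b = act (R n) n (Emb A (\<e> n)) b"
    using a b by (simp_all add: rep_act_Emb)
  have "pure (R m) (R n) (m + n) m (Emb A a) n (Emb A b) (\<e> (m + n)) =
     pure (R m) (R n) (m + n) m (Emb A (\<e> m)) n (Emb A (\<e> n)) (Mu A m n a b)"
    unfolding 1 using pure_balanced[OF rep_obj rep_obj HOL.refl one_rep one_rep alg.one_closed a b] ab by simp
  then show ?thesis
    by (intro rep_hom_eqI[OF D C.comp_mor[OF r r D rab rep_mul] C.comp_mor[OF r D D rep_mul d]])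
     (simp add: comp_apply[OF r rab one_rep] comp_apply[OF r rep_mul one_rep] rep_arr_apply ab rep_mul_apply a b
      day_arr_apply[OF rep_obj rep_obj rep_obj rep_obj ra rb HOL.refl one_rep one_rep])
qed

end

text \<open>By \<open>rep_mul_nat\<close> the multiplication by \<open>Mu A m n a b\<close> is
  conjugate to a tensor product of multiplications, and \<open>F\<close> turns this into a tensor
  product of arrows of \<open>E\<close> up to conjugation by \<open>Mul F\<close>. One vanishing
  factor makes it zero, so killed elements stay killed when strands are added.\<close>

lemma FA_rep_arr_mu_zero:
  fixes E :: "('k, 'p, 'b, 'z) moncat_scheme" (structure) and F :: "(('k, 'u, 'x) mobj, ('k, 'u, 'x) marr, 'p, 'b, 'w) monfun_scheme"
  assumes E: "bifunctor_category K E" and F: "strong_monoidal_functor K CC E F"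
    and a: "a \<in> \<A> m" and b: "b \<in> \<A> n"
    and z: "FA F (rep_arr A m a) = \<zero>\<^bsub>Hom E (FO F (rep_obj A m)) (FO F (rep_obj A m))\<^esub> \<or>
     FA F (rep_arr A n b) = \<zero>\<^bsub>Hom E (FO F (rep_obj A n)) (FO F (rep_obj A n))\<^esub>"
  shows "FA F (rep_arr A (m + n) (Mu A m n a b)) = \<zero>\<^bsub>Hom E (FO F (rep_obj A (m + n))) (FO F (rep_obj A (m + n)))\<^esub>"
proof -
  interpret E: bifunctor_category K E by (rule E)
  interpret F: strong_monoidal_functor K CC E F by (rule F)
  let ?R = "rep_obj A" and ?D = "day (rep_obj A m) (rep_obj A n)"
  let ?f = "rep_arr A m a" and ?g = "rep_arr A n b" and ?h = "rep_arr A (m + n) (Mu A m n a b)"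
  note D = day_obj[OF rep_obj[of m] rep_obj[of n]] and r = rep_obj[of m] rep_obj[of n] rep_obj[of "m + n"]
  note f = rep_arr[OF a] and g = rep_arr[OF b] and h = rep_arr[OF mu_closed[OF a b]]
  note o = F.obj_closed[OF r(1)] F.obj_closed[OF r(2)] F.obj_closed[OF r(3)] F.obj_closed[OF D]
  note d = day_arr[OF r(1,2,1,2) f g] and s = rep_mul_iso[of m n] and s' = rep_mul[of m n]
  note mi = F.mul_iso[OF r(1,2), unfolded CC_simps(8)] and T = E.tensor_obj[OF o(1,2)]
  have mm: "Mul F (?R m) (?R n) \<in> mor E (FO F (?R m) \<boxtimes> FO F (?R n)) (FO F ?D)" using mi by (simp add: iso_arr_def)
  have "FA F ?f \<boxdot> FA F ?g = \<zero>\<^bsub>Hom E (FO F (?R m) \<boxtimes> FO F (?R n)) (FO F (?R m) \<boxtimes> FO F (?R n))\<^esub>"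
    using z E.tensor_zero_left[OF o(1,2,1,2) F.arr[OF r(2,2) g]] E.tensor_zero_right[OF o(1,2,1,2) F.arr[OF r(1,1) f]] by auto
  then have "FA F (day_arr K A ?f ?g) \<bullet> Mul F (?R m) (?R n) = \<zero>\<^bsub>Hom E (FO F ?D) (FO F ?D)\<^esub> \<bullet> Mul F (?R m) (?R n)"
    using F.mul_nat[OF r(1,2,1,2) f g] E.comp_zero_right[OF T T o(4) mm] E.comp_zero_left[OF T o(4,4) mm]
    by (simp add: CC_simps(9))
  then have z1: "FA F (day_arr K A ?f ?g) = \<zero>\<^bsub>Hom E (FO F ?D) (FO F ?D)\<^esub>"
    by (rule E.iso_epi[OF T o(4,4) mi F.arr[OF D D d] E.hom_zero[OF o(4,4)]])
  let ?s = "FA F (rep_mul m n)"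
  have si: "iso_arr E (FO F (?R (m + n))) (FO F ?D) ?s"
    by (rule linear_functor_iso[OF CC_linear F.linear_functor_axioms r(3) D s])
  note v = E.inv_arr[OF o(3,4) si] and sm = F.arr[OF r(3) D s']
  have "?s \<bullet> FA F ?h = FA F (day_arr K A ?f ?g) \<bullet> ?s"
    using F.comp[OF r(3,3) D h s'] F.comp[OF r(3) D D s' d] rep_mul_nat[OF a b] by simp
  also have "\<dots> = \<zero>\<^bsub>Hom E (FO F (?R (m + n))) (FO F ?D)\<^esub>" using z1 E.comp_zero_left[OF o(3,4,4) sm] by simp
  finally show ?thesis
    using E.comp_assoc[OF o(3,3,4,3) F.arr[OF r(3,3) h] sm v(1)] v(2) E.id_left[OF o(3,3) F.arr[OF r(3,3) h]]
     E.comp_zero_right[OF o(3,4,3) v(1)] by simp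
qed

end

section \<open>Factorization of the Orellana--Ram functor\<close>

context hecke_extension
begin

text \<open>Left multiplication \<open>rep_arr\<close> is an algebra homomorphism to the
  endomorphisms of the representable module, and so respects polynomials.\<close>

lemma rep_arr_hecke_poly:
  assumes t: "t \<in> \<B> n"
  shows "rep_arr BS n (hecke_poly n t) = X.A.C.quad (rep_obj BS n) (\<ominus>\<^bsub>K\<^esub> q) (inv\<^bsub>K\<^esub> q) (rep_arr BS n t)"
proof -
  have sh: "t \<oplus>\<^bsub>BA n\<^esub> r \<odot>\<^bsub>BA n\<^esub> \<one>\<^bsub>BA n\<^esub> \<in> \<B> n"
    "rep_arr BS n (t \<oplus>\<^bsub>BA n\<^esub> r \<odot>\<^bsub>BA n\<^esub> \<one>\<^bsub>BA n\<^esub>) = rep_arr BS n t \<oplus>\<^bsub>Hom BC (rep_obj BS n) (rep_obj BS n)\<^esub>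
     r \<odot>\<^bsub>Hom BC (rep_obj BS n) (rep_obj BS n)\<^esub> Id BC (rep_obj BS n)" if "r \<in> carrier K" for r
    using that t X.A.rep_arr_add[of t n "r \<odot>\<^bsub>BA n\<^esub> \<one>\<^bsub>BA n\<^esub>"] X.A.rep_arr_smult[of "\<one>\<^bsub>BA n\<^esub>" n r] X.A.rep_arr_one[of n]
    by simp_all
  have nq: "\<ominus>\<^bsub>K\<^esub> q \<in> carrier K" using q_closed by simp
  have "hecke_poly n t = (t \<oplus>\<^bsub>BA n\<^esub> (\<ominus>\<^bsub>K\<^esub> q) \<odot>\<^bsub>BA n\<^esub> \<one>\<^bsub>BA n\<^esub>) \<otimes>\<^bsub>BA n\<^esub> (t \<oplus>\<^bsub>BA n\<^esub> inv\<^bsub>K\<^esub> q \<odot>\<^bsub>BA n\<^esub> \<one>\<^bsub>BA n\<^esub>)"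
    using t q_closed by (simp add: hecke_poly_def a_minus_def BM.smult_l_minus)
  then show ?thesis
    using X.A.rep_arr_mult[of "t \<oplus>\<^bsub>BA n\<^esub> (\<ominus>\<^bsub>K\<^esub> q) \<odot>\<^bsub>BA n\<^esub> \<one>\<^bsub>BA n\<^esub>" n "t \<oplus>\<^bsub>BA n\<^esub> inv\<^bsub>K\<^esub> q \<odot>\<^bsub>BA n\<^esub> \<one>\<^bsub>BA n\<^esub>"]
     sh[OF nq] sh[OF inv_q]
    by (simp add: X.A.C.quad_def)
qed

lemma inv_InB [simp]: "Hilbert_Choice.inv InB (InB b) = b"
  by (rule inv_f_f) (simp add: inj_def)

text \<open>Recognising the map as an instance of \<open>rep_mul\<close> shows that it is
  invertible; this gives meaning to the \<open>inv_arr\<close> in \<open>gen_t\<close>.\<close>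

lemma square_iso_eq: "square_iso K = X.A.rep_mul 1 1"
proof -
  let ?G = "rep_obj BS 1" and ?e = "InB \<one>\<^bsub>BA 1\<^esub>"
  have "day_elt K BS ?G ?G 2 [(1, ?e, 1, ?e, x)] =
     act (day_obj K BS ?G ?G) 2 (X.A.pure ?G ?G 2 1 ?e 1 ?e \<one>\<^bsub>BA 2\<^esub>) (Hilbert_Choice.inv InB x)"
    if x: "x \<in> el (rep_obj BS 2) 2" for x
  proof -
    obtain a where a: "x = InB a" "a \<in> \<B> 2" using x X.A.FO_rep(1)[of 2 2] by auto
    then show ?thesis
     using X.A.day_act[OF X.A.rep_obj X.A.rep_obj _ X.A.one_rep X.A.one_rep, of 1 1 2 "\<one>\<^bsub>BA 2\<^esub>" a] BA_one
     by (simp add: X.A.pure_def)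
  qed
  then show ?thesis
    unfolding square_iso_def gen_obj_def Let_def X.A.rep_mul_def X.A.yon_def X.A.mk_arr_def one_add_one seq_sel
    by (auto simp: fun_eq_iff intro!: X.A.lmap_of_cong)
qed

lemma square_iso: "iso_arr BC (rep_obj BS 2) (day_obj K BS (gen_obj K) (gen_obj K)) (square_iso K)"
  using X.A.rep_mul_iso[of 1 1] unfolding square_iso_eq gen_obj_def one_add_one .

context
  fixes E :: "('k, 'p, 'b) moncat" (structure) and F :: "(('k, 'u) braid_mobj, ('k, 'u) braid_marr, 'p, 'b) monfun"
  assumes E: "bifunctor_category K E" and F: "strong_monoidal_functor K BC E F"
begin

interpretation E: bifunctor_category K E by (rule E)
interpretation F: strong_monoidal_functor K BC E F by (rule F)

abbreviation (input) "R \<equiv> rep_obj BS"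
abbreviation "killed n b \<equiv> FA F (rep_arr BS n b) = \<zero>\<^bsub>Hom E (FO F (R n)) (FO F (R n))\<^esub>"

lemmas FR = F.obj_closed[OF X.A.rep_obj]

text \<open>The set is the kernel of the homomorphism from \<open>BA n\<close> to the endomorphisms
  of \<open>FO F (R n)\<close>; the ideal laws are read off from functoriality and linearity of
  \<open>F\<close>.\<close>

lemma killed_ideal: "ideal {b \<in> \<B> n. killed n b} (BA n)" (is "ideal ?J _")
proof (rule idealI[OF BA_ring])
  note r = X.A.rep_obj[of n]
  have o: "FO F (R n) \<in> Ob E" by (rule FR)
  interpret H: module K "Hom E (FO F (R n)) (FO F (R n))" by (rule E.hom_space[OF o o])
  have m: "rep_arr BS n b \<in> mor BC (R n) (R n)" if "b \<in> \<B> n" for b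
    using X.A.rep_arr[of b n] that by simp
  have add: "killed n (b \<oplus>\<^bsub>BA n\<^esub> b')" if "b \<in> ?J" "b' \<in> ?J" for b b'
    using that F.add[OF r r m m, of b b'] X.A.rep_arr_add[of b n b'] by simp
  have sm: "killed n (t \<odot>\<^bsub>BA n\<^esub> b)" if "b \<in> ?J" "t \<in> carrier K" for b t
    using that F.smult[OF r r m, of b t] X.A.rep_arr_smult[of b n t] by simp
  have z: "\<zero>\<^bsub>BA n\<^esub> \<in> ?J"
    using X.A.rep_arr_smult[of "\<zero>\<^bsub>BA n\<^esub>" n "\<zero>\<^bsub>K\<^esub>"] F.smult[OF r r m, of "\<zero>\<^bsub>BA n\<^esub>" "\<zero>\<^bsub>K\<^esub>"] F.arr[OF r r m, of "\<zero>\<^bsub>BA n\<^esub>"] by simp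
  show "subgroup ?J (add_monoid (BA n))"
  proof (rule B.add.subgroupI)
    show "?J \<subseteq> \<B> n" "?J \<noteq> {}" using z by auto
  next
    fix b assume b: "b \<in> ?J"
    then have "\<ominus>\<^bsub>BA n\<^esub> b = (\<ominus>\<^bsub>K\<^esub> \<one>\<^bsub>K\<^esub>) \<odot>\<^bsub>BA n\<^esub> b" by (simp add: BM.smult_l_minus)
    then show "\<ominus>\<^bsub>BA n\<^esub> b \<in> ?J" using b sm[OF b, of "\<ominus>\<^bsub>K\<^esub> \<one>\<^bsub>K\<^esub>"] by simp
  qed (use add in auto)
  fix b x assume b: "b \<in> ?J" and x: "x \<in> \<B> n"
  then have b': "b \<in> \<B> n" "killed n b" by simp_all
  show "x \<otimes>\<^bsub>BA n\<^esub> b \<in> ?J"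
    using b' x X.A.rep_arr_mult[of x n b] F.comp[OF r r r m[OF b'(1)] m[OF x]] E.comp_zero_right[OF o o o F.arr[OF r r m[OF x]]]
    by simp
  show "b \<otimes>\<^bsub>BA n\<^esub> x \<in> ?J"
    using b' x X.A.rep_arr_mult[of b n x] F.comp[OF r r r m[OF x] m[OF b'(1)]] E.comp_zero_left[OF o o o F.arr[OF r r m[OF x]]]
    by simp
qed

text \<open>The generator \<open>t_i\<close> on \<open>n\<close> strands is \<open>t_1\<close> on
  two strands with \<open>i - 1\<close> strands added on the left and \<open>n - i - 1\<close> on
  the right; these numbers are \<open>l\<close> and \<open>k\<close>. Products with units under
  \<open>braid_mu\<close> therefore spread the relation from \<open>t_1\<close> to all generators,
  and \<open>killed_ideal\<close> spreads it to the ideal.\<close>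

lemma hecke_ideal_killed:
  assumes k: "killed 2 (hecke_poly 2 (gen 2 1))" and b: "b \<in> I n"
  shows "killed n b"
proof -
  have mul: "killed (m + k) (braid_mu K m k a b)"
    if "a \<in> \<B> m" "b \<in> \<B> k" "killed m a \<or> killed k b" for m k a b
    using X.A.FA_rep_arr_mu_zero[OF E F, of a m b k] that by simp
  have "hecke_poly n (gen n i) \<in> {b \<in> \<B> n. killed n b}" if i: "1 \<le> i" "i < n" for i
  proof -
    define l where "l = i - 1"
    define k where "k = n - i - 1"
    have n: "n = l + (2 + k)" "i = 1 + l" using i by (auto simp: l_def k_def)
    have g: "gen 2 1 \<in> \<B> 2" "gen (2 + k) 1 \<in> \<B> (2 + k)" by (simp_all add: gen_closed)
    have "killed (2 + k) (hecke_poly (2 + k) (gen (2 + k) 1))"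
     using mul[OF hecke_poly_closed[OF g(1)] BA_one[of k]] \<open>killed 2 _\<close> hecke_poly_mu(1)[OF g(1), of k] gen_mu(1)[of 1 2 k] by simp
    then have "killed n (hecke_poly n (gen n i))"
     using mul[OF BA_one[of l] hecke_poly_closed[OF g(2)]] hecke_poly_mu(2)[OF g(2), of l] gen_mu(2)[of 1 "2 + k" l]
     unfolding n by simp
    then show ?thesis using gen_closed[OF i] by (simp add: hecke_poly_closed)
  qed
  from hecke_ideal_le[OF killed_ideal this] show ?thesis using b by blast
qed

text \<open>The arrow \<open>gen_t\<close> is conjugate, by \<open>square_iso\<close>, to
  multiplication by the generator, and \<open>rel\<close> makes its image under \<open>F\<close>
  conjugate to \<open>c\<close> through \<open>Mul F\<close> and \<iota>. Along the composite
  isomorphism from \<open>Z \<boxtimes> Z\<close> to \<open>FO F (R 2)\<close> the vanishing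
  polynomial of \<open>c\<close> is carried to that of the generator.\<close>

lemma hecke_poly_killed:
  assumes o: "Z \<in> Ob E" and \<iota>: "iso_arr E Z (FO F (gen_obj K)) \<iota>" and c: "c \<in> mor E (Z \<boxtimes> Z) (Z \<boxtimes> Z)"
    and rel: "FA F (gen_t K) \<bullet> Mul F (gen_obj K) (gen_obj K) \<bullet> (\<iota> \<boxdot> \<iota>) =
       (Mul F (gen_obj K) (gen_obj K) \<bullet> (\<iota> \<boxdot> \<iota>)) \<bullet> c"
    and z: "E.quad (Z \<boxtimes> Z) (\<ominus>\<^bsub>K\<^esub> q) (inv\<^bsub>K\<^esub> q) c = \<zero>\<^bsub>Hom E (Z \<boxtimes> Z) (Z \<boxtimes> Z)\<^esub>"
  shows "killed 2 (hecke_poly 2 (gen 2 1))"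
proof -
  let ?G = "gen_obj K :: ('k, 'u) braid_mobj" and ?s = "square_iso K :: ('k, 'u) braid_marr"
  let ?S = "day_obj K BS ?G ?G" and ?T = "rep_arr BS 2 (gen 2 1)"
  let ?i = "inv_arr BC (R 2) ?S ?s" and ?\<phi> = "Mul F ?G ?G \<bullet> (\<iota> \<boxdot> \<iota>)"
  have g: "gen 2 1 \<in> \<B> 2" by (simp add: gen_closed)
  have G: "?G \<in> Ob BC" unfolding gen_obj_def by (rule X.A.rep_obj)
  note r = X.A.rep_obj[of 2] and S = X.A.day_obj[OF G G] and v = X.A.C.inv_arr[OF X.A.rep_obj[of 2] X.A.day_obj[OF G G] square_iso]
  note FG = F.obj_closed[OF G] and FS = F.obj_closed[OF S] and ZZ = E.tensor_obj[OF o o]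
  have s: "?s \<in> mor BC (R 2) ?S" using square_iso by (simp add: iso_arr_def)
  have T: "?T \<in> mor BC (R 2) (R 2)" using X.A.rep_arr[of "gen 2 1" 2] g by simp
  note Ti = X.A.C.comp_mor[OF S r r v(1) T]
  have gt: "gen_t K = ?s \<bullet>\<^bsub>BC\<^esub> (?T \<bullet>\<^bsub>BC\<^esub> ?i)"
    by (simp add: gen_t_def Let_def affine_braid_category_def gen_def X.A.CC_simps(8))
  have gm: "gen_t K \<in> mor BC ?S ?S" unfolding gt by (rule X.A.C.comp_mor[OF S r S Ti s])
  have ii: "iso_arr BC ?S (R 2) ?i" unfolding iso_arr_def using v s by blast
  have \<phi>: "iso_arr E (Z \<boxtimes> Z) (FO F ?S) ?\<phi>"
    using E.iso_comp[OF ZZ E.tensor_obj[OF FG FG] FS E.tensor_iso[OF o o FG FG \<iota> \<iota>]] F.mul_iso[OF G G] by (simp add: X.A.CC_simps(8))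
  have \<phi>m: "?\<phi> \<in> mor E (Z \<boxtimes> Z) (FO F ?S)" using \<phi> by (simp add: iso_arr_def)
  note Fi = F.arr[OF S r v(1)] and FT = F.arr[OF r r T] and Fg = F.arr[OF S S gm]
  have iso: "iso_arr E (Z \<boxtimes> Z) (FO F (R 2)) (FA F ?i \<bullet> ?\<phi>)"
    by (rule E.iso_comp[OF ZZ FS FR \<phi> linear_functor_iso[OF X.A.CC_linear F.linear_functor_axioms S r ii]])
  have \<iota>m: "\<iota> \<boxdot> \<iota> \<in> mor E (Z \<boxtimes> Z) (FO F ?G \<boxtimes> FO F ?G)"
    using E.tensor_iso[OF o o FG FG \<iota> \<iota>] by (simp add: iso_arr_def)
  have "?i \<bullet>\<^bsub>BC\<^esub> gen_t K = ?T \<bullet>\<^bsub>BC\<^esub> ?i"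
    using X.A.C.comp_assoc[OF S r S r Ti s v(1)] X.A.C.id_left[OF S r Ti] by (simp add: gt v(2))
  then have e: "FA F ?T \<bullet> FA F ?i = FA F ?i \<bullet> FA F (gen_t K)"
    using F.comp[OF S r r v(1) T] F.comp[OF S S r gm v(1)] by simp
  have "FA F ?T \<bullet> (FA F ?i \<bullet> ?\<phi>) = (FA F ?i \<bullet> FA F (gen_t K)) \<bullet> ?\<phi>"
    unfolding e[symmetric] by (rule E.comp_assoc[OF ZZ FS FR FR \<phi>m Fi FT, symmetric])
  also have "\<dots> = FA F ?i \<bullet> (FA F (gen_t K) \<bullet> ?\<phi>)" by (rule E.comp_assoc[OF ZZ FS FS FR \<phi>m Fg Fi])
  also have "\<dots> = (FA F ?i \<bullet> ?\<phi>) \<bullet> c"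
    unfolding rel by (rule E.comp_assoc[OF ZZ ZZ FS FR c \<phi>m Fi, symmetric])
  finally have "FA F ?T \<bullet> (FA F ?i \<bullet> ?\<phi>) = (FA F ?i \<bullet> ?\<phi>) \<bullet> c" .
  from E.quad_intertwine[OF ZZ FR c FT iso _ inv_q this z]
  show ?thesis
    using linear_functor_quad[OF X.A.CC_linear E.linear_category_axioms F.linear_functor_axioms r T _ inv_q, of "\<ominus>\<^bsub>K\<^esub> q"] q_closed
     rep_arr_hecke_poly[OF g] by simp
qed

end

end

theorem proposition8p6:
  fixes K :: "'k ring"
    and C :: "('k, 'o, 'a) braidcat"
    and X :: 'o
    and q :: 'k
    and OR :: "(('k, 'u) braid_mobj, ('k, 'u) braid_marr,
      ('o, 'a, 'o, 'a) funct, (('o, 'a, 'o, 'a) funct, 'o \<Rightarrow> 'a) trans) monfun"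
  assumes "braided_category K C"
    and "hecke_object K C q X"
    and "orellana_ram_functor K C X OR"
  shows "\<exists>(OR' :: (('k, 'u) hecke_mobj, ('k, 'u) hecke_marr,
      ('o, 'a, 'o, 'a) funct, (('o, 'a, 'o, 'a) funct, 'o \<Rightarrow> 'a) trans) monfun) \<theta>.
    strong_monoidal_functor K (affine_hecke_category K q) (endofunctor_category K C) OR' \<and>
    monoidal_natural_iso (affine_braid_category K) (endofunctor_category K C) OR
      (comp_monfun (affine_braid_category K) (endofunctor_category K C) OR' (hecke_quotient K q)) \<theta>"
proof -
  interpret C: braided_category K C by (rule assms(1))
  have q: "q \<in> carrier K" "q \<noteq> \<zero>\<^bsub>K\<^esub>" and X: "X \<in> Ob C"
    using assms(2) by (simp_all add: hecke_object_def)
  interpret hecke_extension K q "TYPE('u)"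
    by (intro hecke_extension.intro hecke_parameter.intro convolution.intro hecke_parameter_axioms.intro C.K.field_axioms q)
  let ?E = "endofunctor_category K C" and ?O = "or_O C X"
  have E: "bifunctor_category K ?E" by (rule C.endofunctor_category_bifunctor)
  interpret E: bifunctor_category K ?E by (rule E)
  from assms(3) obtain \<iota> where F: "strong_monoidal_functor K BC ?E OR"
    and coc: "cocontinuous TYPE(('k, 'u) univ) BC ?E OR"
    and \<iota>: "iso_arr ?E ?O (FO OR (gen_obj K)) \<iota>"
    and rel: "FA OR (gen_t K) \<bullet>\<^bsub>?E\<^esub> Mul OR (gen_obj K) (gen_obj K) \<bullet>\<^bsub>?E\<^esub> (\<iota> \<boxdot>\<^bsub>?E\<^esub> \<iota>) =
          (Mul OR (gen_obj K) (gen_obj K) \<bullet>\<^bsub>?E\<^esub> (\<iota> \<boxdot>\<^bsub>?E\<^esub> \<iota>)) \<bullet>\<^bsub>?E\<^esub> or_c C X"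
    unfolding orellana_ram_functor_def affine_braid_category_def Let_def by blast
  have O: "?O \<in> Ob ?E" using C.or_O[OF X] by (simp add: endofunctor_category_simps)
  have XX: "X \<boxtimes>\<^bsub>C\<^esub> X \<in> Ob C" using X by (simp add: C.tensor_obj)
  have "C.quad (X \<boxtimes>\<^bsub>C\<^esub> X) (\<ominus>\<^bsub>K\<^esub> q) (inv\<^bsub>K\<^esub> q) (Braid C X X) = \<zero>\<^bsub>Hom C (X \<boxtimes>\<^bsub>C\<^esub> X) (X \<boxtimes>\<^bsub>C\<^esub> X)\<^esub>"
    using assms(2) unfolding hecke_object_def Let_def C.quad_minus[OF XX q(1)] by simp
  from C.or_c_quad[OF X this] inv_q q
  have "E.quad (?O \<boxtimes>\<^bsub>?E\<^esub> ?O) (\<ominus>\<^bsub>K\<^esub> q) (inv\<^bsub>K\<^esub> q) (or_c C X) = \<zero>\<^bsub>Hom ?E (?O \<boxtimes>\<^bsub>?E\<^esub> ?O) (?O \<boxtimes>\<^bsub>?E\<^esub> ?O)\<^esub>"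
    by (simp add: endofunctor_category_simps(8))
  from hecke_poly_killed[OF E F O \<iota> _ rel this] C.or_c[OF X]
  have "FA OR (rep_arr BS 2 (hecke_poly 2 (gen 2 1))) = \<zero>\<^bsub>Hom ?E (FO OR (rep_obj BS 2)) (FO OR (rep_obj BS 2))\<^esub>"
    by (simp add: endofunctor_category_simps(8))
  from factors_through_hecke_quotient[OF E F coc hecke_ideal_killed[OF E F this]]
  show ?thesis
    unfolding affine_braid_category_def affine_hecke_category_def by blast
qed

end
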